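(* Let $\mathcal{N}\subset\mathcal{M}$ be a connected inclusion of multi-matrix algebras, with $\mathcal{M}\cong\bigoplus_{i=1}^mM_{\alpha_i}(\mathbb{C})$ and $\mathcal{N}\cong\bigoplus_{j=1}^nM_{\beta_j}(\mathbb{C})$, let $\alpha=(\alpha_1,\dots,\alpha_m)^t$, $\beta=(\beta_1,\dots,\beta_n)^t$, let $D$ be its $m\times n$ matrix dimension (equivalently its inclusion matrix) and $d=\|D\|$ its scalar dimension, so that $d^2$ is its index. Then $\mathcal{N}\subset\mathcal{M}$ is super-extremal if and only if, in addition to $D\beta=\alpha$ (which always holds), the equality $D^t\alpha=d^2\beta$ holds. If this is the case, then $$d^2=\frac{\|\alpha\|^2}{\|\beta\|^2},$$ where $\|\cdot\|$ is the $l^2$-norm, i.e. the index is the ratio of the algebraic dimensions of $\mathcal{M}$ and $\mathcal{N}$; moreover $d^2\in\mathbb{N}$, and every positive integer arises as the index of some connected super-extremal inclusion of multi-matrices.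
   Context: A multi-matrix algebra is a finite direct sum of full matrix algebras; inclusions are unital. $\mathcal{N}\subset\mathcal{M}$ is connected if $\mathcal{Z}(\mathcal{N})\cap\mathcal{Z}(\mathcal{M})=\mathbb{C}\mathbf{1}$. $E(\mathcal{M},\mathcal{N})$ is the set of normal faithful conditional expectations $\mathcal M\to\mathcal N$. For $E\in E(\mathcal{M},\mathcal{N})$, $E^{-1}$ is Kosaki's operator-valued weight from $\mathcal{N}'$ to $\mathcal{M}'$, determined by $d(\varphi\circ E)/d\psi=d\varphi/d(\psi\circ E^{-1})$ (spatial derivatives; $\varphi,\psi$ normal faithful semifinite weights on $\mathcal{N}$, $\mathcal{M}'$), $\mathrm{Ind}(E)=E^{-1}(\mathbf{1})\in\mathcal{Z}(\mathcal{M})$, and the dual expectation is $E'=\mathrm{Ind}(E)^{-1}E^{-1}\in E(\mathcal{N}',\mathcal{M}')$. The (minimal) index is the minimum of $\|\mathrm{Ind}(E)\|$ over $E(\mathcal{M},\mathcal{N})$, attained for connected inclusions at a unique $E^0$, the minimal expectation; it equals $\|D\|^2$. The spherical state $\omega_s$ is the unique faithful state on $\mathcal{N}'\cap\mathcal{M}$ with $\omega_s=\omega_s\circ E^0=\omega_s\circ{E^0}'$ there. With $p_i$, $q_j$ the minimal central projections of $\mathcal{M}$, $\mathcal{N}$, the matrix dimension $D$ has $(i,j)$ entry the square root of the minimal index of the subfactor $\mathcal{N}p_iq_j\subset q_j\mathcal{M}p_iq_j$ if $p_iq_j\neq0$, and $0$ otherwise; it coincides with the usual inclusion matrix, whose $(i,j)$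 entry is the multiplicity with which $M_{\beta_j}(\mathbb{C})$ is embedded in $M_{\alpha_i}(\mathbb{C})$. Markov trace: for a faithful normalized trace $\tau$ on $\mathcal{M}$, let $E_{\mathcal{N},\tau}$ be the $\tau$-preserving conditional expectation onto $\mathcal{N}$ and $e$ the corresponding Jones projection on $L^2(\mathcal{M},\tau)$. $\tau$ is a (normalized) Markov trace for $\mathcal{N}\subset\mathcal{M}$ of modulus $b$ if there is a trace $\tau_1$ on the basic construction generated by $\mathcal{M}$ and $e$ that extends $\tau$ and satisfies $b\,\tau_1(xe)=\tau(x)$, $x\in\mathcal{M}$; for connected multi-matrix inclusions it exists and is unique. The inclusion is super-extremal if $E^0=E_{\mathcal{N},\tau}$ and $\omega_s=\tau_{\restriction\mathcal{N}'\cap\mathcal{M}}$, with $\tau$ the normalized Markov trace. *)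

theory Defs
  imports
    "HOL-Analysis.L2_Norm"
    "HOL-Library.FuncSet"
    "Jordan_Normal_Form.VS_Connect"
    "Jordan_Normal_Form.Schur_Decomposition"
begin

definition l2norm :: "'a::real_normed_field vec \<Rightarrow> real" where
  "l2norm v = L2_set (\<lambda>i. norm (v $ i)) {..<dim_vec v}"

definition opnorm :: "'a::real_normed_field mat \<Rightarrow> real" where
  "opnorm A = Sup {l2norm (A *\<^sub>v v) | v. v \<in> carrier_vec (dim_col A) \<and> l2norm v \<le> 1}"

abbreviation is_zero_mat :: "complex mat \<Rightarrow> bool" where
  "is_zero_mat x \<equiv> x = 0\<^sub>m (dim_row x) (dim_col x)"

text \<open>
  All algebras act on a Hilbert space that is the range of an orthogonal projection \<open>u\<close> in
  some full matrix algebra. For the inclusion under study \<open>u\<close> is an identity matrix; proper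
  projections are needed for the reduced algebras \<open>N p q\<close> and \<open>q M p q\<close>, which act on the
  range of \<open>p q\<close>. In every definition the parameter \<open>u\<close> stands for this Hilbert space and is
  the unit of the algebras concerned.
\<close>

definition is_projection :: "complex mat \<Rightarrow> bool" where
  "is_projection u \<longleftrightarrow> square_mat u \<and> mat_adjoint u = u \<and> u * u = u"

definition hilb :: "complex mat \<Rightarrow> complex vec set" where
  "hilb u = {v \<in> carrier_vec (dim_row u). u *\<^sub>v v = v}"

definition ops :: "complex mat \<Rightarrow> complex mat set" where
  "ops u = {x \<in> carrier_mat (dim_row u) (dim_row u). u * x = x \<and> x * u = x}"

definition star_subalgebra :: "complex mat \<Rightarrow> complex mat set \<Rightarrow> bool" where
  "star_subalgebra u A \<longleftrightarrow> is_projection u \<and> A \<subseteq> ops u \<and> u \<in> A \<and>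
     (\<forall>x\<in>A. \<forall>y\<in>A. x + y \<in> A \<and> x * y \<in> A) \<and>
     (\<forall>x\<in>A. \<forall>c. c \<cdot>\<^sub>m x \<in> A \<and> mat_adjoint x \<in> A)"

definition commutant :: "complex mat \<Rightarrow> complex mat set \<Rightarrow> complex mat set" where
  "commutant u A = {x \<in> ops u. \<forall>a\<in>A. a * x = x * a}"

definition center :: "complex mat set \<Rightarrow> complex mat set" where
  "center A = {x \<in> A. \<forall>a\<in>A. a * x = x * a}"

definition unital_inclusion :: "complex mat \<Rightarrow> complex mat set \<Rightarrow> complex mat set \<Rightarrow> bool" where
  "unital_inclusion u N M \<longleftrightarrow> star_subalgebra u N \<and> star_subalgebra u M \<and> N \<subseteq> M"

definition connected_inclusion :: "complex mat \<Rightarrow> complex mat set \<Rightarrow> complex mat set \<Rightarrow> bool" where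
  "connected_inclusion u N M \<longleftrightarrow> center N \<inter> center M = {c \<cdot>\<^sub>m u | c. True}"

definition algebra_dim :: "nat \<Rightarrow> complex mat set \<Rightarrow> nat" where
  "algebra_dim k A = vectorspace.dim class_ring ((module_mat TYPE(complex) k k)\<lparr>carrier := A\<rparr>)"

text \<open>
  An element of the direct sum of the full matrix algebras of sizes \<open>ns ! 0, ns ! 1, \<dots>\<close> is the
  function sending a position \<open>i\<close> to its component; the operations are pointwise.
\<close>

definition direct_sum :: "nat list \<Rightarrow> (nat \<Rightarrow> complex mat) set" where
  "direct_sum ns = (\<Pi>\<^sub>E i\<in>{..<length ns}. carrier_mat (ns ! i) (ns ! i))"

definition block_embed :: "nat list \<Rightarrow> nat \<Rightarrow> complex mat \<Rightarrow> nat \<Rightarrow> complex mat" where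
  "block_embed ns j x = (\<lambda>i\<in>{..<length ns}. if i = j then x else 0\<^sub>m (ns ! i) (ns ! i))"

definition multi_matrix_iso ::
    "complex mat set \<Rightarrow> nat list \<Rightarrow> (complex mat \<Rightarrow> nat \<Rightarrow> complex mat) \<Rightarrow> bool" where
  "multi_matrix_iso A ns \<Phi> \<longleftrightarrow> ns \<noteq> [] \<and> (\<forall>n\<in>set ns. 0 < n) \<and>
     bij_betw \<Phi> A (direct_sum ns) \<and>
     (\<forall>i<length ns. \<forall>x\<in>A.
        (\<forall>y\<in>A. \<Phi> (x + y) i = \<Phi> x i + \<Phi> y i \<and> \<Phi> (x * y) i = \<Phi> x i * \<Phi> y i) \<and>
        (\<forall>c. \<Phi> (c \<cdot>\<^sub>m x) i = c \<cdot>\<^sub>m \<Phi> x i) \<and>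
        \<Phi> (mat_adjoint x) i = mat_adjoint (\<Phi> x i))"

definition multi_matrix_algebra :: "complex mat set \<Rightarrow> bool" where
  "multi_matrix_algebra A \<longleftrightarrow> (\<exists>ns \<Phi>. multi_matrix_iso A ns \<Phi>)"

definition min_central_projections :: "complex mat set \<Rightarrow> complex mat set" where
  "min_central_projections A = {z \<in> center A. is_projection z \<and> \<not> is_zero_mat z \<and>
     (\<forall>w \<in> center A. is_projection w \<and> w * z = w \<longrightarrow> is_zero_mat w \<or> w = z)}"

definition central_projection ::
    "complex mat set \<Rightarrow> nat list \<Rightarrow> (complex mat \<Rightarrow> nat \<Rightarrow> complex mat) \<Rightarrow> nat \<Rightarrow> complex mat" where
  "central_projection A ns \<Phi> i =
     (THE z. z \<in> min_central_projections A \<and> \<Phi> z = block_embed ns i (1\<^sub>m (ns ! i)))"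

text \<open>
  A possibly non-unital \<open>*\<close>-homomorphism \<open>\<iota>\<close> between the full matrix algebras of sizes \<open>b\<close> and
  \<open>a\<close> embeds with multiplicity \<open>l\<close> if it is unitarily equivalent to
  \<open>x \<mapsto> x \<oplus> \<dots> \<oplus> x \<oplus> 0\<close> with \<open>l\<close> copies of \<open>x\<close>.
\<close>

definition embeds_with_multiplicity ::
    "nat \<Rightarrow> nat \<Rightarrow> (complex mat \<Rightarrow> complex mat) \<Rightarrow> nat \<Rightarrow> bool" where
  "embeds_with_multiplicity a b \<iota> l \<longleftrightarrow> l * b \<le> a \<and>
     (\<exists>U \<in> carrier_mat a a. U * mat_adjoint U = 1\<^sub>m a \<and> mat_adjoint U * U = 1\<^sub>m a \<and>
        (\<forall>x \<in> carrier_mat b b. \<iota> x =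
           U * diag_block_mat (replicate l x @ [0\<^sub>m (a - l * b) (a - l * b)]) * mat_adjoint U))"

definition is_inclusion_matrix ::
    "complex mat set \<Rightarrow> nat list \<Rightarrow> (complex mat \<Rightarrow> nat \<Rightarrow> complex mat) \<Rightarrow>
     nat list \<Rightarrow> (complex mat \<Rightarrow> nat \<Rightarrow> complex mat) \<Rightarrow> nat mat \<Rightarrow> bool" where
  "is_inclusion_matrix N \<beta>s \<Psi> \<alpha>s \<Phi> \<Lambda> \<longleftrightarrow> \<Lambda> \<in> carrier_mat (length \<alpha>s) (length \<beta>s) \<and>
     (\<forall>i<length \<alpha>s. \<forall>j<length \<beta>s.
        embeds_with_multiplicity (\<alpha>s ! i) (\<beta>s ! j)
          (\<lambda>x. \<Phi> (inv_into N \<Psi> (block_embed \<beta>s j x)) i) (\<Lambda> $$ (i, j)))"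

text \<open>
  In finite dimension, normality is automatic and semifinite weights and semifinite
  operator-valued weights are everywhere finite, so they are linear maps on the whole algebra.
\<close>

definition linear_functional :: "complex mat set \<Rightarrow> (complex mat \<Rightarrow> complex) \<Rightarrow> bool" where
  "linear_functional A \<phi> \<longleftrightarrow>
     (\<forall>x\<in>A. \<forall>y\<in>A. \<phi> (x + y) = \<phi> x + \<phi> y) \<and> (\<forall>x\<in>A. \<forall>c. \<phi> (c \<cdot>\<^sub>m x) = c * \<phi> x)"

definition faithful_weight :: "complex mat set \<Rightarrow> (complex mat \<Rightarrow> complex) \<Rightarrow> bool" where
  "faithful_weight A \<phi> \<longleftrightarrow> linear_functional A \<phi> \<and>
     (\<forall>x\<in>A. 0 \<le> \<phi> (mat_adjoint x * x)) \<and>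
     (\<forall>x\<in>A. \<phi> (mat_adjoint x * x) = 0 \<longrightarrow> is_zero_mat x)"

definition faithful_state :: "complex mat \<Rightarrow> complex mat set \<Rightarrow> (complex mat \<Rightarrow> complex) \<Rightarrow> bool" where
  "faithful_state u A \<phi> \<longleftrightarrow> faithful_weight A \<phi> \<and> \<phi> u = 1"

definition op_valued_weight ::
    "complex mat set \<Rightarrow> complex mat set \<Rightarrow> (complex mat \<Rightarrow> complex mat) \<Rightarrow> bool" where
  "op_valued_weight A B E \<longleftrightarrow> E \<in> A \<rightarrow>\<^sub>E B \<and>
     (\<forall>x\<in>A. \<forall>y\<in>A. E (x + y) = E x + E y) \<and> (\<forall>x\<in>A. \<forall>c. E (c \<cdot>\<^sub>m x) = c \<cdot>\<^sub>m E x) \<and>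
     (\<forall>x\<in>A. \<forall>a\<in>B. \<forall>b\<in>B. E (a * x * b) = a * E x * b) \<and>
     (\<forall>x\<in>A. \<exists>y\<in>B. E (mat_adjoint x * x) = mat_adjoint y * y) \<and>
     (\<forall>x\<in>A. is_zero_mat (E (mat_adjoint x * x)) \<longrightarrow> is_zero_mat x)"

definition cond_exps ::
    "complex mat \<Rightarrow> complex mat set \<Rightarrow> complex mat set \<Rightarrow> (complex mat \<Rightarrow> complex mat) set" where
  "cond_exps u M N = {E. op_valued_weight M N E \<and> E u = u}"

text \<open>
  Connes' operator \<open>\<theta>\<^sup>\<psi>(\<xi>) = R R\<^sup>*\<close> for a faithful weight \<open>\<psi>\<close> on \<open>B\<close>, where \<open>R\<close> maps the GNS space
  of \<open>\<psi>\<close> to the Hilbert space by sending the class of \<open>y \<in> B\<close> to \<open>y \<xi>\<close>. Below, \<open>z\<close> represents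
  the GNS vector \<open>R\<^sup>* \<eta>\<close>. Note that \<open>v \<bullet>c w\<close> is linear in \<open>v\<close>, so that
  \<open>\<psi> (mat_adjoint y * z)\<close> is the GNS inner product of \<open>z\<close> and \<open>y\<close> in the same convention.
\<close>

definition theta ::
    "complex mat \<Rightarrow> complex mat set \<Rightarrow> (complex mat \<Rightarrow> complex) \<Rightarrow> complex vec \<Rightarrow> complex mat" where
  "theta u B \<psi> \<xi> = (THE T. T \<in> ops u \<and>
     (\<forall>\<eta>\<in>hilb u. \<exists>z\<in>B. T *\<^sub>v \<eta> = z *\<^sub>v \<xi> \<and>
        (\<forall>y\<in>B. \<psi> (mat_adjoint y * z) = \<eta> \<bullet>c (y *\<^sub>v \<xi>))))"

text \<open>
  The spatial derivative \<open>d\<phi>/d\<psi>\<close>, for \<open>\<phi>\<close> on \<open>A\<close> and \<open>\<psi>\<close> on the commutant of \<open>A\<close>, is the operator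
  of the quadratic form \<open>\<xi> \<mapsto> \<phi>(\<theta>\<^sup>\<psi>(\<xi>))\<close>.
\<close>

definition spatial_derivative ::
    "complex mat \<Rightarrow> complex mat set \<Rightarrow> (complex mat \<Rightarrow> complex) \<Rightarrow> (complex mat \<Rightarrow> complex) \<Rightarrow>
     complex mat" where
  "spatial_derivative u A \<phi> \<psi> = (THE T. T \<in> ops u \<and>
     (\<forall>\<xi>\<in>hilb u. (T *\<^sub>v \<xi>) \<bullet>c \<xi> = \<phi> (theta u (commutant u A) \<psi> \<xi>)))"

definition kosaki_inverse ::
    "complex mat \<Rightarrow> complex mat set \<Rightarrow> complex mat set \<Rightarrow> (complex mat \<Rightarrow> complex mat) \<Rightarrow>
     complex mat \<Rightarrow> complex mat" where
  "kosaki_inverse u M N E = (THE F. op_valued_weight (commutant u N) (commutant u M) F \<and>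
     (\<forall>\<phi> \<psi>. faithful_weight N \<phi> \<and> faithful_weight (commutant u M) \<psi> \<longrightarrow>
        spatial_derivative u M (\<phi> \<circ> E) \<psi> = spatial_derivative u N \<phi> (\<psi> \<circ> F)))"

definition Ind ::
    "complex mat \<Rightarrow> complex mat set \<Rightarrow> complex mat set \<Rightarrow> (complex mat \<Rightarrow> complex mat) \<Rightarrow>
     complex mat" where
  "Ind u M N E = kosaki_inverse u M N E u"

definition ops_inverse :: "complex mat \<Rightarrow> complex mat \<Rightarrow> complex mat" where
  "ops_inverse u x = (THE y. y \<in> ops u \<and> x * y = u \<and> y * x = u)"

definition dual_expectation ::
    "complex mat \<Rightarrow> complex mat set \<Rightarrow> complex mat set \<Rightarrow> (complex mat \<Rightarrow> complex mat) \<Rightarrow>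
     complex mat \<Rightarrow> complex mat" where
  "dual_expectation u M N E =
     (\<lambda>x \<in> commutant u N. ops_inverse u (Ind u M N E) * kosaki_inverse u M N E x)"

definition minimal_index :: "complex mat \<Rightarrow> complex mat set \<Rightarrow> complex mat set \<Rightarrow> real" where
  "minimal_index u M N = (LEAST r. \<exists>E \<in> cond_exps u M N. r = opnorm (Ind u M N E))"

definition minimal_expectation ::
    "complex mat \<Rightarrow> complex mat set \<Rightarrow> complex mat set \<Rightarrow> complex mat \<Rightarrow> complex mat" where
  "minimal_expectation u M N = (THE E. E \<in> cond_exps u M N \<and>
     (\<forall>F \<in> cond_exps u M N. opnorm (Ind u M N E) \<le> opnorm (Ind u M N F)))"

definition spherical_state ::
    "complex mat \<Rightarrow> complex mat set \<Rightarrow> complex mat set \<Rightarrow> complex mat \<Rightarrow> complex" where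
  "spherical_state u M N = (THE \<omega>. \<omega> \<in> extensional (commutant u N \<inter> M) \<and>
     faithful_state u (commutant u N \<inter> M) \<omega> \<and>
     (\<forall>x \<in> commutant u N \<inter> M.
        \<omega> (minimal_expectation u M N x) = \<omega> x \<and>
        \<omega> (dual_expectation u M N (minimal_expectation u M N) x) = \<omega> x))"

definition matrix_dimension ::
    "complex mat set \<Rightarrow> nat list \<Rightarrow> (complex mat \<Rightarrow> nat \<Rightarrow> complex mat) \<Rightarrow>
     complex mat set \<Rightarrow> nat list \<Rightarrow> (complex mat \<Rightarrow> nat \<Rightarrow> complex mat) \<Rightarrow> real mat" where
  "matrix_dimension M \<alpha>s \<Phi> N \<beta>s \<Psi> = mat (length \<alpha>s) (length \<beta>s) (\<lambda>(i, j).
     let p = central_projection M \<alpha>s \<Phi> i; q = central_projection N \<beta>s \<Psi> j in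
     if is_zero_mat (p * q) then 0
     else sqrt (minimal_index (p * q) {q * x * (p * q) | x. x \<in> M} {x * (p * q) | x. x \<in> N}))"

definition faithful_normalized_trace ::
    "complex mat \<Rightarrow> complex mat set \<Rightarrow> (complex mat \<Rightarrow> complex) \<Rightarrow> bool" where
  "faithful_normalized_trace u A \<tau> \<longleftrightarrow>
     faithful_state u A \<tau> \<and> (\<forall>x\<in>A. \<forall>y\<in>A. \<tau> (x * y) = \<tau> (y * x))"

definition trace_expectation ::
    "complex mat \<Rightarrow> complex mat set \<Rightarrow> complex mat set \<Rightarrow> (complex mat \<Rightarrow> complex) \<Rightarrow>
     complex mat \<Rightarrow> complex mat" where
  "trace_expectation u M N \<tau> = (THE E. E \<in> cond_exps u M N \<and> (\<forall>x\<in>M. \<tau> (E x) = \<tau> x))"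

text \<open>
  For a faithful trace \<open>\<tau>\<close> on the finite-dimensional algebra \<open>M\<close>, the space \<open>L\<^sup>2(M, \<tau>)\<close> is \<open>M\<close> itself
  with inner product \<open>\<tau> (mat_adjoint y * x)\<close>, \<open>M\<close> acts on it by left multiplication, and the Jones
  projection, that is the orthogonal projection onto \<open>N\<close>, is the \<open>\<tau>\<close>-preserving conditional
  expectation regarded as an operator on \<open>M\<close>. Operators on \<open>L\<^sup>2(M, \<tau>)\<close> are extensional functions
  on \<open>M\<close>. The generators below form a self-adjoint set, so the algebra they generate is the
  generated von Neumann algebra.
\<close>

definition left_mult :: "complex mat set \<Rightarrow> complex mat \<Rightarrow> complex mat \<Rightarrow> complex mat" where
  "left_mult M x = (\<lambda>y\<in>M. x * y)"

inductive_set basic_construction ::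
    "complex mat \<Rightarrow> complex mat set \<Rightarrow> complex mat set \<Rightarrow> (complex mat \<Rightarrow> complex) \<Rightarrow>
     (complex mat \<Rightarrow> complex mat) set"
  for u :: "complex mat" and M N :: "complex mat set" and \<tau> :: "complex mat \<Rightarrow> complex" where
  left: "x \<in> M \<Longrightarrow> left_mult M x \<in> basic_construction u M N \<tau>"
| jones: "trace_expectation u M N \<tau> \<in> basic_construction u M N \<tau>"
| add: "S \<in> basic_construction u M N \<tau> \<Longrightarrow> T \<in> basic_construction u M N \<tau> \<Longrightarrow>
    (\<lambda>y\<in>M. S y + T y) \<in> basic_construction u M N \<tau>"
| scale: "S \<in> basic_construction u M N \<tau> \<Longrightarrow> (\<lambda>y\<in>M. c \<cdot>\<^sub>m S y) \<in> basic_construction u M N \<tau>"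
| comp: "S \<in> basic_construction u M N \<tau> \<Longrightarrow> T \<in> basic_construction u M N \<tau> \<Longrightarrow>
    compose M S T \<in> basic_construction u M N \<tau>"

definition basic_construction_trace ::
    "complex mat \<Rightarrow> complex mat set \<Rightarrow> complex mat set \<Rightarrow> (complex mat \<Rightarrow> complex) \<Rightarrow>
     ((complex mat \<Rightarrow> complex mat) \<Rightarrow> complex) \<Rightarrow> bool" where
  "basic_construction_trace u M N \<tau> \<tau>1 \<longleftrightarrow>
     (\<forall>S \<in> basic_construction u M N \<tau>.
        (\<forall>T \<in> basic_construction u M N \<tau>.
           \<tau>1 (\<lambda>y\<in>M. S y + T y) = \<tau>1 S + \<tau>1 T \<and> \<tau>1 (compose M S T) = \<tau>1 (compose M T S)) \<and>
        (\<forall>c. \<tau>1 (\<lambda>y\<in>M. c \<cdot>\<^sub>m S y) = c * \<tau>1 S) \<and>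
        ((\<forall>y\<in>M. 0 \<le> \<tau> (mat_adjoint y * S y)) \<longrightarrow> 0 \<le> \<tau>1 S))"

definition is_markov_trace ::
    "complex mat \<Rightarrow> complex mat set \<Rightarrow> complex mat set \<Rightarrow> real \<Rightarrow> (complex mat \<Rightarrow> complex) \<Rightarrow> bool" where
  "is_markov_trace u M N b \<tau> \<longleftrightarrow> faithful_normalized_trace u M \<tau> \<and>
     (\<exists>\<tau>1. basic_construction_trace u M N \<tau> \<tau>1 \<and>
        (\<forall>x\<in>M. \<tau>1 (left_mult M x) = \<tau> x \<and>
           complex_of_real b * \<tau>1 (compose M (left_mult M x) (trace_expectation u M N \<tau>)) = \<tau> x))"

definition markov_trace ::
    "complex mat \<Rightarrow> complex mat set \<Rightarrow> complex mat set \<Rightarrow> complex mat \<Rightarrow> complex" where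
  "markov_trace u M N = (THE \<tau>. \<tau> \<in> extensional M \<and> (\<exists>b. is_markov_trace u M N b \<tau>))"

definition super_extremal :: "complex mat \<Rightarrow> complex mat set \<Rightarrow> complex mat set \<Rightarrow> bool" where
  "super_extremal u M N \<longleftrightarrow>
     minimal_expectation u M N = trace_expectation u M N (markov_trace u M N) \<and>
     (\<forall>x \<in> commutant u N \<inter> M. spherical_state u M N x = markov_trace u M N x)"

end

theory Submission
  imports Defs
begin

text \<open>
  Choosing matrix units for \<open>M\<close> and, inside each block of \<open>M\<close>, for the action of \<open>N\<close>, one obtains an
  orthonormal basis of the Hilbert space indexed by paths \<open>(i, j, l, a, c)\<close> in which \<open>M\<close>, \<open>N\<close> and
  their commutants act on complementary groups of indices; here \<open>l\<close> runs over the \<open>D i j\<close> copies of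
  the \<open>j\<close>-th block of \<open>N\<close> in the \<open>i\<close>-th block of \<open>M\<close>. For the traces that are canonical in this basis,
  spatial derivatives are quotients of densities. Hence every operator-valued weight
  from \<open>M\<close> to \<open>N\<close> has the form \<open>x \<mapsto> Ecan (\<kappa> x)\<close> with \<open>\<kappa>\<close> positive and invertible in the relative commutant, and
  its Kosaki inverse is the analogous map on the commutants with \<open>\<kappa>\<close> replaced by its inverse.

  Let \<open>D y = d x\<close> and \<open>D\<^sup>t x = d y\<close> be the normalized Perron-Frobenius vectors. A Cauchy-Schwarz argument
  shows that the index is minimal, with value \<open>d\<^sup>2\<close>, exactly for \<open>\<kappa> = x\<^sub>i / (d y\<^sub>j)\<close>. The spherical
  state has weights \<open>x\<^sub>i y\<^sub>j / d\<close>, and the Markov trace has weights proportional to \<open>x\<^sub>i\<close>, so that its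
  expectation is always the minimal one. Comparing the two states on the relative commutant,
  super-extremality means that \<open>y\<close> is proportional to \<open>\<beta>\<close>, that is, \<open>D\<^sup>t \<alpha> = d\<^sup>2 \<beta>\<close>. In that
  case \<open>d\<^sup>2\<close> is a rational eigenvalue of the integral matrix \<open>D\<^sup>t D\<close>, hence an integer. Scalars inside
  the diagonal matrices of size \<open>r\<close> realize the index \<open>r\<close>.
\<close>

text \<open>Every object of the statement is a definite description, so each has to be computed in
  closed form and then shown unique; densities with respect to fixed traces turn both tasks into
  matrix identities. Two requirements shape the set-up. The matrix dimension refers to corners
  acting on the range of \<open>p * q\<close>, so orthonormal systems are not assumed to span and
  the projection \<open>one\<close> onto their span serves as unit; a corner is then the same kind
  of inclusion with one row and one column, and its minimal index comes from the general
  computation. Secondly, Kosaki's inverse lives on the commutants, so presentations are kept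
  symmetric under exchanging the coordinate moved by an algebra with the one moved by its commutant,
  and lemmas are used on both sides. Connectedness enters through one fact: a function of rows and a
  function of columns that agree along all pairs with \<open>0 < D i j\<close> form a single element
  of both centers and are constant. This gives strict positivity of the Perron-Frobenius vectors and
  uniqueness of the Markov trace and of the spherical state.\<close>

section \<open>Adjoints and the complex inner product\<close>

lemma mat_adjoint_index [simp]:
  assumes "i < dim_col (A :: complex mat)" "j < dim_row A"
  shows "mat_adjoint A $$ (i, j) = cnj (A $$ (j, i))"
  using assms unfolding mat_adjoint_def mat_of_rows_def by simp

lemma mat_adjoint_dim [simp]:
  "dim_row (mat_adjoint (A :: complex mat)) = dim_col A"
  "dim_col (mat_adjoint A) = dim_row A"
  unfolding mat_adjoint_def mat_of_rows_def by simp_all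

lemma mat_adjoint_carrier [simp]:
  "(A :: complex mat) \<in> carrier_mat n m \<Longrightarrow> mat_adjoint A \<in> carrier_mat m n"
  by (auto intro!: carrier_matI)

lemma mat_adjoint_adjoint [simp]: "mat_adjoint (mat_adjoint (A :: complex mat)) = A"
  by (rule eq_matI) auto

lemma mat_adjoint_add:
  "(A :: complex mat) \<in> carrier_mat n m \<Longrightarrow> B \<in> carrier_mat n m \<Longrightarrow>
   mat_adjoint (A + B) = mat_adjoint A + mat_adjoint B"
  by (rule eq_matI) auto

lemma mat_adjoint_smult: "mat_adjoint (c \<cdot>\<^sub>m (A :: complex mat)) = cnj c \<cdot>\<^sub>m mat_adjoint A"
  by (rule eq_matI) auto

lemma mat_adjoint_mult:
  "(A :: complex mat) \<in> carrier_mat n m \<Longrightarrow> B \<in> carrier_mat m l \<Longrightarrow>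
   mat_adjoint (A * B) = mat_adjoint B * mat_adjoint A"
  by (rule eq_matI) (auto simp: scalar_prod_def mult.commute)

lemma mat_adjoint_one [simp]: "mat_adjoint (1\<^sub>m n :: complex mat) = 1\<^sub>m n"
  by (rule eq_matI) auto

lemma mat_adjoint_zero [simp]: "mat_adjoint (0\<^sub>m n m :: complex mat) = 0\<^sub>m m n"
  by (rule eq_matI) auto

lemma cscalar_sum:
  "w \<in> carrier_vec n \<Longrightarrow> v \<bullet>c w = (\<Sum>i<n. v $ i * cnj (w $ i))" for v w :: "complex vec"
  by (auto simp: scalar_prod_def lessThan_atLeast0)

lemma cscalar_commute:
  "v \<in> carrier_vec n \<Longrightarrow> w \<in> carrier_vec n \<Longrightarrow> cnj (v \<bullet>c w) = w \<bullet>c v" for v w :: "complex vec"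
  by (simp add: cscalar_sum mult.commute)

lemma cscalar_mult_mat_vec:
  fixes v w :: "complex vec"
  assumes "x \<in> carrier_mat n m" "v \<in> carrier_vec m" "w \<in> carrier_vec n"
  shows "(x *\<^sub>v v) \<bullet>c w = v \<bullet>c (mat_adjoint x *\<^sub>v w)"
proof -
  have "(x *\<^sub>v v) \<bullet>c w = (\<Sum>i<n. \<Sum>j<m. x $$ (i,j) * v $ j * cnj (w $ i))"
    using assms by (simp add: cscalar_sum[of _ n] scalar_prod_def sum_distrib_right lessThan_atLeast0)
  also have "\<dots> = (\<Sum>j<m. \<Sum>i<n. x $$ (i,j) * v $ j * cnj (w $ i))"
    by (rule sum.swap)
  also have "\<dots> = v \<bullet>c (mat_adjoint x *\<^sub>v w)"
    using assms by (simp add: cscalar_sum[of _ m] scalar_prod_def sum_distrib_left lessThan_atLeast0 ac_simps)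
  finally show ?thesis .
qed

lemma cscalar_smult_left:
  "v \<in> carrier_vec n \<Longrightarrow> w \<in> carrier_vec n \<Longrightarrow> (c \<cdot>\<^sub>v v) \<bullet>c w = c * (v \<bullet>c w)" for v w :: "complex vec"
  by (simp add: cscalar_sum sum_distrib_left mult.assoc)

lemma cscalar_smult_right:
  "v \<in> carrier_vec n \<Longrightarrow> w \<in> carrier_vec n \<Longrightarrow> v \<bullet>c (c \<cdot>\<^sub>v w) = cnj c * (v \<bullet>c w)" for v w :: "complex vec"
  by (subst cscalar_sum[of _ n], simp, subst cscalar_sum[of _ n]) (simp_all add: sum_distrib_left ac_simps)

lemma cscalar_add_left:
  "v \<in> carrier_vec n \<Longrightarrow> v' \<in> carrier_vec n \<Longrightarrow> w \<in> carrier_vec n \<Longrightarrow>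
   (v + v') \<bullet>c w = v \<bullet>c w + v' \<bullet>c w" for v w :: "complex vec"
  by (simp add: cscalar_sum sum.distrib distrib_right)

lemma cscalar_add_right:
  "v \<in> carrier_vec n \<Longrightarrow> w \<in> carrier_vec n \<Longrightarrow> w' \<in> carrier_vec n \<Longrightarrow>
   v \<bullet>c (w + w') = v \<bullet>c w + v \<bullet>c w'" for v w :: "complex vec"
  by (subst (1 2 3) cscalar_sum[of _ n]) (simp_all add: sum.distrib distrib_left)

lemma cscalar_eqI:
  assumes "v \<in> carrier_vec n" "v' \<in> carrier_vec n"
    and "\<And>w. w \<in> carrier_vec n \<Longrightarrow> v \<bullet>c w = v' \<bullet>c w"
  shows "v = (v' :: complex vec)"
proof (rule eq_vecI)
  fix i assume "i < dim_vec v'"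
  then have i: "i < n" using assms by auto
  have "v \<bullet>c unit_vec n i = v $ i" if "v \<in> carrier_vec n" for v :: "complex vec"
    using i by (subst cscalar_sum[of _ n]) (auto simp: if_distrib cong: if_cong)
  then show "v $ i = v' $ i" using assms by (metis unit_vec_carrier)
qed (use assms in auto)

lemma cscalar_mat_eqI:
  assumes "x \<in> carrier_mat n m" "y \<in> carrier_mat n m"
    and "\<And>v w. v \<in> carrier_vec m \<Longrightarrow> w \<in> carrier_vec n \<Longrightarrow> (x *\<^sub>v v) \<bullet>c w = (y *\<^sub>v v) \<bullet>c w"
  shows "x = (y :: complex mat)"
proof (rule eq_matI)
  fix i j assume "i < dim_row y" "j < dim_col y"
  then have ij: "i < n" "j < m" using assms by auto
  have "x *\<^sub>v unit_vec m j = y *\<^sub>v unit_vec m j"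
    by (rule cscalar_eqI[of _ n]) (use assms in auto)
  then have "(x *\<^sub>v unit_vec m j) $ i = (y *\<^sub>v unit_vec m j) $ i" by simp
  then show "x $$ (i, j) = y $$ (i, j)" using ij assms by (simp add: scalar_prod_right_unit)
qed (use assms in auto)

lemma mat_vec_eqI:
  assumes "x \<in> carrier_mat n m" "y \<in> carrier_mat n m"
    and "\<And>v. v \<in> carrier_vec m \<Longrightarrow> x *\<^sub>v v = y *\<^sub>v v"
  shows "x = (y :: complex mat)"
  by (rule cscalar_mat_eqI) (use assms in auto)

lemma smult_mat_vec:
  "x \<in> carrier_mat n m \<Longrightarrow> v \<in> carrier_vec m \<Longrightarrow> (c \<cdot>\<^sub>m x) *\<^sub>v v = c \<cdot>\<^sub>v (x *\<^sub>v v)" for x :: "complex mat"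
  by (rule eq_vecI) (auto simp: scalar_prod_def sum_distrib_left mult.assoc)

text \<open>The form at \<open>v + d \<cdot>\<^sub>v w\<close> gives one relation between the two
  cross terms for each scalar \<open>d\<close>; the values \<open>d = 1\<close> and
  \<open>d = \<i>\<close> together force both terms to vanish.\<close>

lemma polarization:
  assumes T: "T \<in> carrier_mat n n"
    and H: "\<And>v w. v \<in> H \<Longrightarrow> w \<in> H \<Longrightarrow> v + w \<in> H" "\<And>v c. v \<in> H \<Longrightarrow> c \<cdot>\<^sub>v v \<in> H" "H \<subseteq> carrier_vec n"
    and zero: "\<And>v. v \<in> H \<Longrightarrow> (T *\<^sub>v v) \<bullet>c v = 0"
    and v: "v \<in> H" and w: "w \<in> H"
  shows "(T *\<^sub>v v) \<bullet>c w = (0 :: complex)"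
proof -
  have c: "v \<in> carrier_vec n" "w \<in> carrier_vec n" using v w H by auto
  have e: "(T *\<^sub>v v) \<bullet>c (d \<cdot>\<^sub>v w) + (T *\<^sub>v (d \<cdot>\<^sub>v w)) \<bullet>c v = 0" for d
  proof -
    have "(T *\<^sub>v (v + d \<cdot>\<^sub>v w)) \<bullet>c (v + d \<cdot>\<^sub>v w) = 0" using zero H v w by blast
    moreover have "(T *\<^sub>v (v + d \<cdot>\<^sub>v w)) \<bullet>c (v + d \<cdot>\<^sub>v w) =
      (T *\<^sub>v v) \<bullet>c v + (T *\<^sub>v v) \<bullet>c (d \<cdot>\<^sub>v w) + (T *\<^sub>v (d \<cdot>\<^sub>v w)) \<bullet>c v + (T *\<^sub>v (d \<cdot>\<^sub>v w)) \<bullet>c (d \<cdot>\<^sub>v w)"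
      using T c by (simp add: mult_add_distrib_mat_vec[of _ n n] cscalar_add_left[of _ n] cscalar_add_right[of _ n])
    moreover have "(T *\<^sub>v (d \<cdot>\<^sub>v w)) \<bullet>c (d \<cdot>\<^sub>v w) = 0" using zero H w by blast
    ultimately show ?thesis using zero v by simp
  qed
  have e': "cnj d * ((T *\<^sub>v v) \<bullet>c w) + d * ((T *\<^sub>v w) \<bullet>c v) = 0" for d
    using e[of d] T c by (simp add: cscalar_smult_right[of _ n] cscalar_smult_left[of _ n] mult_mat_vec[of _ n n])
  have "(T *\<^sub>v w) \<bullet>c v = - ((T *\<^sub>v v) \<bullet>c w)"
    using e'[of 1] by (simp add: eq_neg_iff_add_eq_0 add.commute)
  moreover have "(T *\<^sub>v w) \<bullet>c v = ((T *\<^sub>v v) \<bullet>c w)" using e'[of \<i>]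
    by (simp add: algebra_simps)
  ultimately show ?thesis by simp
qed

subsection \<open>Operators in an orthonormal basis\<close>

text \<open>The system may span a proper subspace, as it does for the corners. The projection
  \<open>one\<close> onto its span then takes the place of the unit \<open>u\<close> of the
  definitions.\<close>

locale onb =
  fixes k :: nat and P :: "'p set" and \<xi> :: "'p \<Rightarrow> complex vec"
  assumes finP [simp]: "finite P"
    and xi_carrier [simp]: "p \<in> P \<Longrightarrow> \<xi> p \<in> carrier_vec k"
    and ortho: "p \<in> P \<Longrightarrow> q \<in> P \<Longrightarrow> \<xi> p \<bullet>c \<xi> q = (if p = q then 1 else 0)"
begin

definition vop :: "('p \<Rightarrow> complex) \<Rightarrow> complex vec" where
  "vop f = vec k (\<lambda>r. \<Sum>p\<in>P. f p * \<xi> p $ r)"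

definition coef :: "complex vec \<Rightarrow> 'p \<Rightarrow> complex" where
  "coef v p = v \<bullet>c \<xi> p"

definition opr :: "('p \<Rightarrow> 'p \<Rightarrow> complex) \<Rightarrow> complex mat" where
  "opr K = mat k k (\<lambda>(r, c). \<Sum>p\<in>P. \<Sum>q\<in>P. K p q * \<xi> p $ r * cnj (\<xi> q $ c))"

text \<open>Matrix coefficients in the chosen system, not a null space. \<open>opr\<close> and
  \<open>ker\<close> are mutually inverse between kernels on \<open>P\<close> and operators in
  \<open>ops one\<close>.\<close>

definition ker :: "complex mat \<Rightarrow> 'p \<Rightarrow> 'p \<Rightarrow> complex" where
  "ker x p q = coef (x *\<^sub>v \<xi> q) p"

definition one :: "complex mat" where
  "one = opr (\<lambda>p q. if p = q then 1 else 0)"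

lemma vop_carrier [simp]: "vop f \<in> carrier_vec k" by (simp add: vop_def)
lemma opr_carrier [simp]: "opr K \<in> carrier_mat k k" by (simp add: opr_def)
lemma opr_dim [simp]: "dim_row (opr K) = k" "dim_col (opr K) = k" by (simp_all add: opr_def)
lemma one_carrier [simp]: "one \<in> carrier_mat k k" by (simp add: one_def)
lemma one_dim [simp]: "dim_row one = k" "dim_col one = k" by (simp_all add: one_def)

lemma xi_dim [simp]: "p \<in> P \<Longrightarrow> dim_vec (\<xi> p) = k"
  using xi_carrier carrier_vecD by blast

lemma vop_cong: "(\<And>p. p \<in> P \<Longrightarrow> f p = g p) \<Longrightarrow> vop f = vop g"
  by (simp add: vop_def)

lemma opr_cong: "(\<And>p q. p \<in> P \<Longrightarrow> q \<in> P \<Longrightarrow> K p q = L p q) \<Longrightarrow> opr K = opr L"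
  by (simp add: opr_def)

lemma vop_inner: "w \<in> carrier_vec k \<Longrightarrow> vop f \<bullet>c w = (\<Sum>p\<in>P. f p * cnj (coef w p))"
proof -
  assume w: "w \<in> carrier_vec k"
  have "vop f \<bullet>c w = (\<Sum>r<k. \<Sum>p\<in>P. f p * (\<xi> p $ r * cnj (w $ r)))"
    using w by (simp add: vop_def cscalar_sum[of _ k] sum_distrib_right mult.assoc)
  also have "\<dots> = (\<Sum>p\<in>P. f p * (\<Sum>r<k. \<xi> p $ r * cnj (w $ r)))"
    by (subst sum.swap) (simp add: sum_distrib_left)
  also have "\<dots> = (\<Sum>p\<in>P. f p * cnj (coef w p))"
    using w by (intro sum.cong) (auto simp: coef_def cscalar_commute[of _ k] simp flip: cscalar_sum)
  finally show ?thesis .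
qed

lemma vop_xi: "p \<in> P \<Longrightarrow> vop (\<lambda>q. if q = p then 1 else 0) = \<xi> p"
  by (rule eq_vecI) (auto simp: vop_def if_distrib[of "\<lambda>x. x * _"] cong: if_cong)

lemma coef_xi: "p \<in> P \<Longrightarrow> q \<in> P \<Longrightarrow> coef (\<xi> p) q = (if p = q then 1 else 0)"
  by (simp add: coef_def ortho)

lemma coef_vop [simp]: "p \<in> P \<Longrightarrow> coef (vop f) p = f p"
  by (subst coef_def) (simp add: vop_inner coef_xi if_distrib cong: if_cong)

lemma vop_inner_vop: "vop f \<bullet>c vop g = (\<Sum>p\<in>P. f p * cnj (g p))"
  by (simp add: vop_inner)

lemma opr_mult_vec: "v \<in> carrier_vec k \<Longrightarrow> opr K *\<^sub>v v = vop (\<lambda>p. \<Sum>q\<in>P. K p q * coef v q)"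
proof (rule eq_vecI)
  assume v: "v \<in> carrier_vec k"
  fix r assume "r < dim_vec (vop (\<lambda>p. \<Sum>q\<in>P. K p q * coef v q))"
  then have r: "r < k" by (simp add: vop_def)
  have "(opr K *\<^sub>v v) $ r = (\<Sum>c<k. (\<Sum>p\<in>P. \<Sum>q\<in>P. K p q * \<xi> p $ r * cnj (\<xi> q $ c)) * v $ c)"
    using v r by (simp add: opr_def scalar_prod_def lessThan_atLeast0)
  also have "\<dots> = (\<Sum>c<k. \<Sum>p\<in>P. \<Sum>q\<in>P. K p q * \<xi> p $ r * (v $ c * cnj (\<xi> q $ c)))"
    by (simp add: sum_distrib_right sum_distrib_left ac_simps)
  also have "\<dots> = (\<Sum>p\<in>P. \<Sum>q\<in>P. \<Sum>c<k. K p q * \<xi> p $ r * (v $ c * cnj (\<xi> q $ c)))"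
    by (subst sum.swap, rule sum.cong[OF refl], rule sum.swap)
  also have "\<dots> = (\<Sum>p\<in>P. (\<Sum>q\<in>P. K p q * coef v q) * \<xi> p $ r)"
    using v by (intro sum.cong refl)
      (simp add: coef_def sum_distrib_left sum_distrib_right cscalar_sum[of _ k] ac_simps)
  finally show "(opr K *\<^sub>v v) $ r = vop (\<lambda>p. \<Sum>q\<in>P. K p q * coef v q) $ r"
    using r by (simp add: vop_def)
qed (simp add: vop_def opr_def)

lemma opr_mult_vop [simp]: "opr K *\<^sub>v vop f = vop (\<lambda>p. \<Sum>q\<in>P. K p q * f q)"
  by (simp add: opr_mult_vec)

lemma opr_mult_xi: "q \<in> P \<Longrightarrow> opr K *\<^sub>v \<xi> q = vop (\<lambda>p. K p q)"
  by (subst opr_mult_vec) (auto intro!: vop_cong simp: coef_xi if_distrib cong: if_cong)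

lemma ker_opr [simp]: "p \<in> P \<Longrightarrow> q \<in> P \<Longrightarrow> ker (opr K) p q = K p q"
  by (simp add: ker_def opr_mult_xi)

lemma opr_mult: "opr K * opr L = opr (\<lambda>p q. \<Sum>r\<in>P. K p r * L r q)"
proof (rule mat_vec_eqI)
  fix v :: "complex vec" assume v: "v \<in> carrier_vec k"
  have "opr K * opr L *\<^sub>v v = opr K *\<^sub>v (opr L *\<^sub>v v)"
    using v by (simp add: assoc_mult_mat_vec[of _ k k _ k])
  also have "\<dots> = vop (\<lambda>p. \<Sum>r\<in>P. K p r * (\<Sum>q\<in>P. L r q * coef v q))"
    using v by (simp add: opr_mult_vec[OF v])
  also have "\<dots> = vop (\<lambda>p. \<Sum>q\<in>P. (\<Sum>r\<in>P. K p r * L r q) * coef v q)"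
    by (rule vop_cong) (simp add: sum_distrib_left sum_distrib_right mult.assoc, rule sum.swap)
  finally show "opr K * opr L *\<^sub>v v = opr (\<lambda>p q. \<Sum>r\<in>P. K p r * L r q) *\<^sub>v v"
    by (simp add: opr_mult_vec[OF v])
qed (auto intro!: mult_carrier_mat)

lemma opr_add: "opr K + opr L = opr (\<lambda>p q. K p q + L p q)"
  by (rule eq_matI) (auto simp: opr_def sum.distrib algebra_simps)

lemma opr_smult: "c \<cdot>\<^sub>m opr K = opr (\<lambda>p q. c * K p q)"
  by (rule eq_matI) (auto simp: opr_def sum_distrib_left algebra_simps)

lemma opr_adjoint: "mat_adjoint (opr K) = opr (\<lambda>p q. cnj (K q p))"
proof (rule eq_matI)
  fix r c assume "r < dim_row (opr (\<lambda>p q. cnj (K q p)))" "c < dim_col (opr (\<lambda>p q. cnj (K q p)))"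
  then show "mat_adjoint (opr K) $$ (r, c) = opr (\<lambda>p q. cnj (K q p)) $$ (r, c)"
    by (subst mat_adjoint_index) (auto simp: opr_def ac_simps intro: sum.swap)
qed auto

lemma opr_zero: "opr (\<lambda>p q. 0) = 0\<^sub>m k k"
  by (rule eq_matI) (auto simp: opr_def)

lemma one_mult_vec: "v \<in> carrier_vec k \<Longrightarrow> one *\<^sub>v v = vop (coef v)"
  unfolding one_def by (subst opr_mult_vec)
    (auto intro!: vop_cong simp: if_distrib[of "\<lambda>x. x * _"] cong: if_cong)

lemma opr_one [simp]: "opr K * one = opr K" "one * opr K = opr K"
  unfolding one_def opr_mult
  by (auto intro!: opr_cong simp: if_distrib[of "\<lambda>x. x * _"] if_distrib[of "\<lambda>x. _ * x"] cong: if_cong)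

lemma one_adjoint [simp]: "mat_adjoint one = one"
  unfolding one_def opr_adjoint by (rule opr_cong) auto

lemma one_one [simp]: "one * one = one"
  using opr_one(1) one_def by metis

lemma one_projection: "is_projection one"
  by (simp add: is_projection_def)

lemma hilb_one_iff: "v \<in> hilb one \<longleftrightarrow> (\<exists>f. v = vop f)"
proof
  assume "v \<in> hilb one"
  then show "\<exists>f. v = vop f" using one_mult_vec[of v] by (auto simp: hilb_def)
next
  assume "\<exists>f. v = vop f"
  then show "v \<in> hilb one" by (auto simp: hilb_def one_mult_vec intro!: vop_cong)
qed

lemma vop_coef: "v \<in> hilb one \<Longrightarrow> vop (coef v) = v"
  by (auto simp: hilb_one_iff intro!: vop_cong)

lemma vop_hilb [simp]: "vop f \<in> hilb one" by (auto simp: hilb_one_iff)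

lemma xi_hilb [simp]: "p \<in> P \<Longrightarrow> \<xi> p \<in> hilb one"
  by (metis vop_xi vop_hilb)

lemma opr_ops [simp]: "opr K \<in> ops one" by (simp add: ops_def)

lemma opr_ker: "x \<in> ops one \<Longrightarrow> opr (ker x) = x"
proof (rule cscalar_mat_eqI[symmetric, of _ k k])
  assume x: "x \<in> ops one"
  then show c: "x \<in> carrier_mat k k" by (simp add: ops_def)
  fix v w :: "complex vec" assume v: "v \<in> carrier_vec k" and w: "w \<in> carrier_vec k"
  \<comment> \<open>Membership in \<open>ops one\<close> is what allows \<open>x\<close> to be
    computed from basis vectors alone: both arguments may be projected to the span.\<close>
  have xe: "x *\<^sub>v v = one *\<^sub>v (x *\<^sub>v (one *\<^sub>v v))"
    using x v c by (simp add: ops_def flip: assoc_mult_mat_vec[of _ k k _ k])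
  have "(x *\<^sub>v v) \<bullet>c w = (\<Sum>p\<in>P. coef (x *\<^sub>v vop (coef v)) p * cnj (coef w p))"
    using v w c by (simp add: xe one_mult_vec[of "x *\<^sub>v _"] one_mult_vec[OF v] vop_inner)
  also have "\<dots> = (\<Sum>p\<in>P. (\<Sum>q\<in>P. ker x p q * coef v q) * cnj (coef w p))"
  proof (rule sum.cong[OF refl])
    fix p assume p: "p \<in> P"
    have "coef (x *\<^sub>v vop (coef v)) p = vop (coef v) \<bullet>c (mat_adjoint x *\<^sub>v \<xi> p)"
      unfolding coef_def using p c by (intro cscalar_mult_mat_vec) auto
    also have "\<dots> = (\<Sum>q\<in>P. coef v q * cnj (coef (mat_adjoint x *\<^sub>v \<xi> p) q))"
      using c p by (intro vop_inner) (auto intro!: mult_mat_vec_carrier[of _ k k])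
    also have "\<dots> = (\<Sum>q\<in>P. ker x p q * coef v q)"
    proof (rule sum.cong[OF refl])
      fix q assume q: "q \<in> P"
      have "cnj (coef (mat_adjoint x *\<^sub>v \<xi> p) q) = \<xi> q \<bullet>c (mat_adjoint x *\<^sub>v \<xi> p)"
        unfolding coef_def using p q c
        by (intro cscalar_commute[of _ k]) (auto intro!: mult_mat_vec_carrier[of _ k k])
      also have "\<dots> = ker x p q" unfolding ker_def coef_def
        using p q c by (subst cscalar_mult_mat_vec[of x k k]) auto
      finally show "coef v q * cnj (coef (mat_adjoint x *\<^sub>v \<xi> p) q) = ker x p q * coef v q" by simp
    qed
    finally show "coef (x *\<^sub>v vop (coef v)) p * cnj (coef w p) =
      (\<Sum>q\<in>P. ker x p q * coef v q) * cnj (coef w p)" by simp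
  qed
  also have "\<dots> = (opr (ker x) *\<^sub>v v) \<bullet>c w"
    using v w by (simp add: opr_mult_vec vop_inner)
  finally show "(x *\<^sub>v v) \<bullet>c w = (opr (ker x) *\<^sub>v v) \<bullet>c w" .
qed simp_all

lemma ops_one_iff: "x \<in> ops one \<longleftrightarrow> (\<exists>K. x = opr K)"
  using opr_ker by (metis opr_ops)

lemma ops_eqI: "x \<in> ops one \<Longrightarrow> y \<in> ops one \<Longrightarrow> (\<And>p q. p \<in> P \<Longrightarrow> q \<in> P \<Longrightarrow> ker x p q = ker y p q) \<Longrightarrow> x = y"
  by (metis opr_ker opr_cong)

end

section \<open>Positive kernels and their square roots\<close>

lemma psd_diag:
  fixes X :: "'s \<Rightarrow> 's \<Rightarrow> complex"
  assumes fin: "finite S" and psd: "\<And>f. 0 \<le> (\<Sum>s\<in>S. \<Sum>t\<in>S. X s t * f t * cnj (f s))"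
    and s: "s \<in> S"
  shows "0 \<le> X s s"
proof -
  let ?f = "\<lambda>r. if r = s then 1 else 0"
  have "(\<Sum>p\<in>S. \<Sum>t\<in>S. X p t * ?f t * cnj (?f p)) = (\<Sum>p\<in>S. if p = s then X s s else 0)"
    using s fin by (intro sum.cong) (auto simp: if_distrib[of "\<lambda>x. _ * x"] cong: if_cong)
  then show ?thesis using psd[of ?f] s fin by simp
qed

text \<open>Only vectors supported on two points are tested, so both claims concern a 2 by 2 form:
  its values are real, and if one diagonal entry vanishes, a nonzero off-diagonal entry would make
  some value negative.\<close>

lemma psd_hermitian:
  fixes X :: "'s \<Rightarrow> 's \<Rightarrow> complex"
  assumes fin: "finite S" and psd: "\<And>f. 0 \<le> (\<Sum>s\<in>S. \<Sum>t\<in>S. X s t * f t * cnj (f s))"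
    and s: "s \<in> S" and t: "t \<in> S"
  shows "X s t = cnj (X t s)"
    and "X s s = 0 \<Longrightarrow> X s t = 0"
proof -
  have diag: "0 \<le> X s s" if "s \<in> S" for s
    using psd_diag[OF fin psd that] .
  have e: "0 \<le> X s s * (a * cnj a) + X t t * (c * cnj c) + (X s t * (c * cnj a) + X t s * (a * cnj c))"
    if st: "s \<noteq> t" for a c
  proof -
    let ?f = "\<lambda>r. if r = s then a else if r = t then c else 0"
    have "(\<Sum>p\<in>S. \<Sum>q\<in>S. X p q * ?f q * cnj (?f p)) = (\<Sum>p\<in>{s,t}. \<Sum>q\<in>S. X p q * ?f q * cnj (?f p))"
      using fin s t by (intro sum.mono_neutral_right) auto
    also have "\<dots> = (\<Sum>p\<in>{s,t}. \<Sum>q\<in>{s,t}. X p q * ?f q * cnj (?f p))"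
      using fin s t by (intro sum.cong sum.mono_neutral_right) auto
    also have "\<dots> = X s s * (a * cnj a) + X t t * (c * cnj c) + (X s t * (c * cnj a) + X t s * (a * cnj c))"
      using st by (simp add: algebra_simps)
    finally show ?thesis using psd[of ?f] by simp
  qed
  have im: "Im (X s s) = 0" "Im (X t t) = 0" using diag s t by (auto simp: less_eq_complex_def)
  show herm: "X s t = cnj (X t s)"
  proof (cases "s = t")
    case True
    then show ?thesis using im by (simp add: complex_eq_iff)
  next
    case False
    from e[OF False, of 1 1] e[OF False, of 1 \<i>] show ?thesis using im
      by (simp add: less_eq_complex_def complex_eq_iff)
  qed
  assume 0: "X s s = 0"
  show "X s t = 0"
  proof (rule ccontr)
    assume ne: "X s t \<noteq> 0"
    then have st: "s \<noteq> t" using 0 by auto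
    have e': "0 \<le> X t t + (X t s * c + X s t * cnj c)" for c
      using e[OF st, of c 1] 0 by (simp add: algebra_simps)
    define m where "m = (cmod (X s t))\<^sup>2"
    have m: "m > 0" using ne by (simp add: m_def)
    \<comment> \<open>Chosen so that the value of the form at \<open>c = - r * X s t\<close> has
      real part \<open>Re (X t t) - 2 * r * m = -1\<close>.\<close>
    define r where "r = (Re (X t t) + 1) / (2 * m)"
    have "X s t * cnj (X s t) = complex_of_real m" unfolding m_def complex_norm_square by simp
    then have "X t s * (- complex_of_real r * X s t) + X s t * cnj (- complex_of_real r * X s t)
        = - (2 * complex_of_real (r * m))"
      using herm by (simp add: algebra_simps)
    then have "0 \<le> X t t - 2 * complex_of_real (r * m)"
      using e'[of "- complex_of_real r * X s t"] 0 by (simp add: algebra_simps)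
    then have "0 \<le> Re (X t t) - 2 * r * m" by (simp add: less_eq_complex_def)
    then show False using m by (simp add: r_def)
  qed
qed

text \<open>Elimination of one index: subtracting the rank one part through \<open>s0\<close> leaves
  the Schur complement, which is positive again and is factored by induction. A zero pivot
  \<open>a\<close> is covered because its whole row vanishes and division by zero gives
  zero.\<close>

lemma cholesky:
  fixes X :: "'s \<Rightarrow> 's \<Rightarrow> complex"
  assumes "finite S" and "\<And>f. 0 \<le> (\<Sum>s\<in>S. \<Sum>t\<in>S. X s t * f t * cnj (f s))"
  shows "\<exists>Y. \<forall>s\<in>S. \<forall>t\<in>S. X s t = (\<Sum>r\<in>S. cnj (Y r s) * Y r t)"
  using assms
proof (induction S arbitrary: X rule: finite_induct)
  case (insert s0 S)
  note psd = insert(4)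
  have fin: "finite (insert s0 S)" using insert(1) by simp
  define a where "a = X s0 s0"
  have herm: "X s t = cnj (X t s)" if "s \<in> insert s0 S" "t \<in> insert s0 S" for s t
    using psd_hermitian(1)[OF fin psd] that by blast
  have a0: "X s0 t = 0" if "a = 0" "t \<in> insert s0 S" for t
    using psd_hermitian(2)[OF fin psd] that unfolding a_def by blast
  have "0 \<le> (\<Sum>s\<in>S. \<Sum>t\<in>S. (X s t - X s s0 * X s0 t / a) * f t * cnj (f s))" for f
  proof -
    define g where "g = (\<Sum>t\<in>S. X s0 t * f t)"
    have g': "(\<Sum>s\<in>S. X s s0 * cnj (f s)) = cnj g"
      unfolding g_def cnj_sum using herm[of _ s0] by (intro sum.cong) auto
    \<comment> \<open>The value at \<open>s0\<close> minimizes the form for given values on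
      \<open>S\<close>. Completing the square there turns positivity of \<open>X\<close> into
      positivity of the Schur complement.\<close>
    define h where "h = (\<lambda>s. if s = s0 then - g / a else f s)"
    have hS: "h s = f s" if "s \<in> S" for s using that insert(2) by (auto simp: h_def)
    have "cnj a = a" using herm[of s0 s0] by (simp add: a_def)
    have "(\<Sum>s\<in>insert s0 S. \<Sum>t\<in>insert s0 S. X s t * h t * cnj (h s)) =
      (a * h s0 + (\<Sum>t\<in>S. X s0 t * f t)) * cnj (h s0) +
      (\<Sum>s\<in>S. (X s s0 * h s0 + (\<Sum>t\<in>S. X s t * f t)) * cnj (f s))"
      using insert(1,2) by (simp add: a_def hS sum_distrib_right distrib_right mult.assoc)
    also have "\<dots> = (a * h s0 + g) * cnj (h s0) + (h s0 * cnj g + (\<Sum>s\<in>S. (\<Sum>t\<in>S. X s t * f t) * cnj (f s)))"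
      unfolding g'[symmetric] by (simp add: g_def sum.distrib sum_distrib_left algebra_simps)
    also have "\<dots> = (\<Sum>s\<in>S. (\<Sum>t\<in>S. X s t * f t) * cnj (f s)) - g * cnj g / a"
      using \<open>cnj a = a\<close> a0 by (cases "a = 0") (auto simp: h_def g_def)
    also have "\<dots> = (\<Sum>s\<in>S. \<Sum>t\<in>S. (X s t - X s s0 * X s0 t / a) * f t * cnj (f s))"
    proof -
      have "g * cnj g / a = (\<Sum>s\<in>S. \<Sum>t\<in>S. X s s0 * X s0 t / a * f t * cnj (f s))"
        unfolding g'[symmetric] unfolding g_def
        by (simp add: sum_distrib_left sum_distrib_right sum_divide_distrib ac_simps)
      then show ?thesis
        by (simp add: left_diff_distrib sum_subtractf sum_distrib_right)
    qed
    finally show ?thesis using psd[of h] by simp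
  qed
  from insert.IH[OF this] obtain Y where
    Y: "\<And>s t. s \<in> S \<Longrightarrow> t \<in> S \<Longrightarrow> X s t - X s s0 * X s0 t / a = (\<Sum>r\<in>S. cnj (Y r s) * Y r t)" by blast
  have apos: "0 \<le> a" unfolding a_def by (rule psd_diag[OF fin psd]) auto
  define b where "b = complex_of_real (sqrt (Re a))"
  have b: "b * b = a" "cnj b = b" using apos
    by (auto simp: b_def less_eq_complex_def complex_eq_iff simp flip: of_real_mult)
  \<comment> \<open>The row of \<open>s0\<close>, divided by the root of the pivot, is put on top of
    the factor of the Schur complement, whose column at \<open>s0\<close> is filled with
    zeros.\<close>
  define Z where "Z r t = (if r = s0 then X s0 t / b else if t = s0 then 0 else Y r t)" for r t
  have b0: "b = 0 \<longleftrightarrow> a = 0" using b by auto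
  have sumZ: "(\<Sum>r\<in>insert s0 S. cnj (Z r s) * Z r t) = X s s0 * X s0 t / a + (\<Sum>r\<in>S. cnj (Z r s) * Z r t)"
    if st: "s \<in> insert s0 S" "t \<in> insert s0 S" for s t
  proof -
    have "cnj (Z s0 s) * Z s0 t = cnj (X s0 s) * X s0 t / (b * b)" using b by (simp add: Z_def)
    also have "\<dots> = X s s0 * X s0 t / a" using herm[of s s0] st b by simp
    finally show ?thesis using insert(1,2) by simp
  qed
  show ?case
  proof (intro exI ballI)
    fix s t assume st: "s \<in> insert s0 S" "t \<in> insert s0 S"
    have "(\<Sum>r\<in>S. cnj (Z r s) * Z r t) = (if s = s0 \<or> t = s0 then 0 else (\<Sum>r\<in>S. cnj (Y r s) * Y r t))"
      using insert(2) by (auto simp: Z_def intro!: sum.neutral sum.cong)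
    moreover have "X s s0 * X s0 t / a = X s t" if "s = s0 \<or> t = s0"
      using that a0[of t] a0[of s] herm[of s s0] st by (cases "a = 0") (auto simp: a_def)
    ultimately show "X s t = (\<Sum>r\<in>insert s0 S. cnj (Z r s) * Z r t)"
      using sumZ[OF st] Y[of s t] st by (auto simp: diff_eq_eq add.commute)
  qed
qed simp

section \<open>Algebras with a trace and their commutants, abstractly\<close>

text \<open>The assumption \<open>riesz\<close> gives every functional a density in
  \<open>A\<close>. It stands in for finite dimension, so that the theory of weights can be
  developed without a basis.\<close>

locale tracial_alg =
  fixes k :: nat and u :: "complex mat" and A :: "complex mat set" and T :: "complex mat \<Rightarrow> complex"
  assumes u_carrier [simp]: "u \<in> carrier_mat k k"
    and star: "star_subalgebra u A"
    and faithful: "faithful_weight A T"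
    and tracial: "x \<in> A \<Longrightarrow> y \<in> A \<Longrightarrow> T (x * y) = T (y * x)"
    and riesz: "linear_functional A \<phi> \<Longrightarrow> \<exists>\<rho>\<in>A. \<forall>x\<in>A. \<phi> x = T (\<rho> * x)"

text \<open>
  \<open>eA v w\<close> and \<open>eB v w\<close> are the densities of the vector functionals \<open>a \<mapsto> (a *\<^sub>v v) \<bullet>c w\<close> with respect
  to the traces. The condition \<open>dual\<close> normalizes the two traces against each other: it makes Connes'
  operator of \<open>v\<close> for the trace \<open>TB\<close> equal to \<open>eA v v\<close>.
\<close>

locale dual_pair =
  A: tracial_alg k u A TA + B: tracial_alg k u B TB
  for k u A TA B TB +
  fixes eA eB :: "complex vec \<Rightarrow> complex vec \<Rightarrow> complex mat"
  assumes commA: "commutant u A = B" and commB: "commutant u B = A"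
    and eA_in: "v \<in> hilb u \<Longrightarrow> w \<in> hilb u \<Longrightarrow> eA v w \<in> A"
    and eB_in: "v \<in> hilb u \<Longrightarrow> w \<in> hilb u \<Longrightarrow> eB v w \<in> B"
    and TA_eA: "a \<in> A \<Longrightarrow> v \<in> hilb u \<Longrightarrow> w \<in> hilb u \<Longrightarrow> TA (a * eA v w) = (a *\<^sub>v v) \<bullet>c w"
    and TB_eB: "b \<in> B \<Longrightarrow> v \<in> hilb u \<Longrightarrow> w \<in> hilb u \<Longrightarrow> TB (b * eB v w) = (b *\<^sub>v v) \<bullet>c w"
    and dual: "v \<in> hilb u \<Longrightarrow> w \<in> hilb u \<Longrightarrow> z \<in> hilb u \<Longrightarrow> eA v w *\<^sub>v z = eB z w *\<^sub>v v"
    and rootA: "h \<in> A \<Longrightarrow> (\<And>v. v \<in> hilb u \<Longrightarrow> 0 \<le> (h *\<^sub>v v) \<bullet>c v) \<Longrightarrow> \<exists>y\<in>A. h = mat_adjoint y * y"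
    and rootB: "h \<in> B \<Longrightarrow> (\<And>v. v \<in> hilb u \<Longrightarrow> 0 \<le> (h *\<^sub>v v) \<bullet>c v) \<Longrightarrow> \<exists>y\<in>B. h = mat_adjoint y * y"

section \<open>Concrete block algebras in an orthonormal system\<close>

context onb
begin

text \<open>In block \<open>i\<close> this is \<open>X i\<close> tensored with the identity on the
  multiplicity coordinate \<open>cc\<close>. The coordinate maps are arguments, so that exchanging
  \<open>cs\<close> and \<open>cc\<close> describes the commutant and other triples describe other
  algebras on the same system.\<close>

definition bop :: "('p \<Rightarrow> 'i) \<Rightarrow> ('p \<Rightarrow> 's) \<Rightarrow> ('p \<Rightarrow> 'c) \<Rightarrow> ('i \<Rightarrow> 's \<Rightarrow> 's \<Rightarrow> complex) \<Rightarrow> complex mat" where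
  "bop ci cs cc X = opr (\<lambda>p q. if ci p = ci q \<and> cc p = cc q then X (ci p) (cs p) (cs q) else 0)"

definition balg :: "('p \<Rightarrow> 'i) \<Rightarrow> ('p \<Rightarrow> 's) \<Rightarrow> ('p \<Rightarrow> 'c) \<Rightarrow> complex mat set" where
  "balg ci cs cc = range (bop ci cs cc)"

end

text \<open>
  Basis labels are triples \<open>(i, s, c)\<close>: the operators acting on the coordinate \<open>s\<close> form a multi-matrix
  algebra, those acting on the multiplicity coordinate \<open>c\<close> form its commutant.
\<close>

locale fac = onb k P \<xi> for k and P :: "'p set" and \<xi> +
  fixes I :: "'i set" and S :: "'i \<Rightarrow> 's set" and C :: "'i \<Rightarrow> 'c set"
    and ci :: "'p \<Rightarrow> 'i" and cs :: "'p \<Rightarrow> 's" and cc :: "'p \<Rightarrow> 'c" and mk :: "'i \<Rightarrow> 's \<Rightarrow> 'c \<Rightarrow> 'p"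
  assumes finI [simp]: "finite I"
    and finS [simp]: "i \<in> I \<Longrightarrow> finite (S i)" and finC [simp]: "i \<in> I \<Longrightarrow> finite (C i)"
    and neS [simp]: "i \<in> I \<Longrightarrow> S i \<noteq> {}" and neC [simp]: "i \<in> I \<Longrightarrow> C i \<noteq> {}"
    and mk_in [simp]: "i \<in> I \<Longrightarrow> s \<in> S i \<Longrightarrow> c \<in> C i \<Longrightarrow> mk i s c \<in> P"
    and ci_mk [simp]: "i \<in> I \<Longrightarrow> s \<in> S i \<Longrightarrow> c \<in> C i \<Longrightarrow> ci (mk i s c) = i"
    and cs_mk [simp]: "i \<in> I \<Longrightarrow> s \<in> S i \<Longrightarrow> c \<in> C i \<Longrightarrow> cs (mk i s c) = s"
    and cc_mk [simp]: "i \<in> I \<Longrightarrow> s \<in> S i \<Longrightarrow> c \<in> C i \<Longrightarrow> cc (mk i s c) = c"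
    and ci_in [simp]: "p \<in> P \<Longrightarrow> ci p \<in> I"
    and cs_in [simp]: "p \<in> P \<Longrightarrow> cs p \<in> S (ci p)"
    and cc_in [simp]: "p \<in> P \<Longrightarrow> cc p \<in> C (ci p)"
    and mk_eta [simp]: "p \<in> P \<Longrightarrow> mk (ci p) (cs p) (cc p) = p"
begin

text \<open>The axioms do not distinguish the two coordinates, so whatever is proved for the algebra
  also holds for its commutant.\<close>

lemma fac_swap: "fac k P \<xi> I C S ci cc cs (\<lambda>i c s. mk i s c)"
  by unfold_locales auto

lemma slice:
  assumes i: "i \<in> I" and c: "c \<in> C i"
  shows "(\<Sum>p\<in>P. if ci p = i \<and> cc p = c then h p else 0) = (\<Sum>s\<in>S i. h (mk i s c))"
proof -
  have "(\<Sum>p\<in>P. if ci p = i \<and> cc p = c then h p else 0) = sum h {p \<in> P. ci p = i \<and> cc p = c}"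
    by (simp add: sum.inter_filter)
  also have "\<dots> = (\<Sum>s\<in>S i. h (mk i s c))"
    by (rule sum.reindex_bij_witness[of _ "\<lambda>s. mk i s c" cs]) (use i c in auto)
  finally show ?thesis .
qed

lemma slice':
  assumes i: "i \<in> I" and s: "s \<in> S i"
  shows "(\<Sum>p\<in>P. if ci p = i \<and> cs p = s then h p else 0) = (\<Sum>c\<in>C i. h (mk i s c))"
  using fac.slice[OF fac_swap i s, of h] by simp

abbreviation "em \<equiv> bop ci cs cc"
abbreviation "alg \<equiv> balg ci cs cc"

lemma bop_in [simp]: "em X \<in> alg" by (simp add: balg_def)

lemma algE: "x \<in> alg \<Longrightarrow> (\<And>X. x = em X \<Longrightarrow> thesis) \<Longrightarrow> thesis" by (auto simp: balg_def)

lemma bop_cong: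
  "(\<And>i s t. i \<in> I \<Longrightarrow> s \<in> S i \<Longrightarrow> t \<in> S i \<Longrightarrow> X i s t = Y i s t) \<Longrightarrow> em X = em Y"
  unfolding bop_def by (rule opr_cong) (metis ci_in cs_in)

lemma bop_mult: "em X * em Y = em (\<lambda>i s t. \<Sum>r\<in>S i. X i s r * Y i r t)"
  unfolding bop_def opr_mult
proof (rule opr_cong)
  fix p q assume p: "p \<in> P" and q: "q \<in> P"
  have "(\<Sum>r\<in>P. (if ci p = ci r \<and> cc p = cc r then X (ci p) (cs p) (cs r) else 0) *
      (if ci r = ci q \<and> cc r = cc q then Y (ci r) (cs r) (cs q) else 0)) =
    (\<Sum>r\<in>P. if ci r = ci p \<and> cc r = cc p then X (ci p) (cs p) (cs r) *
       (if ci p = ci q \<and> cc p = cc q then Y (ci p) (cs r) (cs q) else 0) else 0)"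
    by (rule sum.cong) auto
  also have "\<dots> = (if ci p = ci q \<and> cc p = cc q then \<Sum>r\<in>S (ci p). X (ci p) (cs p) r * Y (ci p) r (cs q) else 0)"
    using p q by (subst slice) (auto intro!: sum.cong)
  finally show "(\<Sum>r\<in>P. (if ci p = ci r \<and> cc p = cc r then X (ci p) (cs p) (cs r) else 0) *
      (if ci r = ci q \<and> cc r = cc q then Y (ci r) (cs r) (cs q) else 0)) = \<dots>" .
qed

lemma bop_add: "em X + em Y = em (\<lambda>i s t. X i s t + Y i s t)"
  unfolding bop_def opr_add by (rule opr_cong) auto

lemma bop_smult: "c \<cdot>\<^sub>m em X = em (\<lambda>i s t. c * X i s t)"
  unfolding bop_def opr_smult by (rule opr_cong) auto

lemma bop_adjoint: "mat_adjoint (em X) = em (\<lambda>i s t. cnj (X i t s))"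
  unfolding bop_def opr_adjoint by (rule opr_cong) auto

lemma bop_one: "em (\<lambda>i s t. if s = t then 1 else 0) = one"
  unfolding bop_def one_def by (rule opr_cong) (auto, metis mk_eta)

lemma bop_carrier [simp]: "em X \<in> carrier_mat k k" by (simp add: bop_def)

lemma ker_bop [simp]: "p \<in> P \<Longrightarrow> q \<in> P \<Longrightarrow>
    ker (em X) p q = (if ci p = ci q \<and> cc p = cc q then X (ci p) (cs p) (cs q) else 0)"
  by (simp add: bop_def)

lemma bop_vop: "em X *\<^sub>v vop f = vop (\<lambda>p. \<Sum>t\<in>S (ci p). X (ci p) (cs p) t * f (mk (ci p) t (cc p)))"
proof -
  have "(\<Sum>q\<in>P. (if ci p = ci q \<and> cc p = cc q then X (ci p) (cs p) (cs q) else 0) * f q)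
     = (\<Sum>t\<in>S (ci p). X (ci p) (cs p) t * f (mk (ci p) t (cc p)))" if p: "p \<in> P" for p
  proof -
    have "(\<Sum>q\<in>P. (if ci p = ci q \<and> cc p = cc q then X (ci p) (cs p) (cs q) else 0) * f q)
      = (\<Sum>q\<in>P. if ci q = ci p \<and> cc q = cc p then X (ci p) (cs p) (cs q) * f q else 0)"
      by (rule sum.cong) auto
    also have "\<dots> = (\<Sum>t\<in>S (ci p). X (ci p) (cs p) t * f (mk (ci p) t (cc p)))"
      using p by (subst slice) auto
    finally show ?thesis .
  qed
  then show ?thesis by (auto simp: bop_def intro!: vop_cong)
qed

lemma star_alg: "star_subalgebra one alg"
  unfolding star_subalgebra_def
proof (intro conjI ballI allI)
  show "is_projection one" by (rule one_projection)
  show "alg \<subseteq> ops one" by (auto simp: balg_def bop_def)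
  show "one \<in> alg" using bop_in bop_one by metis
qed (auto elim!: algE simp: bop_add bop_mult bop_smult bop_adjoint)

text \<open>
  For elements of the algebra the choice of the multiplicity index is irrelevant.
\<close>

definition btr :: "complex mat \<Rightarrow> complex" where
  "btr x = (\<Sum>i\<in>I. \<Sum>s\<in>S i. ker x (mk i s (SOME c. c \<in> C i)) (mk i s (SOME c. c \<in> C i)))"

lemma some_C: "i \<in> I \<Longrightarrow> (SOME c. c \<in> C i) \<in> C i"
  using neC some_in_eq by metis

lemma btr_bop [simp]: "btr (em X) = (\<Sum>i\<in>I. \<Sum>s\<in>S i. X i s s)"
  unfolding btr_def by (intro sum.cong refl) (simp add: some_C)

lemma btr_linear: "linear_functional alg btr"
  unfolding linear_functional_def
  by (auto elim!: algE simp: bop_add bop_smult sum.distrib sum_distrib_left)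

lemma btr_tracial: "x \<in> alg \<Longrightarrow> y \<in> alg \<Longrightarrow> btr (x * y) = btr (y * x)"
proof (elim algE)
  fix X Y assume x: "x = em X" and y: "y = em Y"
  have "(\<Sum>s\<in>S i. \<Sum>t\<in>S i. X i s t * Y i t s) = (\<Sum>s\<in>S i. \<Sum>t\<in>S i. Y i s t * X i t s)" for i
    by (subst sum.swap) (simp add: mult.commute)
  then show ?thesis by (simp add: x y bop_mult)
qed

lemma btr_star: "btr (mat_adjoint (em X) * em X) = complex_of_real (\<Sum>i\<in>I. \<Sum>s\<in>S i. \<Sum>t\<in>S i. (cmod (X i t s))\<^sup>2)"
  unfolding bop_adjoint bop_mult btr_bop of_real_sum complex_norm_square
  by (simp add: mult.commute)

lemma btr_faithful: "faithful_weight alg btr"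
  unfolding faithful_weight_def
proof (intro conjI ballI impI)
  show "linear_functional alg btr" by (rule btr_linear)
  fix x assume "x \<in> alg"
  then obtain X where x: "x = em X" by (elim algE)
  show "0 \<le> btr (mat_adjoint x * x)" unfolding x btr_star
    by (simp add: less_eq_complex_def sum_nonneg)
  assume "btr (mat_adjoint x * x) = 0"
  then have "(\<Sum>i\<in>I. \<Sum>s\<in>S i. \<Sum>t\<in>S i. (cmod (X i t s))\<^sup>2) = 0"
    unfolding x btr_star using of_real_eq_0_iff by blast
  then have z: "(\<Sum>s\<in>S i. \<Sum>t\<in>S i. (cmod (X i t s))\<^sup>2) = 0" if "i \<in> I" for i
    using that by (subst (asm) sum_nonneg_eq_0_iff) (auto intro!: sum_nonneg)
  have z': "(\<Sum>t\<in>S i. (cmod (X i t s))\<^sup>2) = 0" if "i \<in> I" "s \<in> S i" for i s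
    using z[OF that(1)] that by (subst (asm) sum_nonneg_eq_0_iff) (auto intro!: sum_nonneg)
  have "X i t s = 0" if "i \<in> I" "s \<in> S i" "t \<in> S i" for i s t
    using z'[OF that(1,2)] that by (subst (asm) sum_nonneg_eq_0_iff) auto
  then have "x = em (\<lambda>i s t. 0)" unfolding x by (intro bop_cong) auto
  also have "\<dots> = 0\<^sub>m k k" unfolding bop_def using opr_zero by (simp cong: if_cong)
  finally show "is_zero_mat x" by simp
qed

definition mu :: "'i \<Rightarrow> 's \<Rightarrow> 's \<Rightarrow> complex mat" where
  "mu i s t = em (\<lambda>i' s' t'. if i' = i \<and> s' = s \<and> t' = t then 1 else 0)"

lemma mu_in [simp]: "mu i s t \<in> alg" by (simp add: mu_def)

lemma linear_bop:
  assumes lin: "linear_functional alg \<phi>"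
  shows "\<phi> (em X) = (\<Sum>i\<in>I. \<Sum>s\<in>S i. \<Sum>t\<in>S i. X i s t * \<phi> (mu i s t))"
proof -
  have add: "\<phi> (em X + em Y) = \<phi> (em X) + \<phi> (em Y)" for X Y
    using lin by (simp add: linear_functional_def)
  have smult: "\<phi> (c \<cdot>\<^sub>m em X) = c * \<phi> (em X)" for X c
    using lin by (simp add: linear_functional_def)
  have z: "\<phi> (em (\<lambda>i s t. 0)) = 0" using smult[of 0 "\<lambda>i s t. 0"] by (simp add: bop_smult)
  define W where "W = (SIGMA i:I. S i \<times> S i)"
  \<comment> \<open>Linearity speaks of two summands, so the entries are switched on one at a time:
    \<open>F\<close> is the set of positions filled so far.\<close>
  have "finite F \<Longrightarrow> \<phi> (em (\<lambda>i s t. if (i, s, t) \<in> F then X i s t else 0)) =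
      (\<Sum>(i, s, t)\<in>F. X i s t * \<phi> (mu i s t))" for F
  proof (induction rule: finite_induct)
    case empty
    then show ?case using z by simp
  next
    case (insert w F)
    obtain i s t where w: "w = (i, s, t)" by (cases w)
    have "em (\<lambda>i' s' t'. if (i', s', t') \<in> insert w F then X i' s' t' else 0) =
      X i s t \<cdot>\<^sub>m mu i s t + em (\<lambda>i s t. if (i, s, t) \<in> F then X i s t else 0)"
      using insert(2) unfolding mu_def bop_smult bop_add w
      by (intro arg_cong[of _ _ em]) (auto simp: fun_eq_iff)
    then have "\<phi> (em (\<lambda>i' s' t'. if (i', s', t') \<in> insert w F then X i' s' t' else 0)) =
      X i s t * \<phi> (mu i s t) + \<phi> (em (\<lambda>i s t. if (i, s, t) \<in> F then X i s t else 0))"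
      unfolding mu_def by (simp add: bop_smult add flip: smult)
    then show ?case using insert by (simp add: w)
  qed
  from this[of W] have "\<phi> (em (\<lambda>i s t. if (i, s, t) \<in> W then X i s t else 0)) =
      (\<Sum>(i, s, t)\<in>W. X i s t * \<phi> (mu i s t))" by (simp add: W_def)
  moreover have "em (\<lambda>i s t. if (i, s, t) \<in> W then X i s t else 0) = em X"
    by (rule bop_cong) (auto simp: W_def)
  moreover have "(\<Sum>(i, s, t)\<in>W. X i s t * \<phi> (mu i s t)) =
      (\<Sum>i\<in>I. \<Sum>s\<in>S i. \<Sum>t\<in>S i. X i s t * \<phi> (mu i s t))"
    unfolding W_def by (subst sum.Sigma[symmetric]; simp add: sum.cartesian_product case_prod_unfold)
  ultimately show ?thesis by simp
qed

text \<open>The density is the matrix of the values of \<open>\<phi>\<close> on matrix units with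
  the two indices exchanged, as for the trace pairing of a full matrix algebra.\<close>

lemma btr_riesz: "linear_functional alg \<phi> \<Longrightarrow> \<exists>\<rho>\<in>alg. \<forall>x\<in>alg. \<phi> x = btr (\<rho> * x)"
proof (intro bexI ballI)
  assume lin: "linear_functional alg \<phi>"
  fix x assume "x \<in> alg"
  then obtain X where x: "x = em X" by (elim algE)
  show "\<phi> x = btr (em (\<lambda>i s t. \<phi> (mu i t s)) * x)"
    unfolding x linear_bop[OF lin, of X] bop_mult btr_bop
    by (rule sum.cong[OF refl], subst sum.swap) (simp add: mult.commute)
qed simp

lemma tracial_alg: "tracial_alg k one alg btr"
  by unfold_locales (auto simp: star_alg btr_faithful btr_tracial btr_riesz)

text \<open>Operators moving different coordinates commute. Conversely, commuting with the matrix
  units \<open>mu\<close> makes the coefficients vanish unless \<open>ci\<close> and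
  \<open>cs\<close> agree and makes them independent of the common value of \<open>cs\<close>, which
  is the form with the coordinates exchanged.\<close>

lemma commutant_alg: "commutant one alg = balg ci cc cs"
proof (intro equalityI subsetI)
  interpret sw: fac k P \<xi> I C S ci cc cs "\<lambda>i c s. mk i s c" by (rule fac_swap)
  fix x assume "x \<in> balg ci cc cs"
  then obtain Y where x: "x = bop ci cc cs Y" by (elim sw.algE)
  have "a * x = x * a" if "a \<in> alg" for a
  proof -
    obtain X where a: "a = em X" using \<open>a \<in> alg\<close> by (elim algE)
    show ?thesis unfolding x a bop_def opr_mult
    proof (rule opr_cong)
      fix p q assume p: "p \<in> P" and q: "q \<in> P"
      have "(\<Sum>r\<in>P. (if ci p = ci r \<and> cc p = cc r then X (ci p) (cs p) (cs r) else 0) *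
         (if ci r = ci q \<and> cs r = cs q then Y (ci r) (cc r) (cc q) else 0)) =
         (\<Sum>r\<in>P. if ci r = ci p \<and> cc r = cc p then X (ci p) (cs p) (cs r) *
         (if ci p = ci q \<and> cs r = cs q then Y (ci p) (cc p) (cc q) else 0) else 0)"
        by (rule sum.cong) auto
      also have "\<dots> = (if ci p = ci q then X (ci p) (cs p) (cs q) * Y (ci p) (cc p) (cc q) else 0)"
        using p q by (subst slice) (auto simp: if_distrib[of "\<lambda>x. _ * x"] cong: if_cong)
      finally have 1: "(\<Sum>r\<in>P. (if ci p = ci r \<and> cc p = cc r then X (ci p) (cs p) (cs r) else 0) *
         (if ci r = ci q \<and> cs r = cs q then Y (ci r) (cc r) (cc q) else 0)) = \<dots>" .
      have "(\<Sum>r\<in>P. (if ci p = ci r \<and> cs p = cs r then Y (ci p) (cc p) (cc r) else 0) *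
         (if ci r = ci q \<and> cc r = cc q then X (ci r) (cs r) (cs q) else 0)) =
         (\<Sum>r\<in>P. if ci r = ci p \<and> cs r = cs p then Y (ci p) (cc p) (cc r) *
         (if ci p = ci q \<and> cc r = cc q then X (ci p) (cs p) (cs q) else 0) else 0)"
        by (rule sum.cong) auto
      also have "\<dots> = (if ci p = ci q then X (ci p) (cs p) (cs q) * Y (ci p) (cc p) (cc q) else 0)"
        using p q by (subst slice') (auto simp: if_distrib[of "\<lambda>x. _ * x"] mult.commute cong: if_cong)
      finally show "(\<Sum>r\<in>P. (if ci p = ci r \<and> cc p = cc r then X (ci p) (cs p) (cs r) else 0) *
         (if ci r = ci q \<and> cs r = cs q then Y (ci r) (cc r) (cc q) else 0)) =
        (\<Sum>r\<in>P. (if ci p = ci r \<and> cs p = cs r then Y (ci p) (cc p) (cc r) else 0) *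
         (if ci r = ci q \<and> cc r = cc q then X (ci r) (cs r) (cs q) else 0))"
        using 1 by simp
    qed
  qed
  then show "x \<in> commutant one alg" by (auto simp: commutant_def x bop_def)
next
  fix x assume x: "x \<in> commutant one alg"
  then obtain K where K: "x = opr K" by (auto simp: commutant_def ops_one_iff)
  \<comment> \<open>This is the coefficient at \<open>p\<close>, \<open>q\<close> of the commutation
    with the unit \<open>mu ?i s ?t\<close>, where \<open>?t\<close> is the coordinate of
    \<open>q\<close>: each side retains at most one term.\<close>
  have key: "K p (mk (ci q) s (cc q)) = (if ci p = ci q \<and> cs p = s then K (mk (ci q) (cs q) (cc p)) q else 0)"
    if p: "p \<in> P" and q: "q \<in> P" and s: "s \<in> S (ci q)" for p q s
  proof -
    let ?i = "ci q" and ?t = "cs q"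
    have "mu ?i s ?t * x = x * mu ?i s ?t" using x by (auto simp: commutant_def)
    then have "ker (x * mu ?i s ?t) p q = ker (mu ?i s ?t * x) p q" by simp
    then have "(\<Sum>r\<in>P. K p r * (if ci r = ?i \<and> cc r = cc q then if ci r = ?i \<and> cs r = s \<and> cs q = ?t then 1 else 0 else 0))
      = (\<Sum>r\<in>P. (if ci p = ci r \<and> cc p = cc r then if ci p = ?i \<and> cs p = s \<and> cs r = ?t then 1 else 0 else 0) * K r q)"
      unfolding mu_def bop_def K opr_mult using p q by (simp cong: if_cong)
    moreover have "(\<Sum>r\<in>P. K p r * (if ci r = ?i \<and> cc r = cc q then if ci r = ?i \<and> cs r = s \<and> cs q = ?t then 1 else 0 else 0))
      = (\<Sum>r\<in>P. if ci r = ?i \<and> cc r = cc q then if cs r = s then K p r else 0 else 0)"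
      by (rule sum.cong) auto
    moreover have "\<dots> = K p (mk ?i s (cc q))"
      using q s by (subst slice) auto
    moreover have "(\<Sum>r\<in>P. (if ci p = ci r \<and> cc p = cc r then if ci p = ?i \<and> cs p = s \<and> cs r = ?t then 1 else 0 else 0) * K r q)
      = (\<Sum>r\<in>P. if ci r = ci p \<and> cc r = cc p then if ci p = ?i \<and> cs p = s \<and> cs r = ?t then K r q else 0 else 0)"
      by (rule sum.cong) auto
    moreover have "\<dots> = (if ci p = ?i \<and> cs p = s then K (mk ?i ?t (cc p)) q else 0)"
      using p q by (subst slice) auto
    ultimately show ?thesis by simp
  qed
  \<comment> \<open>The coefficients do not depend on the value of \<open>cs\<close>, so a fixed
    reference value in each block defines the matrix.\<close>
  define Y where "Y i c d = K (mk i (SOME s. s \<in> S i) c) (mk i (SOME s. s \<in> S i) d)" for i c d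
  have "K p q = (if ci p = ci q \<and> cs p = cs q then Y (ci p) (cc p) (cc q) else 0)"
    if p: "p \<in> P" and q: "q \<in> P" for p q
  proof (cases "ci p = ci q \<and> cs p = cs q")
    case False
    then show ?thesis using key[OF p q, of "cs q"] q by auto
  next
    case True
    let ?s0 = "SOME s. s \<in> S (ci q)"
    have s0: "?s0 \<in> S (ci q)" using neS[of "ci q"] q some_in_eq by (metis ci_in)
    have m: "mk (ci q) ?s0 (cc q) \<in> P" using s0 q by simp
    have "K p (mk (ci q) (cs q) (cc q)) =
        K (mk (ci q) ?s0 (cc p)) (mk (ci q) ?s0 (cc q))"
      using key[OF p m, of "cs q"] True p q s0 by (metis cc_in cc_mk ci_in ci_mk cs_in cs_mk)
    then show ?thesis using True q by (simp add: Y_def)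
  qed
  then have "x = bop ci cc cs Y" unfolding K bop_def by (intro opr_cong) auto
  then show "x \<in> balg ci cc cs" by (simp add: balg_def)
qed

text \<open>The rank one operator built from \<open>v\<close> and \<open>w\<close>, with the
  multiplicity coordinate traced out.\<close>

definition bexp :: "complex vec \<Rightarrow> complex vec \<Rightarrow> complex mat" where
  "bexp v w = em (\<lambda>i s t. \<Sum>c\<in>C i. coef v (mk i s c) * cnj (coef w (mk i t c)))"

lemma bexp_in [simp]: "bexp v w \<in> alg" by (simp add: bexp_def)

lemma sum_P: "(\<Sum>p\<in>P. g p) = (\<Sum>i\<in>I. \<Sum>s\<in>S i. \<Sum>c\<in>C i. g (mk i s c))"
proof -
  have "(\<Sum>i\<in>I. \<Sum>s\<in>S i. \<Sum>c\<in>C i. g (mk i s c)) = (\<Sum>i\<in>I. \<Sum>(s, c)\<in>S i \<times> C i. g (mk i s c))"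
    by (simp add: sum.cartesian_product)
  also have "\<dots> = (\<Sum>(i, s, c)\<in>(SIGMA i:I. S i \<times> C i). g (mk i s c))"
    by (subst sum.Sigma) (auto simp: case_prod_unfold)
  also have "\<dots> = (\<Sum>p\<in>P. g p)"
    by (rule sum.reindex_bij_witness[of _ "\<lambda>p. (ci p, cs p, cc p)" "\<lambda>(i, s, c). mk i s c"]) auto
  finally show ?thesis by simp
qed

lemma btr_bexp:
  assumes "a \<in> alg" "v \<in> hilb one" "w \<in> hilb one"
  shows "btr (a * bexp v w) = (a *\<^sub>v v) \<bullet>c w"
proof -
  obtain X where a: "a = em X" using assms by (elim algE)
  have "(a *\<^sub>v v) \<bullet>c w = (em X *\<^sub>v vop (coef v)) \<bullet>c vop (coef w)"
    using assms by (simp add: vop_coef a)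
  also have "\<dots> = (\<Sum>i\<in>I. \<Sum>s\<in>S i. \<Sum>c\<in>C i. (\<Sum>t\<in>S i. X i s t * coef v (mk i t c)) * cnj (coef w (mk i s c)))"
    unfolding bop_vop vop_inner_vop sum_P by (intro sum.cong refl) simp
  also have "\<dots> = (\<Sum>i\<in>I. \<Sum>s\<in>S i. \<Sum>t\<in>S i. X i s t * (\<Sum>c\<in>C i. coef v (mk i t c) * cnj (coef w (mk i s c))))"
  proof (intro sum.cong refl)
    fix i s
    show "(\<Sum>c\<in>C i. (\<Sum>t\<in>S i. X i s t * coef v (mk i t c)) * cnj (coef w (mk i s c))) =
     (\<Sum>t\<in>S i. X i s t * (\<Sum>c\<in>C i. coef v (mk i t c) * cnj (coef w (mk i s c))))"
      unfolding sum_distrib_left sum_distrib_right by (subst sum.swap) (simp add: mult.assoc)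
  qed
  also have "\<dots> = btr (a * bexp v w)" by (simp add: a bexp_def bop_mult)
  finally show ?thesis by simp
qed

text \<open>Cholesky factorization in each block. Positivity of the block \<open>X i\<close> is read
  off from vectors supported on one multiplicity value \<open>c0\<close>, where the operator acts as
  \<open>X i\<close>.\<close>

lemma alg_root:
  assumes h: "h \<in> alg" and pos: "\<And>v. v \<in> hilb one \<Longrightarrow> 0 \<le> (h *\<^sub>v v) \<bullet>c v"
  shows "\<exists>y\<in>alg. h = mat_adjoint y * y"
proof -
  obtain X where X: "h = em X" using h by (elim algE)
  have "\<exists>Y. \<forall>s\<in>S i. \<forall>t\<in>S i. X i s t = (\<Sum>r\<in>S i. cnj (Y r s) * Y r t)" if i: "i \<in> I" for i
  proof (rule cholesky)
    show "finite (S i)" using i by simp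
    fix f :: "'s \<Rightarrow> complex"
    obtain c0 where c0: "c0 \<in> C i" using neC[OF i] by blast
    define g where "g p = (if ci p = i \<and> cc p = c0 then f (cs p) else 0)" for p
    have "(h *\<^sub>v vop g) \<bullet>c vop g = (\<Sum>p\<in>P. if ci p = i \<and> cc p = c0 then
       (\<Sum>t\<in>S i. X i (cs p) t * g (mk i t c0)) * cnj (f (cs p)) else 0)"
      unfolding X bop_vop vop_inner_vop by (rule sum.cong) (auto simp: g_def)
    also have "\<dots> = (\<Sum>s\<in>S i. (\<Sum>t\<in>S i. X i s t * g (mk i t c0)) * cnj (f s))"
      using i c0 by (subst slice) (auto intro!: sum.cong)
    also have "\<dots> = (\<Sum>s\<in>S i. \<Sum>t\<in>S i. X i s t * f t * cnj (f s))"
      using i c0 by (auto intro!: sum.cong simp: g_def sum_distrib_right)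
    finally show "0 \<le> (\<Sum>s\<in>S i. \<Sum>t\<in>S i. X i s t * f t * cnj (f s))" using pos[of "vop g"] by simp
  qed
  then obtain Y where "\<And>i s t. i \<in> I \<Longrightarrow> s \<in> S i \<Longrightarrow> t \<in> S i \<Longrightarrow> X i s t = (\<Sum>r\<in>S i. cnj (Y i r s) * Y i r t)"
    by metis
  then have "h = mat_adjoint (em Y) * em Y" unfolding X bop_adjoint bop_mult by (intro bop_cong) auto
  then show ?thesis using bop_in by blast
qed

definition btr' :: "complex mat \<Rightarrow> complex" where
  "btr' = fac.btr \<xi> I C S (\<lambda>i c s. mk i s c)"

definition bexp' :: "complex vec \<Rightarrow> complex vec \<Rightarrow> complex mat" where
  "bexp' = fac.bexp k P \<xi> S ci cc cs (\<lambda>i c s. mk i s c)"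

text \<open>The condition \<open>dual\<close> holds because in coordinates both sides are the same
  double sum, over the moved coordinate and the multiplicity coordinate, taken in different order.
  With these traces no factor depending on block sizes appears.\<close>

lemma dual_pair: "dual_pair k one alg btr (balg ci cc cs) btr' bexp bexp'"
proof -
  interpret sw: fac k P \<xi> I C S ci cc cs "\<lambda>i c s. mk i s c" by (rule fac_swap)
  note [simp] = btr'_def bexp'_def
  show ?thesis
  proof (intro dual_pair.intro dual_pair_axioms.intro)
    show "tracial_alg k one alg btr" by (rule tracial_alg)
    show "tracial_alg k one (balg ci cc cs) btr'" using sw.tracial_alg by simp
    show "commutant one alg = balg ci cc cs" by (rule commutant_alg)
    show "commutant one (balg ci cc cs) = alg" by (rule sw.commutant_alg)
  next
    fix v w z assume v: "v \<in> hilb one" and w: "w \<in> hilb one" and z: "z \<in> hilb one"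
    have "bexp v w *\<^sub>v vop (coef z) = sw.bexp z w *\<^sub>v vop (coef v)"
      unfolding bexp_def sw.bexp_def bop_vop sw.bop_vop
    proof (rule vop_cong)
      fix p assume p: "p \<in> P"
      have "(\<Sum>t\<in>S (ci p). (\<Sum>c\<in>C (ci p). coef v (mk (ci p) (cs p) c) * cnj (coef w (mk (ci p) t c))) * coef z (mk (ci p) t (cc p)))
        = (\<Sum>t\<in>S (ci p). \<Sum>c\<in>C (ci p). coef v (mk (ci p) (cs p) c) * cnj (coef w (mk (ci p) t c)) * coef z (mk (ci p) t (cc p)))"
        by (simp add: sum_distrib_right)
      also have "\<dots> = (\<Sum>c\<in>C (ci p). \<Sum>t\<in>S (ci p). coef v (mk (ci p) (cs p) c) * cnj (coef w (mk (ci p) t c)) * coef z (mk (ci p) t (cc p)))"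
        by (rule sum.swap)
      also have "\<dots> = (\<Sum>c\<in>C (ci p). (\<Sum>t\<in>S (ci p). coef z (mk (ci p) t (cc p)) * cnj (coef w (mk (ci p) t c))) * coef v (mk (ci p) (cs p) c))"
        by (simp add: sum_distrib_right sum_distrib_left ac_simps)
      finally show "(\<Sum>t\<in>S (ci p). (\<Sum>c\<in>C (ci p). coef v (mk (ci p) (cs p) c) * cnj (coef w (mk (ci p) t c))) * coef z (mk (ci p) t (cc p)))
        = \<dots>" .
    qed
    then show "bexp v w *\<^sub>v z = bexp' z w *\<^sub>v v" using v z by (simp add: vop_coef)
  qed (auto simp: btr_bexp sw.btr_bexp alg_root sw.alg_root)
qed

end

subsection \<open>Spatial derivatives\<close>

declare assoc_mult_mat [simp del] assoc_mult_mat_vec [simp del]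

lemma mult_assoc_sq:
  "x \<in> carrier_mat k k \<Longrightarrow> y \<in> carrier_mat k k \<Longrightarrow> z \<in> carrier_mat k k \<Longrightarrow> x * y * z = x * (y * z)"
  for x y z :: "complex mat"
  by (rule assoc_mult_mat)

lemma mult_car [simp]: "x \<in> carrier_mat k k \<Longrightarrow> y \<in> carrier_mat k k \<Longrightarrow> x * y \<in> carrier_mat k k"
  by simp

lemma smult_smult_mat: "a \<cdot>\<^sub>m (b \<cdot>\<^sub>m x) = (a * b) \<cdot>\<^sub>m (x :: complex mat)"
  by (rule eq_matI) auto

lemma mult_mat_zero_vec: "x \<in> carrier_mat n m \<Longrightarrow> x *\<^sub>v 0\<^sub>v m = 0\<^sub>v n" for x :: "complex mat"
  by (rule eq_vecI) auto

lemma injective_imp_invertible: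
  assumes A: "A \<in> carrier_mat n n"
    and inj: "\<And>v. v \<in> carrier_vec n \<Longrightarrow> A *\<^sub>v v = 0\<^sub>v n \<Longrightarrow> v = 0\<^sub>v n"
  shows "\<exists>B\<in>carrier_mat n n. A * B = 1\<^sub>m n \<and> B * A = (1\<^sub>m n :: complex mat)"
proof -
  have "det A \<noteq> 0" using det_0_iff_vec_prod_zero[OF A] inj by blast
  from det_non_zero_imp_unit[OF A this, of undefined]
  show ?thesis by (auto simp: Units_def ring_mat_simps)
qed

context tracial_alg
begin

lemma u_dim [simp]: "dim_row u = k" "dim_col u = k" using u_carrier by blast+

lemma in_ops: "x \<in> A \<Longrightarrow> x \<in> ops u" using star by (auto simp: star_subalgebra_def)
lemma car [simp]: "x \<in> A \<Longrightarrow> x \<in> carrier_mat k k" using in_ops by (simp add: ops_def)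
lemma dim_in [simp]: "x \<in> A \<Longrightarrow> dim_row x = k" "x \<in> A \<Longrightarrow> dim_col x = k"
  using car by (blast dest: carrier_matD)+
lemma u_left [simp]: "x \<in> A \<Longrightarrow> u * x = x" using in_ops by (simp add: ops_def)
lemma u_right [simp]: "x \<in> A \<Longrightarrow> x * u = x" using in_ops by (simp add: ops_def)
lemma add_in [simp]: "x \<in> A \<Longrightarrow> y \<in> A \<Longrightarrow> x + y \<in> A" using star by (auto simp: star_subalgebra_def)
lemma mult_in [simp]: "x \<in> A \<Longrightarrow> y \<in> A \<Longrightarrow> x * y \<in> A" using star by (auto simp: star_subalgebra_def)
lemma smult_in [simp]: "x \<in> A \<Longrightarrow> c \<cdot>\<^sub>m x \<in> A" using star by (auto simp: star_subalgebra_def)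
lemma adj_in [simp]: "x \<in> A \<Longrightarrow> mat_adjoint x \<in> A" using star by (auto simp: star_subalgebra_def)
lemma u_in [simp]: "u \<in> A" using star by (auto simp: star_subalgebra_def)
lemma u_adj [simp]: "mat_adjoint u = u" using star by (auto simp: star_subalgebra_def is_projection_def)

lemma zero_in [simp]: "0\<^sub>m k k \<in> A"
proof -
  have "0 \<cdot>\<^sub>m u = 0\<^sub>m k k" by (rule eq_matI) auto
  then show ?thesis using smult_in[OF u_in, of 0] by simp
qed

lemma T_add [simp]: "x \<in> A \<Longrightarrow> y \<in> A \<Longrightarrow> T (x + y) = T x + T y"
  using faithful by (auto simp: faithful_weight_def linear_functional_def)
lemma T_smult [simp]: "x \<in> A \<Longrightarrow> T (c \<cdot>\<^sub>m x) = c * T x"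
  using faithful by (auto simp: faithful_weight_def linear_functional_def)
lemma T_pos: "x \<in> A \<Longrightarrow> 0 \<le> T (mat_adjoint x * x)"
  using faithful by (auto simp: faithful_weight_def)
lemma is_zero: "x \<in> A \<Longrightarrow> is_zero_mat x \<longleftrightarrow> x = 0\<^sub>m k k"
  using car carrier_matD by metis
lemma T_faithful: "x \<in> A \<Longrightarrow> T (mat_adjoint x * x) = 0 \<Longrightarrow> x = 0\<^sub>m k k"
  using faithful is_zero by (auto simp: faithful_weight_def)

lemma mult_zero [simp]: "x \<in> A \<Longrightarrow> x * 0\<^sub>m k k = 0\<^sub>m k k" "x \<in> A \<Longrightarrow> 0\<^sub>m k k * x = 0\<^sub>m k k"
  using right_mult_zero_mat[of x k k k] left_mult_zero_mat[of x k k k] by auto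

lemma T_zero [simp]: "T (0\<^sub>m k k) = 0"
proof -
  have "0 \<cdot>\<^sub>m u = 0\<^sub>m k k" by (rule eq_matI) auto
  then show ?thesis using T_smult[OF u_in, of 0] by simp
qed

lemma diff_zero:
  "x \<in> carrier_mat k k \<Longrightarrow> y \<in> carrier_mat k k \<Longrightarrow> x + (-1) \<cdot>\<^sub>m y = 0\<^sub>m k k \<Longrightarrow> x = (y :: complex mat)"
proof (rule eq_matI)
  assume x: "x \<in> carrier_mat k k" "y \<in> carrier_mat k k" and 0: "x + (-1) \<cdot>\<^sub>m y = 0\<^sub>m k k"
  fix i j assume "i < dim_row y" "j < dim_col y"
  then have ij: "i < k" "j < k" using x by auto
  then have "(x + (-1) \<cdot>\<^sub>m y) $$ (i,j) = 0" using 0 by simp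
  then show "x $$ (i,j) = y $$ (i,j)" using x ij by simp
qed auto

lemma nondeg: "d \<in> A \<Longrightarrow> (\<And>a. a \<in> A \<Longrightarrow> T (a * d) = 0) \<Longrightarrow> d = 0\<^sub>m k k"
  using T_faithful by simp

lemma T_eqI:
  assumes x: "x \<in> A" and y: "y \<in> A" and eq: "\<And>a. a \<in> A \<Longrightarrow> T (a * x) = T (a * y)"
  shows "x = y"
proof (rule diff_zero)
  have "T (a * (x + (-1) \<cdot>\<^sub>m y)) = 0" if a: "a \<in> A" for a
  proof -
    have "a * (x + (-1) \<cdot>\<^sub>m y) = a * x + (-1) \<cdot>\<^sub>m (a * y)"
      using a x y by (simp add: mult_add_distrib_mat[of _ k k _ k] mult_smult_distrib[of _ k k _ k])
    then show ?thesis using a x y eq by simp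
  qed
  then show "x + (-1) \<cdot>\<^sub>m y = 0\<^sub>m k k" using x y by (intro nondeg) auto
qed (use x y in auto)

text \<open>Positivity forces hermiticity: \<open>T\<close> of the square of
  \<open>x + c \<cdot>\<^sub>m u\<close> is real, and its expansion gives a linear condition for
  \<open>c = 1\<close> and one for \<open>c = \<i>\<close>.\<close>

lemma T_adj: assumes x: "x \<in> A" shows "T (mat_adjoint x) = cnj (T x)"
proof -
  have "mat_adjoint (x + c \<cdot>\<^sub>m u) * (x + c \<cdot>\<^sub>m u) =
    mat_adjoint x * x + c \<cdot>\<^sub>m mat_adjoint x + (cnj c \<cdot>\<^sub>m x + (cnj c * c) \<cdot>\<^sub>m u)" for c
  proof -
    have "mat_adjoint (x + c \<cdot>\<^sub>m u) * (x + c \<cdot>\<^sub>m u) = (mat_adjoint x + cnj c \<cdot>\<^sub>m u) * (x + c \<cdot>\<^sub>m u)"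
      using x by (simp add: mat_adjoint_add[of _ k k] mat_adjoint_smult)
    also have "\<dots> = mat_adjoint x * (x + c \<cdot>\<^sub>m u) + (cnj c \<cdot>\<^sub>m u) * (x + c \<cdot>\<^sub>m u)"
      using x by (intro add_mult_distrib_mat[of _ k k _ _ k]) auto
    also have "\<dots> = mat_adjoint x * x + mat_adjoint x * (c \<cdot>\<^sub>m u) + ((cnj c \<cdot>\<^sub>m u) * x + (cnj c \<cdot>\<^sub>m u) * (c \<cdot>\<^sub>m u))"
      using x by (simp add: mult_add_distrib_mat[of _ k k _ k])
    also have "\<dots> = mat_adjoint x * x + c \<cdot>\<^sub>m mat_adjoint x + (cnj c \<cdot>\<^sub>m x + (cnj c * c) \<cdot>\<^sub>m u)"
      using x by (simp add: mult_smult_distrib[of _ k k _ k] mult_smult_assoc_mat[of _ k k _ k] smult_smult_mat mult.commute)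
    finally show ?thesis .
  qed
  then have "0 \<le> T (mat_adjoint x * x) + c * T (mat_adjoint x) + (cnj c * T x + (cnj c * c) * T u)" for c
    using T_pos[of "x + c \<cdot>\<^sub>m u"] x by simp
  moreover have "0 \<le> T (mat_adjoint x * x)" "0 \<le> T u"
    using T_pos[OF x] T_pos[of u] by auto
  ultimately have "Im (c * T (mat_adjoint x) + cnj c * T x) = 0" for c
    by (auto simp: less_eq_complex_def)
  from this[of 1] this[of \<i>] show ?thesis by (simp add: complex_eq_iff)
qed

text \<open>Densities of faithful weights. Positivity is stated through the trace because it comes
  from a functional; \<open>hpos\<close>, introduced once vectors are available, is positivity as an
  operator, and the two agree for invertible elements.\<close>

definition posd :: "complex mat \<Rightarrow> bool" where
  "posd h \<longleftrightarrow> h \<in> A \<and> (\<forall>x\<in>A. 0 \<le> T (h * (mat_adjoint x * x)) \<and>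
     (T (h * (mat_adjoint x * x)) = 0 \<longrightarrow> x = 0\<^sub>m k k))"

lemma cyc: "x \<in> A \<Longrightarrow> y \<in> A \<Longrightarrow> z \<in> A \<Longrightarrow> T (x * (y * z)) = T (y * (z * x))"
  using tracial[of x "y * z"] by (simp add: mult_assoc_sq[of _ k])

lemma density:
  assumes "faithful_weight A \<phi>"
  obtains \<rho> where "posd \<rho>" "\<And>x. x \<in> A \<Longrightarrow> \<phi> x = T (\<rho> * x)"
proof -
  obtain \<rho> where \<rho>: "\<rho> \<in> A" "\<And>x. x \<in> A \<Longrightarrow> \<phi> x = T (\<rho> * x)"
    using riesz[of \<phi>] assms by (auto simp: faithful_weight_def)
  have "posd \<rho>" unfolding posd_def
  proof (intro conjI ballI impI)
    fix x assume x: "x \<in> A"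
    then have e: "T (\<rho> * (mat_adjoint x * x)) = \<phi> (mat_adjoint x * x)" using \<rho>(2) by simp
    show "0 \<le> T (\<rho> * (mat_adjoint x * x))" unfolding e using assms x by (simp add: faithful_weight_def)
    assume "T (\<rho> * (mat_adjoint x * x)) = 0"
    then have "is_zero_mat x" unfolding e using assms x by (auto simp: faithful_weight_def)
    then show "x = 0\<^sub>m k k" using is_zero[OF x] by blast
  qed (rule \<rho>(1))
  then show ?thesis using \<rho> that by blast
qed

end

lemma hilbD: "v \<in> hilb u \<Longrightarrow> u \<in> carrier_mat k k \<Longrightarrow> v \<in> carrier_vec k" "v \<in> hilb u \<Longrightarrow> u *\<^sub>v v = v"
  by (auto simp: hilb_def)

lemma ops_hilb:
  assumes "x \<in> ops u" "u \<in> carrier_mat k k" "v \<in> carrier_vec k"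
  shows "x *\<^sub>v v \<in> hilb u"
proof -
  have x: "x \<in> carrier_mat k k" "u * x = x" using assms by (auto simp: ops_def)
  have "u *\<^sub>v (x *\<^sub>v v) = (u * x) *\<^sub>v v"
    using assms x by (intro assoc_mult_mat_vec[symmetric]) auto
  then show ?thesis using assms x by (auto simp: hilb_def)
qed

lemma hilb_add: "u \<in> carrier_mat k k \<Longrightarrow> v \<in> hilb u \<Longrightarrow> w \<in> hilb u \<Longrightarrow> v + w \<in> hilb u"
  by (auto simp: hilb_def mult_add_distrib_mat_vec[of _ k k])

lemma hilb_smult: "u \<in> carrier_mat k k \<Longrightarrow> v \<in> hilb u \<Longrightarrow> c \<cdot>\<^sub>v v \<in> hilb u"
  by (auto simp: hilb_def mult_mat_vec[of _ k k])

lemma ops_eqI_hilb: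
  assumes x: "x \<in> ops u" and y: "y \<in> ops u" and u: "u \<in> carrier_mat k k"
    and proj: "is_projection u"
    and eq: "\<And>v. v \<in> hilb u \<Longrightarrow> x *\<^sub>v v = y *\<^sub>v v"
  shows "x = y"
proof (rule mat_vec_eqI[of _ k k])
  show c: "x \<in> carrier_mat k k" "y \<in> carrier_mat k k" using x y u by (auto simp: ops_def)
  fix v :: "complex vec" assume v: "v \<in> carrier_vec k"
  have "u \<in> ops u" using proj u by (auto simp: ops_def is_projection_def)
  then have "u *\<^sub>v v \<in> hilb u" using ops_hilb u v by blast
  then have "x *\<^sub>v (u *\<^sub>v v) = y *\<^sub>v (u *\<^sub>v v)" by (rule eq)
  then have "(x * u) *\<^sub>v v = (y * u) *\<^sub>v v"
    using v c u by (simp add: assoc_mult_mat_vec[of _ k k _ k])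
  then show "x *\<^sub>v v = y *\<^sub>v v" using x y by (simp add: ops_def)
qed

context dual_pair
begin

text \<open>Exchanging \<open>A\<close> and \<open>B\<close> merely exchanges the vectors
  \<open>v\<close> and \<open>z\<close> in the condition \<open>dual\<close>.\<close>

lemma dual_pair_swap: "dual_pair k u B TB A TA eB eA"
  by (intro dual_pair.intro dual_pair_axioms.intro)
    (auto simp: A.tracial_alg_axioms B.tracial_alg_axioms commA commB eA_in eB_in TA_eA TB_eB dual rootA rootB)

lemma hilb_car [simp]: "v \<in> hilb u \<Longrightarrow> v \<in> carrier_vec k"
  using hilbD A.u_carrier by blast

lemma hilb_closed [simp]: "x \<in> A \<Longrightarrow> v \<in> hilb u \<Longrightarrow> x *\<^sub>v v \<in> hilb u" "x \<in> B \<Longrightarrow> v \<in> hilb u \<Longrightarrow> x *\<^sub>v v \<in> hilb u"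
  using ops_hilb[OF A.in_ops A.u_carrier] ops_hilb[OF B.in_ops A.u_carrier] by auto

lemma comm: "a \<in> A \<Longrightarrow> b \<in> B \<Longrightarrow> a * b = b * a"
  using commA by (auto simp: commutant_def)

lemma eA_adj: assumes v: "v \<in> hilb u" and w: "w \<in> hilb u" shows "mat_adjoint (eA v w) = eA w v"
proof (rule A.T_eqI)
  fix a assume a: "a \<in> A"
  have "TA (a * mat_adjoint (eA v w)) = TA (mat_adjoint (eA v w * mat_adjoint a))"
    using a v w by (simp add: mat_adjoint_mult[of _ k k _ k] eA_in)
  also have "\<dots> = cnj (TA (mat_adjoint a * eA v w))"
    using a v w by (simp add: A.T_adj eA_in A.tracial)
  also have "\<dots> = cnj ((mat_adjoint a *\<^sub>v v) \<bullet>c w)" using a v w by (simp add: TA_eA)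
  also have "\<dots> = w \<bullet>c (mat_adjoint a *\<^sub>v v)"
    using a v w by (intro cscalar_commute[of _ k]) auto
  also have "\<dots> = (a *\<^sub>v w) \<bullet>c v" using a v w by (subst cscalar_mult_mat_vec[of a k k]) auto
  also have "\<dots> = TA (a * eA w v)" using a v w by (simp add: TA_eA)
  finally show "TA (a * mat_adjoint (eA v w)) = TA (a * eA w v)" .
qed (use v w in \<open>auto simp: eA_in\<close>)

text \<open>Positivity of \<open>eA v v\<close> is proved on the other side of the duality:
  \<open>dual\<close> turns its quadratic form at \<open>z\<close> into \<open>TB\<close> of a
  square built from \<open>eB v z\<close>.\<close>

lemma eA_root: assumes v: "v \<in> hilb u" obtains y where "y \<in> A" "eA v v = mat_adjoint y * y"
proof -
  interpret sw: dual_pair k u B TB A TA eB eA by (rule dual_pair_swap)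
  have "0 \<le> (eA v v *\<^sub>v z) \<bullet>c z" if z: "z \<in> hilb u" for z
  proof -
    have "(eA v v *\<^sub>v z) \<bullet>c z = (eB z v *\<^sub>v v) \<bullet>c z" using v z by (simp add: dual)
    also have "\<dots> = TB (eB z v * eB v z)" using v z by (simp add: TB_eB eB_in)
    also have "\<dots> = TB (mat_adjoint (eB v z) * eB v z)" using v z by (simp add: sw.eA_adj)
    finally show ?thesis using B.T_pos eB_in v z by simp
  qed
  then show ?thesis using rootA[of "eA v v"] eA_in v that by metis
qed

definition hpos :: "complex mat \<Rightarrow> bool" where
  "hpos h \<longleftrightarrow> (\<forall>v\<in>hilb u. 0 \<le> (h *\<^sub>v v) \<bullet>c v)"

text \<open>A vector functional has the density \<open>eA v v\<close>, which is a square, so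
  positivity under the trace contains positivity at every vector.\<close>

lemma hpos_posI:
  assumes h: "h \<in> A" and pos: "\<And>x. x \<in> A \<Longrightarrow> 0 \<le> TA (h * (mat_adjoint x * x))"
  shows "hpos h"
  unfolding hpos_def
proof
  fix v assume v: "v \<in> hilb u"
  obtain y where y: "y \<in> A" "eA v v = mat_adjoint y * y" using eA_root[OF v] .
  have "(h *\<^sub>v v) \<bullet>c v = TA (h * eA v v)" using h v by (simp add: TA_eA)
  then show "0 \<le> (h *\<^sub>v v) \<bullet>c v" using pos[OF y(1)] y by simp
qed

lemma posd_hpos: "A.posd h \<Longrightarrow> hpos h"
  by (rule hpos_posI) (auto simp: A.posd_def)

lemma hpos_root: "h \<in> A \<Longrightarrow> hpos h \<Longrightarrow> \<exists>y\<in>A. h = mat_adjoint y * y"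
  using rootA by (auto simp: hpos_def)

lemma hpos_adj: "h \<in> A \<Longrightarrow> hpos h \<Longrightarrow> mat_adjoint h = h"
  using hpos_root[of h] by (auto simp: mat_adjoint_mult[of _ k k _ k])

text \<open>With \<open>h = mat_adjoint y * y\<close>, the trace of \<open>h\<close> against the
  square of \<open>x\<close> is the squared trace norm of \<open>y * mat_adjoint x\<close>. If it
  vanishes, the left inverse \<open>g\<close> removes \<open>h\<close> and leaves \<open>x\<close>
  zero.\<close>

lemma hpos_posd:
  assumes h: "h \<in> A" and pos: "hpos h" and g: "g \<in> carrier_mat k k" "g * h = u"
  shows "A.posd h"
  unfolding A.posd_def
proof (intro conjI ballI impI)
  show "h \<in> A" by fact
  obtain y where y: "y \<in> A" "h = mat_adjoint y * y" using hpos_root[OF h pos] by blast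
  fix x assume x: "x \<in> A"
  have e: "TA (h * (mat_adjoint x * x)) = TA (mat_adjoint (y * mat_adjoint x) * (y * mat_adjoint x))"
  proof -
    have "TA (h * (mat_adjoint x * x)) = TA (x * (h * mat_adjoint x))"
      using x h A.cyc[of x h "mat_adjoint x"] by simp
    also have "x * (h * mat_adjoint x) = mat_adjoint (y * mat_adjoint x) * (y * mat_adjoint x)"
      using x y by (simp add: mat_adjoint_mult[of _ k k _ k] mult_assoc_sq[of _ k])
    finally show ?thesis .
  qed
  show "0 \<le> TA (h * (mat_adjoint x * x))" unfolding e using x y by (intro A.T_pos) auto
  assume "TA (h * (mat_adjoint x * x)) = 0"
  then have "y * mat_adjoint x = 0\<^sub>m k k" unfolding e using x y by (intro A.T_faithful) auto
  then have "h * mat_adjoint x = 0\<^sub>m k k" using x y by (simp add: mult_assoc_sq[of _ k])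
  then have "u * mat_adjoint x = 0\<^sub>m k k"
    using x h g by (simp add: mult_assoc_sq[of _ k] flip: g(2))
  then have "mat_adjoint (mat_adjoint x) = 0\<^sub>m k k" using x by simp
  then show "x = 0\<^sub>m k k" by simp
qed

text \<open>Faithfulness excludes a kernel, and the inverse lies in \<open>A\<close> by the double
  commutant property, since it commutes with everything that commutes with \<open>h\<close>. The
  last conclusion keeps this fact for elements that must also stay in a second commutant.\<close>

lemma posd_inverse:
  assumes h: "A.posd h"
  obtains g where "A.posd g" "g * h = u" "h * g = u"
    "\<And>x. x \<in> ops u \<Longrightarrow> x * h = h * x \<Longrightarrow> x * g = g * x"
proof -
  have hA [simp]: "h \<in> A" using h by (simp add: A.posd_def)
  have pos: "hpos h" by (rule posd_hpos[OF h])
  have hadj: "mat_adjoint h = h" using hpos_adj pos by simp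
  \<comment> \<open>Adding the complementary projection makes an element of the corner invertible as
    a full matrix; the inverse in the corner is cut out again by \<open>u\<close>.\<close>
  define m where "m = h + (1\<^sub>m k - u)"
  have m [simp]: "m \<in> carrier_mat k k" unfolding m_def by (simp add: minus_carrier_mat)
  have uu: "u * u = u" by simp
  have um: "u * m = h"
  proof -
    have "u * m = u * h + u * (1\<^sub>m k - u)" unfolding m_def
      by (rule mult_add_distrib_mat[of _ k k _ k]) (auto simp: minus_carrier_mat)
    also have "u * (1\<^sub>m k - u) = u * 1\<^sub>m k - u * u"
      by (rule mult_minus_distrib_mat[of _ k k _ k]) auto
    finally have "u * m = h + (u - u)" using uu by (simp add: right_mult_one_mat[of _ k k])
    moreover have "h + (u - u) = h" using A.car[OF hA] by (intro eq_matI) (auto simp del: A.car)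
    ultimately show ?thesis by simp
  qed
  have inj: "v = 0\<^sub>v k" if v: "v \<in> carrier_vec k" and 0: "m *\<^sub>v v = 0\<^sub>v k" for v
  proof -
    have "u *\<^sub>v (m *\<^sub>v v) = h *\<^sub>v v" using v um by (simp flip: assoc_mult_mat_vec[of _ k k _ k])
    moreover have "u *\<^sub>v 0\<^sub>v k = 0\<^sub>v k" by (intro mult_mat_zero_vec) simp
    ultimately have hv: "h *\<^sub>v v = 0\<^sub>v k" using 0 by simp
    have "m *\<^sub>v v = h *\<^sub>v v + (v - u *\<^sub>v v)"
      unfolding m_def using v
      by (simp add: add_mult_distrib_mat_vec[of _ k k] minus_mult_distrib_mat_vec[of _ k k] minus_carrier_mat)
    moreover have "v - u *\<^sub>v v \<in> carrier_vec k"
      using v by (intro minus_carrier_vec mult_mat_vec_carrier[of u k k]) auto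
    ultimately have z: "v - u *\<^sub>v v = 0\<^sub>v k" using 0 hv by simp
    have "u *\<^sub>v v = v"
    proof (rule eq_vecI)
      fix i assume "i < dim_vec v"
      then have i: "i < k" using v by simp
      have "(v - u *\<^sub>v v) $ i = 0" using z i by simp
      then show "(u *\<^sub>v v) $ i = v $ i" using i v by (simp del: index_mult_mat_vec)
    qed (use v in auto)
    then have vh: "v \<in> hilb u" using v unfolding hilb_def by simp
    \<comment> \<open>A vector \<open>v\<close> killed by \<open>h\<close> has a vector functional
      whose density is annihilated by \<open>h\<close>; faithfulness of \<open>h\<close> turns this
      into \<open>eA v v = 0\<close>.\<close>
    have "h * eA v v = 0\<^sub>m k k"
    proof (rule A.nondeg)
      fix a assume a: "a \<in> A"
      have "TA (a * (h * eA v v)) = TA ((a * h) * eA v v)"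
        using a vh by (simp add: mult_assoc_sq[of _ k] eA_in)
      also have "\<dots> = (a *\<^sub>v (h *\<^sub>v v)) \<bullet>c v"
        using a vh by (simp add: TA_eA assoc_mult_mat_vec[of _ k k _ k])
      also have "\<dots> = 0"
      proof -
        have "a *\<^sub>v 0\<^sub>v k = 0\<^sub>v k" using a by (intro mult_mat_zero_vec) simp
        then show ?thesis using v hv by simp
      qed
      finally show "TA (a * (h * eA v v)) = 0" .
    qed (use vh in \<open>simp add: eA_in\<close>)
    moreover obtain y where y: "y \<in> A" "eA v v = mat_adjoint y * y" using eA_root[OF vh] .
    ultimately have "TA (h * (mat_adjoint y * y)) = 0" by simp
    then have "y = 0\<^sub>m k k" using h y by (auto simp: A.posd_def)
    then have "eA v v = 0\<^sub>m k k" using y by simp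
    then have "TA (u * eA v v) = 0" using eA_in[OF vh vh] by simp
    then have "v \<bullet>c v = 0" using TA_eA[OF A.u_in vh vh] \<open>u *\<^sub>v v = v\<close> by simp
    then show ?thesis using conjugate_square_eq_0_vec[OF v] by simp
  qed
  obtain n where n [simp]: "n \<in> carrier_mat k k" and mn: "m * n = 1\<^sub>m k" "n * m = 1\<^sub>m k"
    using injective_imp_invertible[OF m inj] by blast
  define g where "g = u * (n * u)"
  have gc [simp]: "g \<in> carrier_mat k k" by (simp add: g_def)
  have mu: "m * u = h"
  proof -
    have "m * u = h * u + (1\<^sub>m k - u) * u" unfolding m_def
      by (rule add_mult_distrib_mat[of _ k k _ _ k]) (auto simp: minus_carrier_mat)
    also have "(1\<^sub>m k - u) * u = 1\<^sub>m k * u - u * u"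
      by (rule minus_mult_distrib_mat[of _ k k _ _ k]) auto
    finally have "m * u = h + (u - u)" using uu by (simp add: left_mult_one_mat[of _ k k])
    moreover have "h + (u - u) = h" using A.car[OF hA] by (intro eq_matI) (auto simp del: A.car)
    ultimately show ?thesis by simp
  qed
  have commn: "x * n = n * x" if x: "x \<in> carrier_mat k k" "x * m = m * x" for x
  proof -
    have "n * (x * m) * n = n * (m * x) * n" using x by simp
    then have "n * x * (m * n) = (n * m) * x * n" using x(1) by (simp add: mult_assoc_sq[of _ k])
    then show ?thesis using x mn by simp
  qed
  have un: "u * n = n * u" using commn[of u] um mu by simp
  have uh: "u * h = h" "h * u = h" by simp_all
  have hg: "h * g = u"
  proof -
    have "h * g = (h * u) * (n * u)" unfolding g_def by (rule mult_assoc_sq[symmetric]) auto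
    also have "\<dots> = (u * m) * (n * u)" unfolding uh um ..
    also have "\<dots> = u * ((m * n) * u)" by (simp add: mult_assoc_sq[of _ k])
    finally show ?thesis using mn by (simp add: left_mult_one_mat[of _ k k])
  qed
  have gh: "g * h = u"
  proof -
    have "g * h = (u * n) * (u * h)" unfolding g_def by (simp add: mult_assoc_sq[of _ k] del: A.u_left)
    also have "\<dots> = (u * n) * (m * u)" unfolding uh mu ..
    also have "\<dots> = u * ((n * m) * u)" by (simp add: mult_assoc_sq[of _ k])
    finally show ?thesis using mn by (simp add: left_mult_one_mat[of _ k k])
  qed
  have gops: "g \<in> ops u"
    using uu by (simp add: ops_def g_def mult_assoc_sq[of _ k]) (simp add: uu flip: mult_assoc_sq[of u k u])
  have commg: "x * g = g * x" if x: "x \<in> ops u" "x * h = h * x" for x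
  proof -
    have xc [simp]: "x \<in> carrier_mat k k" and xu: "x * u = x" "u * x = x" using x by (auto simp: ops_def)
    have "g * (x * h) * g = g * (h * x) * g" using x by simp
    then have "g * x * (h * g) = (g * h) * x * g" by (simp add: mult_assoc_sq[of _ k])
    then have "g * x * u = u * x * g" using gh hg by simp
    then show ?thesis using xu by (simp add: mult_assoc_sq[of _ k])
  qed
  have gA [simp]: "g \<in> A"
  proof -
    have "g \<in> commutant u B" unfolding commutant_def
      using gops commg B.in_ops comm[OF hA] by auto
    then show ?thesis using commB by simp
  qed
  have gadj: "mat_adjoint g = g"
  proof -
    have "mat_adjoint (h * g) = u" using hg by simp
    then have "mat_adjoint g * h = u" using hadj by (simp add: mat_adjoint_mult[of _ k k _ k])
    then have "mat_adjoint g * h * g = u * g" by simp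
    then show ?thesis using hg by (simp add: mult_assoc_sq[of _ k])
  qed
  have "hpos g"
  proof (rule hpos_posI)
    fix x assume x: "x \<in> A"
    have "TA (g * (mat_adjoint x * x)) = TA ((u * mat_adjoint x) * (x * g))"
      using x A.cyc[of g "mat_adjoint x" x] by simp
    also have "(u * mat_adjoint x) * (x * g) = h * (mat_adjoint (x * g) * (x * g))"
      using x gadj by (simp add: mat_adjoint_mult[of _ k k _ k] mult_assoc_sq[of _ k] flip: hg)
    finally show "0 \<le> TA (g * (mat_adjoint x * x))" using h x by (simp add: A.posd_def)
  qed simp
  then have "A.posd g" using hpos_posd[of g h] hg by simp
  then show ?thesis using that gh hg commg by blast
qed

text \<open>For the trace itself, \<open>dual\<close> says that Connes' operator of \<open>v\<close>
  is \<open>eA v v\<close>; a density \<open>\<sigma>\<close> is compensated by its inverse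
  \<open>g\<close> in one argument.\<close>

lemma theta_eq:
  assumes \<psi>: "faithful_weight B \<psi>" and \<sigma>: "\<sigma> \<in> B" "\<And>y. y \<in> B \<Longrightarrow> \<psi> y = TB (\<sigma> * y)"
    and g: "g \<in> B" "g * \<sigma> = u" and v: "v \<in> hilb u"
  shows "theta u B \<psi> v = eA (g *\<^sub>v v) v"
  unfolding theta_def
proof (rule the_equality)
  have gv: "g *\<^sub>v v \<in> hilb u" using g v by simp
  \<comment> \<open>The GNS vector of \<open>z\<close> is represented by \<open>eB z v * g\<close>:
    cyclicity of the trace moves \<open>g\<close> next to \<open>\<sigma>\<close>, and what remains
    is a vector functional.\<close>
  have main: "eA (g *\<^sub>v v) v *\<^sub>v z = (eB z v * g) *\<^sub>v v \<and>
      (\<forall>y\<in>B. \<psi> (mat_adjoint y * (eB z v * g)) = z \<bullet>c (y *\<^sub>v v))" if z: "z \<in> hilb u" for z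
  proof (intro conjI ballI)
    show "eA (g *\<^sub>v v) v *\<^sub>v z = (eB z v * g) *\<^sub>v v"
      using gv v z g by (simp add: dual eB_in assoc_mult_mat_vec[of _ k k _ k])
    fix y assume y: "y \<in> B"
    have "\<psi> (mat_adjoint y * (eB z v * g)) = TB (\<sigma> * ((mat_adjoint y * eB z v) * g))"
      using \<sigma> y v z g by (simp add: eB_in mult_assoc_sq[of _ k])
    also have "\<dots> = TB ((mat_adjoint y * eB z v) * (g * \<sigma>))"
      using \<sigma> y v z g by (intro B.cyc) (auto simp: eB_in)
    also have "\<dots> = TB (mat_adjoint y * eB z v)" using g y v z by (simp add: eB_in)
    also have "\<dots> = z \<bullet>c (y *\<^sub>v v)"
      using y v z by (simp add: TB_eB cscalar_mult_mat_vec[of _ k k])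
    finally show "\<psi> (mat_adjoint y * (eB z v * g)) = z \<bullet>c (y *\<^sub>v v)" .
  qed
  show "eA (g *\<^sub>v v) v \<in> ops u \<and> (\<forall>\<eta>\<in>hilb u. \<exists>z\<in>B. eA (g *\<^sub>v v) v *\<^sub>v \<eta> = z *\<^sub>v v \<and>
      (\<forall>y\<in>B. \<psi> (mat_adjoint y * z) = \<eta> \<bullet>c (y *\<^sub>v v)))"
    using main eB_in g v eA_in[OF gv v] A.in_ops by (meson B.mult_in)
  fix T assume T: "T \<in> ops u \<and> (\<forall>\<eta>\<in>hilb u. \<exists>z\<in>B. T *\<^sub>v \<eta> = z *\<^sub>v v \<and>
      (\<forall>y\<in>B. \<psi> (mat_adjoint y * z) = \<eta> \<bullet>c (y *\<^sub>v v)))"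
  show "T = eA (g *\<^sub>v v) v"
  proof (rule ops_eqI_hilb)
    show "T \<in> ops u" using T by simp
    show "eA (g *\<^sub>v v) v \<in> ops u" using eA_in[OF gv v] A.in_ops by simp
    show "u \<in> carrier_mat k k" by simp
    show "is_projection u" using A.star by (simp add: star_subalgebra_def)
    fix z assume z: "z \<in> hilb u"
    obtain z' where z': "z' \<in> B" "T *\<^sub>v z = z' *\<^sub>v v" "\<And>y. y \<in> B \<Longrightarrow> \<psi> (mat_adjoint y * z') = z \<bullet>c (y *\<^sub>v v)"
      using T z by blast
    define w where "w = eB z v * g"
    have w: "w \<in> B" using z v g by (simp add: w_def eB_in)
    \<comment> \<open>Representatives of a GNS vector are unique: the difference \<open>?d\<close>
      is orthogonal to itself for the faithful weight \<open>\<psi>\<close>.\<close>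
    have "z' = w"
    proof (rule B.diff_zero)
      let ?d = "z' + (-1) \<cdot>\<^sub>m w"
      have d: "?d \<in> B" using z' w by simp
      have "mat_adjoint ?d * ?d = mat_adjoint ?d * z' + (-1) \<cdot>\<^sub>m (mat_adjoint ?d * w)"
        using d z' w by (simp add: mult_add_distrib_mat[of _ k k _ k] mult_smult_distrib[of _ k k _ k])
      then have "\<psi> (mat_adjoint ?d * ?d) = \<psi> (mat_adjoint ?d * z') + (-1) * \<psi> (mat_adjoint ?d * w)"
        using \<psi> d z' w by (simp add: faithful_weight_def linear_functional_def)
      also have "\<dots> = 0" using z'(3)[OF d] main[OF z] d by (simp add: w_def)
      finally show "?d = 0\<^sub>m k k" using \<psi> d B.is_zero[OF d] by (auto simp: faithful_weight_def)
    qed (use z' w in auto)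
    then show "T *\<^sub>v z = eA (g *\<^sub>v v) v *\<^sub>v z" using z' main[OF z] by (simp add: w_def)
  qed
qed

text \<open>Evaluating \<open>\<phi>\<close> at Connes' operator \<open>eA (g *\<^sub>v v) v\<close>
  gives the quadratic form of \<open>\<rho> * g\<close> at once. Uniqueness holds because a complex
  quadratic form determines its operator, by polarization on the range of \<open>u\<close>.\<close>

lemma spatial_derivative_eq:
  assumes \<psi>: "faithful_weight B \<psi>" and \<sigma>: "\<sigma> \<in> B" "\<And>y. y \<in> B \<Longrightarrow> \<psi> y = TB (\<sigma> * y)"
    and g: "g \<in> B" "g * \<sigma> = u" and \<rho>: "\<rho> \<in> A" "\<And>x. x \<in> A \<Longrightarrow> \<phi> x = TA (\<rho> * x)"
  shows "spatial_derivative u A \<phi> \<psi> = \<rho> * g"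
  unfolding spatial_derivative_def commA
proof (rule the_equality)
  have rg: "\<rho> * g \<in> carrier_mat k k" using \<rho> g by (intro mult_car) auto
  have e: "\<phi> (theta u B \<psi> v) = ((\<rho> * g) *\<^sub>v v) \<bullet>c v" if v: "v \<in> hilb u" for v
  proof -
    have "\<phi> (theta u B \<psi> v) = \<phi> (eA (g *\<^sub>v v) v)" using theta_eq[OF \<psi> \<sigma> g v] by simp
    also have "\<dots> = (\<rho> *\<^sub>v (g *\<^sub>v v)) \<bullet>c v" using \<rho> g v by (simp add: eA_in TA_eA)
    finally show ?thesis using \<rho> g v by (simp add: assoc_mult_mat_vec[of _ k k _ k])
  qed
  have ops: "\<rho> * g \<in> ops u"
    using \<rho> g rg by (auto simp: ops_def mult_assoc_sq[of _ k] simp flip: mult_assoc_sq[of u k])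
  then show "\<rho> * g \<in> ops u \<and> (\<forall>v\<in>hilb u. ((\<rho> * g) *\<^sub>v v) \<bullet>c v = \<phi> (theta u B \<psi> v))"
    using e by simp
  fix T assume T: "T \<in> ops u \<and> (\<forall>v\<in>hilb u. (T *\<^sub>v v) \<bullet>c v = \<phi> (theta u B \<psi> v))"
  have Tc: "T \<in> carrier_mat k k" using T by (simp add: ops_def)
  let ?D = "T - \<rho> * g"
  have Dc: "?D \<in> carrier_mat k k" using rg by (simp add: minus_carrier_mat)
  have Dv: "?D *\<^sub>v v = T *\<^sub>v v - (\<rho> * g) *\<^sub>v v" if "v \<in> carrier_vec k" for v
    using that Tc rg by (intro minus_mult_distrib_mat_vec) auto
  have sub: "(x - y) \<bullet>c w = x \<bullet>c w - y \<bullet>c w" if "x \<in> carrier_vec k" "y \<in> carrier_vec k" "w \<in> carrier_vec k"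
    for x y w :: "complex vec"
    using that by (intro minus_scalar_prod_distrib[of _ k]) auto
  show "T = \<rho> * g"
  proof (rule ops_eqI_hilb)
    show "T \<in> ops u" "\<rho> * g \<in> ops u" using T ops by auto
    show "u \<in> carrier_mat k k" by simp
    show "is_projection u" using A.star by (simp add: star_subalgebra_def)
    fix v assume v: "v \<in> hilb u"
    let ?w = "?D *\<^sub>v v"
    have hT: "T *\<^sub>v v \<in> hilb u" "(\<rho> * g) *\<^sub>v v \<in> hilb u"
      using ops_hilb[of _ u k] T ops v by auto
    have wh: "?w \<in> hilb u"
    proof -
      have "u *\<^sub>v (T *\<^sub>v v - (\<rho> * g) *\<^sub>v v) = u *\<^sub>v (T *\<^sub>v v) - u *\<^sub>v ((\<rho> * g) *\<^sub>v v)"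
        using hT by (intro mult_minus_distrib_mat_vec[of _ k k]) auto
      then have "u *\<^sub>v ?w = ?w" using hilbD(2)[OF hT(1)] hilbD(2)[OF hT(2)] v by (simp add: Dv)
      moreover have "?w \<in> carrier_vec k" using Dc v by simp
      ultimately show ?thesis unfolding hilb_def by simp
    qed
    have "?w \<bullet>c ?w = 0"
    proof (rule polarization[OF Dc _ _ _ _ v wh])
      show "\<And>v w. v \<in> hilb u \<Longrightarrow> w \<in> hilb u \<Longrightarrow> v + w \<in> hilb u"
        using hilb_add[OF A.u_carrier] by auto
      show "\<And>v c. v \<in> hilb u \<Longrightarrow> c \<cdot>\<^sub>v v \<in> hilb u"
        using hilb_smult[OF A.u_carrier] by auto
      show "hilb u \<subseteq> carrier_vec k" by auto
      fix v assume v: "v \<in> hilb u"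
      have "T *\<^sub>v v \<in> carrier_vec k" "(\<rho> * g) *\<^sub>v v \<in> carrier_vec k" using Tc rg v by auto
      then show "(?D *\<^sub>v v) \<bullet>c v = 0" using v T e by (simp add: Dv sub)
    qed
    then have "?w = 0\<^sub>v k" using conjugate_square_eq_0_vec[of ?w k] wh by simp
    then have z: "T *\<^sub>v v - (\<rho> * g) *\<^sub>v v = 0\<^sub>v k" using v by (simp add: Dv)
    show "T *\<^sub>v v = (\<rho> * g) *\<^sub>v v"
    proof (rule eq_vecI)
      fix i assume "i < dim_vec ((\<rho> * g) *\<^sub>v v)"
      then have i: "i < k" using carrier_matD(1)[OF A.car[OF \<rho>(1)]] by simp
      have "(T *\<^sub>v v - (\<rho> * g) *\<^sub>v v) $ i = 0" using z i by simp
      then show "(T *\<^sub>v v) $ i = ((\<rho> * g) *\<^sub>v v) $ i"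
        using i Tc \<rho>(1) by (simp del: index_mult_mat_vec)
    qed (use Tc rg in auto)
  qed
qed

end

section \<open>Operator-valued weights of an inclusion and Kosaki's inverse\<close>

locale alg_incl =
  M: dual_pair k u M TM M' TM' eM eM' + N: dual_pair k u N TN N' TN' eN eN'
  for k u M TM M' TM' eM eM' N TN N' TN' eN eN' +
  assumes NM: "N \<subseteq> M"
begin

lemma NM_in [simp]: "x \<in> N \<Longrightarrow> x \<in> M" using NM by blast
lemma M'N' [simp]: "x \<in> M' \<Longrightarrow> x \<in> N'"
  using NM M.commA N.commA by (auto simp: commutant_def)

text \<open>Passing to commutants reverses the inclusion, so Kosaki's inverse is described by the
  same construction on this instance.\<close>

lemma alg_incl_swap: "alg_incl k u N' TN' N TN eN' eN M' TM' M TM eM' eM"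
  by (intro alg_incl.intro alg_incl_axioms.intro N.dual_pair_swap M.dual_pair_swap) auto

definition R :: "complex mat set" where "R = N' \<inter> M"

lemma R_M [simp]: "x \<in> R \<Longrightarrow> x \<in> M" and R_N' [simp]: "x \<in> R \<Longrightarrow> x \<in> N'" unfolding R_def by blast+
lemma R_mult [simp]: "x \<in> R \<Longrightarrow> y \<in> R \<Longrightarrow> x * y \<in> R" unfolding R_def by simp

text \<open>
  \<open>Ecan\<close> intertwines the canonical traces and is not unital in general.
\<close>

definition Ecan :: "complex mat \<Rightarrow> complex mat" where
  "Ecan x = (THE y. y \<in> N \<and> (\<forall>n\<in>N. TN (n * y) = TM (n * x)))"

lemma Ecan_ex: "x \<in> M \<Longrightarrow> \<exists>!y. y \<in> N \<and> (\<forall>n\<in>N. TN (n * y) = TM (n * x))"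
proof (rule ex_ex1I)
  assume x: "x \<in> M"
  have "linear_functional N (\<lambda>n. TM (n * x))"
    unfolding linear_functional_def using x
    by (auto simp: add_mult_distrib_mat[of _ k k _ _ k] mult_smult_assoc_mat[of _ k k _ k])
  from N.A.riesz[OF this] obtain y where "y \<in> N" "\<forall>n\<in>N. TM (n * x) = TN (y * n)" by blast
  then show "\<exists>y. y \<in> N \<and> (\<forall>n\<in>N. TN (n * y) = TM (n * x))" using N.A.tracial by metis
next
  fix y z assume "y \<in> N \<and> (\<forall>n\<in>N. TN (n * y) = TM (n * x))" "z \<in> N \<and> (\<forall>n\<in>N. TN (n * z) = TM (n * x))"
  then show "y = z" by (intro N.A.T_eqI) auto
qed

lemma Ecan_in [simp]: "x \<in> M \<Longrightarrow> Ecan x \<in> N"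
  and TN_Ecan: "x \<in> M \<Longrightarrow> n \<in> N \<Longrightarrow> TN (n * Ecan x) = TM (n * x)"
  using theI'[OF Ecan_ex] unfolding Ecan_def by auto

lemma Ecan_eqI: "x \<in> M \<Longrightarrow> y \<in> N \<Longrightarrow> (\<And>n. n \<in> N \<Longrightarrow> TN (n * y) = TM (n * x)) \<Longrightarrow> Ecan x = y"
  unfolding Ecan_def by (rule the1_equality[OF Ecan_ex]) auto

lemma Ecan_add: "x \<in> M \<Longrightarrow> y \<in> M \<Longrightarrow> Ecan (x + y) = Ecan x + Ecan y"
  by (rule Ecan_eqI) (auto simp: mult_add_distrib_mat[of _ k k _ k] TN_Ecan)

lemma Ecan_smult: "x \<in> M \<Longrightarrow> Ecan (c \<cdot>\<^sub>m x) = c \<cdot>\<^sub>m Ecan x"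
  by (rule Ecan_eqI) (auto simp: mult_smult_distrib[of _ k k _ k] TN_Ecan)

lemma Ecan_left: assumes "x \<in> M" "a \<in> N" shows "Ecan (a * x) = a * Ecan x"
proof (rule Ecan_eqI)
  fix n assume n: "n \<in> N"
  have "TN (n * (a * Ecan x)) = TN ((n * a) * Ecan x)" using assms n by (simp add: mult_assoc_sq[of _ k])
  also have "\<dots> = TM ((n * a) * x)" using assms n by (intro TN_Ecan) auto
  finally show "TN (n * (a * Ecan x)) = TM (n * (a * x))" using assms n by (simp add: mult_assoc_sq[of _ k])
qed (use assms in auto)

lemma Ecan_right: assumes "x \<in> M" "a \<in> N" shows "Ecan (x * a) = Ecan x * a"
proof (rule Ecan_eqI)
  fix n assume n: "n \<in> N"
  have "TN (n * (Ecan x * a)) = TN ((a * n) * Ecan x)"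
    using assms n N.A.cyc[of a n "Ecan x"] by (simp add: mult_assoc_sq[of _ k])
  also have "\<dots> = TM ((a * n) * x)" using assms n by (intro TN_Ecan) auto
  also have "\<dots> = TM (n * (x * a))" using assms n M.A.cyc[of a n x] by (simp add: mult_assoc_sq[of _ k])
  finally show "TN (n * (Ecan x * a)) = TM (n * (x * a))" .
qed (use assms in auto)

definition Ew :: "complex mat \<Rightarrow> complex mat \<Rightarrow> complex mat" where
  "Ew \<kappa> = (\<lambda>x\<in>M. Ecan (\<kappa> * x))"

lemma TN_Ew: "\<kappa> \<in> R \<Longrightarrow> x \<in> M \<Longrightarrow> n \<in> N \<Longrightarrow> TN (n * Ew \<kappa> x) = TM (n * (\<kappa> * x))"
  by (simp add: Ew_def TN_Ecan)

text \<open>As \<open>\<kappa>\<close> commutes with \<open>N\<close>, testing the image of a square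
  against a square from \<open>N\<close> gives \<open>TM\<close> of \<open>\<kappa>\<close> times a
  single square, that of \<open>x * mat_adjoint n\<close>. Positivity and faithfulness are thus
  inherited from \<open>\<kappa>\<close>.\<close>

lemma Ew_weight:
  assumes \<kappa>: "\<kappa> \<in> R" "M.A.posd \<kappa>"
  shows "op_valued_weight M N (Ew \<kappa>)"
proof -
  have \<kappa>M [simp]: "\<kappa> \<in> M" using \<kappa> by simp
  show ?thesis
    unfolding op_valued_weight_def
  proof (intro conjI ballI allI impI)
    show "Ew \<kappa> \<in> M \<rightarrow>\<^sub>E N" by (auto simp: Ew_def)
  next
    fix x y assume "x \<in> M" "y \<in> M"
    then show "Ew \<kappa> (x + y) = Ew \<kappa> x + Ew \<kappa> y"
      by (simp add: Ew_def mult_add_distrib_mat[of _ k k _ k] Ecan_add)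
  next
    fix x c assume "x \<in> M"
    then show "Ew \<kappa> (c \<cdot>\<^sub>m x) = c \<cdot>\<^sub>m Ew \<kappa> x"
      by (simp add: Ew_def mult_smult_distrib[of _ k k _ k] Ecan_smult)
  next
    fix x a b assume x: "x \<in> M" and a: "a \<in> N" and b: "b \<in> N"
    have "\<kappa> * (a * x * b) = (\<kappa> * a) * (x * b)" using x a b by (simp add: mult_assoc_sq[of _ k])
    also have "\<kappa> * a = a * \<kappa>" using a \<kappa> N.comm[of a \<kappa>] by simp
    finally have "\<kappa> * (a * x * b) = a * ((\<kappa> * x) * b)" using x a b by (simp add: mult_assoc_sq[of _ k])
    then show "Ew \<kappa> (a * x * b) = a * Ew \<kappa> x * b"
      using x a b Ecan_left[of "\<kappa> * x * b" a] Ecan_right[of "\<kappa> * x" b] mult_assoc_sq[of a k "Ecan (\<kappa> * x)" b]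
      by (simp add: Ew_def)
  next
    fix x assume x: "x \<in> M"
    have "N.hpos (Ew \<kappa> (mat_adjoint x * x))"
    proof (rule N.hpos_posI)
      show "Ew \<kappa> (mat_adjoint x * x) \<in> N" using x by (simp add: Ew_def)
      fix n assume n: "n \<in> N"
      have "TN (Ew \<kappa> (mat_adjoint x * x) * (mat_adjoint n * n)) = TN ((mat_adjoint n * n) * Ew \<kappa> (mat_adjoint x * x))"
        using n x by (intro N.A.tracial) (auto simp: Ew_def)
      also have "\<dots> = TM ((mat_adjoint n * n) * (\<kappa> * (mat_adjoint x * x)))"
        using n x \<kappa> by (intro TN_Ew) auto
      also have "\<dots> = TM (mat_adjoint n * ((n * \<kappa>) * (mat_adjoint x * x)))"
        using n x by (simp add: mult_assoc_sq[of _ k])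
      also have "\<dots> = TM ((n * \<kappa>) * ((mat_adjoint x * x) * mat_adjoint n))"
        using n x by (intro M.A.cyc) auto
      also have "n * \<kappa> = \<kappa> * n" using n \<kappa> N.comm[of n \<kappa>] by simp
      also have "\<kappa> * n * ((mat_adjoint x * x) * mat_adjoint n) =
        \<kappa> * (mat_adjoint (x * mat_adjoint n) * (x * mat_adjoint n))"
        using n x by (simp add: mult_assoc_sq[of _ k] mat_adjoint_mult[of _ k k _ k])
      finally show "0 \<le> TN (Ew \<kappa> (mat_adjoint x * x) * (mat_adjoint n * n))"
        using \<kappa> n x by (simp add: M.A.posd_def)
    qed
    then show "\<exists>y\<in>N. Ew \<kappa> (mat_adjoint x * x) = mat_adjoint y * y"
      using x by (intro N.hpos_root) (auto simp: Ew_def)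
  next
    fix x assume x: "x \<in> M" and 0: "is_zero_mat (Ew \<kappa> (mat_adjoint x * x))"
    have "Ew \<kappa> (mat_adjoint x * x) \<in> N" using x by (simp add: Ew_def)
    then have "Ew \<kappa> (mat_adjoint x * x) = 0\<^sub>m k k" using 0 N.A.is_zero by blast
    then have "TM (u * (\<kappa> * (mat_adjoint x * x))) = 0"
      using x \<kappa> by (subst TN_Ew[symmetric]) auto
    then have "TM (\<kappa> * (mat_adjoint x * x)) = 0" using x by simp
    then have "x = 0\<^sub>m k k" using \<kappa> x by (simp add: M.A.posd_def)
    then show "is_zero_mat x" by simp
  qed
qed

text \<open>Here \<open>\<kappa>\<close> is the density of \<open>TN \<circ> E\<close> with respect
  to \<open>TM\<close>. It commutes with \<open>N\<close> because \<open>E\<close> is an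
  \<open>N\<close>-bimodule map and \<open>TN\<close> is a trace.\<close>

lemma weight_Ew:
  assumes E: "op_valued_weight M N E"
  obtains \<kappa> where "\<kappa> \<in> R" "M.A.posd \<kappa>" "E = Ew \<kappa>"
proof -
  have EN [simp]: "E x \<in> N" if "x \<in> M" for x using E that by (auto simp: op_valued_weight_def)
  have Eadd: "E (x + y) = E x + E y" if "x \<in> M" "y \<in> M" for x y using E that by (simp add: op_valued_weight_def)
  have Esm: "E (c \<cdot>\<^sub>m x) = c \<cdot>\<^sub>m E x" if "x \<in> M" for x c using E that by (simp add: op_valued_weight_def)
  have Ebi: "E (a * x * b) = a * E x * b" if "x \<in> M" "a \<in> N" "b \<in> N" for x a b
    using E that by (simp add: op_valued_weight_def)
  have El: "E (a * x) = a * E x" if "x \<in> M" "a \<in> N" for x a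
    using Ebi[OF that N.A.u_in] that by simp
  have Er: "E (x * a) = E x * a" if "x \<in> M" "a \<in> N" for x a
    using Ebi[OF that(1) N.A.u_in that(2)] that by simp
  have "faithful_weight M (\<lambda>x. TN (E x))"
    unfolding faithful_weight_def linear_functional_def
  proof (intro conjI ballI allI impI)
    fix x assume x: "x \<in> M"
    obtain y where y: "y \<in> N" "E (mat_adjoint x * x) = mat_adjoint y * y"
      using E x by (auto simp: op_valued_weight_def)
    then show "0 \<le> TN (E (mat_adjoint x * x))" using N.A.T_pos by simp
    assume "TN (E (mat_adjoint x * x)) = 0"
    then have "y = 0\<^sub>m k k" using y N.A.T_faithful by simp
    then have "E (mat_adjoint x * x) = 0\<^sub>m k k" using y by simp
    then have "is_zero_mat (E (mat_adjoint x * x))" by simp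
    then show "is_zero_mat x" using E x unfolding op_valued_weight_def by blast
  qed (simp_all add: Eadd Esm)
  then obtain \<kappa> where \<kappa>: "M.A.posd \<kappa>" "\<And>x. x \<in> M \<Longrightarrow> TN (E x) = TM (\<kappa> * x)"
    using M.A.density by blast
  have \<kappa>M [simp]: "\<kappa> \<in> M" using \<kappa> by (simp add: M.A.posd_def)
  have comm: "n * \<kappa> = \<kappa> * n" if n: "n \<in> N" for n
  proof (rule M.A.T_eqI)
    fix x assume x: "x \<in> M"
    have "TM (x * (n * \<kappa>)) = TM (\<kappa> * (x * n))" using n x M.A.cyc[of \<kappa> x n] by simp
    also have "\<dots> = TN (E x * n)" using n x by (simp add: Er flip: \<kappa>(2))
    also have "\<dots> = TN (n * E x)" using n x by (simp add: N.A.tracial)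
    also have "\<dots> = TM (\<kappa> * (n * x))" using n x by (simp add: \<kappa>(2)[symmetric] El)
    also have "\<dots> = TM (x * (\<kappa> * n))" using n x M.A.cyc[of x \<kappa> n] by simp
    finally show "TM (x * (n * \<kappa>)) = TM (x * (\<kappa> * n))" .
  qed (use n in auto)
  have "\<kappa> \<in> commutant u N"
    unfolding commutant_def using comm M.A.in_ops[OF \<kappa>M] by auto
  then have \<kappa>R: "\<kappa> \<in> R" unfolding R_def N.commA by simp
  have "E x = Ew \<kappa> x" if x: "x \<in> M" for x
  proof -
    have "Ecan (\<kappa> * x) = E x"
    proof (rule Ecan_eqI)
      fix n assume n: "n \<in> N"
      have "TN (n * E x) = TN (E (n * x))" using x n El by simp
      also have "\<dots> = TM ((\<kappa> * n) * x)" using x n \<kappa>(2) by (simp add: mult_assoc_sq[of _ k])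
      also have "\<dots> = TM (n * (\<kappa> * x))" using x n by (simp flip: comm) (simp add: mult_assoc_sq[of _ k])
      finally show "TN (n * E x) = TM (n * (\<kappa> * x))" .
    qed (use x in auto)
    then show ?thesis using x by (simp add: Ew_def)
  qed
  moreover have "E \<in> extensional M" "Ew \<kappa> \<in> extensional M"
    using E by (auto simp: op_valued_weight_def Ew_def PiE_def)
  ultimately have "E = Ew \<kappa>" by (intro extensionalityI) auto
  then show ?thesis using that \<kappa>R \<kappa>(1) by blast
qed

text \<open>The inverse stays in \<open>M\<close> by invertibility in a dual pair, and in
  \<open>N'\<close> because commutation with \<open>N\<close> passes to inverses.\<close>

lemma inverse_R:
  assumes \<kappa>: "\<kappa> \<in> R" "M.A.posd \<kappa>"
  obtains \<zeta> where "\<zeta> \<in> R" "N.B.posd \<zeta>" "M.A.posd \<zeta>" "\<zeta> * \<kappa> = u" "\<kappa> * \<zeta> = u"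
proof -
  interpret sw: dual_pair k u N' TN' N TN eN' eN by (rule N.dual_pair_swap)
  obtain \<zeta> where \<zeta>: "M.A.posd \<zeta>" "\<zeta> * \<kappa> = u" "\<kappa> * \<zeta> = u" "\<And>x. x \<in> ops u \<Longrightarrow> x * \<kappa> = \<kappa> * x \<Longrightarrow> x * \<zeta> = \<zeta> * x"
    using M.posd_inverse[OF \<kappa>(2)] by blast
  have \<zeta>M: "\<zeta> \<in> M" using \<zeta> by (simp add: M.A.posd_def)
  have \<zeta>N': "\<zeta> \<in> N'"
    unfolding N.commA[symmetric] commutant_def
    using M.A.in_ops[OF \<zeta>M] \<zeta>(4)[OF N.A.in_ops N.comm[OF _ R_N'[OF \<kappa>(1)]]] by blast
  have "sw.hpos \<zeta>" using M.posd_hpos[OF \<zeta>(1)] by (simp add: M.hpos_def sw.hpos_def)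
  then have "N.B.posd \<zeta>" using sw.hpos_posd[OF \<zeta>N' _ _ \<zeta>(3)] \<kappa> by simp
  then show ?thesis using that \<zeta> \<zeta>M \<zeta>N' unfolding R_def by blast
qed

definition Fw :: "complex mat \<Rightarrow> complex mat \<Rightarrow> complex mat" where
  "Fw = alg_incl.Ew N' TN' M' TM'"

lemma faithful_comp:
  assumes E: "op_valued_weight M N E" and \<phi>: "faithful_weight N \<phi>"
  shows "faithful_weight M (\<phi> \<circ> E)"
  unfolding faithful_weight_def linear_functional_def
proof (intro conjI ballI allI impI)
  fix x assume x: "x \<in> M"
  obtain y where y: "y \<in> N" "E (mat_adjoint x * x) = mat_adjoint y * y"
    using E x by (auto simp: op_valued_weight_def)
  then show "0 \<le> (\<phi> \<circ> E) (mat_adjoint x * x)" using \<phi> by (simp add: faithful_weight_def)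
  assume "(\<phi> \<circ> E) (mat_adjoint x * x) = 0"
  then have "is_zero_mat y" using \<phi> y by (simp add: faithful_weight_def)
  then have "y = 0\<^sub>m k k" using y N.A.is_zero by blast
  then have "E (mat_adjoint x * x) = 0\<^sub>m k k" using y by simp
  then have "is_zero_mat (E (mat_adjoint x * x))" by simp
  then show "is_zero_mat x" using E x unfolding op_valued_weight_def by blast
next
  fix x y assume "x \<in> M" "y \<in> M"
  moreover from this have "E x \<in> N" "E y \<in> N" using E by (auto simp: op_valued_weight_def)
  ultimately show "(\<phi> \<circ> E) (x + y) = (\<phi> \<circ> E) x + (\<phi> \<circ> E) y"
    using E \<phi> by (simp add: op_valued_weight_def faithful_weight_def linear_functional_def)
next
  fix x c assume "x \<in> M"
  moreover from this have "E x \<in> N" using E by (auto simp: op_valued_weight_def)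
  ultimately show "(\<phi> \<circ> E) (c \<cdot>\<^sub>m x) = c * (\<phi> \<circ> E) x"
    using E \<phi> by (simp add: op_valued_weight_def faithful_weight_def linear_functional_def)
qed

lemma T_Ew: "\<kappa> \<in> R \<Longrightarrow> \<rho> \<in> N \<Longrightarrow> x \<in> M \<Longrightarrow> TN (\<rho> * Ew \<kappa> x) = TM ((\<rho> * \<kappa>) * x)"
  by (simp add: TN_Ew mult_assoc_sq[of _ k])

text \<open>Let \<open>\<rho>\<close>, \<open>\<sigma>\<close> be the densities of the two weights
  and \<open>g\<close> the inverse of \<open>\<sigma>\<close>. The left derivative is
  \<open>\<rho> * \<kappa> * g\<close>; the right one, for an operator-valued weight of density
  \<open>\<mu>\<close> with inverse \<open>\<nu>\<close>, is \<open>\<rho> * \<nu> * g\<close>. They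
  agree for all weights exactly if \<open>\<nu> = \<kappa>\<close>.\<close>

lemma kosaki_inverse_Ew:
  assumes \<kappa>: "\<kappa> \<in> R" "M.A.posd \<kappa>" and \<zeta>: "\<zeta> \<in> R" "N.B.posd \<zeta>" "\<zeta> * \<kappa> = u" "\<kappa> * \<zeta> = u"
  shows "kosaki_inverse u M N (Ew \<kappa>) = Fw \<zeta>"
proof -
  interpret sw: alg_incl k u N' TN' N TN eN' eN M' TM' M TM eM' eM by (rule alg_incl_swap)
  have Rsw: "sw.R = R" by (auto simp: R_def sw.R_def)
  have \<kappa>' [simp]: "\<kappa> \<in> M" "\<kappa> \<in> N'" using \<kappa> by auto
  have E: "op_valued_weight M N (Ew \<kappa>)" using Ew_weight \<kappa> by blast
  have key: "spatial_derivative u M (\<phi> \<circ> Ew \<kappa>) \<psi> = (\<rho> * \<kappa>) * g \<and>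
      spatial_derivative u N \<phi> (\<psi> \<circ> sw.Ew \<mu>) = \<rho> * (\<nu> * g)"
    if \<phi>: "faithful_weight N \<phi>" "\<rho> \<in> N" "\<And>x. x \<in> N \<Longrightarrow> \<phi> x = TN (\<rho> * x)"
      and \<psi>: "faithful_weight M' \<psi>" "\<sigma> \<in> M'" "\<And>x. x \<in> M' \<Longrightarrow> \<psi> x = TM' (\<sigma> * x)" "g \<in> M'" "g * \<sigma> = u"
      and \<mu>: "\<mu> \<in> R" "N.B.posd \<mu>" "\<nu> \<in> R" "\<nu> * \<mu> = u" for \<phi> \<psi> \<rho> \<sigma> g \<mu> \<nu>
  proof
    have EN: "Ew \<kappa> x \<in> N" if "x \<in> M" for x using that by (simp add: Ew_def)
    show "spatial_derivative u M (\<phi> \<circ> Ew \<kappa>) \<psi> = (\<rho> * \<kappa>) * g"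
    proof (rule M.spatial_derivative_eq[OF \<psi>(1,2,3,4,5)])
      show "\<rho> * \<kappa> \<in> M" using \<phi> by simp
      fix x assume "x \<in> M"
      then show "(\<phi> \<circ> Ew \<kappa>) x = TM (\<rho> * \<kappa> * x)" using \<phi> EN \<kappa> by (simp add: T_Ew)
    qed
    have Fw: "op_valued_weight N' M' (sw.Ew \<mu>)" using sw.Ew_weight[of \<mu>] \<mu> Rsw by simp
    have FM: "sw.Ew \<mu> x \<in> M'" if "x \<in> N'" for x using that \<mu> by (simp add: sw.Ew_def)
    show "spatial_derivative u N \<phi> (\<psi> \<circ> sw.Ew \<mu>) = \<rho> * (\<nu> * g)"
    proof (rule N.spatial_derivative_eq)
      show "faithful_weight N' (\<psi> \<circ> sw.Ew \<mu>)" using sw.faithful_comp[OF Fw \<psi>(1)] .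
      show "\<sigma> * \<mu> \<in> N'" "\<nu> * g \<in> N'" using \<psi> \<mu> by auto
      show "\<rho> \<in> N" "\<And>x. x \<in> N \<Longrightarrow> \<phi> x = TN (\<rho> * x)" by fact+
      show "(\<psi> \<circ> sw.Ew \<mu>) x = TN' (\<sigma> * \<mu> * x)" if "x \<in> N'" for x
        using that \<psi> \<mu> FM sw.T_Ew[of \<mu> \<sigma> x] Rsw by simp
      have "\<nu> * g * (\<sigma> * \<mu>) = \<nu> * ((g * \<sigma>) * \<mu>)" using \<psi>(2,4) \<mu>(1,3) by (simp add: mult_assoc_sq[of _ k])
      then show "\<nu> * g * (\<sigma> * \<mu>) = u" using \<psi> \<mu> by simp
    qed
  qed
  have sol: "spatial_derivative u M (\<phi> \<circ> Ew \<kappa>) \<psi> = spatial_derivative u N \<phi> (\<psi> \<circ> sw.Ew \<zeta>)"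
    if \<phi>: "faithful_weight N \<phi>" and \<psi>: "faithful_weight M' \<psi>" for \<phi> \<psi>
  proof -
    obtain \<rho> where \<rho>: "N.A.posd \<rho>" "\<And>x. x \<in> N \<Longrightarrow> \<phi> x = TN (\<rho> * x)" using N.A.density[OF \<phi>] by blast
    obtain \<sigma> where \<sigma>: "M.B.posd \<sigma>" "\<And>x. x \<in> M' \<Longrightarrow> \<psi> x = TM' (\<sigma> * x)" using M.B.density[OF \<psi>] by blast
    obtain g where g: "M.B.posd g" "g * \<sigma> = u" using sw.N.posd_inverse[OF \<sigma>(1)] by blast
    have [simp]: "\<rho> \<in> N" "\<sigma> \<in> M'" "g \<in> M'" using \<rho> \<sigma> g by (auto simp: N.A.posd_def M.B.posd_def)
    from key[OF \<phi> _ \<rho>(2) \<psi> _ \<sigma>(2) _ g(2) \<zeta>(1,2) \<kappa>(1) \<zeta>(4)]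
    show ?thesis by (simp add: mult_assoc_sq[of _ k])
  qed
  show ?thesis
    unfolding kosaki_inverse_def Fw_def M.commA N.commA
  proof (rule the_equality)
    show "op_valued_weight N' M' (sw.Ew \<zeta>) \<and>
      (\<forall>\<phi> \<psi>. faithful_weight N \<phi> \<and> faithful_weight M' \<psi> \<longrightarrow>
        spatial_derivative u M (\<phi> \<circ> Ew \<kappa>) \<psi> = spatial_derivative u N \<phi> (\<psi> \<circ> sw.Ew \<zeta>))"
      using sol sw.Ew_weight[of \<zeta>] \<zeta> Rsw by simp
    fix F assume F: "op_valued_weight N' M' F \<and>
      (\<forall>\<phi> \<psi>. faithful_weight N \<phi> \<and> faithful_weight M' \<psi> \<longrightarrow>
        spatial_derivative u M (\<phi> \<circ> Ew \<kappa>) \<psi> = spatial_derivative u N \<phi> (\<psi> \<circ> F))"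
    then obtain \<mu> where \<mu>: "\<mu> \<in> R" "N.B.posd \<mu>" "F = sw.Ew \<mu>" using sw.weight_Ew[of F] Rsw by auto
    obtain \<nu> where \<nu>: "\<nu> \<in> R" "\<nu> * \<mu> = u" "\<mu> * \<nu> = u" using sw.inverse_R[of \<mu>] \<mu> Rsw by metis
    \<comment> \<open>For uniqueness the two canonical traces are used as test weights; their
      densities are the unit, so the equation reduces to \<open>\<kappa> = \<nu>\<close>.\<close>
    have TNf: "faithful_weight N TN" by (rule N.A.faithful)
    have TMf: "faithful_weight M' TM'" by (rule M.B.faithful)
    have "TN x = TN (u * x)" if "x \<in> N" for x using that by simp
    moreover have "TM' x = TM' (u * x)" if "x \<in> M'" for x using that by simp
    ultimately have "spatial_derivative u M (TN \<circ> Ew \<kappa>) TM' = u * \<kappa> * u \<and>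
      spatial_derivative u N TN (TM' \<circ> sw.Ew \<mu>) = u * (\<nu> * u)"
      using TNf TMf \<mu> \<nu> by (intro key[where \<sigma> = u]) auto
    then have "u * \<kappa> * u = u * (\<nu> * u)" using F TNf TMf \<mu> by auto
    then have "\<kappa> = \<nu>" using \<nu> by simp
    have "\<mu> * (\<nu> * \<zeta>) = (\<mu> * \<nu>) * \<zeta>"
      by (rule mult_assoc_sq[of _ k, symmetric]) (use \<mu> \<nu> \<zeta> in auto)
    then have "\<mu> = \<zeta>" using \<open>\<kappa> = \<nu>\<close> \<mu>(1) \<nu>(3) \<zeta>(1,4) by simp
    then show "F = sw.Ew \<zeta>" using \<mu> by simp
  qed
qed

end

subsection \<open>Inclusions in a path basis\<close>

text \<open>
  The path \<open>(i, j, l, a, c)\<close> runs through block \<open>i\<close> of \<open>M\<close> and the \<open>l\<close>-th copy of block \<open>j\<close> of \<open>N\<close> in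
  it; \<open>a\<close> is the coordinate moved by \<open>N\<close> and \<open>c\<close> the coordinate moved by the commutant of \<open>M\<close>. The
  projections below present \<open>M\<close>, \<open>N\<close> and the relative commutant \<open>R\<close> as algebras of type \<open>fac\<close>.
\<close>

type_synonym path = "nat \<times> nat \<times> nat \<times> nat \<times> nat"

definition paths :: "nat set \<Rightarrow> nat set \<Rightarrow> (nat \<Rightarrow> nat \<Rightarrow> nat) \<Rightarrow> (nat \<Rightarrow> nat) \<Rightarrow> (nat \<Rightarrow> nat) \<Rightarrow> path set" where
  "paths I J D \<beta> \<mu> = {(i, j, l, a, c). i \<in> I \<and> j \<in> J \<and> l < D i j \<and> a < \<beta> j \<and> c < \<mu> i}"

definition Mi :: "path \<Rightarrow> nat" where "Mi = (\<lambda>(i, j, l, a, c). i)"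
definition Ms :: "path \<Rightarrow> nat \<times> nat \<times> nat" where "Ms = (\<lambda>(i, j, l, a, c). (j, l, a))"
definition Mc :: "path \<Rightarrow> nat" where "Mc = (\<lambda>(i, j, l, a, c). c)"
definition Ni :: "path \<Rightarrow> nat" where "Ni = (\<lambda>(i, j, l, a, c). j)"
definition Ns :: "path \<Rightarrow> nat" where "Ns = (\<lambda>(i, j, l, a, c). a)"
definition Nc :: "path \<Rightarrow> nat \<times> nat \<times> nat" where "Nc = (\<lambda>(i, j, l, a, c). (i, l, c))"
definition Ri :: "path \<Rightarrow> nat \<times> nat" where "Ri = (\<lambda>(i, j, l, a, c). (i, j))"
definition Rs :: "path \<Rightarrow> nat" where "Rs = (\<lambda>(i, j, l, a, c). l)"
definition Rc :: "path \<Rightarrow> nat \<times> nat" where "Rc = (\<lambda>(i, j, l, a, c). (a, c))"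

definition mkM :: "nat \<Rightarrow> nat \<times> nat \<times> nat \<Rightarrow> nat \<Rightarrow> path" where "mkM i = (\<lambda>(j, l, a) c. (i, j, l, a, c))"
definition mkN :: "nat \<Rightarrow> nat \<Rightarrow> nat \<times> nat \<times> nat \<Rightarrow> path" where "mkN j a = (\<lambda>(i, l, c). (i, j, l, a, c))"
definition mkR :: "nat \<times> nat \<Rightarrow> nat \<Rightarrow> nat \<times> nat \<Rightarrow> path" where "mkR = (\<lambda>(i, j) l (a, c). (i, j, l, a, c))"

lemmas path_defs = mkM_def mkN_def mkR_def Mi_def Ms_def Mc_def Ni_def Ns_def Nc_def Ri_def Rs_def Rc_def

text \<open>\<open>\<mu> i\<close> is the multiplicity of the \<open>i\<close>-th block of
  \<open>M\<close> on the Hilbert space. The index sets are arbitrary finite sets, so that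
  \<open>{i}\<close> and \<open>{j}\<close> again give an instance; \<open>row_ex\<close> and
  \<open>col_ex\<close> say that every block meets some block of the other algebra.\<close>

locale incl =
  fixes k :: nat and I J :: "nat set" and D :: "nat \<Rightarrow> nat \<Rightarrow> nat" and \<beta> \<mu> :: "nat \<Rightarrow> nat"
    and \<xi> :: "path \<Rightarrow> complex vec"
  assumes finite_I [simp]: "finite I" and finite_J [simp]: "finite J"
    and \<beta>_pos [simp]: "j \<in> J \<Longrightarrow> 0 < \<beta> j" and \<mu>_pos [simp]: "i \<in> I \<Longrightarrow> 0 < \<mu> i"
    and row_ex: "i \<in> I \<Longrightarrow> \<exists>j\<in>J. 0 < D i j" and col_ex: "j \<in> J \<Longrightarrow> \<exists>i\<in>I. 0 < D i j"
    and onb_paths: "onb k (paths I J D \<beta> \<mu>) \<xi>"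
begin

abbreviation "P \<equiv> paths I J D \<beta> \<mu>"

sublocale onb k P \<xi> by (rule onb_paths)

definition "SM i = (SIGMA j:J. {..<D i j} \<times> {..<\<beta> j})"
definition "CN j = (SIGMA i:I. {..<D i j} \<times> {..<\<mu> i})"
definition "SR ij = {..<D (fst ij) (snd ij)}"
definition "CR ij = {..<\<beta> (snd ij)} \<times> {..<\<mu> (fst ij)}"
definition "CM i = {..<\<mu> i}"
definition "SN j = {..<\<beta> j}"
text \<open>The blocks of the relative commutant. A pair with \<open>D i j = 0\<close> carries no
  path and is left out because \<open>fac\<close> asks for nonempty blocks.\<close>

definition "IR = {(i, j). i \<in> I \<and> j \<in> J \<and> 0 < D i j}"

lemma finite_IR [simp]: "finite IR"
  by (rule finite_subset[of _ "I \<times> J"]) (auto simp: IR_def)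

lemma SM_ne: "i \<in> I \<Longrightarrow> SM i \<noteq> {}"
proof -
  assume "i \<in> I"
  then obtain j where "j \<in> J" "0 < D i j" using row_ex by blast
  then have "(j, 0, 0) \<in> SM i" by (simp add: SM_def)
  then show ?thesis by blast
qed

lemma CN_ne: "j \<in> J \<Longrightarrow> CN j \<noteq> {}"
proof -
  assume "j \<in> J"
  then obtain i where "i \<in> I" "0 < D i j" using col_ex by blast
  then have "(i, 0, 0) \<in> CN j" by (simp add: CN_def)
  then show ?thesis by blast
qed

sublocale Mf: fac k P \<xi> I SM CM Mi Ms Mc mkM
proof unfold_locales
  show "SM i \<noteq> {}" if "i \<in> I" for i using that by (rule SM_ne)
  show "CM i \<noteq> {}" if "i \<in> I" for i using \<mu>_pos[OF that] by (auto simp: CM_def)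
qed (auto simp: path_defs paths_def SM_def CM_def)

sublocale Nf: fac k P \<xi> J SN CN Ni Ns Nc mkN
proof unfold_locales
  show "CN j \<noteq> {}" if "j \<in> J" for j using that by (rule CN_ne)
  show "SN j \<noteq> {}" if "j \<in> J" for j using \<beta>_pos[OF that] by (auto simp: SN_def)
qed (auto simp: path_defs paths_def CN_def SN_def)

sublocale Rf: fac k P \<xi> IR SR CR Ri Rs Rc mkR
proof unfold_locales
  show "finite IR" by simp
  show "CR ij \<noteq> {}" if "ij \<in> IR" for ij
  proof -
    have "(0, 0) \<in> CR ij" using that by (auto simp: IR_def CR_def)
    then show ?thesis by auto
  qed
qed (auto simp: path_defs paths_def IR_def SR_def CR_def)

abbreviation "M \<equiv> balg Mi Ms Mc"
abbreviation "M' \<equiv> balg Mi Mc Ms"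
abbreviation "N \<equiv> balg Ni Ns Nc"
abbreviation "N' \<equiv> balg Ni Nc Ns"
abbreviation "TM \<equiv> Mf.btr"
abbreviation "TM' \<equiv> Mf.btr'"
abbreviation "TN \<equiv> Nf.btr"
abbreviation "TN' \<equiv> Nf.btr'"

lemma N_in_M: "bop Ni Ns Nc X = bop Mi Ms Mc (\<lambda>i (j, l, a) (j', l', a'). if j = j' \<and> l = l' then X j a a' else 0)"
  unfolding bop_def by (rule opr_cong) (auto simp: path_defs split: prod.splits)

sublocale alg_incl k one M TM M' TM' Mf.bexp Mf.bexp' N TN N' TN' Nf.bexp Nf.bexp'
proof (intro alg_incl.intro alg_incl_axioms.intro Mf.dual_pair Nf.dual_pair)
  show "N \<subseteq> M"
  proof
    fix x assume "x \<in> N"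
    then obtain X where "x = bop Ni Ns Nc X" by (elim Nf.algE)
    then show "x \<in> M" unfolding N_in_M by simp
  qed
qed

abbreviation "em \<equiv> bop Ri Rs Rc"
abbreviation "TR \<equiv> Rf.btr"

lemma R_in_M: "em Z = bop Mi Ms Mc (\<lambda>i (j, l, a) (j', l', a'). if j = j' \<and> a = a' then Z (i, j) l l' else 0)"
  unfolding bop_def by (rule opr_cong) (auto simp: path_defs split: prod.splits)

lemma R_in_N': "em Z = bop Ni Nc Ns (\<lambda>j (i, l, c) (i', l', c'). if i = i' \<and> c = c' then Z (i, j) l l' else 0)"
  unfolding bop_def by (rule opr_cong) (auto simp: path_defs split: prod.splits)

lemma em_R [simp]: "em Z \<in> R"
proof -
  have "em Z \<in> M" by (subst R_in_M) simp
  moreover have "em Z \<in> N'" by (subst R_in_N') (simp add: balg_def)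
  ultimately show ?thesis unfolding R_def by blast
qed

text \<open>Membership in \<open>M\<close> and in \<open>N'\<close> gives two forms of the same
  kernel. Together they force \<open>i\<close>, \<open>j\<close>, \<open>a\<close>, \<open>c\<close>
  to be preserved and the entries to be independent of \<open>a\<close> and \<open>c\<close>, so
  only a matrix in \<open>l\<close> is left for each pair \<open>(i, j)\<close>.\<close>

lemma R_alg: "R = balg Ri Rs Rc"
proof (intro equalityI subsetI)
  fix x assume x: "x \<in> R"
  obtain X where X: "x = bop Mi Ms Mc X" using x by (elim R_M[THEN Mf.algE])
  obtain Y where Y: "x = bop Ni Nc Ns Y" using R_N'[OF x] by (auto simp: balg_def)
  have eq: "(if Mi p = Mi q \<and> Mc p = Mc q then X (Mi p) (Ms p) (Ms q) else 0) =
      (if Ni p = Ni q \<and> Ns p = Ns q then Y (Ni p) (Nc p) (Nc q) else 0)" if "p \<in> P" "q \<in> P" for p q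
  proof -
    have "ker x p q = (if Mi p = Mi q \<and> Mc p = Mc q then X (Mi p) (Ms p) (Ms q) else 0)"
      unfolding X bop_def by (rule ker_opr[OF that])
    moreover have "ker x p q = (if Ni p = Ni q \<and> Ns p = Ns q then Y (Ni p) (Nc p) (Nc q) else 0)"
      unfolding Y bop_def by (rule ker_opr[OF that])
    ultimately show ?thesis by (rule trans[OF sym])
  qed
  have "x = em (\<lambda>(i, j) l l'. X i (j, l, 0) (j, l', 0))"
    unfolding X bop_def
  proof (rule opr_cong)
    fix p q assume p: "p \<in> P" and q: "q \<in> P"
    obtain i j l a c where pp: "p = (i, j, l, a, c)" by (cases p)
    obtain i' j' l' a' c' where qq: "q = (i', j', l', a', c')" by (cases q)
    show "(if Mi p = Mi q \<and> Mc p = Mc q then X (Mi p) (Ms p) (Ms q) else 0) =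
      (if Ri p = Ri q \<and> Rc p = Rc q then (case Ri p of (i, j) \<Rightarrow> \<lambda>l l'. X i (j, l, 0) (j, l', 0)) (Rs p) (Rs q) else 0)"
    proof (cases "i = i' \<and> j = j' \<and> a = a' \<and> c = c'")
      case False
      then show ?thesis using eq[OF p q] by (auto simp: pp qq path_defs)
    next
      case True
      \<comment> \<open>The entry is compared with the one at \<open>a = 0\<close> for the same
        \<open>i\<close>, \<open>j\<close>, \<open>c\<close>; the form coming from \<open>N'\<close>
        gives both the same value.\<close>
      then have "(i, j, l, 0, c) \<in> P" "(i, j, l', 0, c) \<in> P"
        using p q by (auto simp: pp qq paths_def)
      from eq[OF this] eq[OF p q] True show ?thesis by (auto simp: pp qq path_defs)
    qed
  qed
  then show "x \<in> balg Ri Rs Rc" by (simp add: balg_def)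
next
  fix x assume "x \<in> balg Ri Rs Rc"
  then obtain Z where "x = em Z" by (elim Rf.algE)
  then show "x \<in> R" by simp
qed

lemma RE: "x \<in> R \<Longrightarrow> (\<And>Z. x = em Z \<Longrightarrow> thesis) \<Longrightarrow> thesis"
  unfolding R_alg by (elim Rf.algE)

text \<open>These are the central elements of \<open>R\<close>. If \<open>f\<close> depends on
  \<open>i\<close> only, they lie in the center of \<open>M\<close>; if on \<open>j\<close> only, in
  the center of \<open>N\<close>.\<close>

definition dg :: "(nat \<Rightarrow> nat \<Rightarrow> complex) \<Rightarrow> complex mat" where
  "dg f = opr (\<lambda>p q. if p = q then f (Mi p) (Ni p) else 0)"

lemma dg_em: "dg f = em (\<lambda>(i, j) l l'. if l = l' then f i j else 0)"
  unfolding dg_def bop_def by (rule opr_cong) (auto simp: path_defs split: prod.splits)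

lemma dg_R [simp]: "dg f \<in> R" by (simp add: dg_em)
lemma dg_carrier [simp]: "dg f \<in> carrier_mat k k" by (simp add: dg_def)

lemma dg_one: "dg (\<lambda>i j. 1) = one" by (simp add: dg_def one_def)

lemma dg_cong: "(\<And>i j. i \<in> I \<Longrightarrow> j \<in> J \<Longrightarrow> 0 < D i j \<Longrightarrow> f i j = g i j) \<Longrightarrow> dg f = dg g"
  unfolding dg_def by (rule opr_cong) (auto simp: paths_def path_defs)

lemma dg_eqD: "dg f = dg g \<Longrightarrow> i \<in> I \<Longrightarrow> j \<in> J \<Longrightarrow> 0 < D i j \<Longrightarrow> f i j = g i j"
proof -
  assume "dg f = dg g" and ij: "i \<in> I" "j \<in> J" "0 < D i j"
  then have "ker (dg f) (i,j,0,0,0) (i,j,0,0,0) = ker (dg g) (i,j,0,0,0) (i,j,0,0,0)" by simp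
  then show ?thesis unfolding dg_def by (subst (asm) (1 2) ker_opr) (use ij in \<open>auto simp: paths_def path_defs\<close>)
qed

lemma dg_mult: "dg f * dg g = dg (\<lambda>i j. f i j * g i j)"
  unfolding dg_def opr_mult
  by (rule opr_cong) (auto simp: if_distrib[of "\<lambda>x. x * _"] cong: if_cong)

lemma dg_em_mult: "dg f * em Z = em (\<lambda>(i, j) l l'. f i j * Z (i, j) l l')"
  unfolding dg_em Rf.bop_mult
  by (rule Rf.bop_cong) (auto simp: if_distrib[of "\<lambda>x. x * _"] cong: if_cong)

lemma em_dg_mult: "em Z * dg f = em (\<lambda>(i, j) l l'. f i j * Z (i, j) l l')"
  unfolding dg_em Rf.bop_mult
  by (rule Rf.bop_cong) (auto simp: if_distrib[of "\<lambda>x. _ * x"] mult.commute cong: if_cong)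

lemma dg_smult: "c \<cdot>\<^sub>m dg f = dg (\<lambda>i j. c * f i j)"
  unfolding dg_def opr_smult by (rule opr_cong) auto
lemma dg_adjoint: "mat_adjoint (dg f) = dg (\<lambda>i j. cnj (f i j))"
  unfolding dg_def opr_adjoint by (rule opr_cong) auto

lemma dg_M: "dg (\<lambda>i j. f i) = bop Mi Ms Mc (\<lambda>i s t. if s = t then f i else 0)"
  and dg_M': "dg (\<lambda>i j. f i) = bop Mi Mc Ms (\<lambda>i s t. if s = t then f i else 0)"
  and dg_N: "dg (\<lambda>i j. g j) = bop Ni Ns Nc (\<lambda>j s t. if s = t then g j else 0)"
  and dg_N': "dg (\<lambda>i j. g j) = bop Ni Nc Ns (\<lambda>j s t. if s = t then g j else 0)"
  unfolding dg_def bop_def by (rule opr_cong, auto simp: path_defs split: prod.splits)+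

lemma dg_M_in [simp]: "dg (\<lambda>i j. f i) \<in> M" "dg (\<lambda>i j. f i) \<in> M'"
  and dg_N_in [simp]: "dg (\<lambda>i j. g j) \<in> N" "dg (\<lambda>i j. g j) \<in> N'"
proof -
  show "dg (\<lambda>i j. f i) \<in> M" by (subst dg_M) simp
  show "dg (\<lambda>i j. f i) \<in> M'" by (subst dg_M') (simp add: balg_def)
  show "dg (\<lambda>i j. g j) \<in> N" by (subst dg_N) simp
  show "dg (\<lambda>i j. g j) \<in> N'" by (subst dg_N') (simp add: balg_def)
qed

lemma TR_em: "TR (em Z) = (\<Sum>(i, j)\<in>IR. \<Sum>l<D i j. Z (i, j) l l)"
  unfolding Rf.btr_bop SR_def by (intro sum.cong refl) (auto split: prod.splits)

lemma sum_IR: "(\<Sum>(i, j)\<in>IR. \<Sum>l<D i j. h i j l) = (\<Sum>i\<in>I. \<Sum>j\<in>J. \<Sum>l<D i j. h i j l)"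
  for h :: "nat \<Rightarrow> nat \<Rightarrow> nat \<Rightarrow> 'b::comm_monoid_add"
proof -
  have "(\<Sum>(i, j)\<in>IR. \<Sum>l<D i j. h i j l) = (\<Sum>(i, j)\<in>I \<times> J. \<Sum>l<D i j. h i j l)"
    by (rule sum.mono_neutral_left) (auto simp: IR_def intro!: gr0I)
  then show ?thesis by (simp add: sum.cartesian_product)
qed

lemma TR_dg: "TR (dg f) = (\<Sum>i\<in>I. \<Sum>j\<in>J. of_nat (D i j) * f i j)"
proof -
  have "TR (dg f) = (\<Sum>(i, j)\<in>IR. \<Sum>l<D i j. f i j)"
    unfolding dg_em TR_em by (intro sum.cong refl) auto
  then show ?thesis unfolding sum_IR by simp
qed

lemma sum_SM: "(\<Sum>s\<in>SM i. h s) = (\<Sum>j\<in>J. \<Sum>l<D i j. \<Sum>a<\<beta> j. h (j, l, a))"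
  unfolding SM_def by (simp add: sum.cartesian_product sum.Sigma case_prod_unfold)

lemma sum_CN: "(\<Sum>s\<in>CN j. h s) = (\<Sum>i\<in>I. \<Sum>l<D i j. \<Sum>c<\<mu> i. h (i, l, c))"
  unfolding CN_def by (simp add: sum.cartesian_product sum.Sigma case_prod_unfold)

text \<open>An element of \<open>R\<close> acts trivially on the coordinate \<open>a\<close>, so its
  image is central in \<open>N\<close>: the trace over all copies of block \<open>j\<close>. The
  summation index \<open>i\<close> shadows the argument \<open>i\<close>, so the right side depends
  on \<open>j\<close> alone; in \<open>Fcan_em\<close> the roles of rows and columns are
  exchanged.\<close>

lemma Ecan_em: "Ecan (em Z) = dg (\<lambda>i j. \<Sum>i\<in>I. \<Sum>l<D i j. Z (i, j) l l)"
proof (rule Ecan_eqI)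
  fix n assume "n \<in> N"
  then obtain X where n: "n = bop Ni Ns Nc X" by (elim Nf.algE)
  have "TM (n * em Z) = (\<Sum>i\<in>I. \<Sum>s\<in>SM i. \<Sum>t\<in>SM i.
     (case s of (j, l, a) \<Rightarrow> \<lambda>(j', l', a'). if j = j' \<and> l = l' then X j a a' else 0) t *
     (case t of (j, l, a) \<Rightarrow> \<lambda>(j', l', a'). if j = j' \<and> a = a' then Z (i, j) l l' else 0) s)"
    unfolding n N_in_M R_in_M Mf.bop_mult Mf.btr_bop ..
  also have "\<dots> = (\<Sum>i\<in>I. \<Sum>s\<in>SM i. \<Sum>t\<in>SM i. if t = s then case s of (j, l, a) \<Rightarrow> X j a a * Z (i, j) l l else 0)"
    by (intro sum.cong refl) (auto split: prod.splits)
  also have "\<dots> = (\<Sum>i\<in>I. \<Sum>s\<in>SM i. case s of (j, l, a) \<Rightarrow> X j a a * Z (i, j) l l)"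
    by (intro sum.cong refl) simp
  also have "\<dots> = (\<Sum>i\<in>I. \<Sum>j\<in>J. \<Sum>l<D i j. \<Sum>a<\<beta> j. X j a a * Z (i, j) l l)"
    by (simp add: sum_SM)
  also have "\<dots> = (\<Sum>j\<in>J. \<Sum>i\<in>I. \<Sum>l<D i j. \<Sum>a<\<beta> j. X j a a * Z (i, j) l l)" by (rule sum.swap)
  also have "\<dots> = (\<Sum>j\<in>J. \<Sum>a<\<beta> j. X j a a * (\<Sum>i\<in>I. \<Sum>l<D i j. Z (i, j) l l))"
    by (simp flip: sum_distrib_left sum_distrib_right)
  also have "\<dots> = TN (n * dg (\<lambda>i j. \<Sum>i\<in>I. \<Sum>l<D i j. Z (i, j) l l))"
    unfolding n dg_N Nf.bop_mult Nf.btr_bop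
    by (simp add: if_distrib[of "\<lambda>x. _ * x"] SN_def CM_def cong: if_cong)
  finally show "TN (n * dg (\<lambda>i j. \<Sum>i\<in>I. \<Sum>l<D i j. Z (i, j) l l)) = TM (n * em Z)" by simp
qed auto

sublocale sw: alg_incl k one N' TN' N TN Nf.bexp' Nf.bexp M' TM' M TM Mf.bexp' Mf.bexp
  by (rule alg_incl_swap)

interpretation Mf': fac k P \<xi> I CM SM Mi Mc Ms "\<lambda>i c s. mkM i s c"
  by (rule Mf.fac_swap)
interpretation Nf': fac k P \<xi> J CN SN Ni Nc Ns "\<lambda>j s a. mkN j a s"
  by (rule Nf.fac_swap)

lemma TM'_bop: "TM' (bop Mi Mc Ms X) = (\<Sum>i\<in>I. \<Sum>c<\<mu> i. X i c c)"
  unfolding Mf.btr'_def Mf'.btr_bop CM_def ..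
lemma TN'_bop: "TN' (bop Ni Nc Ns X) = (\<Sum>j\<in>J. \<Sum>s\<in>CN j. X j s s)"
  unfolding Nf.btr'_def by (rule Nf'.btr_bop)

lemma M'_in_N': "bop Mi Mc Ms X = bop Ni Nc Ns (\<lambda>j (i, l, c) (i', l', c'). if i = i' \<and> l = l' then X i c c' else 0)"
  unfolding bop_def by (rule opr_cong) (auto simp: path_defs split: prod.splits)

lemma Fcan_em: "sw.Ecan (em Z) = dg (\<lambda>i j. \<Sum>j\<in>J. \<Sum>l<D i j. Z (i, j) l l)"
proof (rule sw.Ecan_eqI)
  fix n assume "n \<in> M'"
  then obtain X where n: "n = bop Mi Mc Ms X" by (elim Mf'.algE)
  have "TN' (n * em Z) = (\<Sum>j\<in>J. \<Sum>s\<in>CN j. \<Sum>t\<in>CN j.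
     (case s of (i, l, c) \<Rightarrow> \<lambda>(i', l', c'). if i = i' \<and> l = l' then X i c c' else 0) t *
     (case t of (i, l, c) \<Rightarrow> \<lambda>(i', l', c'). if i = i' \<and> c = c' then Z (i, j) l l' else 0) s)"
    unfolding n M'_in_N' R_in_N' Nf'.bop_mult TN'_bop ..
  also have "\<dots> = (\<Sum>j\<in>J. \<Sum>s\<in>CN j. \<Sum>t\<in>CN j. if t = s then case s of (i, l, c) \<Rightarrow> X i c c * Z (i, j) l l else 0)"
    by (intro sum.cong refl) (auto split: prod.splits)
  also have "\<dots> = (\<Sum>j\<in>J. \<Sum>s\<in>CN j. case s of (i, l, c) \<Rightarrow> X i c c * Z (i, j) l l)"
    by (intro sum.cong refl) simp
  also have "\<dots> = (\<Sum>j\<in>J. \<Sum>i\<in>I. \<Sum>l<D i j. \<Sum>c<\<mu> i. X i c c * Z (i, j) l l)"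
    by (simp add: sum_CN)
  also have "\<dots> = (\<Sum>i\<in>I. \<Sum>j\<in>J. \<Sum>l<D i j. \<Sum>c<\<mu> i. X i c c * Z (i, j) l l)" by (rule sum.swap)
  also have "\<dots> = (\<Sum>i\<in>I. \<Sum>c<\<mu> i. X i c c * (\<Sum>j\<in>J. \<Sum>l<D i j. Z (i, j) l l))"
    by (simp flip: sum_distrib_left sum_distrib_right)
  also have "\<dots> = TM' (n * dg (\<lambda>i j. \<Sum>j\<in>J. \<Sum>l<D i j. Z (i, j) l l))"
    unfolding n dg_M' Mf'.bop_mult TM'_bop
    by (simp add: if_distrib[of "\<lambda>x. _ * x"] SN_def CM_def cong: if_cong)
  finally show "TM' (n * dg (\<lambda>i j. \<Sum>j\<in>J. \<Sum>l<D i j. Z (i, j) l l)) = TN' (n * em Z)" by simp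
qed auto

end

subsection \<open>The minimal expectation\<close>

lemma opnorm_bdd:
  "bdd_above {l2norm (A *\<^sub>v v) | v. v \<in> carrier_vec (dim_col A) \<and> l2norm v \<le> 1}"
proof (rule bdd_aboveI)
  fix t assume "t \<in> {l2norm (A *\<^sub>v v) | v. v \<in> carrier_vec (dim_col A) \<and> l2norm v \<le> 1}"
  then obtain v where v: "v \<in> carrier_vec (dim_col A)" "l2norm v \<le> 1" and t: "t = l2norm (A *\<^sub>v v)" by blast
  have vj: "norm (v $ j) \<le> 1" if "j < dim_col A" for j
    using member_le_L2_set[of "{..<dim_vec v}" j "\<lambda>i. norm (v $ i)"] v that
    by (auto simp: l2norm_def)
  have "t \<le> (\<Sum>i<dim_vec (A *\<^sub>v v). norm ((A *\<^sub>v v) $ i))"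
    unfolding t l2norm_def by (rule L2_set_le_sum) auto
  also have "\<dots> = (\<Sum>i<dim_row A. norm ((A *\<^sub>v v) $ i))" by simp
  also have "\<dots> \<le> (\<Sum>i<dim_row A. \<Sum>j<dim_col A. norm (A $$ (i,j)))"
  proof (rule sum_mono)
    fix i assume i: "i \<in> {..<dim_row A}"
    have "norm ((A *\<^sub>v v) $ i) \<le> (\<Sum>j<dim_col A. norm (A $$ (i,j) * v $ j))"
      using i v by (simp add: scalar_prod_def lessThan_atLeast0 norm_sum)
    also have "\<dots> \<le> (\<Sum>j<dim_col A. norm (A $$ (i,j)))"
      by (rule sum_mono) (auto simp: norm_mult intro!: mult_left_le vj)
    finally show "norm ((A *\<^sub>v v) $ i) \<le> (\<Sum>j<dim_col A. norm (A $$ (i,j)))" .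
  qed
  finally show "t \<le> (\<Sum>i<dim_row A. \<Sum>j<dim_col A. norm (A $$ (i,j)))" .
qed

lemma opnorm_ge: "v \<in> carrier_vec (dim_col A) \<Longrightarrow> l2norm v \<le> 1 \<Longrightarrow> l2norm (A *\<^sub>v v) \<le> opnorm A"
  unfolding opnorm_def by (rule cSup_upper[OF _ opnorm_bdd]) blast

lemma opnorm_le:
  assumes "\<And>v. v \<in> carrier_vec (dim_col A) \<Longrightarrow> l2norm v \<le> 1 \<Longrightarrow> l2norm (A *\<^sub>v v) \<le> c"
  shows "opnorm A \<le> c"
  unfolding opnorm_def
proof (rule cSup_least)
  have "0\<^sub>v (dim_col A) \<in> carrier_vec (dim_col A) \<and> l2norm (0\<^sub>v (dim_col A) :: 'a vec) \<le> 1"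
    by (simp add: l2norm_def L2_set_def)
  then show "{l2norm (A *\<^sub>v v) |v. v \<in> carrier_vec (dim_col A) \<and> l2norm v \<le> 1} \<noteq> {}" by blast
qed (use assms in auto)

lemma l2norm_smult: "l2norm (c \<cdot>\<^sub>v v) = norm c * l2norm v"
  unfolding l2norm_def by (subst L2_set_right_distrib) (auto simp: norm_mult intro!: L2_set_cong)

lemma l2norm_cscalar:
  "v \<in> carrier_vec n \<Longrightarrow> (l2norm v)\<^sup>2 = Re (v \<bullet>c v)" for v :: "complex vec"
proof -
  assume "v \<in> carrier_vec n"
  then have "v \<bullet>c v = (\<Sum>i<n. v $ i * cnj (v $ i))" and "dim_vec v = n" by (auto intro: cscalar_sum)
  then show ?thesis
    by (simp add: l2norm_def L2_set_def sum_nonneg cmod_power2 flip: complex_norm_square power2_eq_square)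
qed

lemma l2norm_nonneg [simp]: "0 \<le> l2norm v" by (simp add: l2norm_def)

lemma (in tracial_alg) posd_pos: "posd h \<Longrightarrow> x \<in> A \<Longrightarrow> 0 \<le> T (h * (mat_adjoint x * x))"
  and posd_faithful: "posd h \<Longrightarrow> x \<in> A \<Longrightarrow> T (h * (mat_adjoint x * x)) = 0 \<Longrightarrow> x = 0\<^sub>m k k"
  by (simp_all add: posd_def)

context incl
begin

lemma opnorm_dg_ge:
  assumes i: "i \<in> I"
  shows "cmod (f i) \<le> opnorm (dg (\<lambda>i j. f i))"
proof -
  obtain j where j: "j \<in> J" "0 < D i j" using row_ex[OF i] by blast
  \<comment> \<open>The first path through block \<open>i\<close> gives a unit eigenvector with
    eigenvalue \<open>f i\<close>.\<close>
  let ?p = "(i, j, 0, 0, 0) :: path"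
  have p: "?p \<in> P" using i j by (auto simp: paths_def)
  have e: "dg (\<lambda>i j. f i) *\<^sub>v \<xi> ?p = f i \<cdot>\<^sub>v \<xi> ?p"
  proof -
    have "dg (\<lambda>i j. f i) *\<^sub>v \<xi> ?p = vop (\<lambda>p. if p = ?p then f i else 0)"
      unfolding dg_def opr_mult_xi[OF p] by (rule vop_cong) (auto simp: path_defs)
    also have "\<dots> = f i \<cdot>\<^sub>v \<xi> ?p"
      using p by (intro eq_vecI) (auto simp: vop_def if_distrib[of "\<lambda>x. x * _"] cong: if_cong)
    finally show ?thesis .
  qed
  have "(l2norm (\<xi> ?p))\<^sup>2 = 1" using p by (subst l2norm_cscalar[of _ k]) (auto simp: ortho)
  then have 1: "l2norm (\<xi> ?p) = 1" by (simp add: power2_eq_1_iff) (use l2norm_nonneg in \<open>smt (verit)\<close>)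
  have "l2norm (dg (\<lambda>i j. f i) *\<^sub>v \<xi> ?p) \<le> opnorm (dg (\<lambda>i j. f i))"
    using p 1 by (intro opnorm_ge) (auto simp: dg_def)
  then show ?thesis unfolding e l2norm_smult 1 by simp
qed

lemma l2norm_one_le: "v \<in> carrier_vec k \<Longrightarrow> l2norm (one *\<^sub>v v) \<le> l2norm v"
proof -
  assume v: "v \<in> carrier_vec k"
  let ?o = "one *\<^sub>v v"
  have o: "?o \<in> carrier_vec k" using v by (intro mult_mat_vec_carrier[of _ k k]) auto
  have oo: "?o \<bullet>c ?o = ?o \<bullet>c v"
  proof -
    have "?o \<bullet>c ?o = v \<bullet>c (one *\<^sub>v ?o)" using v o by (subst cscalar_mult_mat_vec[of one k k]) auto
    also have "one *\<^sub>v ?o = ?o" using v by (simp flip: assoc_mult_mat_vec[of one k k one k v])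
    also have "v \<bullet>c ?o = ?o \<bullet>c v" using v o by (subst cscalar_mult_mat_vec[of one k k]) auto
    finally show ?thesis .
  qed
  have sub: "(a - b) \<bullet>c w = a \<bullet>c w - b \<bullet>c w" if "a \<in> carrier_vec k" "b \<in> carrier_vec k" "w \<in> carrier_vec k"
    for a b w :: "complex vec"
    using that by (intro minus_scalar_prod_distrib[of _ k]) auto
  have sub': "w \<bullet>c (a - b) = w \<bullet>c a - w \<bullet>c b" if "a \<in> carrier_vec k" "b \<in> carrier_vec k" "w \<in> carrier_vec k"
    for a b w :: "complex vec"
    using cscalar_commute[of "a - b" k w] cscalar_commute[of a k w] cscalar_commute[of b k w] that sub
    by (metis complex_cnj_diff minus_carrier_vec)
  have vo: "v \<bullet>c ?o = ?o \<bullet>c v" using v o by (subst cscalar_mult_mat_vec[of one k k]) auto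
  have "0 \<le> (v - ?o) \<bullet>c (v - ?o)" by (rule conjugate_square_ge_0_vec)
  also have "\<dots> = v \<bullet>c v - ?o \<bullet>c ?o"
    using v o vo oo by (simp add: sub sub')
  finally have "Re (?o \<bullet>c ?o) \<le> Re (v \<bullet>c v)" by (simp add: less_eq_complex_def)
  then have "(l2norm ?o)\<^sup>2 \<le> (l2norm v)\<^sup>2" using v o by (simp add: l2norm_cscalar[of _ k])
  then show ?thesis by (rule power2_le_imp_le) simp
qed

lemma opnorm_dg_const:
  assumes "I \<noteq> {}"
  shows "opnorm (dg (\<lambda>i j. c)) = cmod c"
proof (rule antisym)
  obtain i where "i \<in> I" using assms by blast
  then show "cmod c \<le> opnorm (dg (\<lambda>i j. c))" using opnorm_dg_ge[of i "\<lambda>_. c"] by simp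
  show "opnorm (dg (\<lambda>i j. c)) \<le> cmod c"
  proof (rule opnorm_le)
    fix v :: "complex vec" assume v: "v \<in> carrier_vec (dim_col (dg (\<lambda>i j. c)))" and v1: "l2norm v \<le> 1"
    have vk: "v \<in> carrier_vec k" using v by (simp add: dg_def)
    have "dg (\<lambda>i j. c) = c \<cdot>\<^sub>m one" by (simp add: dg_one[symmetric] dg_smult)
    then have "dg (\<lambda>i j. c) *\<^sub>v v = c \<cdot>\<^sub>v (one *\<^sub>v v)" using vk by (simp add: smult_mat_vec[of _ k k])
    then have "l2norm (dg (\<lambda>i j. c) *\<^sub>v v) = cmod c * l2norm (one *\<^sub>v v)" by (simp add: l2norm_smult)
    also have "\<dots> \<le> cmod c * 1" using l2norm_one_le[OF vk] v1 by (intro mult_left_mono) auto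
    finally show "l2norm (dg (\<lambda>i j. c) *\<^sub>v v) \<le> cmod c" by simp
  qed
qed

definition pos_on :: "(nat \<Rightarrow> nat \<Rightarrow> real) \<Rightarrow> bool" where
  "pos_on f \<longleftrightarrow> (\<forall>i\<in>I. \<forall>j\<in>J. 0 < D i j \<longrightarrow> 0 < f i j)"

lemma pos_on_nz: "pos_on f \<Longrightarrow> i \<in> I \<Longrightarrow> j \<in> J \<Longrightarrow> 0 < D i j \<Longrightarrow> f i j \<noteq> 0"
  unfolding pos_on_def by (metis less_irrefl)

abbreviation "rdg f \<equiv> dg (\<lambda>i j. complex_of_real (f i j))"

text \<open>The relative commutant together with its own commutant is a third dual pair. Its trace
  \<open>TR\<close> makes densities on \<open>R\<close> comparable and supplies the positivity
  behind the index bound.\<close>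

sublocale Rdp: dual_pair k one R TR "balg Ri Rc Rs" Rf.btr' Rf.bexp Rf.bexp'
  unfolding R_alg by (rule Rf.dual_pair)

lemma rdg_hpos: "pos_on f \<Longrightarrow> v \<in> hilb one \<Longrightarrow> 0 \<le> (rdg f *\<^sub>v v) \<bullet>c v"
proof -
  assume f: "pos_on f" and v: "v \<in> hilb one"
  then obtain g where g: "v = vop g" by (auto simp: hilb_one_iff)
  have "(rdg f *\<^sub>v v) \<bullet>c v = (\<Sum>p\<in>P. complex_of_real (f (Mi p) (Ni p) * (cmod (g p))\<^sup>2))"
    unfolding g dg_def opr_mult_vop vop_inner_vop
    by (rule sum.cong) (auto simp: if_distrib[of "\<lambda>x. x * _"] complex_norm_square mult.assoc simp del: of_real_power cong: if_cong)
  also have "0 \<le> \<dots>"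
  proof (rule sum_nonneg)
    fix p assume "p \<in> P"
    then have "0 < f (Mi p) (Ni p)" using f by (auto simp: pos_on_def paths_def path_defs)
    then show "0 \<le> complex_of_real (f (Mi p) (Ni p) * (cmod (g p))\<^sup>2)"
      by (simp add: less_eq_complex_def)
  qed
  finally show ?thesis .
qed

lemma rdg_inverse: "pos_on f \<Longrightarrow> rdg (\<lambda>i j. 1 / f i j) * rdg f = one"
  unfolding dg_mult dg_one[symmetric] by (rule dg_cong) (simp add: pos_on_nz)

lemma rdg_inverse': "pos_on f \<Longrightarrow> rdg f * rdg (\<lambda>i j. 1 / f i j) = one"
  unfolding dg_mult dg_one[symmetric] by (rule dg_cong) (simp add: pos_on_nz)

lemma posd_rdg:
  assumes f: "pos_on f"
  shows "M.A.posd (rdg f)" and "N.B.posd (rdg f)" and "Rdp.A.posd (rdg f)"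
    and "rdg f \<in> N \<Longrightarrow> N.A.posd (rdg f)"
proof -
  show "M.A.posd (rdg f)" using rdg_hpos[OF f] rdg_inverse[OF f]
    by (intro M.hpos_posd) (auto simp: M.hpos_def)
  show "N.B.posd (rdg f)" using rdg_hpos[OF f] rdg_inverse[OF f]
    by (intro sw.M.hpos_posd) (auto simp: sw.M.hpos_def)
  show "Rdp.A.posd (rdg f)" using rdg_hpos[OF f] rdg_inverse[OF f]
    by (intro Rdp.hpos_posd) (auto simp: Rdp.hpos_def)
  show "N.A.posd (rdg f)" if "rdg f \<in> N" using rdg_hpos[OF f] rdg_inverse[OF f] that
    by (intro N.hpos_posd) (auto simp: N.hpos_def)
qed

lemma posd_R: "\<kappa> \<in> R \<Longrightarrow> M.A.posd \<kappa> \<Longrightarrow> Rdp.A.posd \<kappa>"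
proof -
  assume k: "\<kappa> \<in> R" "M.A.posd \<kappa>"
  obtain g where "M.A.posd g" "g * \<kappa> = one" using M.posd_inverse[OF k(2)] by blast
  then show ?thesis using M.posd_hpos[OF k(2)] k(1)
    by (intro Rdp.hpos_posd[of _ g]) (auto simp: M.A.posd_def Rdp.hpos_def M.hpos_def)
qed

lemma Ind_Ew:
  assumes \<kappa>: "\<kappa> \<in> R" "M.A.posd \<kappa>" and L: "N.B.posd (em L)" "em L * \<kappa> = one" "\<kappa> * em L = one"
  shows "Ind one M N (Ew \<kappa>) = dg (\<lambda>i j. \<Sum>j\<in>J. \<Sum>l<D i j. L (i, j) l l)"
proof -
  have "Ind one M N (Ew \<kappa>) = sw.Ew (em L) one"
    unfolding Ind_def using kosaki_inverse_Ew[OF \<kappa> em_R L] by (simp add: Fw_def)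
  also have "\<dots> = sw.Ecan (em L)" by (simp add: sw.Ew_def R_N' N.B.u_right)
  finally show ?thesis by (simp add: Fcan_em)
qed

lemma Ew_one: "Ew (em K) one = dg (\<lambda>i j. \<Sum>i\<in>I. \<Sum>l<D i j. K (i, j) l l)"
  by (simp add: Ew_def Ecan_em)

text \<open>Unitality of the expectation is a trace condition on each column of its density
  \<open>em K\<close>, while the index reads the row traces of the inverse density
  \<open>em L\<close>. Minimizing the index thus becomes a problem about a positive block matrix and
  its inverse.\<close>

lemma cond_expsE:
  assumes "E \<in> cond_exps one M N"
  obtains K L where "E = Ew (em K)" "M.A.posd (em K)" "M.A.posd (em L)" "N.B.posd (em L)"
    "em L * em K = one" "em K * em L = one"
    "\<And>j. j \<in> J \<Longrightarrow> (\<Sum>i\<in>I. \<Sum>l<D i j. K (i, j) l l) = 1"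
    "Ind one M N E = dg (\<lambda>i j. \<Sum>j\<in>J. \<Sum>l<D i j. L (i, j) l l)"
proof -
  have E: "op_valued_weight M N E" "E one = one" using assms by (auto simp: cond_exps_def)
  obtain \<kappa> where \<kappa>: "\<kappa> \<in> R" "M.A.posd \<kappa>" "E = Ew \<kappa>" using weight_Ew[OF E(1)] by blast
  obtain \<zeta> where \<zeta>: "\<zeta> \<in> R" "N.B.posd \<zeta>" "M.A.posd \<zeta>" "\<zeta> * \<kappa> = one" "\<kappa> * \<zeta> = one"
    using inverse_R[OF \<kappa>(1,2)] by blast
  obtain K where K: "\<kappa> = em K" using RE[OF \<kappa>(1)] by blast
  obtain L where L: "\<zeta> = em L" using RE[OF \<zeta>(1)] by blast
  have "dg (\<lambda>i j. \<Sum>i\<in>I. \<Sum>l<D i j. K (i, j) l l) = dg (\<lambda>i j. 1)"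
    using E(2) \<kappa>(3) K Ew_one dg_one by simp
  then have "(\<Sum>i\<in>I. \<Sum>l<D i j. K (i, j) l l) = 1" if "j \<in> J" for j
    using col_ex[OF that] that dg_eqD[of "\<lambda>i j. \<Sum>i\<in>I. \<Sum>l<D i j. K (i, j) l l" "\<lambda>i j. 1" _ j] by blast
  moreover have "Ind one M N E = dg (\<lambda>i j. \<Sum>j\<in>J. \<Sum>l<D i j. L (i, j) l l)"
    using Ind_Ew[OF \<kappa>(1,2)] \<zeta> unfolding \<kappa>(3) L by blast
  ultimately show ?thesis using that \<kappa> \<zeta> unfolding K L by blast
qed

lemma cond_exps_rdg:
  assumes f: "pos_on f" and 1: "\<And>j. j \<in> J \<Longrightarrow> (\<Sum>i\<in>I. real (D i j) * f i j) = 1"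
  shows "Ew (rdg f) \<in> cond_exps one M N"
    and "Ind one M N (Ew (rdg f)) = dg (\<lambda>i j. complex_of_real (\<Sum>j\<in>J. real (D i j) / f i j))"
    and "kosaki_inverse one M N (Ew (rdg f)) = sw.Ew (rdg (\<lambda>i j. 1 / f i j))"
proof -
  have "Ew (rdg f) one = dg (\<lambda>i j. \<Sum>i\<in>I. \<Sum>l<D i j.
      (\<lambda>(i, j) l l'. if l = l' then complex_of_real (f i j) else 0) (i, j) l l)"
    unfolding dg_em[of "\<lambda>i j. complex_of_real (f i j)"] by (rule Ew_one)
  also have "\<dots> = dg (\<lambda>i j. \<Sum>i\<in>I. \<Sum>l<D i j. complex_of_real (f i j))"
    by (rule dg_cong) simp
  also have "\<dots> = dg (\<lambda>i j. 1)"
  proof (rule dg_cong)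
    fix j assume "j \<in> J"
    have "(\<Sum>i\<in>I. \<Sum>l<D i j. complex_of_real (f i j)) = complex_of_real (\<Sum>i\<in>I. real (D i j) * f i j)" by simp
    then show "(\<Sum>i\<in>I. \<Sum>l<D i j. complex_of_real (f i j)) = 1" using 1[OF \<open>j \<in> J\<close>] by simp
  qed
  finally show "Ew (rdg f) \<in> cond_exps one M N"
    using Ew_weight[OF dg_R posd_rdg(1)[OF f]] by (simp add: cond_exps_def dg_one)
  have f': "pos_on (\<lambda>i j. 1 / f i j)" using f by (auto simp: pos_on_def)
  have "Ind one M N (Ew (rdg f)) = dg (\<lambda>i j. \<Sum>j\<in>J. \<Sum>l<D i j.
      (\<lambda>(i, j) l l'. if l = l' then complex_of_real (1 / f i j) else 0) (i, j) l l)"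
    by (rule Ind_Ew) (use f posd_rdg[OF f] posd_rdg[OF f'] rdg_inverse[OF f] rdg_inverse'[OF f] in \<open>auto simp flip: dg_em\<close>)
  also have "\<dots> = dg (\<lambda>i j. complex_of_real (\<Sum>j\<in>J. real (D i j) / f i j))"
    by (rule dg_cong) simp
  finally show "Ind one M N (Ew (rdg f)) = dg (\<lambda>i j. complex_of_real (\<Sum>j\<in>J. real (D i j) / f i j))" .
  show "kosaki_inverse one M N (Ew (rdg f)) = sw.Ew (rdg (\<lambda>i j. 1 / f i j))"
    using kosaki_inverse_Ew[OF dg_R posd_rdg(1)[OF f] dg_R posd_rdg(2)[OF f'] rdg_inverse[OF f] rdg_inverse'[OF f]]
    by (simp add: Fw_def)
qed

end

text \<open>The Perron-Frobenius vectors are parameters. For connected inclusions their existence is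
  proved separately; with one row and one column the constant \<open>1\<close> serves for both
  vectors, and \<open>d\<close> is the only entry of \<open>D\<close>.\<close>

locale pf_incl = incl k I J D \<beta> \<mu> \<xi> for k I J D \<beta> \<mu> \<xi> +
  fixes x y :: "nat \<Rightarrow> real" and d :: real
  assumes x_pos: "i \<in> I \<Longrightarrow> 0 < x i" and y_pos: "j \<in> J \<Longrightarrow> 0 < y j" and d_pos: "0 < d"
    and Dy: "i \<in> I \<Longrightarrow> (\<Sum>j\<in>J. real (D i j) * y j) = d * x i"
    and Dx: "j \<in> J \<Longrightarrow> (\<Sum>i\<in>I. real (D i j) * x i) = d * y j"
    and x_norm: "(\<Sum>i\<in>I. (x i)\<^sup>2) = 1"
begin

lemma xDy: "(\<Sum>i\<in>I. \<Sum>j\<in>J. real (D i j) * (x i * y j)) = d"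
proof -
  have "(\<Sum>i\<in>I. \<Sum>j\<in>J. real (D i j) * (x i * y j)) = (\<Sum>i\<in>I. x i * (\<Sum>j\<in>J. real (D i j) * y j))"
    by (simp add: sum_distrib_left ac_simps)
  also have "\<dots> = (\<Sum>i\<in>I. d * (x i)\<^sup>2)" by (rule sum.cong) (auto simp: Dy power2_eq_square)
  finally show ?thesis using x_norm by (simp flip: sum_distrib_left)
qed

lemma y_norm: "(\<Sum>j\<in>J. (y j)\<^sup>2) = 1"
proof -
  have "d = (\<Sum>j\<in>J. y j * (\<Sum>i\<in>I. real (D i j) * x i))"
    unfolding xDy[symmetric] by (subst sum.swap) (simp add: sum_distrib_left mult.left_commute mult.commute)
  also have "\<dots> = (\<Sum>j\<in>J. d * (y j)\<^sup>2)" by (rule sum.cong) (auto simp: Dx power2_eq_square)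
  finally show ?thesis using d_pos by (simp flip: sum_distrib_left)
qed

lemma I_ne: "I \<noteq> {}" using x_norm by auto

text \<open>The equality case of the index bound: the solution of
  \<open>x i = d * y j * \<kappa>0 i j\<close>. The eigenvector equation in column \<open>j\<close>
  is exactly its unitality.\<close>

definition "\<kappa>0 = (\<lambda>i j. x i / (d * y j))"
definition "E0 = Ew (rdg \<kappa>0)"

lemma \<kappa>0_pos: "pos_on \<kappa>0" using x_pos y_pos d_pos by (auto simp: pos_on_def \<kappa>0_def)

lemma \<kappa>0_sum: "j \<in> J \<Longrightarrow> (\<Sum>i\<in>I. real (D i j) * \<kappa>0 i j) = 1"
proof -
  assume j: "j \<in> J"
  have "(\<Sum>i\<in>I. real (D i j) * \<kappa>0 i j) = (\<Sum>i\<in>I. real (D i j) * x i) / (d * y j)"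
    by (simp add: \<kappa>0_def sum_divide_distrib)
  then show ?thesis using Dx[OF j] y_pos[OF j] d_pos by simp
qed

lemma E0_cond: "E0 \<in> cond_exps one M N" unfolding E0_def by (rule cond_exps_rdg(1)[OF \<kappa>0_pos \<kappa>0_sum])

lemma Ind_E0: "Ind one M N E0 = dg (\<lambda>i j. complex_of_real (d\<^sup>2))"
proof -
  have "Ind one M N E0 = dg (\<lambda>i j. complex_of_real (\<Sum>j\<in>J. real (D i j) / \<kappa>0 i j))"
    unfolding E0_def by (rule cond_exps_rdg(2)[OF \<kappa>0_pos \<kappa>0_sum])
  also have "\<dots> = dg (\<lambda>i j. complex_of_real (d\<^sup>2))"
  proof (rule dg_cong)
  fix i assume i: "i \<in> I"
  have "(\<Sum>j\<in>J. real (D i j) / \<kappa>0 i j) = (\<Sum>j\<in>J. real (D i j) * y j) * (d / x i)"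
    by (simp add: \<kappa>0_def sum_distrib_left sum_distrib_right sum_divide_distrib ac_simps)
  also have "\<dots> = d\<^sup>2" using Dy[OF i] x_pos[OF i] by (simp add: power2_eq_square)
  finally show "complex_of_real (\<Sum>j\<in>J. real (D i j) / \<kappa>0 i j) = complex_of_real (d\<^sup>2)" by simp
  qed
  finally show ?thesis .
qed

lemma opnorm_E0: "opnorm (Ind one M N E0) = d\<^sup>2"
  unfolding Ind_E0 opnorm_dg_const[OF I_ne] by (simp add: norm_power)

text \<open>
  Since \<open>em L\<close> is the inverse of the density \<open>em K\<close>, the left side is nonnegative, which bounds the
  index from below; it vanishes only if \<open>em K\<close> is the density of \<open>E0\<close>.
\<close>

lemma square_expansion:
  assumes K: "em K \<in> R" and L: "em L * em K = one"
  defines "w \<equiv> rdg (\<lambda>i j. x i) + (-1) \<cdot>\<^sub>m (rdg (\<lambda>i j. d * y j) * em K)"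
  assumes K1: "\<And>j. j \<in> J \<Longrightarrow> (\<Sum>i\<in>I. \<Sum>l<D i j. K (i, j) l l) = 1"
  shows "TR (em L * (w * w)) = (\<Sum>i\<in>I. complex_of_real ((x i)\<^sup>2) * (\<Sum>j\<in>J. \<Sum>l<D i j. L (i, j) l l)) - complex_of_real (d\<^sup>2)"
proof -
  define X where "X = rdg (\<lambda>i j. x i)"
  define Y where "Y = rdg (\<lambda>i j. d * y j)"
  have XYR [simp]: "X \<in> R" "Y \<in> R" by (auto simp: X_def Y_def)
  have [simp]: "X \<in> carrier_mat k k" "Y \<in> carrier_mat k k" by (auto simp: X_def Y_def)
  have w_eq: "w = X + (-1) \<cdot>\<^sub>m (Y * em K)" by (simp only: w_def X_def Y_def)
  have [simp]: "em K \<in> carrier_mat k k" "em L \<in> carrier_mat k k" by (auto simp: bop_def)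
  have YK [simp]: "Y * em K \<in> R" by simp
  have wR: "w \<in> R" unfolding w_eq by simp
  have wc [simp]: "w \<in> carrier_mat k k" using wR by simp
  have LY: "em L * (Y * em K) = Y"
  proof -
    have "em L * (Y * em K) = (em L * Y) * em K" by (simp add: mult_assoc_sq[of _ k])
    also have "em L * Y = Y * em L" by (simp only: X_def Y_def dg_em_mult em_dg_mult)
    also have "Y * em L * em K = Y * (em L * em K)" by (rule mult_assoc_sq[of _ k]) auto
    finally show ?thesis using L by (simp add: Rdp.A.u_right)
  qed
  have LX: "em L * X = X * em L" by (simp only: X_def Y_def dg_em_mult em_dg_mult)
  have Lw: "em L * w = X * em L + (-1) \<cdot>\<^sub>m Y"
    unfolding w_eq
    by (subst mult_add_distrib_mat[of _ k k _ k]) (auto simp: mult_smult_distrib[of _ k k _ k] LY LX)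
  have "em L * (w * w) = (em L * w) * w" by (simp add: mult_assoc_sq[of _ k])
  also have "\<dots> = (X * em L + (-1) \<cdot>\<^sub>m Y) * w" unfolding Lw ..
  also have "\<dots> = X * (em L * w) + (-1) \<cdot>\<^sub>m (Y * w)"
    by (subst add_mult_distrib_mat[of _ k k _ _ k])
      (auto simp: mult_smult_assoc_mat[of _ k k _ k] mult_assoc_sq[of _ k])
  also have "\<dots> = (X * (X * em L) + (-1) \<cdot>\<^sub>m (X * Y)) + (-1) \<cdot>\<^sub>m (Y * X + (-1) \<cdot>\<^sub>m (Y * (Y * em K)))"
    unfolding Lw unfolding w_eq
    by (simp add: mult_add_distrib_mat[of _ k k _ k] mult_smult_distrib[of _ k k _ k])
  \<comment> \<open>The first term is the index averaged with the weights
    \<open>(x i)\<^sup>2\<close>. Each cross term is \<open>d\<^sup>2\<close>, and so is the last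
    one, by unitality and the normalization of \<open>y\<close>.\<close>
  finally have "TR (em L * (w * w)) = TR (X * (X * em L)) - TR (X * Y) - TR (Y * X) + TR (Y * (Y * em K))"
    by (simp add: algebra_simps)
  also have "TR (X * (X * em L)) = (\<Sum>i\<in>I. \<Sum>j\<in>J. \<Sum>l<D i j. complex_of_real ((x i)\<^sup>2) * L (i, j) l l)"
    unfolding X_def Y_def dg_em_mult TR_em sum_IR[symmetric] by (intro sum.cong refl) (auto simp: power2_eq_square ac_simps)
  also have "\<dots> = (\<Sum>i\<in>I. complex_of_real ((x i)\<^sup>2) * (\<Sum>j\<in>J. \<Sum>l<D i j. L (i, j) l l))"
    by (simp add: sum_distrib_left)
  also have "TR (X * Y) = complex_of_real (d\<^sup>2)"
  proof -
    have "TR (X * Y) = complex_of_real (\<Sum>i\<in>I. \<Sum>j\<in>J. d * (real (D i j) * (x i * y j)))"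
      unfolding X_def Y_def dg_mult TR_dg by (simp add: ac_simps)
    then show ?thesis using xDy by (simp add: power2_eq_square flip: sum_distrib_left of_real_sum of_real_mult)
  qed
  also have "TR (Y * X) = complex_of_real (d\<^sup>2)"
    using \<open>TR (X * Y) = complex_of_real (d\<^sup>2)\<close> by (simp add: X_def Y_def dg_mult mult.commute)
  also have "TR (Y * (Y * em K)) = (\<Sum>i\<in>I. \<Sum>j\<in>J. \<Sum>l<D i j. complex_of_real ((d * y j)\<^sup>2) * K (i, j) l l)"
    unfolding X_def Y_def dg_em_mult TR_em sum_IR[symmetric] by (intro sum.cong refl) (auto simp: power2_eq_square ac_simps)
  also have "\<dots> = (\<Sum>j\<in>J. complex_of_real ((d * y j)\<^sup>2) * (\<Sum>i\<in>I. \<Sum>l<D i j. K (i, j) l l))"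
    by (subst sum.swap) (simp add: sum_distrib_left)
  also have "\<dots> = complex_of_real (d\<^sup>2 * (\<Sum>j\<in>J. (y j)\<^sup>2))"
    by (simp add: K1 power_mult_distrib sum_distrib_left)
  finally show ?thesis by (simp add: y_norm)
qed

text \<open>The squares of \<open>x\<close> sum to one, so the average of the row values
  \<open>c i\<close> of the index is at most its norm; by the square expansion it is at least
  \<open>d\<^sup>2\<close>. If the norm is at most \<open>d\<^sup>2\<close>, the expansion vanishes
  and faithfulness gives \<open>w = 0\<close>.\<close>

lemma index_bound:
  assumes E: "E \<in> cond_exps one M N"
  shows "d\<^sup>2 \<le> opnorm (Ind one M N E)" and "opnorm (Ind one M N E) \<le> d\<^sup>2 \<Longrightarrow> E = E0"
proof -
  obtain K L where EK: "E = Ew (em K)" and K: "M.A.posd (em K)" and L: "M.A.posd (em L)"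
    and LK: "em L * em K = one" and K1: "\<And>j. j \<in> J \<Longrightarrow> (\<Sum>i\<in>I. \<Sum>l<D i j. K (i, j) l l) = 1"
    and ind: "Ind one M N E = dg (\<lambda>i j. \<Sum>j\<in>J. \<Sum>l<D i j. L (i, j) l l)"
    using cond_expsE[OF E] by blast
  define c where "c i = (\<Sum>j\<in>J. \<Sum>l<D i j. L (i, j) l l)" for i
  define X where "X = rdg (\<lambda>i j. x i)"
  define Y where "Y = rdg (\<lambda>i j. d * y j)"
  have XYR [simp]: "X \<in> R" "Y \<in> R" by (auto simp: X_def Y_def)
  have [simp]: "X \<in> carrier_mat k k" "Y \<in> carrier_mat k k" by (auto simp: X_def Y_def)
  have XYadj: "mat_adjoint X = X" "mat_adjoint Y = Y" by (simp_all add: X_def Y_def dg_adjoint)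
  have YK: "em K * Y = Y * em K" by (simp only: Y_def dg_em_mult em_dg_mult)
  have [simp]: "em K \<in> carrier_mat k k" by (auto simp: bop_def)
  define w where "w = X + (-1) \<cdot>\<^sub>m (Y * em K)"
  have wR [simp]: "w \<in> R" by (simp add: w_def)
  have wadj: "mat_adjoint w = w"
  proof -
    have "mat_adjoint (em K) = em K" using M.hpos_adj[OF _ M.posd_hpos[OF K]] by simp
    then have "mat_adjoint (Y * em K) = Y * em K"
      by (simp add: mat_adjoint_mult[of _ k k _ k] XYadj YK)
    then show ?thesis unfolding w_def
      by (simp add: mat_adjoint_add[of _ k k] mat_adjoint_smult XYadj)
  qed
  have sq: "TR (em L * (w * w)) = (\<Sum>i\<in>I. complex_of_real ((x i)\<^sup>2) * c i) - complex_of_real (d\<^sup>2)"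
    unfolding w_def X_def Y_def c_def by (rule square_expansion[OF em_R LK K1])
  have LR: "Rdp.A.posd (em L)" using posd_R[OF em_R L] .
  have "0 \<le> TR (em L * (w * w))" using Rdp.A.posd_pos[OF LR wR] wadj by simp
  then have re: "d\<^sup>2 \<le> (\<Sum>i\<in>I. (x i)\<^sup>2 * Re (c i))" and im: "Im (TR (em L * (w * w))) = 0"
    unfolding sq by (auto simp: less_eq_complex_def)
  have up: "(\<Sum>i\<in>I. (x i)\<^sup>2 * Re (c i)) \<le> opnorm (Ind one M N E)"
  proof -
    have "(\<Sum>i\<in>I. (x i)\<^sup>2 * Re (c i)) \<le> (\<Sum>i\<in>I. (x i)\<^sup>2 * opnorm (Ind one M N E))"
    proof (intro sum_mono mult_left_mono)
      fix i assume "i \<in> I"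
      have "Re (c i) \<le> cmod (c i)" by (rule complex_Re_le_cmod)
      also have "\<dots> \<le> opnorm (Ind one M N E)"
        unfolding ind c_def[symmetric] by (rule opnorm_dg_ge[OF \<open>i \<in> I\<close>])
      finally show "Re (c i) \<le> opnorm (Ind one M N E)" .
    qed simp
    then show ?thesis using x_norm by (simp flip: sum_distrib_right)
  qed
  show "d\<^sup>2 \<le> opnorm (Ind one M N E)" using re up by simp
  assume "opnorm (Ind one M N E) \<le> d\<^sup>2"
  then have "Re (TR (em L * (w * w))) = 0" unfolding sq using re up by simp
  then have "TR (em L * (mat_adjoint w * w)) = 0" using im wadj by (simp add: complex_eq_iff)
  then have "w = 0\<^sub>m k k" by (rule Rdp.A.posd_faithful[OF LR wR])
  then have z: "X + (-1) \<cdot>\<^sub>m (Y * em K) = 0\<^sub>m k k" by (simp only: w_def)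
  have XY: "X = Y * em K" by (rule M.A.diff_zero[OF _ _ z]) simp_all
  \<comment> \<open>\<open>w = 0\<close> says \<open>X = Y * em K\<close>; the density is recovered
    by dividing by the invertible diagonal element \<open>Y\<close>.\<close>
  have "em K = dg (\<lambda>i j. complex_of_real (1 / (d * y j))) * (Y * em K)"
    unfolding Y_def dg_em_mult
  proof (rule Rf.bop_cong)
    fix ij l l' assume "ij \<in> IR"
    then obtain i j where ij: "ij = (i, j)" "j \<in> J" by (auto simp: IR_def)
    then show "K ij l l' = (case ij of (i, j) \<Rightarrow> \<lambda>l l'. complex_of_real (1 / (d * y j)) *
        (case (i, j) of (i, j) \<Rightarrow> \<lambda>l l'. complex_of_real (d * y j) * K (i, j) l l') l l') l l'"
      using y_pos[OF ij(2)] d_pos by simp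
  qed
  also have "\<dots> = rdg \<kappa>0" unfolding XY[symmetric] unfolding X_def dg_mult by (rule dg_cong) (simp add: \<kappa>0_def)
  finally show "E = E0" unfolding EK E0_def by simp
qed

lemma minimal_index: "minimal_index one M N = d\<^sup>2"
  unfolding minimal_index_def
proof (rule Least_equality)
  show "\<exists>E\<in>cond_exps one M N. d\<^sup>2 = opnorm (Ind one M N E)" using E0_cond opnorm_E0 by metis
qed (use index_bound(1) in auto)

lemma minimal_expectation: "minimal_expectation one M N = E0"
  unfolding minimal_expectation_def
proof (rule the_equality)
  show "E0 \<in> cond_exps one M N \<and> (\<forall>F\<in>cond_exps one M N. opnorm (Ind one M N E0) \<le> opnorm (Ind one M N F))"
    using E0_cond index_bound(1) opnorm_E0 by simp
  fix E assume E: "E \<in> cond_exps one M N \<and> (\<forall>F\<in>cond_exps one M N. opnorm (Ind one M N E) \<le> opnorm (Ind one M N F))"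
  then have "opnorm (Ind one M N E) \<le> d\<^sup>2" using E0_cond opnorm_E0 by metis
  then show "E = E0" using index_bound(2) E by blast
qed

end

subsection \<open>Traces and trace-preserving expectations\<close>

lemma extensional_eqI:
  "f \<in> extensional A \<Longrightarrow> g \<in> extensional A \<Longrightarrow> (\<And>x. x \<in> A \<Longrightarrow> f x = g x) \<Longrightarrow> f = g"
  by (rule extensionalityI)

context fac
begin

text \<open>Read in the two presentations, the kernel is diagonal in \<open>s\<close> with an entry
  that depends on the block only, so each block contributes a scalar.\<close>

lemma center_elem:
  assumes "x \<in> alg" "x \<in> balg ci cc cs"
  shows "\<exists>g. x = em (\<lambda>i s t. if s = t then g i else 0)"
proof -
  obtain X where X: "x = em X" using assms by (elim algE)
  obtain Y where Y: "x = bop ci cc cs Y" using assms by (auto simp: balg_def)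
  have kX: "ker x p q = (if ci p = ci q \<and> cc p = cc q then X (ci p) (cs p) (cs q) else 0)" if "p \<in> P" "q \<in> P" for p q
    unfolding X bop_def by (rule ker_opr[OF that])
  have kY: "ker x p q = (if ci p = ci q \<and> cs p = cs q then Y (ci p) (cc p) (cc q) else 0)" if "p \<in> P" "q \<in> P" for p q
    unfolding Y bop_def by (rule ker_opr[OF that])
  define c0 where "c0 i = (SOME c. c \<in> C i)" for i
  have c0: "c0 i \<in> C i" if "i \<in> I" for i using some_C[OF that] by (simp add: c0_def)
  have "x = em (\<lambda>i s t. if s = t then Y i (c0 i) (c0 i) else 0)"
    unfolding X
  proof (rule bop_cong)
    fix i s t assume i: "i \<in> I" "s \<in> S i" "t \<in> S i"
    note c = c0[OF i(1)]
    have "X i s t = ker x (mk i s (c0 i)) (mk i t (c0 i))" using i c by (subst kX) auto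
    also have "\<dots> = (if s = t then Y i (c0 i) (c0 i) else 0)" using i c by (subst kY) auto
    finally show "X i s t = (if s = t then Y i (c0 i) (c0 i) else 0)" .
  qed
  then show ?thesis by (intro exI[of _ "\<lambda>i. Y i (c0 i) (c0 i)"])
qed

end

text \<open>The size \<open>k\<close> is fixed in advance so that the empty sum is
  \<open>0\<^sub>m k k\<close>.\<close>

definition matsum :: "nat \<Rightarrow> ('v \<Rightarrow> complex mat) \<Rightarrow> 'v set \<Rightarrow> complex mat" where
  "matsum k f V = mat k k (\<lambda>rc. \<Sum>v\<in>V. f v $$ rc)"

lemma matsum_carrier [simp]: "matsum k f V \<in> carrier_mat k k" by (simp add: matsum_def)

lemma matsum_empty: "matsum k f {} = 0\<^sub>m k k" by (rule eq_matI) (auto simp: matsum_def)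

lemma matsum_insert:
  "finite V \<Longrightarrow> v \<notin> V \<Longrightarrow> f v \<in> carrier_mat k k \<Longrightarrow> matsum k f (insert v V) = f v + matsum k f V"
  by (rule eq_matI) (auto simp: matsum_def)

lemma matsum_cong: "(\<And>v. v \<in> V \<Longrightarrow> f v = g v) \<Longrightarrow> matsum k f V = matsum k g V"
  unfolding matsum_def by (intro cong_mat) auto

lemma matsum_adjoint:
  assumes "\<And>v. v \<in> V \<Longrightarrow> f v \<in> carrier_mat k k"
  shows "mat_adjoint (matsum k f V) = matsum k (\<lambda>v. mat_adjoint (f v)) V"
proof (rule eq_matI)
  fix i j assume "i < dim_row (matsum k (\<lambda>v. mat_adjoint (f v)) V)" "j < dim_col (matsum k (\<lambda>v. mat_adjoint (f v)) V)"
  then have ij: "i < k" "j < k" by (auto simp: matsum_def)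
  have "mat_adjoint (f v) $$ (i, j) = cnj (f v $$ (j, i))" if "v \<in> V" for v
    using assms[OF that] ij by (intro mat_adjoint_index) auto
  then show "mat_adjoint (matsum k f V) $$ (i, j) = matsum k (\<lambda>v. mat_adjoint (f v)) V $$ (i, j)"
    using ij by (subst mat_adjoint_index) (auto simp: matsum_def)
qed (auto simp: matsum_def)

lemma (in onb) matsum_opr: "matsum k (\<lambda>v. opr (K v)) V = opr (\<lambda>p q. \<Sum>v\<in>V. K v p q)"
proof (rule eq_matI)
  fix r c assume "r < dim_row (opr (\<lambda>p q. \<Sum>v\<in>V. K v p q))" "c < dim_col (opr (\<lambda>p q. \<Sum>v\<in>V. K v p q))"
  then have rc: "r < k" "c < k" by auto
  have "matsum k (\<lambda>v. opr (K v)) V $$ (r, c) = (\<Sum>v\<in>V. \<Sum>p\<in>P. \<Sum>q\<in>P. K v p q * \<xi> p $ r * cnj (\<xi> q $ c))"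
    using rc by (simp add: matsum_def opr_def)
  also have "\<dots> = (\<Sum>p\<in>P. \<Sum>v\<in>V. \<Sum>q\<in>P. K v p q * \<xi> p $ r * cnj (\<xi> q $ c))" by (rule sum.swap)
  also have "\<dots> = (\<Sum>p\<in>P. \<Sum>q\<in>P. \<Sum>v\<in>V. K v p q * \<xi> p $ r * cnj (\<xi> q $ c))"
    by (rule sum.cong[OF refl], rule sum.swap)
  also have "\<dots> = opr (\<lambda>p q. \<Sum>v\<in>V. K v p q) $$ (r, c)"
    using rc by (simp add: opr_def sum_distrib_right)
  finally show "matsum k (\<lambda>v. opr (K v)) V $$ (r, c) = opr (\<lambda>p q. \<Sum>v\<in>V. K v p q) $$ (r, c)" .
qed (auto simp: matsum_def)

lemma (in tracial_alg) matsum_in: "finite V \<Longrightarrow> (\<And>v. v \<in> V \<Longrightarrow> f v \<in> A) \<Longrightarrow> matsum k f V \<in> A"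
  by (induction V rule: finite_induct) (auto simp: matsum_empty matsum_insert)

lemma (in tracial_alg) linear_matsum:
  assumes lin: "linear_functional A \<phi>"
  shows "finite V \<Longrightarrow> (\<And>v. v \<in> V \<Longrightarrow> f v \<in> A) \<Longrightarrow> \<phi> (matsum k f V) = (\<Sum>v\<in>V. \<phi> (f v))"
proof (induction V rule: finite_induct)
  case empty
  have "0 \<cdot>\<^sub>m 0\<^sub>m k k = (0\<^sub>m k k :: complex mat)" by (rule eq_matI) auto
  then have "\<phi> (0\<^sub>m k k) = 0 * \<phi> (0\<^sub>m k k)"
    using lin zero_in unfolding linear_functional_def by metis
  then show ?case by (simp add: matsum_empty)
next
  case (insert v V)
  then have "\<phi> (f v + matsum k f V) = \<phi> (f v) + \<phi> (matsum k f V)"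
    using lin by (simp add: linear_functional_def matsum_in)
  then show ?case using insert by (simp add: matsum_insert)
qed

lemma matsum_left:
  assumes V: "finite V" "\<And>v. v \<in> V \<Longrightarrow> f v \<in> carrier_mat k k" and x: "x \<in> carrier_mat k k"
  shows "x * matsum k f V = matsum k (\<lambda>v. x * f v) V"
  using V
proof (induction V rule: finite_induct)
  case empty
  then show ?case using x by (simp add: matsum_empty right_mult_zero_mat[of _ k k])
next
  case (insert v V)
  then have "x * (f v + matsum k f V) = x * f v + x * matsum k f V"
    using x by (intro mult_add_distrib_mat[of _ k k]) auto
  then show ?case using insert x by (simp add: matsum_insert mult_car)
qed

context incl
begin

lemma TM_em: "TM (em Z) = (\<Sum>i\<in>I. \<Sum>j\<in>J. \<Sum>l<D i j. complex_of_nat (\<beta> j) * Z (i, j) l l)"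
  unfolding R_in_M Mf.btr_bop sum_SM by simp

lemma TM_dg_em: "TM (dg f * em Z) = TR (dg (\<lambda>i j. complex_of_nat (\<beta> j) * f i j) * em Z)"
  unfolding dg_em_mult TM_em TR_em sum_IR[symmetric] by (intro sum.cong refl) (auto simp: ac_simps)

text \<open>The size of the \<open>i\<close>-th block of \<open>M\<close>, that is the entry of
  \<alpha> at \<open>i\<close>, expressed through paths.\<close>

definition dimM :: "nat \<Rightarrow> nat" where "dimM i = (\<Sum>j\<in>J. D i j * \<beta> j)"

lemma dimM_pos: "i \<in> I \<Longrightarrow> 0 < dimM i"
proof -
  assume "i \<in> I"
  then obtain j where j: "j \<in> J" "0 < D i j" using row_ex by blast
  then have "0 < D i j * \<beta> j" by simp
  also have "\<dots> \<le> dimM i" unfolding dimM_def using j by (intro member_le_sum) auto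
  finally show ?thesis .
qed

lemma card_SM: "(\<Sum>s\<in>SM i. c) = of_nat (dimM i) * (c :: complex)"
  unfolding sum_SM dimM_def by (simp add: sum_distrib_right mult.assoc)

lemma TM_dg: "TM (dg (\<lambda>i j. f i)) = (\<Sum>i\<in>I. of_nat (dimM i) * f i)"
  unfolding dg_M Mf.btr_bop by (intro sum.cong refl) (simp only: simp_thms if_True card_SM)

text \<open>The density of a trace commutes with \<open>M\<close>, hence is a scalar on each block;
  positivity and faithfulness of these scalars are tested on the block projections.\<close>

lemma trace_density:
  assumes "faithful_normalized_trace one M \<tau>"
  obtains s where "\<And>i. i \<in> I \<Longrightarrow> 0 < s i" "(\<Sum>i\<in>I. real (dimM i) * s i) = 1"
    "\<And>x. x \<in> M \<Longrightarrow> \<tau> x = TM (rdg (\<lambda>i j. s i) * x)"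
proof -
  have fw: "faithful_weight M \<tau>" and t1: "\<tau> one = 1" and tr: "\<And>x y. x \<in> M \<Longrightarrow> y \<in> M \<Longrightarrow> \<tau> (x * y) = \<tau> (y * x)"
    using assms by (auto simp: faithful_normalized_trace_def faithful_state_def)
  obtain \<rho> where \<rho>: "M.A.posd \<rho>" "\<And>x. x \<in> M \<Longrightarrow> \<tau> x = TM (\<rho> * x)" using M.A.density[OF fw] by blast
  have \<rho>M [simp]: "\<rho> \<in> M" using \<rho> by (simp add: M.A.posd_def)
  have "x * \<rho> = \<rho> * x" if x: "x \<in> M" for x
  proof (rule M.A.T_eqI)
    fix y assume y: "y \<in> M"
    have "TM (y * (x * \<rho>)) = TM (\<rho> * (y * x))" using x y M.A.cyc[of \<rho> y x] by simp
    also have "\<dots> = TM (\<rho> * (x * y))" using tr[OF x y] x y by (simp flip: \<rho>(2))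
    also have "\<dots> = TM (y * (\<rho> * x))" using x y M.A.cyc[of y \<rho> x] by simp
    finally show "TM (y * (x * \<rho>)) = TM (y * (\<rho> * x))" .
  qed (use x in auto)
  then have "\<rho> \<in> commutant one M" unfolding commutant_def using M.A.in_ops[OF \<rho>M] by blast
  then have "\<rho> \<in> M'" using M.commA by simp
  then obtain g where g: "\<rho> = dg (\<lambda>i j. g i)" using Mf.center_elem[OF \<rho>M] dg_M by metis
  have gp: "0 \<le> g i \<and> g i \<noteq> 0" if i: "i \<in> I" for i
  proof -
    let ?e = "dg (\<lambda>i' j. if i' = i then 1 else 0)"
    have e: "mat_adjoint ?e * ?e = ?e" by (auto simp: dg_adjoint dg_mult intro: dg_cong)
    have "\<rho> * ?e = dg (\<lambda>i' j. if i' = i then g i' else 0)" unfolding g dg_mult by (rule dg_cong) auto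
    then have te: "TM (\<rho> * (mat_adjoint ?e * ?e)) = of_nat (dimM i) * g i"
      unfolding e using i by (simp add: TM_dg if_distrib[of "\<lambda>x. _ * x"] cong: if_cong)
    have eM: "?e \<in> M" by simp
    have "0 \<le> of_nat (dimM i) * g i" using M.A.posd_pos[OF \<rho>(1) eM] te by simp
    then have "0 \<le> g i" using dimM_pos[OF i] by (auto simp: less_eq_complex_def zero_le_mult_iff)
    moreover have "g i \<noteq> 0"
    proof
      assume "g i = 0"
      then have "?e = 0\<^sub>m k k" using M.A.posd_faithful[OF \<rho>(1) eM] te by simp
      also have "\<dots> = dg (\<lambda>i j. 0)" by (simp add: dg_def opr_zero cong: if_cong)
      finally show False using dg_eqD[of "\<lambda>i' j. if i' = i then 1 else 0" "\<lambda>i j. 0" i] row_ex[OF i] i by auto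
    qed
    ultimately show ?thesis by simp
  qed
  define s where "s i = Re (g i)" for i
  have gs: "g i = complex_of_real (s i)" if "i \<in> I" for i
    using gp[OF that] by (auto simp: s_def less_eq_complex_def complex_eq_iff)
  have \<rho>s: "\<rho> = rdg (\<lambda>i j. s i)" unfolding g by (rule dg_cong) (simp add: gs)
  have sp: "0 < s i" if "i \<in> I" for i
    using gp[OF that] by (auto simp: s_def less_eq_complex_def complex_eq_iff intro: order.not_eq_order_implies_strict)
  have "TM \<rho> = 1" using \<rho>(2)[OF M.A.u_in] t1 by simp
  then have "complex_of_real (\<Sum>i\<in>I. real (dimM i) * s i) = 1" unfolding \<rho>s TM_dg by simp
  then have "(\<Sum>i\<in>I. real (dimM i) * s i) = 1" using of_real_eq_1_iff by blast
  then show ?thesis using that sp \<rho>(2) unfolding \<rho>s by blast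
qed

text \<open>\<open>s i\<close> is the value of the trace on a minimal projection of block
  \<open>i\<close>.\<close>

definition tauS :: "(nat \<Rightarrow> real) \<Rightarrow> complex mat \<Rightarrow> complex" where
  "tauS s = (\<lambda>x\<in>M. TM (rdg (\<lambda>i j. s i) * x))"

lemma pos_on_I: "(\<And>i. i \<in> I \<Longrightarrow> 0 < s i) \<Longrightarrow> pos_on (\<lambda>i j. s i)"
  by (simp add: pos_on_def)

lemma rdg_comm: "x \<in> M \<Longrightarrow> dg (\<lambda>i j. f i) * x = x * dg (\<lambda>i j. f i)"
  using M.comm[of x "dg (\<lambda>i j. f i)"] by simp

lemma tauS_trace:
  assumes s: "\<And>i. i \<in> I \<Longrightarrow> 0 < s i" and 1: "(\<Sum>i\<in>I. real (dimM i) * s i) = 1"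
  shows "faithful_normalized_trace one M (tauS s)"
  unfolding faithful_normalized_trace_def faithful_state_def faithful_weight_def linear_functional_def
proof (intro conjI ballI allI impI)
  let ?S = "rdg (\<lambda>i j. s i)"
  have pos: "M.A.posd ?S" by (rule posd_rdg(1)[OF pos_on_I[OF s]])
  fix x assume x: "x \<in> M"
  show "0 \<le> tauS s (mat_adjoint x * x)" using M.A.posd_pos[OF pos x] x by (simp add: tauS_def)
  show "is_zero_mat x" if "tauS s (mat_adjoint x * x) = 0"
    using M.A.posd_faithful[OF pos x] x that by (simp add: tauS_def)
  show "tauS s (c \<cdot>\<^sub>m x) = c * tauS s x" for c
    using x by (simp add: tauS_def mult_smult_distrib[of _ k k _ k])
  fix y assume y: "y \<in> M"
  show "tauS s (x + y) = tauS s x + tauS s y"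
    using x y by (simp add: tauS_def mult_add_distrib_mat[of _ k k _ k])
  have "TM (?S * (x * y)) = TM (x * (y * ?S))" using x y by (intro M.A.cyc) auto
  also have "y * ?S = ?S * y" using y rdg_comm by simp
  also have "TM (x * (?S * y)) = TM (?S * (y * x))" using x y by (intro M.A.cyc) auto
  finally show "tauS s (x * y) = tauS s (y * x)" using x y by (simp add: tauS_def)
next
  have "TM (rdg (\<lambda>i j. s i)) = complex_of_real (\<Sum>i\<in>I. real (dimM i) * s i)" unfolding TM_dg by simp
  then show "tauS s one = 1" using 1 by (simp add: tauS_def M.A.u_right)
qed

text \<open>The values of the restriction of \<open>tauS s\<close> to \<open>N\<close> on minimal
  projections: restricting a trace applies the transpose of \<open>D\<close> to its weights.\<close>

definition tN :: "(nat \<Rightarrow> real) \<Rightarrow> nat \<Rightarrow> real" where "tN s j = (\<Sum>i\<in>I. real (D i j) * s i)"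

lemma tN_pos:
  assumes s: "\<And>i. i \<in> I \<Longrightarrow> 0 < s i" and j: "j \<in> J"
  shows "0 < tN s j"
proof -
  obtain i where i: "i \<in> I" "0 < D i j" using col_ex[OF j] by blast
  have "0 < real (D i j) * s i" using i s by simp
  also have "\<dots> \<le> tN s j" unfolding tN_def using i s by (intro member_le_sum) (auto simp: less_imp_le)
  finally show ?thesis .
qed

lemma tauS_N: "n \<in> N \<Longrightarrow> tauS s n = TN (rdg (\<lambda>i j. tN s j) * n)"
proof -
  assume n: "n \<in> N"
  have "Ecan (rdg (\<lambda>i j. s i)) = rdg (\<lambda>i j. tN s j)"
    unfolding dg_em[of "\<lambda>i j. complex_of_real (s i)"] Ecan_em by (rule dg_cong) (simp add: tN_def)
  then have "TN (n * rdg (\<lambda>i j. tN s j)) = TM (n * rdg (\<lambda>i j. s i))"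
    using n TN_Ecan[of "rdg (\<lambda>i j. s i)" n] by simp
  then show ?thesis using n M.A.tracial N.A.tracial by (simp add: tauS_def)
qed

text \<open>The density is forced by invariance: \<open>tauS s\<close> composed with
  \<open>Ew \<kappa>\<close> has density \<open>tN s j\<close> times \<open>\<kappa>\<close>, and
  this must be \<open>s i\<close>.\<close>

definition ES :: "(nat \<Rightarrow> real) \<Rightarrow> complex mat \<Rightarrow> complex mat" where
  "ES s = Ew (rdg (\<lambda>i j. s i / tN s j))"

lemma ES_pos: "(\<And>i. i \<in> I \<Longrightarrow> 0 < s i) \<Longrightarrow> pos_on (\<lambda>i j. s i / tN s j)"
  using tN_pos by (simp add: pos_on_def)

lemma ES_cond: assumes s: "\<And>i. i \<in> I \<Longrightarrow> 0 < s i" shows "ES s \<in> cond_exps one M N"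
  unfolding ES_def
proof (rule cond_exps_rdg(1)[OF ES_pos[OF s]])
  fix j assume j: "j \<in> J"
  have "(\<Sum>i\<in>I. real (D i j) * (s i / tN s j)) = (\<Sum>i\<in>I. real (D i j) * s i) / tN s j"
    by (simp add: sum_divide_distrib)
  also have "\<dots> = 1" using tN_pos[of s, OF s j] by (simp add: tN_def)
  finally show "(\<Sum>i\<in>I. real (D i j) * (s i / tN s j)) = 1" .
qed

lemma tauS_Ew: "\<kappa> \<in> R \<Longrightarrow> x \<in> M \<Longrightarrow> tauS s (Ew \<kappa> x) = TM ((rdg (\<lambda>i j. tN s j) * \<kappa>) * x)"
proof -
  assume k: "\<kappa> \<in> R" "x \<in> M"
  then have "Ew \<kappa> x \<in> N" by (simp add: Ew_def)
  then show ?thesis using k by (simp add: tauS_N T_Ew)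
qed

lemma trace_expectation_tauS:
  assumes s: "\<And>i. i \<in> I \<Longrightarrow> 0 < s i"
  shows "trace_expectation one M N (tauS s) = ES s" and "x \<in> M \<Longrightarrow> tauS s (ES s x) = tauS s x"
proof -
  let ?T = "rdg (\<lambda>i j. tN s j)" and ?S = "rdg (\<lambda>i j. s i)"
  have TS: "?T * rdg (\<lambda>i j. s i / tN s j) = ?S"
    unfolding dg_mult by (rule dg_cong) (use tN_pos[of s, OF s] in \<open>auto, metis less_irrefl\<close>)
  show pres: "tauS s (ES s x) = tauS s x" if "x \<in> M" for x
    unfolding ES_def using that TS by (simp add: tauS_Ew) (simp add: tauS_def)
  show "trace_expectation one M N (tauS s) = ES s"
    unfolding trace_expectation_def
  proof (rule the_equality)
    show "ES s \<in> cond_exps one M N \<and> (\<forall>x\<in>M. tauS s (ES s x) = tauS s x)"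
      using ES_cond[of s, OF s] pres by blast
    fix E assume E: "E \<in> cond_exps one M N \<and> (\<forall>x\<in>M. tauS s (E x) = tauS s x)"
    obtain K where K: "E = Ew (em K)" using cond_expsE[of E] E by blast
    have "?T * em K = ?S"
    proof (rule M.A.T_eqI)
      fix x assume x: "x \<in> M"
      have "TM ((?T * em K) * x) = TM (?S * x)" using E x tauS_Ew[of "em K" x s] unfolding K
        by (simp add: tauS_def)
      then show "TM (x * (?T * em K)) = TM (x * ?S)" using x M.A.tracial by simp
    qed auto
    then have "rdg (\<lambda>i j. 1 / tN s j) * (?T * em K) = rdg (\<lambda>i j. 1 / tN s j) * ?S" by simp
    moreover have "rdg (\<lambda>i j. 1 / tN s j) * (?T * em K) = em K"
      unfolding dg_em_mult
    proof (rule Rf.bop_cong)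
      fix ij l l' assume "ij \<in> IR"
      then obtain i j where ij: "ij = (i, j)" "j \<in> J" by (auto simp: IR_def)
      then show "(case ij of (i, j) \<Rightarrow> \<lambda>l l'. complex_of_real (1 / tN s j) *
          (case (i, j) of (i, j) \<Rightarrow> \<lambda>l l'. complex_of_real (tN s j) * K (i, j) l l') l l') l l' = K ij l l'"
        using tN_pos[of s, OF s ij(2)] by simp
    qed
    moreover have "rdg (\<lambda>i j. 1 / tN s j) * ?S = rdg (\<lambda>i j. s i / tN s j)" by (simp add: dg_mult)
    ultimately show "E = ES s" unfolding K ES_def by simp
  qed
qed

end

section \<open>Connectedness and uniqueness of the positive eigenvector\<close>

locale conn_incl = incl +
  assumes conn: "connected_inclusion one N M"
begin

text \<open>Agreement along all pairs with \<open>0 < D i j\<close> makes the two diagonal elements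
  equal, so one element lies in both centers and is scalar. This is connectedness of the bipartite
  graph of \<open>D\<close>.\<close>

lemma connected_const:
  assumes gh: "\<And>i j. i \<in> I \<Longrightarrow> j \<in> J \<Longrightarrow> 0 < D i j \<Longrightarrow> g i = (h j :: complex)"
  obtains c where "\<And>i. i \<in> I \<Longrightarrow> g i = c" "\<And>j. j \<in> J \<Longrightarrow> h j = c"
proof -
  have eq: "dg (\<lambda>i j. g i) = dg (\<lambda>i j. h j)" by (rule dg_cong) (use gh in auto)
  have "dg (\<lambda>i j. g i) \<in> center M" unfolding center_def using rdg_comm by simp
  moreover have "dg (\<lambda>i j. h j) \<in> center N" unfolding center_def by (auto intro: N.comm)
  ultimately have "dg (\<lambda>i j. g i) \<in> center N \<inter> center M" using eq by simp
  then obtain c where "dg (\<lambda>i j. g i) = c \<cdot>\<^sub>m one"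
    using conn unfolding connected_inclusion_def by blast
  then have c: "dg (\<lambda>i j. g i) = dg (\<lambda>i j. c)" by (simp add: dg_one[symmetric] dg_smult)
  have "g i = c" if "i \<in> I" for i using dg_eqD[OF c] row_ex[OF that] that by blast
  moreover have "h j = c" if "j \<in> J" for j using dg_eqD[OF c[unfolded eq]] col_ex[OF that] that by blast
  ultimately show ?thesis using that by blast
qed

end

locale pf_conn = pf_incl + conn_incl
begin

text \<open>A vector \<open>s\<close> is compared with \<open>x\<close> through ratios
  \<open>g\<close> on rows and \<open>h\<close> on columns. Summed over all pairs with weights
  \<open>D i j * (x i * y j)\<close>, the squares of \<open>g\<close>, the squares of
  \<open>h\<close> and the products \<open>g i * h j\<close> all give \<open>d * Q\<close>, so the
  weighted sum of \<open>(g i - h j)\<^sup>2\<close> vanishes and \<open>g\<close>, \<open>h\<close>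
  agree along edges.\<close>

lemma eigen_unique:
  assumes eig: "\<And>i. i \<in> I \<Longrightarrow> (\<Sum>j\<in>J. real (D i j) * tN s j) = d\<^sup>2 * s i"
  obtains c where "\<And>i. i \<in> I \<Longrightarrow> s i = c * x i"
proof -
  define g where "g i = s i / x i" for i
  define h where "h j = tN s j / (d * y j)" for j
  have xi: "x i * g i = s i" if "i \<in> I" for i using x_pos[OF that] by (simp add: g_def)
  have yj: "y j * h j = tN s j / d" if "j \<in> J" for j using y_pos[OF that] d_pos by (simp add: h_def)
  define Q where "Q = (\<Sum>i\<in>I. (s i)\<^sup>2)"
  have sDt: "(\<Sum>i\<in>I. \<Sum>j\<in>J. real (D i j) * (s i * tN s j)) = d\<^sup>2 * Q"
  proof -
    have "(\<Sum>i\<in>I. \<Sum>j\<in>J. real (D i j) * (s i * tN s j)) = (\<Sum>i\<in>I. s i * (\<Sum>j\<in>J. real (D i j) * tN s j))"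
      by (simp add: sum_distrib_left ac_simps)
    also have "\<dots> = (\<Sum>i\<in>I. d\<^sup>2 * (s i)\<^sup>2)" by (rule sum.cong) (auto simp: eig power2_eq_square)
    finally show ?thesis by (simp add: Q_def sum_distrib_left)
  qed
  have tt: "(\<Sum>j\<in>J. (tN s j)\<^sup>2) = d\<^sup>2 * Q"
  proof -
    have "(\<Sum>j\<in>J. (tN s j)\<^sup>2) = (\<Sum>j\<in>J. \<Sum>i\<in>I. real (D i j) * (s i * tN s j))"
      by (simp add: power2_eq_square tN_def[of s] sum_distrib_right mult.assoc)
    then show ?thesis using sDt by (subst (asm) sum.swap) simp
  qed
  have 1: "(\<Sum>i\<in>I. \<Sum>j\<in>J. real (D i j) * (x i * y j) * (g i)\<^sup>2) = d * Q"
  proof -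
    have "(\<Sum>i\<in>I. \<Sum>j\<in>J. real (D i j) * (x i * y j) * (g i)\<^sup>2) = (\<Sum>i\<in>I. x i * (g i)\<^sup>2 * (\<Sum>j\<in>J. real (D i j) * y j))"
      by (simp add: sum_distrib_left ac_simps)
    also have "\<dots> = (\<Sum>i\<in>I. d * (s i)\<^sup>2)"
      by (rule sum.cong) (auto simp: Dy power2_eq_square simp flip: xi)
    finally show ?thesis by (simp add: Q_def sum_distrib_left)
  qed
  have 2: "(\<Sum>i\<in>I. \<Sum>j\<in>J. real (D i j) * (x i * y j) * (h j)\<^sup>2) = d * Q"
  proof -
    have "(\<Sum>i\<in>I. \<Sum>j\<in>J. real (D i j) * (x i * y j) * (h j)\<^sup>2) = (\<Sum>j\<in>J. y j * (h j)\<^sup>2 * (\<Sum>i\<in>I. real (D i j) * x i))"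
      by (subst sum.swap) (simp add: sum_distrib_left ac_simps)
    also have "\<dots> = (\<Sum>j\<in>J. d * (y j * h j)\<^sup>2)"
      by (rule sum.cong) (auto simp: Dx power2_eq_square)
    also have "\<dots> = (\<Sum>j\<in>J. d * (tN s j / d)\<^sup>2)" by (rule sum.cong) (auto simp: yj)
    also have "\<dots> = (\<Sum>j\<in>J. (tN s j)\<^sup>2) / d"
      using d_pos by (simp add: sum_divide_distrib power_divide power2_eq_square)
    finally show ?thesis unfolding tt using d_pos by (simp add: power2_eq_square)
  qed
  have 3: "(\<Sum>i\<in>I. \<Sum>j\<in>J. real (D i j) * (x i * y j) * (g i * h j)) = d * Q"
  proof -
    have "(\<Sum>i\<in>I. \<Sum>j\<in>J. real (D i j) * (x i * y j) * (g i * h j)) = (\<Sum>i\<in>I. \<Sum>j\<in>J. real (D i j) * ((x i * g i) * (y j * h j)))"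
      by (simp add: ac_simps)
    also have "\<dots> = (\<Sum>i\<in>I. \<Sum>j\<in>J. real (D i j) * (s i * tN s j)) / d"
      unfolding sum_divide_distrib by (intro sum.cong refl) (simp add: xi yj)
    finally show ?thesis using d_pos by (simp add: sDt power2_eq_square)
  qed
  have "(\<Sum>i\<in>I. \<Sum>j\<in>J. real (D i j) * (x i * y j) * (g i - h j)\<^sup>2) =
    (\<Sum>i\<in>I. \<Sum>j\<in>J. real (D i j) * (x i * y j) * (g i)\<^sup>2) + (\<Sum>i\<in>I. \<Sum>j\<in>J. real (D i j) * (x i * y j) * (h j)\<^sup>2)
    - 2 * (\<Sum>i\<in>I. \<Sum>j\<in>J. real (D i j) * (x i * y j) * (g i * h j))"
    by (simp add: power2_diff sum.distrib sum_subtractf sum_distrib_left algebra_simps)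
  also have "\<dots> = 0" unfolding 1 2 3 by simp
  finally have 0: "(\<Sum>i\<in>I. \<Sum>j\<in>J. real (D i j) * (x i * y j) * (g i - h j)\<^sup>2) = 0" .
  have nn: "0 \<le> real (D i j) * (x i * y j) * (g i - h j)\<^sup>2" if "i \<in> I" "j \<in> J" for i j
    using x_pos[OF that(1)] y_pos[OF that(2)] by simp
  have gh: "g i = h j" if ij: "i \<in> I" "j \<in> J" "0 < D i j" for i j
  proof -
    have "(\<Sum>j\<in>J. real (D i j) * (x i * y j) * (g i - h j)\<^sup>2) = 0"
      using 0 nn ij by (subst (asm) sum_nonneg_eq_0_iff) (auto intro!: sum_nonneg)
    then have "real (D i j) * (x i * y j) * (g i - h j)\<^sup>2 = 0"
      using nn ij by (subst (asm) sum_nonneg_eq_0_iff) auto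
    then show ?thesis using x_pos[OF ij(1)] y_pos[OF ij(2)] ij by auto
  qed
  obtain c where c: "\<And>i. i \<in> I \<Longrightarrow> complex_of_real (g i) = c"
    using connected_const[of "\<lambda>i. complex_of_real (g i)" "\<lambda>j. complex_of_real (h j)"] gh by metis
  have "s i = Re c * x i" if "i \<in> I" for i
    using c[OF that] xi[OF that] by (auto simp: mult.commute)
  then show ?thesis using that by blast
qed

end

subsection \<open>Quasi-bases and the Markov trace\<close>

context fac
begin

lemma matsum_bop: "matsum k (\<lambda>v. em (Z v)) V = em (\<lambda>i s t. \<Sum>v\<in>V. Z v i s t)"
  unfolding bop_def matsum_opr by (rule opr_cong) auto

end

context alg_incl
begin

lemma Ecan_adj: assumes x: "x \<in> M" shows "Ecan (mat_adjoint x) = mat_adjoint (Ecan x)"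
proof (rule Ecan_eqI)
  fix n assume n: "n \<in> N"
  have "TN (n * mat_adjoint (Ecan x)) = TN (mat_adjoint (Ecan x * mat_adjoint n))"
    using n x by (simp add: mat_adjoint_mult[of _ k k _ k])
  also have "\<dots> = cnj (TN (mat_adjoint n * Ecan x))" using n x by (simp add: N.A.T_adj N.A.tracial)
  also have "\<dots> = cnj (TM (mat_adjoint n * x))" using n x by (simp add: TN_Ecan)
  also have "\<dots> = TM (mat_adjoint (mat_adjoint n * x))" using n x by (simp add: M.A.T_adj)
  also have "mat_adjoint (mat_adjoint n * x) = mat_adjoint x * n"
    using n x by (simp add: mat_adjoint_mult[of _ k k _ k])
  also have "TM (mat_adjoint x * n) = TM (n * mat_adjoint x)" using n x by (simp add: M.A.tracial)
  finally show "TN (n * mat_adjoint (Ecan x)) = TM (n * mat_adjoint x)" .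
qed (use x in auto)

lemma Ecan_comm: assumes x: "x \<in> M" and \<kappa>: "\<kappa> \<in> R" shows "Ecan (x * \<kappa>) = Ecan (\<kappa> * x)"
proof (rule Ecan_eqI)
  have \<kappa>M [simp]: "\<kappa> \<in> M" "\<kappa> \<in> N'" using \<kappa> by auto
  fix n assume n: "n \<in> N"
  have "TN (n * Ecan (\<kappa> * x)) = TM (n * (\<kappa> * x))" using n x by (simp add: TN_Ecan)
  also have "n * (\<kappa> * x) = \<kappa> * (n * x)" using n x N.comm[OF n \<kappa>M(2)] by (simp flip: mult_assoc_sq[of _ k])
  also have "TM (\<kappa> * (n * x)) = TM (n * (x * \<kappa>))" using n x by (intro M.A.cyc) auto
  finally show "TN (n * Ecan (\<kappa> * x)) = TM (n * (x * \<kappa>))" .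
qed (use x \<kappa> in auto)

lemma Ew_adj:
  assumes x: "x \<in> M" and \<kappa>: "\<kappa> \<in> R" "M.A.posd \<kappa>"
  shows "Ew \<kappa> (mat_adjoint x) = mat_adjoint (Ew \<kappa> x)"
proof -
  have \<kappa>M [simp]: "\<kappa> \<in> M" using \<kappa> by auto
  have "mat_adjoint \<kappa> = \<kappa>" using M.hpos_adj[OF \<kappa>M M.posd_hpos[OF \<kappa>(2)]] .
  then have "mat_adjoint (Ew \<kappa> x) = Ecan (mat_adjoint x * \<kappa>)"
    using x by (simp add: Ew_def mat_adjoint_mult[of _ k k _ k] flip: Ecan_adj)
  then show ?thesis using x \<kappa>(1) by (simp add: Ew_def Ecan_comm)
qed

end

context incl
begin

lemma Ecan_M: "Ecan (bop Mi Ms Mc Z) = bop Ni Ns Nc (\<lambda>j a b. \<Sum>i\<in>I. \<Sum>l<D i j. Z i (j, l, a) (j, l, b))"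
proof (rule Ecan_eqI)
  fix n assume "n \<in> N"
  then obtain X where n: "n = bop Ni Ns Nc X" by (elim Nf.algE)
  have in1: "(\<Sum>t\<in>SM i. (case (j, l, a) of (j, l, a) \<Rightarrow> \<lambda>(j', l', a'). if j = j' \<and> l = l' then X j a a' else 0) t * Z i t (j, l, a))
      = (\<Sum>b<\<beta> j. X j a b * Z i (j, l, b) (j, l, a))" if "j \<in> J" "l < D i j" for i j l a
  proof -
    have "(\<Sum>t\<in>SM i. (case (j, l, a) of (j, l, a) \<Rightarrow> \<lambda>(j', l', a'). if j = j' \<and> l = l' then X j a a' else 0) t * Z i t (j, l, a))
      = (\<Sum>j'\<in>J. \<Sum>l'<D i j'. \<Sum>b<\<beta> j'. if j' = j \<and> l' = l then X j a b * Z i (j, l, b) (j, l, a) else 0)"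
      unfolding sum_SM by (intro sum.cong refl) auto
    also have "\<dots> = (\<Sum>j'\<in>J. if j' = j then \<Sum>l'<D i j. if l' = l then \<Sum>b<\<beta> j. X j a b * Z i (j, l, b) (j, l, a) else 0 else 0)"
      by (intro sum.cong refl) (auto intro!: sum.cong simp del: sum.delta sum.delta')
    finally show ?thesis using that by simp
  qed
  have "TM (n * bop Mi Ms Mc Z) = (\<Sum>i\<in>I. \<Sum>j\<in>J. \<Sum>l<D i j. \<Sum>a<\<beta> j. \<Sum>b<\<beta> j. X j a b * Z i (j, l, b) (j, l, a))"
    unfolding n N_in_M Mf.bop_mult Mf.btr_bop
    by (rule sum.cong[OF refl], subst sum_SM, intro sum.cong refl, rule in1) auto
  also have "\<dots> = (\<Sum>j\<in>J. \<Sum>i\<in>I. \<Sum>l<D i j. \<Sum>a<\<beta> j. \<Sum>b<\<beta> j. X j a b * Z i (j, l, b) (j, l, a))" by (rule sum.swap)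
  also have "\<dots> = (\<Sum>j\<in>J. \<Sum>a<\<beta> j. \<Sum>b<\<beta> j. X j a b * (\<Sum>i\<in>I. \<Sum>l<D i j. Z i (j, l, b) (j, l, a)))"
  proof (rule sum.cong[OF refl])
    fix j
    have "(\<Sum>i\<in>I. \<Sum>l<D i j. \<Sum>a<\<beta> j. \<Sum>b<\<beta> j. X j a b * Z i (j, l, b) (j, l, a)) =
      (\<Sum>i\<in>I. \<Sum>a<\<beta> j. \<Sum>l<D i j. \<Sum>b<\<beta> j. X j a b * Z i (j, l, b) (j, l, a))"
      by (rule sum.cong[OF refl], rule sum.swap)
    also have "\<dots> = (\<Sum>a<\<beta> j. \<Sum>i\<in>I. \<Sum>l<D i j. \<Sum>b<\<beta> j. X j a b * Z i (j, l, b) (j, l, a))" by (rule sum.swap)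
    also have "\<dots> = (\<Sum>a<\<beta> j. \<Sum>i\<in>I. \<Sum>b<\<beta> j. \<Sum>l<D i j. X j a b * Z i (j, l, b) (j, l, a))"
      by (rule sum.cong[OF refl], rule sum.cong[OF refl], rule sum.swap)
    also have "\<dots> = (\<Sum>a<\<beta> j. \<Sum>b<\<beta> j. \<Sum>i\<in>I. \<Sum>l<D i j. X j a b * Z i (j, l, b) (j, l, a))"
      by (rule sum.cong[OF refl], rule sum.swap)
    finally show "(\<Sum>i\<in>I. \<Sum>l<D i j. \<Sum>a<\<beta> j. \<Sum>b<\<beta> j. X j a b * Z i (j, l, b) (j, l, a)) =
      (\<Sum>a<\<beta> j. \<Sum>b<\<beta> j. X j a b * (\<Sum>i\<in>I. \<Sum>l<D i j. Z i (j, l, b) (j, l, a)))"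
      by (simp add: sum_distrib_left)
  qed
  also have "\<dots> = TN (n * bop Ni Ns Nc (\<lambda>j a b. \<Sum>i\<in>I. \<Sum>l<D i j. Z i (j, l, a) (j, l, b)))"
    unfolding n Nf.bop_mult Nf.btr_bop SN_def ..
  finally show "TN (n * bop Ni Ns Nc (\<lambda>j a b. \<Sum>i\<in>I. \<Sum>l<D i j. Z i (j, l, a) (j, l, b))) = TM (n * bop Mi Ms Mc Z)" by simp
qed auto

lemma dg_M_mult: "dg f * bop Mi Ms Mc X = bop Mi Ms Mc (\<lambda>i s t. f i (fst s) * X i s t)"
proof -
  have "dg f = bop Mi Ms Mc (\<lambda>i s t. if s = t then f i (fst s) else 0)"
    unfolding dg_def bop_def by (rule opr_cong) (auto simp: path_defs split: prod.splits)
  then show ?thesis unfolding Mf.bop_mult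
    by (simp add: Mf.bop_mult, intro Mf.bop_cong) (auto simp: if_distrib[of "\<lambda>x. x * _"] cong: if_cong)
qed

text \<open>A label consists of a row \<open>r\<close> of block \<open>i\<close> of \<open>M\<close>
  and a copy \<open>l\<close> of block \<open>j\<close> of \<open>N\<close> inside that
  block.\<close>

definition V :: "(nat \<times> (nat \<times> nat \<times> nat) \<times> nat \<times> nat) set" where
  "V = (SIGMA i:I. SM i \<times> (SIGMA j:J. {..<D i j}))"

lemma finite_V [simp]: "finite V"
  unfolding V_def by (intro finite_SigmaI finite_cartesian_product) auto

lemma sum_V: "(\<Sum>v\<in>V. h v) = (\<Sum>i\<in>I. \<Sum>r\<in>SM i. \<Sum>j\<in>J. \<Sum>l<D i j. h (i, r, j, l))"
  unfolding V_def by (simp add: sum.cartesian_product sum.Sigma case_prod_unfold)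

text \<open>Matrix units of \<open>M\<close> whose column is the first one, \<open>a = 0\<close>, of
  the copy \<open>(j, l)\<close>; the other columns of the copy are reached by right multiplication
  with \<open>N\<close>. The scale is the inverse root of the density \<open>s i / tN s j\<close> of
  \<open>ES s\<close>.\<close>

definition qb :: "(nat \<Rightarrow> real) \<Rightarrow> nat \<times> (nat \<times> nat \<times> nat) \<times> nat \<times> nat \<Rightarrow> complex mat" where
  "qb s = (\<lambda>(i, r, j, l). bop Mi Ms Mc (\<lambda>i' r' t. if i' = i \<and> r' = r \<and> t = (j, l, 0)
     then complex_of_real (sqrt (tN s j / s i)) else 0))"

lemma qb_in [simp]: "qb s v \<in> M" by (simp add: qb_def case_prod_unfold)

text \<open>Each term cuts out of \<open>Y\<close> the entries in row \<open>r\<close> of block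
  \<open>i\<close> whose column lies in the copy \<open>(j, l)\<close>. Every entry belongs to
  exactly one label, so summation over \<open>V\<close> gives back the whole element.\<close>

lemma quasi_basis_term:
  assumes s: "\<And>i. i \<in> I \<Longrightarrow> 0 < s i" and v: "(i, r, j, l) \<in> V"
  shows "qb s (i, r, j, l) * ES s (mat_adjoint (qb s (i, r, j, l)) * bop Mi Ms Mc Y) =
    bop Mi Ms Mc (\<lambda>i' r' t. if (i', r', fst t, fst (snd t)) = (i, r, j, l) then Y i' r' t else 0)"
proof -
  let ?c = "complex_of_real (sqrt (tN s j / s i))" and ?\<kappa> = "complex_of_real (s i / tN s j)"
  have v': "i \<in> I" "r \<in> SM i" "j \<in> J" "l < D i j" using v by (auto simp: V_def)
  have jl: "(j, l, 0) \<in> SM i" using v' by (simp add: SM_def)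
  have pos: "0 < s i" "0 < tN s j" using s tN_pos[of s, OF s v'(3)] v' by auto
  have cc: "?c * ?c = complex_of_real (tN s j / s i)"
    unfolding of_real_mult[symmetric] using pos by simp
  \<comment> \<open>The two scale factors cancel against the density of the expectation; this fixes
    the constant in \<open>qb\<close>.\<close>
  have ck: "?c * (?\<kappa> * ?c) = 1"
  proof -
    have "?c * (?\<kappa> * ?c) = ?\<kappa> * (?c * ?c)" by (simp only: ac_simps)
    then show ?thesis unfolding cc of_real_mult[symmetric] using pos by simp
  qed
  have 1: "mat_adjoint (qb s (i, r, j, l)) * bop Mi Ms Mc Y =
    bop Mi Ms Mc (\<lambda>i' r' t. if i' = i \<and> r' = (j, l, 0) then ?c * Y i r t else 0)"
    unfolding qb_def prod.case Mf.bop_adjoint Mf.bop_mult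
  proof (rule Mf.bop_cong)
    fix i' r' t assume "i' \<in> I" "r' \<in> SM i'" "t \<in> SM i'"
    have "(\<Sum>q\<in>SM i'. cnj (if i' = i \<and> q = r \<and> r' = (j, l, 0) then ?c else 0) * Y i' q t) =
      (\<Sum>q\<in>SM i'. if q = r then if i' = i \<and> r' = (j, l, 0) then ?c * Y i r t else 0 else 0)"
      by (rule sum.cong) auto
    also have "\<dots> = (if i' = i \<and> r' = (j, l, 0) then ?c * Y i r t else 0)" using v' \<open>i' \<in> I\<close> by simp
    finally show "(\<Sum>q\<in>SM i'. cnj (if i' = i \<and> q = r \<and> r' = (j, l, 0) then ?c else 0) * Y i' q t) = \<dots>" .
  qed
  have 2: "ES s (mat_adjoint (qb s (i, r, j, l)) * bop Mi Ms Mc Y) =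
    bop Ni Ns Nc (\<lambda>j' a b. if j' = j \<and> a = 0 then ?\<kappa> * ?c * Y i r (j, l, b) else 0)"
  proof -
    have "ES s (mat_adjoint (qb s (i, r, j, l)) * bop Mi Ms Mc Y) =
      bop Ni Ns Nc (\<lambda>j' a b. \<Sum>i'\<in>I. \<Sum>l'<D i' j'. complex_of_real (s i' / tN s (fst (j', l', a))) *
        (if i' = i \<and> (j', l', a) = (j, l, 0) then ?c * Y i r (j', l', b) else 0))"
      unfolding 1 by (simp add: ES_def Ew_def dg_M_mult Ecan_M)
    also have "\<dots> = bop Ni Ns Nc (\<lambda>j' a b. if j' = j \<and> a = 0 then ?\<kappa> * ?c * Y i r (j, l, b) else 0)"
    proof (rule Nf.bop_cong)
      fix j' a b
      have "(\<Sum>i'\<in>I. \<Sum>l'<D i' j'. complex_of_real (s i' / tN s (fst (j', l', a))) *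
        (if i' = i \<and> (j', l', a) = (j, l, 0) then ?c * Y i r (j', l', b) else 0)) =
        (\<Sum>i'\<in>I. if i' = i then \<Sum>l'<D i j'. if l' = l then if j' = j \<and> a = 0 then ?\<kappa> * ?c * Y i r (j, l, b) else 0 else 0 else 0)"
        by (intro sum.cong refl) (auto intro!: sum.cong simp del: sum.delta sum.delta')
      also have "\<dots> = (if j' = j \<and> a = 0 then ?\<kappa> * ?c * Y i r (j, l, b) else 0)" using v' by auto
      finally show "(\<Sum>i'\<in>I. \<Sum>l'<D i' j'. complex_of_real (s i' / tN s (fst (j', l', a))) *
        (if i' = i \<and> (j', l', a) = (j, l, 0) then ?c * Y i r (j', l', b) else 0)) = \<dots>" .
    qed
    finally show ?thesis .
  qed
  show ?thesis
    unfolding 2 unfolding qb_def prod.case N_in_M Mf.bop_mult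
  proof (rule Mf.bop_cong)
    fix i' r' t assume i': "i' \<in> I" "r' \<in> SM i'" "t \<in> SM i'"
    obtain j2 l2 a2 where t: "t = (j2, l2, a2)" by (cases t)
    have "(\<Sum>q\<in>SM i'. (if i' = i \<and> r' = r \<and> q = (j, l, 0) then ?c else 0) *
        (case q of (j', l', a) \<Rightarrow> \<lambda>(j'', l'', a'). if j' = j'' \<and> l' = l'' then
           if j' = j \<and> a = 0 then ?\<kappa> * ?c * Y i r (j, l, a') else 0 else 0) t) =
      (\<Sum>q\<in>SM i'. if q = (j, l, 0) then if i' = i \<and> r' = r \<and> j2 = j \<and> l2 = l
         then ?c * (?\<kappa> * ?c) * Y i r (j, l, a2) else 0 else 0)"
      by (rule sum.cong) (auto simp: t)
    also have "\<dots> = (if (i', r', fst t, fst (snd t)) = (i, r, j, l) then Y i' r' t else 0)"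
      unfolding ck using jl i' by (auto simp: t)
    finally show "(\<Sum>q\<in>SM i'. (if i' = i \<and> r' = r \<and> q = (j, l, 0) then ?c else 0) *
        (case q of (j', l', a) \<Rightarrow> \<lambda>(j'', l'', a'). if j' = j'' \<and> l' = l'' then
           if j' = j \<and> a = 0 then ?\<kappa> * ?c * Y i r (j, l, a') else 0 else 0) t) = \<dots>" .
  qed
qed

lemma quasi_basis:
  assumes s: "\<And>i. i \<in> I \<Longrightarrow> 0 < s i" and y: "y \<in> M"
  shows "matsum k (\<lambda>v. qb s v * ES s (mat_adjoint (qb s v) * y)) V = y"
proof -
  obtain Y where Y: "y = bop Mi Ms Mc Y" using y by (elim Mf.algE)
  have "matsum k (\<lambda>v. qb s v * ES s (mat_adjoint (qb s v) * y)) V =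
    matsum k (\<lambda>v. bop Mi Ms Mc (\<lambda>i' r' t. if (i', r', fst t, fst (snd t)) = v then Y i' r' t else 0)) V"
  proof (rule matsum_cong)
    fix v assume v: "v \<in> V"
    obtain i r j l where vv: "v = (i, r, j, l)" by (cases v)
    show "qb s v * ES s (mat_adjoint (qb s v) * y) =
      bop Mi Ms Mc (\<lambda>i' r' t. if (i', r', fst t, fst (snd t)) = v then Y i' r' t else 0)"
      unfolding vv Y by (rule quasi_basis_term[of s, OF s v[unfolded vv]])
  qed
  also have "\<dots> = y"
    unfolding Mf.matsum_bop Y
    by (rule Mf.bop_cong) (auto simp: V_def SM_def)
  finally show ?thesis .
qed

text \<open>A label contributes \<open>tN s j\<close> times a diagonal entry of \<open>x\<close>,
  because the squared scale times \<open>s i\<close> is \<open>tN s j\<close>. Counting copies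
  produces \<open>D\<close> applied to \<open>tN s\<close>, the expression whose eigenvalue is the
  Markov modulus.\<close>

lemma qb_index:
  assumes s: "\<And>i. i \<in> I \<Longrightarrow> 0 < s i" and x: "x \<in> M"
  shows "(\<Sum>v\<in>V. tauS s (mat_adjoint (qb s v) * (x * qb s v))) =
    TM (rdg (\<lambda>i j. \<Sum>j\<in>J. real (D i j) * tN s j) * x)"
proof -
  obtain X where X: "x = bop Mi Ms Mc X" using x by (elim Mf.algE)
  have term1: "tauS s (mat_adjoint (qb s (i, r, j, l)) * (x * qb s (i, r, j, l))) = complex_of_real (tN s j) * X i r r"
    if v: "i \<in> I" "r \<in> SM i" "j \<in> J" "l < D i j" for i r j l
  proof -
    let ?c = "complex_of_real (sqrt (tN s j / s i))"
    have jl: "(j, l, 0) \<in> SM i" using v by (simp add: SM_def)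
    have pos: "0 < s i" "0 < tN s j" using s tN_pos[of s, OF s v(3)] v by auto
    have "?c * ?c = complex_of_real (tN s j / s i)"
      unfolding of_real_mult[symmetric] using pos by simp
    then have cc: "complex_of_real (s i) * (?c * ?c) = complex_of_real (tN s j)" using pos by simp
    have xq: "x * qb s (i, r, j, l) = bop Mi Ms Mc (\<lambda>i' r' t. if i' = i \<and> t = (j, l, 0) then ?c * X i r' r else 0)"
      unfolding X qb_def prod.case Mf.bop_mult
    proof (rule Mf.bop_cong)
      fix i' r' t assume "i' \<in> I" "r' \<in> SM i'" "t \<in> SM i'"
      have "(\<Sum>q\<in>SM i'. X i' r' q * (if i' = i \<and> q = r \<and> t = (j, l, 0) then ?c else 0)) =
        (\<Sum>q\<in>SM i'. if q = r then if i' = i \<and> t = (j, l, 0) then ?c * X i r' r else 0 else 0)"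
        by (rule sum.cong) auto
      then show "(\<Sum>q\<in>SM i'. X i' r' q * (if i' = i \<and> q = r \<and> t = (j, l, 0) then ?c else 0)) =
        (if i' = i \<and> t = (j, l, 0) then ?c * X i r' r else 0)" using v \<open>i' \<in> I\<close> by simp
    qed
    have "mat_adjoint (qb s (i, r, j, l)) * (x * qb s (i, r, j, l)) =
      bop Mi Ms Mc (\<lambda>i' r' t. if i' = i \<and> r' = (j, l, 0) \<and> t = (j, l, 0) then ?c * ?c * X i r r else 0)"
      unfolding xq unfolding qb_def prod.case Mf.bop_adjoint Mf.bop_mult
    proof (rule Mf.bop_cong)
      fix i' r' t assume "i' \<in> I" "r' \<in> SM i'" "t \<in> SM i'"
      have "(\<Sum>q\<in>SM i'. cnj (if i' = i \<and> q = r \<and> r' = (j, l, 0) then ?c else 0) *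
          (if i' = i \<and> t = (j, l, 0) then ?c * X i q r else 0)) =
        (\<Sum>q\<in>SM i'. if q = r then if i' = i \<and> r' = (j, l, 0) \<and> t = (j, l, 0) then ?c * ?c * X i r r else 0 else 0)"
        by (rule sum.cong) auto
      then show "(\<Sum>q\<in>SM i'. cnj (if i' = i \<and> q = r \<and> r' = (j, l, 0) then ?c else 0) *
          (if i' = i \<and> t = (j, l, 0) then ?c * X i q r else 0)) =
        (if i' = i \<and> r' = (j, l, 0) \<and> t = (j, l, 0) then ?c * ?c * X i r r else 0)" using v \<open>i' \<in> I\<close> by simp
    qed
    then have "tauS s (mat_adjoint (qb s (i, r, j, l)) * (x * qb s (i, r, j, l))) =
      (\<Sum>i'\<in>I. \<Sum>q\<in>SM i'. complex_of_real (s i') * (if i' = i \<and> q = (j, l, 0) then ?c * ?c * X i r r else 0))"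
      by (simp add: tauS_def dg_M_mult)
    also have "\<dots> = (\<Sum>i'\<in>I. if i' = i then \<Sum>q\<in>SM i. if q = (j, l, 0) then complex_of_real (s i) * (?c * ?c) * X i r r else 0 else 0)"
      by (intro sum.cong refl) (auto intro!: sum.cong)
    also have "\<dots> = complex_of_real (tN s j) * X i r r" unfolding cc using v jl by simp
    finally show ?thesis .
  qed
  have "(\<Sum>v\<in>V. tauS s (mat_adjoint (qb s v) * (x * qb s v))) =
      (\<Sum>i\<in>I. \<Sum>r\<in>SM i. \<Sum>j\<in>J. \<Sum>l<D i j. complex_of_real (tN s j) * X i r r)"
    unfolding sum_V by (intro sum.cong refl) (auto intro: term1)
  also have "\<dots> = TM (rdg (\<lambda>i j. \<Sum>j\<in>J. real (D i j) * tN s j) * x)"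
    unfolding X dg_M_mult Mf.btr_bop by (simp add: sum_distrib_right mult.assoc)
  finally show ?thesis .
qed

text \<open>Right \<open>N\<close>-linear operators on \<open>M\<close>. The basic construction
  consists of such operators, and they are determined by their values on the quasi-basis.\<close>

definition rlin :: "(complex mat \<Rightarrow> complex mat) \<Rightarrow> bool" where
  "rlin S \<longleftrightarrow> S \<in> extensional M \<and> (\<forall>y\<in>M. S y \<in> M) \<and> (\<forall>y\<in>M. \<forall>z\<in>M. S (y + z) = S y + S z) \<and>
     (\<forall>y\<in>M. \<forall>c. S (c \<cdot>\<^sub>m y) = c \<cdot>\<^sub>m S y) \<and> (\<forall>y\<in>M. \<forall>n\<in>N. S (y * n) = S y * n)"

lemma rlin_in: "rlin S \<Longrightarrow> y \<in> M \<Longrightarrow> S y \<in> M" by (simp add: rlin_def)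

lemma rlin_zero: "rlin S \<Longrightarrow> S (0\<^sub>m k k) = 0\<^sub>m k k"
proof -
  assume S: "rlin S"
  have z: "0 \<cdot>\<^sub>m x = 0\<^sub>m k k" if "x \<in> carrier_mat k k" for x :: "complex mat"
    using that by (intro eq_matI) auto
  have "S (0 \<cdot>\<^sub>m 0\<^sub>m k k) = 0 \<cdot>\<^sub>m S (0\<^sub>m k k)" using S M.A.zero_in unfolding rlin_def by blast
  then show ?thesis using z[of "0\<^sub>m k k"] z[OF M.A.car[OF rlin_in[OF S M.A.zero_in]]] by simp
qed

lemma rlin_matsum:
  assumes S: "rlin S"
  shows "finite W \<Longrightarrow> (\<And>v. v \<in> W \<Longrightarrow> f v \<in> M) \<Longrightarrow> S (matsum k f W) = matsum k (\<lambda>v. S (f v)) W"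
proof (induction W rule: finite_induct)
  case empty
  then show ?case using rlin_zero[OF S] by (simp add: matsum_empty)
next
  case (insert v W)
  have "S (f v + matsum k f W) = S (f v) + S (matsum k f W)"
    using S insert M.A.matsum_in[of W f] unfolding rlin_def by simp
  then show ?case using insert rlin_in[OF S] by (simp add: matsum_insert)
qed

lemma BC_rlin:
  assumes s: "\<And>i. i \<in> I \<Longrightarrow> 0 < s i" and S: "S \<in> basic_construction one M N (tauS s)"
  shows "rlin S"
  using S
proof (induction rule: basic_construction.induct)
  case (left x)
  then show ?case
    by (auto simp: rlin_def left_mult_def extensional_def mult_add_distrib_mat[of _ k k _ k]
        mult_smult_distrib[of _ k k _ k] mult_assoc_sq[of _ k])
next
  case jones
  have E: "op_valued_weight M N (ES s)" using ES_cond[of s, OF s] by (simp add: cond_exps_def)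
  have Er: "ES s (y * n) = ES s y * n" if "y \<in> M" "n \<in> N" for y n
  proof -
    have "ES s (one * y * n) = one * ES s y * n"
      using E that N.A.u_in unfolding op_valued_weight_def by blast
    moreover have "ES s y \<in> N" using E that by (auto simp: op_valued_weight_def)
    ultimately show ?thesis using that by simp
  qed
  have "ES s \<in> extensional M" "\<And>y. y \<in> M \<Longrightarrow> ES s y \<in> N"
    using E by (auto simp: op_valued_weight_def PiE_def)
  moreover have te: "trace_expectation one M N (tauS s) = ES s"
    by (rule trace_expectation_tauS(1)[of s, OF s])
  ultimately show ?case unfolding te
    using E Er by (auto simp: rlin_def op_valued_weight_def)
next
  case (add S T)
  have comm: "a + b + (c + d) = a + c + (b + d)" if "a \<in> carrier_mat k k" "b \<in> carrier_mat k k" "c \<in> carrier_mat k k" "d \<in> carrier_mat k k"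
    for a b c d :: "complex mat" using that by (intro eq_matI) auto
  have sm: "c \<cdot>\<^sub>m (a + b) = c \<cdot>\<^sub>m a + c \<cdot>\<^sub>m b" if "a \<in> carrier_mat k k" "b \<in> carrier_mat k k"
    for a b :: "complex mat" and c using that by (intro eq_matI) (auto simp: algebra_simps)
  show ?case
    using add(3,4) by (auto simp: rlin_def extensional_def comm sm add_mult_distrib_mat[of _ k k _ _ k])
next
  case (scale S c)
  have sm: "c \<cdot>\<^sub>m (a + b) = c \<cdot>\<^sub>m a + c \<cdot>\<^sub>m b" if "a \<in> carrier_mat k k" "b \<in> carrier_mat k k"
    for a b :: "complex mat" and c using that by (intro eq_matI) (auto simp: algebra_simps)
  show ?case
    using scale(2) by (auto simp: rlin_def extensional_def sm smult_smult_mat mult.commute mult_smult_assoc_mat[of _ k k _ k])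
next
  case (comp S T)
  then show ?case by (auto simp: rlin_def extensional_def compose_def)
qed

end

context incl
begin

lemma tauS_linear: assumes s: "\<And>i. i \<in> I \<Longrightarrow> 0 < s i" shows "linear_functional M (tauS s)"
  unfolding linear_functional_def tauS_def
  by (simp add: mult_smult_distrib[of _ k k _ k] mult_add_distrib_mat[of _ k k _ k])

lemma tauS_tracial: "x \<in> M \<Longrightarrow> y \<in> M \<Longrightarrow> tauS s (x * y) = tauS s (y * x)"
proof -
  assume x: "x \<in> M" and y: "y \<in> M"
  let ?S = "rdg (\<lambda>i j. s i)"
  have "TM (?S * (x * y)) = TM (x * (y * ?S))" using x y by (intro M.A.cyc) auto
  also have "y * ?S = ?S * y" using y rdg_comm by simp
  also have "TM (x * (?S * y)) = TM (?S * (y * x))" using x y by (intro M.A.cyc) auto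
  finally show ?thesis using x y by (simp add: tauS_def)
qed

text \<open>This is the adjoint of the reconstruction formula at the unit, since \<open>ES s\<close>
  preserves adjoints.\<close>

lemma quasi_basis_adj:
  assumes s: "\<And>i. i \<in> I \<Longrightarrow> 0 < s i"
  shows "matsum k (\<lambda>v. ES s (qb s v) * mat_adjoint (qb s v)) V = one"
proof -
  have adj: "mat_adjoint (ES s (mat_adjoint (qb s v))) = ES s (qb s v)" for v
    unfolding ES_def using Ew_adj[of "mat_adjoint (qb s v)"] posd_rdg(1)[OF ES_pos[of s, OF s]] by simp
  have EN: "ES s x \<in> M" if "x \<in> M" for x using that by (simp add: ES_def Ew_def)
  have "mat_adjoint (matsum k (\<lambda>v. qb s v * ES s (mat_adjoint (qb s v) * one)) V) =
    matsum k (\<lambda>v. mat_adjoint (qb s v * ES s (mat_adjoint (qb s v) * one))) V"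
    by (rule matsum_adjoint) (auto intro!: M.A.car M.A.mult_in EN)
  also have "\<dots> = matsum k (\<lambda>v. ES s (qb s v) * mat_adjoint (qb s v)) V"
    by (rule matsum_cong) (simp add: mat_adjoint_mult[of _ k k _ k] M.A.car EN adj M.A.u_right)
  finally show ?thesis using quasi_basis[of s, OF s M.A.u_in] by simp
qed

text \<open>
  The trace on the basic construction is \<open>S \<mapsto> 1/b \<Sum> \<tau> (v\<^sup>* S v)\<close>, summed over the quasi-basis. It is
  tracial because all elements of the basic construction are right \<open>N\<close>-linear.
\<close>

lemma markov_if:
  assumes s: "\<And>i. i \<in> I \<Longrightarrow> 0 < s i" and 1: "(\<Sum>i\<in>I. real (dimM i) * s i) = 1" and b: "0 < b"
    and eig: "\<And>i. i \<in> I \<Longrightarrow> (\<Sum>j\<in>J. real (D i j) * tN s j) = b * s i"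
  shows "is_markov_trace one M N b (tauS s)"
proof -
  let ?\<tau> = "tauS s" and ?e = "ES s"
  have te: "trace_expectation one M N ?\<tau> = ?e" by (rule trace_expectation_tauS(1)[of s, OF s])
  have pres: "?\<tau> (?e x) = ?\<tau> x" if "x \<in> M" for x by (rule trace_expectation_tauS(2)[of s, OF s that])
  have E: "op_valued_weight M N ?e" using ES_cond[of s, OF s] by (simp add: cond_exps_def)
  have eN [simp]: "?e x \<in> N" if "x \<in> M" for x using that by (simp add: ES_def Ew_def)
  have er: "?e (x * n) = ?e x * n" if "x \<in> M" "n \<in> N" for x n
  proof -
    have "?e (one * x * n) = one * ?e x * n"
      using E that N.A.u_in unfolding op_valued_weight_def by blast
    then show ?thesis using that by simp
  qed
  have lin: "linear_functional M ?\<tau>" by (rule tauS_linear[of s, OF s])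
  let ?BC = "basic_construction one M N ?\<tau>"
  define t1 where "t1 S = complex_of_real (1 / b) * (\<Sum>v\<in>V. ?\<tau> (mat_adjoint (qb s v) * S (qb s v)))" for S
  have rl: "rlin S" if "S \<in> ?BC" for S by (rule BC_rlin[of s, OF s that])
  have Sin [simp]: "S x \<in> M" if "S \<in> ?BC" "x \<in> M" for S x using rlin_in[OF rl] that by blast
  \<comment> \<open>Expanding \<open>T\<close> at a basis element in the quasi-basis and inserting
    the expectation under the trace gives a double sum in which \<open>S\<close> and
    \<open>T\<close> play symmetric roles; exchanging the two summation indices then proves
    traciality.\<close>
  have comp: "(\<Sum>v\<in>V. ?\<tau> (mat_adjoint (qb s v) * S (T (qb s v)))) =
      (\<Sum>v\<in>V. \<Sum>w\<in>V. ?\<tau> (?e (mat_adjoint (qb s v) * S (qb s w)) * ?e (mat_adjoint (qb s w) * T (qb s v))))"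
    if S: "S \<in> ?BC" and T: "T \<in> ?BC" for S T
  proof (rule sum.cong[OF refl])
    fix v
    let ?y = "T (qb s v)"
    have y: "?y \<in> M" using T by simp
    have t_in: "qb s w * ?e (mat_adjoint (qb s w) * ?y) \<in> M" for w using y by simp
    have "S ?y = S (matsum k (\<lambda>w. qb s w * ?e (mat_adjoint (qb s w) * ?y)) V)"
      using quasi_basis[of s, OF s y] by simp
    also have "\<dots> = matsum k (\<lambda>w. S (qb s w * ?e (mat_adjoint (qb s w) * ?y))) V"
      by (rule rlin_matsum[OF rl[OF S] finite_V t_in])
    also have "\<dots> = matsum k (\<lambda>w. S (qb s w) * ?e (mat_adjoint (qb s w) * ?y)) V"
      using rl[OF S] y by (intro matsum_cong) (simp add: rlin_def)
    finally have Sy: "S ?y = matsum k (\<lambda>w. S (qb s w) * ?e (mat_adjoint (qb s w) * ?y)) V" .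
    have "mat_adjoint (qb s v) * S ?y =
        matsum k (\<lambda>w. mat_adjoint (qb s v) * (S (qb s w) * ?e (mat_adjoint (qb s w) * ?y))) V"
      unfolding Sy using S y by (intro matsum_left) auto
    then have "?\<tau> (mat_adjoint (qb s v) * S ?y) =
        (\<Sum>w\<in>V. ?\<tau> (mat_adjoint (qb s v) * (S (qb s w) * ?e (mat_adjoint (qb s w) * ?y))))"
      using S y by (simp add: M.A.linear_matsum[OF lin])
    also have "\<dots> = (\<Sum>w\<in>V. ?\<tau> (?e (mat_adjoint (qb s v) * S (qb s w)) * ?e (mat_adjoint (qb s w) * ?y)))"
    proof (rule sum.cong[OF refl])
      fix w
      let ?n = "?e (mat_adjoint (qb s w) * ?y)"
      have n: "?n \<in> N" using y by simp
      have z: "mat_adjoint (qb s v) * S (qb s w) \<in> M" using S by simp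
      have "?\<tau> (mat_adjoint (qb s v) * (S (qb s w) * ?n)) = ?\<tau> ((mat_adjoint (qb s v) * S (qb s w)) * ?n)"
        using S n by (subst mult_assoc_sq[of _ k]) auto
      also have "\<dots> = ?\<tau> (?e ((mat_adjoint (qb s v) * S (qb s w)) * ?n))" using z n by (simp add: pres)
      finally show "?\<tau> (mat_adjoint (qb s v) * (S (qb s w) * ?n)) = ?\<tau> (?e (mat_adjoint (qb s v) * S (qb s w)) * ?n)"
        by (simp add: er[OF z n])
    qed
    finally show "?\<tau> (mat_adjoint (qb s v) * S ?y) =
      (\<Sum>w\<in>V. ?\<tau> (?e (mat_adjoint (qb s v) * S (qb s w)) * ?e (mat_adjoint (qb s w) * ?y)))" .
  qed
  have tr: "t1 (compose M S T) = t1 (compose M T S)" if S: "S \<in> ?BC" and T: "T \<in> ?BC" for S T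
  proof -
    have "(\<Sum>v\<in>V. ?\<tau> (mat_adjoint (qb s v) * S (T (qb s v)))) = (\<Sum>v\<in>V. ?\<tau> (mat_adjoint (qb s v) * T (S (qb s v))))"
      unfolding comp[OF S T] comp[OF T S]
      by (subst sum.swap, intro sum.cong refl, rule tauS_tracial) (use S T in auto)
    then show ?thesis by (simp add: t1_def compose_def)
  qed
  have bct: "basic_construction_trace one M N ?\<tau> t1"
    unfolding basic_construction_trace_def
  proof (intro ballI conjI allI impI)
    fix S assume S: "S \<in> ?BC"
    show "t1 (\<lambda>y\<in>M. c \<cdot>\<^sub>m S y) = c * t1 S" for c
    proof -
      have "?\<tau> (mat_adjoint (qb s v) * (c \<cdot>\<^sub>m S (qb s v))) = c * ?\<tau> (mat_adjoint (qb s v) * S (qb s v))" for v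
        using S lin by (simp add: mult_smult_distrib[of _ k k _ k] linear_functional_def)
      then show ?thesis by (simp add: t1_def sum_distrib_left)
    qed
    show "0 \<le> t1 S" if pos: "\<forall>y\<in>M. 0 \<le> ?\<tau> (mat_adjoint y * S y)"
    proof -
      have "0 \<le> (\<Sum>v\<in>V. ?\<tau> (mat_adjoint (qb s v) * S (qb s v)))" using pos by (intro sum_nonneg) simp
      moreover have "0 \<le> complex_of_real (1 / b)" using b by (simp add: less_eq_complex_def)
      ultimately show ?thesis unfolding t1_def by (rule mult_nonneg_nonneg[rotated])
    qed
    fix T assume T: "T \<in> ?BC"
    show "t1 (\<lambda>y\<in>M. S y + T y) = t1 S + t1 T"
    proof -
      have "?\<tau> (mat_adjoint (qb s v) * (S (qb s v) + T (qb s v))) =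
          ?\<tau> (mat_adjoint (qb s v) * S (qb s v)) + ?\<tau> (mat_adjoint (qb s v) * T (qb s v))" for v
        using S T lin by (simp add: mult_add_distrib_mat[of _ k k _ k] linear_functional_def)
      then show ?thesis by (simp add: t1_def sum.distrib distrib_left)
    qed
    show "t1 (compose M S T) = t1 (compose M T S)" by (rule tr[OF S T])
  qed
  have "t1 (left_mult M x) = ?\<tau> x \<and> complex_of_real b * t1 (compose M (left_mult M x) ?e) = ?\<tau> x" if x: "x \<in> M" for x
  proof
    \<comment> \<open>On left multiplications the sum is \<open>qb_index\<close>. The eigenvalue
      equation supplies the factor \<open>b\<close> that the normalization of \<open>t1\<close>
      removes.\<close>
    have "(\<Sum>v\<in>V. ?\<tau> (mat_adjoint (qb s v) * left_mult M x (qb s v))) = TM (rdg (\<lambda>i j. \<Sum>j\<in>J. real (D i j) * tN s j) * x)"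
      using qb_index[of s, OF s x] by (simp add: left_mult_def)
    also have "rdg (\<lambda>i j. \<Sum>j\<in>J. real (D i j) * tN s j) = complex_of_real b \<cdot>\<^sub>m rdg (\<lambda>i j. s i)"
      unfolding dg_smult by (rule dg_cong) (simp add: eig)
    also have "TM (complex_of_real b \<cdot>\<^sub>m rdg (\<lambda>i j. s i) * x) = complex_of_real b * ?\<tau> x"
      using x by (simp add: tauS_def mult_smult_assoc_mat[of _ k k _ k])
    finally show "t1 (left_mult M x) = ?\<tau> x" using b by (simp add: t1_def)
    \<comment> \<open>With the Jones projection present, the adjoint reconstruction formula
      collapses the sum to \<open>?\<tau> x\<close>; the factor \<open>1 / b\<close> in
      \<open>t1\<close> is then the Markov condition.\<close>
    have "(\<Sum>v\<in>V. ?\<tau> (mat_adjoint (qb s v) * compose M (left_mult M x) ?e (qb s v))) =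
        (\<Sum>v\<in>V. ?\<tau> (x * (?e (qb s v) * mat_adjoint (qb s v))))"
    proof (rule sum.cong[OF refl])
      fix v
      have "?\<tau> (mat_adjoint (qb s v) * (x * ?e (qb s v))) = ?\<tau> ((x * ?e (qb s v)) * mat_adjoint (qb s v))"
        using x by (intro tauS_tracial) auto
      then show "?\<tau> (mat_adjoint (qb s v) * compose M (left_mult M x) ?e (qb s v)) =
          ?\<tau> (x * (?e (qb s v) * mat_adjoint (qb s v)))"
        using x by (simp add: compose_def left_mult_def mult_assoc_sq[of _ k])
    qed
    also have "\<dots> = ?\<tau> (matsum k (\<lambda>v. x * (?e (qb s v) * mat_adjoint (qb s v))) V)"
      using x by (intro M.A.linear_matsum[OF lin, symmetric]) auto
    also have "matsum k (\<lambda>v. x * (?e (qb s v) * mat_adjoint (qb s v))) V =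
        x * matsum k (\<lambda>v. ?e (qb s v) * mat_adjoint (qb s v)) V"
      using x by (intro matsum_left[symmetric]) auto
    also have "matsum k (\<lambda>v. ?e (qb s v) * mat_adjoint (qb s v)) V = one" by (rule quasi_basis_adj[of s, OF s])
    finally show "complex_of_real b * t1 (compose M (left_mult M x) ?e) = ?\<tau> x"
      using b x by (simp add: t1_def)
  qed
  then show ?thesis
    unfolding is_markov_trace_def te using tauS_trace[of s, OF s 1] bct by blast
qed

text \<open>By the quasi-basis, left multiplication by \<open>x\<close> is a sum of products of
  \<open>x * qb s v\<close>, the Jones projection and the adjoint of \<open>qb s v\<close>.
  Traciality moves the adjoint to the front, so the Markov property determines the trace of each
  summand; for \<open>x\<close> a block projection the result is the eigenvalue equation at
  \<open>i\<close>.\<close>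

lemma markov_only_if:
  assumes s: "\<And>i. i \<in> I \<Longrightarrow> 0 < s i" and m: "is_markov_trace one M N b (tauS s)" and i: "i \<in> I"
  shows "(\<Sum>j\<in>J. real (D i j) * tN s j) = b * s i"
proof -
  let ?\<tau> = "tauS s" and ?e = "ES s"
  have te: "trace_expectation one M N ?\<tau> = ?e" by (rule trace_expectation_tauS(1)[of s, OF s])
  let ?BC = "basic_construction one M N ?\<tau>"
  obtain t1 where t1: "basic_construction_trace one M N ?\<tau> t1"
    and t1_left: "\<And>x. x \<in> M \<Longrightarrow> t1 (left_mult M x) = ?\<tau> x"
    and t1_e: "\<And>x. x \<in> M \<Longrightarrow> complex_of_real b * t1 (compose M (left_mult M x) ?e) = ?\<tau> x"
    using m unfolding is_markov_trace_def te by blast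
  have t1_add: "t1 (\<lambda>y\<in>M. S y + T y) = t1 S + t1 T" if "S \<in> ?BC" "T \<in> ?BC" for S T
    using t1 that unfolding basic_construction_trace_def by blast
  have t1_scale: "t1 (\<lambda>y\<in>M. c \<cdot>\<^sub>m S y) = c * t1 S" if "S \<in> ?BC" for S c
    using t1 that unfolding basic_construction_trace_def by blast
  have t1_tr: "t1 (compose M S T) = t1 (compose M T S)" if "S \<in> ?BC" "T \<in> ?BC" for S T
    using t1 that unfolding basic_construction_trace_def by blast
  have eBC: "?e \<in> ?BC" using basic_construction.jones[where u = one and M = M and N = N and \<tau> = ?\<tau>] te by simp
  have eN [simp]: "?e x \<in> N" if "x \<in> M" for x using that by (simp add: ES_def Ew_def)
  define x where "x = dg (\<lambda>i' j. if i' = i then 1 else 0)"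
  have x [simp]: "x \<in> M" by (simp add: x_def)
  define F where "F v = compose M (compose M (left_mult M (x * qb s v)) ?e) (left_mult M (mat_adjoint (qb s v)))" for v
  have FBC: "F v \<in> ?BC" for v
    unfolding F_def by (intro basic_construction.comp basic_construction.left eBC) auto
  have sumF: "finite W \<Longrightarrow> (\<lambda>y\<in>M. matsum k (\<lambda>v. F v y) W) \<in> ?BC \<and>
      t1 (\<lambda>y\<in>M. matsum k (\<lambda>v. F v y) W) = (\<Sum>v\<in>W. t1 (F v))" for W
  proof (induction W rule: finite_induct)
    case empty
    \<comment> \<open>The zero operator is obtained in the generated algebra as the multiple by
      \<open>0\<close> of one of the operators \<open>F\<close>; the label chosen for it is
      arbitrary.\<close>
    have "(\<lambda>y\<in>M. matsum k (\<lambda>v. F v y) {}) = (\<lambda>y\<in>M. 0 \<cdot>\<^sub>m F (0, (0,0,0), 0, 0) y)"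
    proof (rule restrict_ext)
      fix y assume "y \<in> M"
      then have "F (0, (0,0,0), 0, 0) y \<in> M" using rlin_in[OF BC_rlin[of s, OF s FBC]] by blast
      then have "F (0, (0,0,0), 0, 0) y \<in> carrier_mat k k" by simp
      then show "matsum k (\<lambda>v. F v y) {} = 0 \<cdot>\<^sub>m F (0, (0,0,0), 0, 0) y"
        unfolding matsum_empty by (intro eq_matI) auto
    qed
    then show ?case using basic_construction.scale[OF FBC[of "(0, (0,0,0), 0, 0)"], of 0]
        t1_scale[OF FBC[of "(0, (0,0,0), 0, 0)"], of 0] by (simp only: mult_zero_left sum.empty simp_thms)
  next
    case (insert v W)
    have "(\<lambda>y\<in>M. matsum k (\<lambda>v. F v y) (insert v W)) = (\<lambda>y\<in>M. F v y + (\<lambda>y\<in>M. matsum k (\<lambda>v. F v y) W) y)"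
    proof (rule restrict_ext)
      fix y assume y: "y \<in> M"
      then have "F v y \<in> M" using rlin_in[OF BC_rlin[of s, OF s FBC]] by blast
      then show "matsum k (\<lambda>v. F v y) (insert v W) = F v y + (\<lambda>y\<in>M. matsum k (\<lambda>v. F v y) W) y"
        using insert y by (simp add: matsum_insert)
    qed
    then show ?case
      unfolding sum.insert[OF insert.hyps]
      using insert.IH basic_construction.add[OF FBC[of v] conjunct1[OF insert.IH]]
        t1_add[OF FBC[of v] conjunct1[OF insert.IH]] by (simp only: simp_thms)
  qed
  have "(\<lambda>y\<in>M. matsum k (\<lambda>v. F v y) V) = left_mult M x"
    unfolding left_mult_def
  proof (rule restrict_ext)
    fix y assume y: "y \<in> M"
    have "matsum k (\<lambda>v. F v y) V = matsum k (\<lambda>v. x * (qb s v * ?e (mat_adjoint (qb s v) * y))) V"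
      using y by (intro matsum_cong) (simp add: F_def compose_def left_mult_def mult_assoc_sq[of _ k])
    also have "\<dots> = x * matsum k (\<lambda>v. qb s v * ?e (mat_adjoint (qb s v) * y)) V"
      using y by (intro matsum_left[symmetric]) auto
    finally show "matsum k (\<lambda>v. F v y) V = x * y" using quasi_basis[of s, OF s y] by simp
  qed
  then have tx: "?\<tau> x = (\<Sum>v\<in>V. t1 (F v))" using sumF[OF finite_V] t1_left[OF x] by simp
  have "complex_of_real b * t1 (F v) = ?\<tau> (mat_adjoint (qb s v) * (x * qb s v))" for v
  proof -
    have xe: "compose M (left_mult M (x * qb s v)) ?e \<in> ?BC"
      by (intro basic_construction.comp basic_construction.left eBC) auto
    have "t1 (F v) = t1 (compose M (left_mult M (mat_adjoint (qb s v))) (compose M (left_mult M (x * qb s v)) ?e))"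
      unfolding F_def by (rule t1_tr[OF xe basic_construction.left]) simp
    also have "compose M (left_mult M (mat_adjoint (qb s v))) (compose M (left_mult M (x * qb s v)) ?e) =
      compose M (left_mult M (mat_adjoint (qb s v) * (x * qb s v))) ?e"
      unfolding compose_def left_mult_def by (rule restrict_ext) (simp add: mult_assoc_sq[of _ k])
    finally show ?thesis by (simp add: t1_e)
  qed
  then have "complex_of_real b * ?\<tau> x = (\<Sum>v\<in>V. ?\<tau> (mat_adjoint (qb s v) * (x * qb s v)))"
    unfolding tx by (simp add: sum_distrib_left)
  also have "\<dots> = TM (rdg (\<lambda>i j. \<Sum>j\<in>J. real (D i j) * tN s j) * x)" by (rule qb_index[of s, OF s x])
  also have "\<dots> = of_nat (dimM i) * complex_of_real (\<Sum>j\<in>J. real (D i j) * tN s j)"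
    unfolding x_def dg_mult TM_dg using i by (simp add: if_distrib[of "\<lambda>x. _ * x"] cong: if_cong)
  also have "?\<tau> x = of_nat (dimM i) * complex_of_real (s i)"
    unfolding tauS_def using x i
    by (simp add: x_def dg_mult TM_dg if_distrib[of "\<lambda>x. _ * x"] cong: if_cong)
  finally have "complex_of_real (real (dimM i) * (b * s i)) = complex_of_real (real (dimM i) * (\<Sum>j\<in>J. real (D i j) * tN s j))"
    by (simp add: ac_simps)
  then have "real (dimM i) * (b * s i) = real (dimM i) * (\<Sum>j\<in>J. real (D i j) * tN s j)"
    using of_real_eq_iff by blast
  then show ?thesis using dimM_pos[OF i] by simp
qed

end

section \<open>Markov trace, spherical state and the criterion for super-extremality\<close>

context pf_conn
begin

text \<open>The pairing of the block sizes with \<open>x\<close>, by which the weights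
  \<open>x\<close> are divided to obtain a normalized trace.\<close>

definition Anorm :: real where "Anorm = (\<Sum>i\<in>I. real (dimM i) * x i)"

lemma Anorm_pos: "0 < Anorm"
proof -
  obtain i where i: "i \<in> I" using I_ne by blast
  have "0 < real (dimM i) * x i" using dimM_pos[OF i] x_pos[OF i] by simp
  also have "\<dots> \<le> Anorm" unfolding Anorm_def using i x_pos by (intro member_le_sum) (auto simp: less_imp_le)
  finally show ?thesis .
qed

definition "sP i = x i / Anorm"

lemma sP_pos: "i \<in> I \<Longrightarrow> 0 < sP i" using x_pos Anorm_pos by (simp add: sP_def)

lemma sP_norm: "(\<Sum>i\<in>I. real (dimM i) * sP i) = 1"
  using Anorm_pos by (simp add: sP_def Anorm_def flip: sum_divide_distrib)

lemma tN_sP: "j \<in> J \<Longrightarrow> tN sP j = d * y j / Anorm"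
  using Dx[of j] by (simp add: tN_def sP_def flip: sum_divide_distrib)

lemma sP_eig: "i \<in> I \<Longrightarrow> (\<Sum>j\<in>J. real (D i j) * tN sP j) = d\<^sup>2 * sP i"
proof -
  assume i: "i \<in> I"
  have "(\<Sum>j\<in>J. real (D i j) * tN sP j) = (\<Sum>j\<in>J. real (D i j) * y j) * (d / Anorm)"
    unfolding sum_distrib_right by (rule sum.cong) (auto simp: tN_sP)
  then show ?thesis using Dy[OF i] by (simp add: sP_def power2_eq_square)
qed

text \<open>The weights of any Markov trace form a positive eigenvector. Pairing its equation with
  \<open>x\<close> forces the modulus to be \<open>d\<^sup>2\<close>; then
  \<open>eigen_unique\<close> and the normalization leave one choice.\<close>

lemma markov_trace_eq: "markov_trace one M N = tauS sP"
  unfolding markov_trace_def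
proof (rule the_equality)
  have "is_markov_trace one M N (d\<^sup>2) (tauS sP)"
    using sP_pos sP_norm sP_eig d_pos by (intro markov_if) auto
  then show "tauS sP \<in> extensional M \<and> (\<exists>b. is_markov_trace one M N b (tauS sP))"
    by (auto simp: tauS_def)
  fix \<tau> assume \<tau>: "\<tau> \<in> extensional M \<and> (\<exists>b. is_markov_trace one M N b \<tau>)"
  then obtain b where b: "is_markov_trace one M N b \<tau>" by blast
  then have "faithful_normalized_trace one M \<tau>" by (simp add: is_markov_trace_def)
  then obtain s where s: "\<And>i. i \<in> I \<Longrightarrow> 0 < s i" "(\<Sum>i\<in>I. real (dimM i) * s i) = 1"
    "\<And>x. x \<in> M \<Longrightarrow> \<tau> x = TM (rdg (\<lambda>i j. s i) * x)" using trace_density by blast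
  have \<tau>s: "\<tau> = tauS s"
    by (rule extensional_eqI[of _ M]) (use \<tau> s(3) in \<open>auto simp: tauS_def\<close>)
  have eig: "(\<Sum>j\<in>J. real (D i j) * tN s j) = b * s i" if "i \<in> I" for i
    by (rule markov_only_if[of s, OF s(1) b[unfolded \<tau>s] that])
  have xs: "0 < (\<Sum>i\<in>I. x i * s i)" using I_ne x_pos s(1) by (intro sum_pos) auto
  have "b * (\<Sum>i\<in>I. x i * s i) = (\<Sum>i\<in>I. x i * (\<Sum>j\<in>J. real (D i j) * tN s j))"
    by (simp add: eig sum_distrib_left ac_simps)
  also have "\<dots> = (\<Sum>j\<in>J. tN s j * (\<Sum>i\<in>I. real (D i j) * x i))"
    unfolding sum_distrib_left by (subst sum.swap) (simp add: ac_simps)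
  also have "\<dots> = (\<Sum>j\<in>J. d * (\<Sum>i\<in>I. real (D i j) * (s i * y j)))"
    by (rule sum.cong[OF refl], simp add: Dx, simp add: tN_def sum_distrib_left sum_distrib_right ac_simps)
  also have "\<dots> = d * (\<Sum>i\<in>I. s i * (\<Sum>j\<in>J. real (D i j) * y j))"
    unfolding sum_distrib_left by (subst sum.swap) (simp add: ac_simps)
  also have "\<dots> = d\<^sup>2 * (\<Sum>i\<in>I. x i * s i)"
    by (simp add: Dy cong: sum.cong) (simp add: sum_distrib_left power2_eq_square ac_simps)
  finally have "b = d\<^sup>2" using xs by simp
  then obtain c where c: "\<And>i. i \<in> I \<Longrightarrow> s i = c * x i" using eigen_unique[of s] eig by blast
  have "c * Anorm = 1" using s(2) unfolding Anorm_def sum_distrib_left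
    by (simp add: c ac_simps cong: sum.cong)
  then have cA: "c = 1 / Anorm" using Anorm_pos by (simp add: field_simps)
  have "rdg (\<lambda>i j. s i) = rdg (\<lambda>i j. sP i)"
    by (rule dg_cong) (simp add: c sP_def cA)
  then show "\<tau> = tauS sP" unfolding \<tau>s tauS_def by simp
qed

lemma trace_expectation_eq: "trace_expectation one M N (markov_trace one M N) = E0"
proof -
  have "rdg (\<lambda>i j. sP i / tN sP j) = rdg \<kappa>0"
    by (rule dg_cong) (use Anorm_pos in \<open>simp add: tN_sP sP_def \<kappa>0_def\<close>)
  then show ?thesis
    unfolding markov_trace_eq using trace_expectation_tauS(1)[of sP, OF sP_pos] by (simp add: ES_def E0_def)
qed

definition omega :: "complex mat \<Rightarrow> complex" where
  "omega = (\<lambda>r\<in>R. TR (rdg (\<lambda>i j. x i * y j / d) * r))"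

lemma E0_em: "E0 (em Z) = dg (\<lambda>i j. \<Sum>i\<in>I. \<Sum>l<D i j. complex_of_real (\<kappa>0 i j) * Z (i, j) l l)"
  by (simp add: E0_def Ew_def dg_em_mult Ecan_em)

lemma ops_inverse_Ind: "ops_inverse one (Ind one M N E0) = rdg (\<lambda>i j. 1 / d\<^sup>2)"
  unfolding ops_inverse_def Ind_E0
proof (rule the_equality)
  have e: "rdg (\<lambda>i j. d\<^sup>2) * rdg (\<lambda>i j. 1 / d\<^sup>2) = one" "rdg (\<lambda>i j. 1 / d\<^sup>2) * rdg (\<lambda>i j. d\<^sup>2) = one"
    using d_pos by (simp_all add: dg_mult dg_one)
  show "rdg (\<lambda>i j. 1 / d\<^sup>2) \<in> ops one \<and> rdg (\<lambda>i j. d\<^sup>2) * rdg (\<lambda>i j. 1 / d\<^sup>2) = one \<and>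
      rdg (\<lambda>i j. 1 / d\<^sup>2) * rdg (\<lambda>i j. d\<^sup>2) = one" using e by (simp add: dg_def)
  fix z assume z: "z \<in> ops one \<and> rdg (\<lambda>i j. d\<^sup>2) * z = one \<and> z * rdg (\<lambda>i j. d\<^sup>2) = one"
  have zc: "z \<in> carrier_mat k k" "z * one = z" using z by (auto simp: ops_def)
  have "z * (rdg (\<lambda>i j. d\<^sup>2) * rdg (\<lambda>i j. 1 / d\<^sup>2)) = (z * rdg (\<lambda>i j. d\<^sup>2)) * rdg (\<lambda>i j. 1 / d\<^sup>2)"
    by (rule mult_assoc_sq[symmetric]) (auto simp: zc)
  then have "z * one = one * rdg (\<lambda>i j. 1 / d\<^sup>2)" unfolding e(1) using z by simp
  then show "z = rdg (\<lambda>i j. 1 / d\<^sup>2)" using zc by (simp add: Rdp.A.u_left)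
qed

lemma dual_em: "dual_expectation one M N E0 (em Z) =
    dg (\<lambda>i j. \<Sum>j\<in>J. \<Sum>l<D i j. complex_of_real (1 / (d\<^sup>2 * \<kappa>0 i j)) * Z (i, j) l l)"
proof -
  have N': "em Z \<in> commutant one N" unfolding N.commA using em_R by simp
  have "kosaki_inverse one M N E0 = sw.Ew (rdg (\<lambda>i j. 1 / \<kappa>0 i j))"
    unfolding E0_def by (rule cond_exps_rdg(3)[of \<kappa>0, OF \<kappa>0_pos \<kappa>0_sum])
  then have "kosaki_inverse one M N E0 (em Z) = sw.Ecan (rdg (\<lambda>i j. 1 / \<kappa>0 i j) * em Z)"
    by (simp add: sw.Ew_def)
  also have "\<dots> = dg (\<lambda>i j. \<Sum>j\<in>J. \<Sum>l<D i j. complex_of_real (1 / \<kappa>0 i j) * Z (i, j) l l)"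
    unfolding dg_em_mult Fcan_em by simp
  finally show ?thesis
    using N' unfolding dual_expectation_def ops_inverse_Ind by (simp add: dg_mult sum_distrib_left)
qed

lemma TR_rdg_em: "TR (dg f * em Z) = (\<Sum>i\<in>I. \<Sum>j\<in>J. \<Sum>l<D i j. f i j * Z (i, j) l l)"
  unfolding dg_em_mult TR_em sum_IR[symmetric] by (intro sum.cong refl) auto

lemma TR_em_dg: "TR (em Z * dg f) = (\<Sum>i\<in>I. \<Sum>j\<in>J. \<Sum>l<D i j. f i j * Z (i, j) l l)"
  unfolding em_dg_mult TR_em sum_IR[symmetric] by (intro sum.cong refl) auto

lemma omega_em: "omega (em Z) = (\<Sum>i\<in>I. \<Sum>j\<in>J. \<Sum>l<D i j. complex_of_real (x i * y j / d) * Z (i, j) l l)"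
  by (simp add: omega_def TR_rdg_em)

lemma omega_dg: "omega (dg f) = (\<Sum>i\<in>I. \<Sum>j\<in>J. of_nat (D i j) * (complex_of_real (x i * y j / d) * f i j))"
  by (simp add: omega_def dg_mult TR_dg)

lemma omega_E0: "omega (E0 (em Z)) = omega (em Z)"
proof -
  define z where "z i j = (\<Sum>l<D i j. Z (i, j) l l)" for i j
  have "omega (E0 (em Z)) = (\<Sum>j\<in>J. \<Sum>i\<in>I. complex_of_real (real (D i j) * x i) * (complex_of_real (y j / d) * (\<Sum>i\<in>I. complex_of_real (\<kappa>0 i j) * z i j)))"
    unfolding E0_em omega_dg sum_distrib_left[symmetric] z_def[symmetric]
    by (subst sum.swap) (simp add: sum_divide_distrib ac_simps)
  also have "\<dots> = (\<Sum>j\<in>J. complex_of_real (\<Sum>i\<in>I. real (D i j) * x i) * (complex_of_real (y j / d) * (\<Sum>i\<in>I. complex_of_real (\<kappa>0 i j) * z i j)))"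
    by (simp only: of_real_sum sum_distrib_right)
  also have "\<dots> = (\<Sum>j\<in>J. \<Sum>i\<in>I. complex_of_real (x i * y j / d) * z i j)"
  proof (rule sum.cong[OF refl])
    fix j assume j: "j \<in> J"
    have "complex_of_real (\<Sum>i\<in>I. real (D i j) * x i) * (complex_of_real (y j / d) * (\<Sum>i\<in>I. complex_of_real (\<kappa>0 i j) * z i j)) =
      (\<Sum>i\<in>I. complex_of_real (d * y j * (y j / d) * \<kappa>0 i j) * z i j)"
      unfolding Dx[OF j] by (simp add: sum_distrib_left ac_simps)
    also have "\<dots> = (\<Sum>i\<in>I. complex_of_real (x i * y j / d) * z i j)"
      using y_pos[OF j] d_pos by (intro sum.cong refl arg_cong2[of _ _ _ _ "(*)"] arg_cong[of _ _ complex_of_real])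
        (simp add: \<kappa>0_def field_simps)
    finally show "complex_of_real (\<Sum>i\<in>I. real (D i j) * x i) * (complex_of_real (y j / d) * (\<Sum>i\<in>I. complex_of_real (\<kappa>0 i j) * z i j)) = \<dots>" .
  qed
  also have "\<dots> = omega (em Z)" unfolding omega_em z_def by (subst sum.swap) (simp add: sum_distrib_left)
  finally show ?thesis .
qed

lemma omega_dual: "omega (dual_expectation one M N E0 (em Z)) = omega (em Z)"
proof -
  define z where "z i j = (\<Sum>l<D i j. Z (i, j) l l)" for i j
  have "omega (dual_expectation one M N E0 (em Z)) = (\<Sum>i\<in>I. \<Sum>j\<in>J. complex_of_real (real (D i j) * y j) * (complex_of_real (x i / d) * (\<Sum>j\<in>J. complex_of_real (1 / (d\<^sup>2 * \<kappa>0 i j)) * z i j)))"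
    unfolding dual_em omega_dg sum_distrib_left[symmetric] z_def[symmetric]
    by (simp add: sum_divide_distrib ac_simps)
  also have "\<dots> = (\<Sum>i\<in>I. complex_of_real (\<Sum>j\<in>J. real (D i j) * y j) * (complex_of_real (x i / d) * (\<Sum>j\<in>J. complex_of_real (1 / (d\<^sup>2 * \<kappa>0 i j)) * z i j)))"
    by (simp only: of_real_sum sum_distrib_right)
  also have "\<dots> = (\<Sum>i\<in>I. \<Sum>j\<in>J. complex_of_real (x i * y j / d) * z i j)"
  proof (rule sum.cong[OF refl])
    fix i assume i: "i \<in> I"
    have "complex_of_real (\<Sum>j\<in>J. real (D i j) * y j) * (complex_of_real (x i / d) * (\<Sum>j\<in>J. complex_of_real (1 / (d\<^sup>2 * \<kappa>0 i j)) * z i j)) =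
      (\<Sum>j\<in>J. complex_of_real (d * x i * (x i / d) * (1 / (d\<^sup>2 * \<kappa>0 i j))) * z i j)"
      unfolding Dy[OF i] by (simp add: sum_distrib_left ac_simps)
    also have "\<dots> = (\<Sum>j\<in>J. complex_of_real (x i * y j / d) * z i j)"
      using x_pos[OF i] d_pos by (intro sum.cong refl arg_cong2[of _ _ _ _ "(*)"] arg_cong[of _ _ complex_of_real])
        (simp add: \<kappa>0_def field_simps power2_eq_square)
    finally show "complex_of_real (\<Sum>j\<in>J. real (D i j) * y j) * (complex_of_real (x i / d) * (\<Sum>j\<in>J. complex_of_real (1 / (d\<^sup>2 * \<kappa>0 i j)) * z i j)) = \<dots>" .
  qed
  also have "\<dots> = omega (em Z)" unfolding omega_em z_def by (simp add: sum_distrib_left)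
  finally show ?thesis .
qed

lemma omega_state: "faithful_state one R omega"
  unfolding faithful_state_def faithful_weight_def linear_functional_def
proof (intro conjI ballI allI impI)
  have pos: "pos_on (\<lambda>i j. x i * y j / d)" using x_pos y_pos d_pos by (simp add: pos_on_def)
  note posd = posd_rdg(3)[OF pos]
  fix r assume r: "r \<in> R"
  show "omega (c \<cdot>\<^sub>m r) = c * omega r" for c
    using r by (simp add: omega_def mult_smult_distrib[of _ k k _ k])
  show "omega (r + r') = omega r + omega r'" if "r' \<in> R" for r'
    using r that by (simp add: omega_def mult_add_distrib_mat[of _ k k _ k])
  show "0 \<le> omega (mat_adjoint r * r)" using Rdp.A.posd_pos[OF posd r] r by (simp add: omega_def)
  show "is_zero_mat r" if "omega (mat_adjoint r * r) = 0"
    using Rdp.A.posd_faithful[OF posd r] r that by (simp add: omega_def)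
next
  have "omega one = complex_of_real (\<Sum>i\<in>I. \<Sum>j\<in>J. real (D i j) * (x i * y j)) / d"
    unfolding dg_one[symmetric] omega_dg by (simp add: sum_divide_distrib)
  then show "omega one = 1" using xDy d_pos by simp
qed

text \<open>Let \<open>h\<close> be the density of an invariant state. Invariance under
  \<open>E0\<close> expresses \<open>h\<close> through its column traces \<open>Q\<close>,
  invariance under the dual expectation through its row traces \<open>Pt\<close>. The two
  expressions agree along edges, so by connectedness \<open>Q j / (y j)\<^sup>2\<close> is constant,
  and the value at the unit fixes the constant.\<close>

lemma spherical_state_eq: "spherical_state one M N = omega"
proof -
  have RR: "commutant one N \<inter> M = R" by (simp add: N.commA R_def)
  show ?thesis
    unfolding spherical_state_def RR minimal_expectation
  proof (rule the_equality)
    show "omega \<in> extensional R \<and> faithful_state one R omega \<and>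
      (\<forall>r\<in>R. omega (E0 r) = omega r \<and> omega (dual_expectation one M N E0 r) = omega r)"
    proof (intro conjI ballI)
      show "omega \<in> extensional R" by (simp add: omega_def)
      fix r assume "r \<in> R"
      then obtain Z where "r = em Z" by (rule RE)
      then show "omega (E0 r) = omega r" "omega (dual_expectation one M N E0 r) = omega r"
        using omega_E0 omega_dual by simp_all
    qed (rule omega_state)
    fix \<phi> assume \<phi>: "\<phi> \<in> extensional R \<and> faithful_state one R \<phi> \<and>
      (\<forall>r\<in>R. \<phi> (E0 r) = \<phi> r \<and> \<phi> (dual_expectation one M N E0 r) = \<phi> r)"
    then have lin: "linear_functional R \<phi>" and \<phi>1: "\<phi> one = 1"
      by (auto simp: faithful_state_def faithful_weight_def)
    obtain h where h: "h \<in> R" "\<And>r. r \<in> R \<Longrightarrow> \<phi> r = TR (h * r)" using Rdp.A.riesz[OF lin] by blast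
    obtain H where H: "h = em H" using h(1) by (rule RE)
    define Q where "Q j = (\<Sum>i\<in>I. \<Sum>l<D i j. H (i, j) l l)" for j
    define Pt where "Pt i = (\<Sum>j\<in>J. \<Sum>l<D i j. H (i, j) l l)" for i
    have \<phi>dg: "\<phi> (dg f) = (\<Sum>i\<in>I. \<Sum>j\<in>J. \<Sum>l<D i j. f i j * H (i, j) l l)" for f
      using h(2)[OF dg_R] unfolding H TR_em_dg by simp
    have sumQ: "(\<Sum>i\<in>I. \<Sum>j\<in>J. \<Sum>l<D i j. f j * H (i, j) l l) = (\<Sum>j\<in>J. Q j * f j)" for f
      unfolding Q_def by (subst sum.swap) (simp add: sum_distrib_left mult.commute)
    have sumP: "(\<Sum>i\<in>I. \<Sum>j\<in>J. \<Sum>l<D i j. f i * H (i, j) l l) = (\<Sum>i\<in>I. Pt i * f i)" for f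
      unfolding Pt_def by (simp add: sum_distrib_left mult.commute)
    have hQ: "h = dg (\<lambda>i j. complex_of_real (\<kappa>0 i j) * Q j)"
    proof (rule Rdp.A.T_eqI)
      fix r assume r: "r \<in> R"
      obtain Z where Z: "r = em Z" using r by (rule RE)
      have "TR (r * h) = \<phi> r" using r h by (simp add: Rdp.A.tracial)
      also have "\<phi> r = \<phi> (E0 r)" using \<phi> r by simp
      also have "\<dots> = (\<Sum>j\<in>J. Q j * (\<Sum>i\<in>I. \<Sum>l<D i j. complex_of_real (\<kappa>0 i j) * Z (i, j) l l))"
        unfolding Z E0_em \<phi>dg by (rule sumQ)
      also have "\<dots> = TR (r * dg (\<lambda>i j. complex_of_real (\<kappa>0 i j) * Q j))"
        unfolding Z TR_em_dg by (subst sum.swap[where A = I and B = J]) (simp add: sum_distrib_left ac_simps)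
      finally show "TR (r * h) = TR (r * dg (\<lambda>i j. complex_of_real (\<kappa>0 i j) * Q j))" .
    qed (use h in auto)
    have hP: "h = dg (\<lambda>i j. complex_of_real (1 / (d\<^sup>2 * \<kappa>0 i j)) * Pt i)"
    proof (rule Rdp.A.T_eqI)
      fix r assume r: "r \<in> R"
      obtain Z where Z: "r = em Z" using r by (rule RE)
      have "TR (r * h) = \<phi> r" using r h by (simp add: Rdp.A.tracial)
      also have "\<phi> r = \<phi> (dual_expectation one M N E0 r)" using \<phi> r by simp
      also have "\<dots> = (\<Sum>i\<in>I. Pt i * (\<Sum>j\<in>J. \<Sum>l<D i j. complex_of_real (1 / (d\<^sup>2 * \<kappa>0 i j)) * Z (i, j) l l))"
        unfolding Z dual_em \<phi>dg by (rule sumP)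
      also have "\<dots> = TR (r * dg (\<lambda>i j. complex_of_real (1 / (d\<^sup>2 * \<kappa>0 i j)) * Pt i))"
        unfolding Z TR_em_dg by (simp add: sum_distrib_left ac_simps)
      finally show "TR (r * h) = TR (r * dg (\<lambda>i j. complex_of_real (1 / (d\<^sup>2 * \<kappa>0 i j)) * Pt i))" .
    qed (use h in auto)
    have "Pt i / complex_of_real ((x i)\<^sup>2) = Q j / complex_of_real ((y j)\<^sup>2)" if ij: "i \<in> I" "j \<in> J" "0 < D i j" for i j
    proof -
      have "complex_of_real (\<kappa>0 i j) * Q j = complex_of_real (1 / (d\<^sup>2 * \<kappa>0 i j)) * Pt i"
        using dg_eqD[OF trans[OF hQ[symmetric] hP] ij] .
      then show ?thesis using x_pos[OF ij(1)] y_pos[OF ij(2)] d_pos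
        by (simp add: \<kappa>0_def field_simps power2_eq_square)
    qed
    then obtain c where c: "\<And>j. j \<in> J \<Longrightarrow> Q j / complex_of_real ((y j)\<^sup>2) = c"
      using connected_const[of "\<lambda>i. Pt i / complex_of_real ((x i)\<^sup>2)" "\<lambda>j. Q j / complex_of_real ((y j)\<^sup>2)"] by metis
    have hc: "h = c \<cdot>\<^sub>m rdg (\<lambda>i j. x i * y j / d)"
      unfolding hQ dg_smult
    proof (rule dg_cong)
      fix i j assume ij: "i \<in> I" "j \<in> J"
      have "Q j = c * complex_of_real ((y j)\<^sup>2)" using c[OF ij(2)] y_pos[OF ij(2)] by (simp add: field_simps)
      then show "complex_of_real (\<kappa>0 i j) * Q j = c * complex_of_real (x i * y j / d)"
        using y_pos[OF ij(2)] d_pos by (simp add: \<kappa>0_def field_simps power2_eq_square)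
    qed
    have \<phi>o: "\<phi> r = c * omega r" if r: "r \<in> R" for r
    proof -
      have "\<phi> r = TR (c \<cdot>\<^sub>m rdg (\<lambda>i j. x i * y j / d) * r)" using h(2)[OF r] hc by simp
      also have "c \<cdot>\<^sub>m rdg (\<lambda>i j. x i * y j / d) * r = c \<cdot>\<^sub>m (rdg (\<lambda>i j. x i * y j / d) * r)"
        using r by (intro mult_smult_assoc_mat[of _ k k _ k]) auto
      also have "TR \<dots> = c * omega r" using r by (simp add: omega_def)
      finally show ?thesis .
    qed
    have "omega one = 1" using omega_state by (simp add: faithful_state_def)
    then have "c = 1" using \<phi>o[OF Rdp.A.u_in] \<phi>1 by simp
    then show "\<phi> = omega" using \<phi>o \<phi>
      by (intro extensional_eqI[of _ R]) (auto simp: omega_def)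
  qed
qed

text \<open>The two expectations always coincide, so only the states on \<open>R\<close> are
  compared. The trace of \<open>M\<close> counts each copy \<open>l\<close> with multiplicity
  \<open>\<beta> j\<close>, so the Markov trace has density \<open>\<beta> j * sP i\<close> on
  \<open>R\<close>, against \<open>x i * y j / d\<close> for the spherical state; the factor
  \<open>x i\<close> cancels.\<close>

lemma super_extremal_iff_y: "super_extremal one M N \<longleftrightarrow> (\<forall>j\<in>J. Anorm * y j = d * real (\<beta> j))"
proof -
  have RR: "commutant one N \<inter> M = R" by (simp add: N.commA R_def)
  have tau_em: "tauS sP r = TR (rdg (\<lambda>i j. real (\<beta> j) * sP i) * r)" if r: "r \<in> R" for r
  proof -
    obtain Z where Z: "r = em Z" using r by (rule RE)
    show ?thesis using r unfolding tauS_def Z by (simp add: TM_dg_em)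
  qed
  have "super_extremal one M N \<longleftrightarrow> (\<forall>r\<in>R. omega r = tauS sP r)"
    unfolding super_extremal_def RR trace_expectation_eq minimal_expectation spherical_state_eq
    unfolding markov_trace_eq by simp
  also have "\<dots> \<longleftrightarrow> rdg (\<lambda>i j. x i * y j / d) = rdg (\<lambda>i j. real (\<beta> j) * sP i)"
  proof
    assume a: "\<forall>r\<in>R. omega r = tauS sP r"
    show "rdg (\<lambda>i j. x i * y j / d) = rdg (\<lambda>i j. real (\<beta> j) * sP i)"
    proof (rule Rdp.A.T_eqI)
      fix r assume r: "r \<in> R"
      have "TR (rdg (\<lambda>i j. x i * y j / d) * r) = TR (rdg (\<lambda>i j. real (\<beta> j) * sP i) * r)"
        using a r tau_em[OF r] by (simp add: omega_def)
      then show "TR (r * rdg (\<lambda>i j. x i * y j / d)) = TR (r * rdg (\<lambda>i j. real (\<beta> j) * sP i))"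
        using r by (simp add: Rdp.A.tracial[of r])
    qed auto
  qed (auto simp: omega_def tau_em)
  also have "\<dots> \<longleftrightarrow> (\<forall>j\<in>J. Anorm * y j = d * real (\<beta> j))"
  proof
    assume eq: "rdg (\<lambda>i j. x i * y j / d) = rdg (\<lambda>i j. real (\<beta> j) * sP i)"
    show "\<forall>j\<in>J. Anorm * y j = d * real (\<beta> j)"
    proof
      fix j assume j: "j \<in> J"
      obtain i where i: "i \<in> I" "0 < D i j" using col_ex[OF j] by blast
      have "complex_of_real (x i * y j / d) = complex_of_real (real (\<beta> j) * sP i)"
        using dg_eqD[OF eq i(1) j i(2)] .
      then have "x i * y j / d = real (\<beta> j) * sP i" using of_real_eq_iff by blast
      then show "Anorm * y j = d * real (\<beta> j)"
        using x_pos[OF i(1)] d_pos Anorm_pos by (simp add: sP_def field_simps)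
    qed
  next
    assume eq: "\<forall>j\<in>J. Anorm * y j = d * real (\<beta> j)"
    show "rdg (\<lambda>i j. x i * y j / d) = rdg (\<lambda>i j. real (\<beta> j) * sP i)"
    proof (rule dg_cong)
      fix i j assume "i \<in> I" "j \<in> J"
      then have "Anorm * y j = d * real (\<beta> j)" using eq by blast
      then have "y j = d * real (\<beta> j) / Anorm" using Anorm_pos by (simp add: field_simps)
      then have "x i * y j / d = real (\<beta> j) * sP i" using d_pos by (simp add: sP_def)
      then show "complex_of_real (x i * y j / d) = complex_of_real (real (\<beta> j) * sP i)" by simp
    qed
  qed
  finally show ?thesis .
qed

text \<open>If \<beta> is a multiple of \<open>y\<close>, applying \<open>D\<close> and then its
  transpose gives the equation for the block sizes. Conversely that equation makes the block sizes
  an eigenvector for \<open>d\<^sup>2\<close>, hence a multiple of \<open>x\<close>, and the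
  transpose of \<open>D\<close> carries the proportionality over to \<beta> and
  \<open>y\<close>.\<close>

lemma super_extremal_iff:
  "super_extremal one M N \<longleftrightarrow> (\<forall>j\<in>J. (\<Sum>i\<in>I. real (D i j) * real (dimM i)) = d\<^sup>2 * real (\<beta> j))"
  unfolding super_extremal_iff_y
proof
  assume a: "\<forall>j\<in>J. Anorm * y j = d * real (\<beta> j)"
  then have b: "real (\<beta> j) = Anorm / d * y j" if "j \<in> J" for j using that d_pos by (simp add: field_simps)
  have al: "real (dimM i) = Anorm * x i" if i: "i \<in> I" for i
  proof -
    have "real (dimM i) = (\<Sum>j\<in>J. real (D i j) * (Anorm / d * y j))"
      unfolding dimM_def by (simp add: b)
    also have "\<dots> = Anorm / d * (\<Sum>j\<in>J. real (D i j) * y j)" by (simp add: sum_distrib_left ac_simps)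
    finally show ?thesis using Dy[OF i] d_pos by simp
  qed
  show "\<forall>j\<in>J. (\<Sum>i\<in>I. real (D i j) * real (dimM i)) = d\<^sup>2 * real (\<beta> j)"
  proof
    fix j assume j: "j \<in> J"
    have "(\<Sum>i\<in>I. real (D i j) * real (dimM i)) = Anorm * (\<Sum>i\<in>I. real (D i j) * x i)"
      by (simp add: al sum_distrib_left ac_simps)
    then show "(\<Sum>i\<in>I. real (D i j) * real (dimM i)) = d\<^sup>2 * real (\<beta> j)"
      using Dx[OF j] d_pos by (simp add: b[OF j] power2_eq_square)
  qed
next
  assume a: "\<forall>j\<in>J. (\<Sum>i\<in>I. real (D i j) * real (dimM i)) = d\<^sup>2 * real (\<beta> j)"
  define s where "s i = real (dimM i)" for i
  have t: "tN s j = d\<^sup>2 * real (\<beta> j)" if "j \<in> J" for j using a that by (simp add: tN_def s_def)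
  have "(\<Sum>j\<in>J. real (D i j) * tN s j) = d\<^sup>2 * s i" for i
    by (simp add: t s_def dimM_def sum_distrib_left ac_simps cong: sum.cong)
  then obtain c where c: "\<And>i. i \<in> I \<Longrightarrow> s i = c * x i" using eigen_unique[of s] by blast
  \<comment> \<open>The factor of proportionality is \<open>Anorm\<close> itself because
    \<open>x\<close> has norm one.\<close>
  have A: "Anorm = c"
  proof -
    have "Anorm = (\<Sum>i\<in>I. c * (x i)\<^sup>2)" unfolding Anorm_def
      by (rule sum.cong) (use c in \<open>auto simp: s_def power2_eq_square\<close>)
    then show ?thesis using x_norm by (simp flip: sum_distrib_left)
  qed
  show "\<forall>j\<in>J. Anorm * y j = d * real (\<beta> j)"
  proof
    fix j assume j: "j \<in> J"
    have "d\<^sup>2 * real (\<beta> j) = c * (\<Sum>i\<in>I. real (D i j) * x i)"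
      unfolding t[OF j, symmetric] tN_def by (simp add: c sum_distrib_left ac_simps)
    then have "d * (d * real (\<beta> j)) = d * (c * y j)" using Dx[OF j] by (simp add: power2_eq_square)
    then show "Anorm * y j = d * real (\<beta> j)" using d_pos A by simp
  qed
qed

end

subsection \<open>Perron-Frobenius vectors\<close>

text \<open>Bolzano-Weierstrass for finitely many coordinates: a monotone subsequence is extracted
  for one coordinate after the other.\<close>

lemma convergent_subseq_finite:
  fixes v :: "nat \<Rightarrow> 'j \<Rightarrow> real"
  assumes "finite J" "\<And>n j. j \<in> J \<Longrightarrow> \<bar>v n j\<bar> \<le> 1"
  shows "\<exists>r y. strict_mono (r :: nat \<Rightarrow> nat) \<and> (\<forall>j\<in>J. (\<lambda>n. v (r n) j) \<longlonglongrightarrow> y j)"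
  using assms
proof (induction J rule: finite_induct)
  case empty
  then show ?case by (auto intro!: exI[of _ id] strict_mono_id)
next
  case (insert j J)
  then obtain r y where r: "strict_mono r" and y: "\<And>j'. j' \<in> J \<Longrightarrow> (\<lambda>n. v (r n) j') \<longlonglongrightarrow> y j'" by blast
  obtain f where f: "strict_mono f" "monoseq (\<lambda>n. v (r (f n)) j)"
    using seq_monosub[of "\<lambda>n. v (r n) j"] by auto
  have "Bseq (\<lambda>n. v (r (f n)) j)" using insert.prems by (intro BseqI'[of _ 1]) auto
  then have "convergent (\<lambda>n. v (r (f n)) j)" using f(2) Bseq_monoseq_convergent by blast
  then obtain l where l: "(\<lambda>n. v (r (f n)) j) \<longlonglongrightarrow> l" by (auto simp: convergent_def)
  have rf: "strict_mono (r \<circ> f)" using r f(1) by (rule strict_mono_o)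
  have "(\<lambda>n. v ((r \<circ> f) n) j') \<longlonglongrightarrow> (y(j := l)) j'" if "j' \<in> insert j J" for j'
  proof (cases "j' = j")
    case True then show ?thesis using l by simp
  next
    case False
    then have "j' \<in> J" using that by simp
    from LIMSEQ_subseq_LIMSEQ[OF y[OF this] f(1)] show ?thesis using False by (simp add: o_def)
  qed
  then show ?case using rf by blast
qed

text \<open>The squared norm \<open>f\<close> of the image attains its supremum on the unit ball by
  compactness. Taking absolute values does not decrease \<open>f\<close>, as \<open>D\<close> has
  nonnegative entries, so the maximizer can be chosen nonnegative. Here \<open>d\<close> is the root
  of the supremum, and homogeneity extends the bound to all vectors.\<close>

lemma nonneg_matrix_maximizer:
  fixes D :: "'i \<Rightarrow> 'j \<Rightarrow> real"
  assumes fin: "finite I" "finite J" and D0: "\<And>i j. 0 \<le> D i j" and ex: "\<exists>i\<in>I. \<exists>j\<in>J. 0 < D i j"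
  obtains d y where "0 < d" "\<And>j. 0 \<le> y j" "(\<Sum>j\<in>J. (y j)\<^sup>2) = 1"
    "(\<Sum>i\<in>I. (\<Sum>j\<in>J. D i j * y j)\<^sup>2) = d\<^sup>2"
    "\<And>w. (\<Sum>i\<in>I. (\<Sum>j\<in>J. D i j * w j)\<^sup>2) \<le> d\<^sup>2 * (\<Sum>j\<in>J. (w j)\<^sup>2)"
proof -
  define f where "f v = (\<Sum>i\<in>I. (\<Sum>j\<in>J. D i j * v j)\<^sup>2)" for v
  define B where "B = {v. (\<Sum>j\<in>J. (v j)\<^sup>2) \<le> (1::real)}"
  define s where "s = Sup (f ` B)"
  have vj: "\<bar>v j\<bar> \<le> 1" if "v \<in> B" "j \<in> J" for v j
  proof -
    have "(v j)\<^sup>2 \<le> (\<Sum>j\<in>J. (v j)\<^sup>2)" using that fin by (intro member_le_sum) auto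
    also have "\<dots> \<le> 1" using that by (simp add: B_def)
    finally show ?thesis by (simp add: abs_square_le_1)
  qed
  have bdd: "bdd_above (f ` B)"
  proof (rule bdd_aboveI)
    fix t assume "t \<in> f ` B"
    then obtain v where v: "v \<in> B" "t = f v" by blast
    have "\<bar>\<Sum>j\<in>J. D i j * v j\<bar> \<le> (\<Sum>j\<in>J. D i j)" for i
    proof -
      have "\<bar>\<Sum>j\<in>J. D i j * v j\<bar> \<le> (\<Sum>j\<in>J. \<bar>D i j * v j\<bar>)" by (rule sum_abs)
      also have "\<dots> \<le> (\<Sum>j\<in>J. D i j)"
        using D0 vj[OF v(1)] by (intro sum_mono) (auto simp: abs_mult intro!: mult_left_le)
      finally show ?thesis .
    qed
    then have "(\<Sum>j\<in>J. D i j * v j)\<^sup>2 \<le> (\<Sum>j\<in>J. D i j)\<^sup>2" for i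
      using power_mono[of "\<bar>\<Sum>j\<in>J. D i j * v j\<bar>" "\<Sum>j\<in>J. D i j" 2] by simp
    then show "t \<le> (\<Sum>i\<in>I. (\<Sum>j\<in>J. D i j)\<^sup>2)" unfolding v(2) f_def by (intro sum_mono)
  qed
  have f0: "0 \<le> f v" for v unfolding f_def by (intro sum_nonneg) simp
  have zB: "(\<lambda>_. 0) \<in> B" by (simp add: B_def)
  have "\<exists>v\<in>B. s - 1 / real (Suc n) < f v" for n
  proof -
    have "s - 1 / real (Suc n) < Sup (f ` B)" by (simp add: s_def)
    moreover have "f ` B \<noteq> {}" using zB by blast
    ultimately show ?thesis using less_cSup_iff[OF _ bdd] by blast
  qed
  then have "\<forall>n. \<exists>v. v \<in> B \<and> s - 1 / real (Suc n) < f v" by blast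
  then obtain v where v': "\<forall>n. v n \<in> B \<and> s - 1 / real (Suc n) < f (v n)" by (rule choice[THEN exE])
  then have v: "v n \<in> B" "s - 1 / real (Suc n) < f (v n)" for n by auto
  define w where "w n j = \<bar>v n j\<bar>" for n j
  have wB: "w n \<in> B" for n using v(1)[of n] by (simp add: B_def w_def)
  have fw: "f (v n) \<le> f (w n)" for n
    unfolding f_def
  proof (rule sum_mono)
    fix i
    have "\<bar>\<Sum>j\<in>J. D i j * v n j\<bar> \<le> (\<Sum>j\<in>J. \<bar>D i j * v n j\<bar>)" by (rule sum_abs)
    also have "\<dots> = (\<Sum>j\<in>J. D i j * w n j)" using D0 by (simp add: abs_mult w_def)
    finally show "(\<Sum>j\<in>J. D i j * v n j)\<^sup>2 \<le> (\<Sum>j\<in>J. D i j * w n j)\<^sup>2"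
      using power_mono[of "\<bar>\<Sum>j\<in>J. D i j * v n j\<bar>" _ 2] by simp
  qed
  obtain r y where r: "strict_mono (r :: nat \<Rightarrow> nat)" and lim: "\<And>j. j \<in> J \<Longrightarrow> (\<lambda>n. w (r n) j) \<longlonglongrightarrow> y j"
    using convergent_subseq_finite[of J w] fin vj[OF wB] by blast
  \<comment> \<open>Set to \<open>0\<close> off \<open>J\<close>, where the limit carries no
    information, because nonnegativity is claimed for every index.\<close>
  define z where "z j = (if j \<in> J then y j else 0)" for j
  have zy: "z j = y j" if "j \<in> J" for j using that by (simp add: z_def)
  have z0: "0 \<le> z j" for j
    using LIMSEQ_le_const[OF lim[of j], of 0] by (auto simp: z_def w_def)
  have "(\<lambda>n. \<Sum>j\<in>J. (w (r n) j)\<^sup>2) \<longlonglongrightarrow> (\<Sum>j\<in>J. (y j)\<^sup>2)" using lim by (intro tendsto_intros) auto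
  then have "(\<Sum>j\<in>J. (y j)\<^sup>2) \<le> 1" by (rule LIMSEQ_le_const2) (use wB in \<open>auto simp: B_def\<close>)
  then have zBall: "z \<in> B" by (simp add: B_def zy)
  have fz: "f z = f y" by (simp add: f_def zy)
  have limf: "(\<lambda>n. f (w (r n))) \<longlonglongrightarrow> f y" unfolding f_def using lim by (intro tendsto_intros) auto
  have "s \<le> f y"
  proof (rule LIMSEQ_le[of "\<lambda>n. s - 1 / real (Suc (r n))" s])
    have "(\<lambda>n. 1 / real (Suc n)) \<longlonglongrightarrow> 0" by (rule LIMSEQ_Suc[OF lim_1_over_n])
    from LIMSEQ_subseq_LIMSEQ[OF this r] have "(\<lambda>n. 1 / real (Suc (r n))) \<longlonglongrightarrow> 0" by (simp add: o_def)
    from tendsto_diff[OF tendsto_const this, of s] show "(\<lambda>n. s - 1 / real (Suc (r n))) \<longlonglongrightarrow> s" by simp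
    show "(\<lambda>n. f (w (r n))) \<longlonglongrightarrow> f y" by (rule limf)
    show "\<exists>N. \<forall>n\<ge>N. s - 1 / real (Suc (r n)) \<le> f (w (r n))"
      using v(2) fw by (meson less_imp_le order_trans)
  qed
  moreover have up: "f v \<le> s" if "v \<in> B" for v unfolding s_def using that bdd by (intro cSup_upper) auto
  ultimately have fzs: "f z = s" using zBall fz by (metis order.antisym)
  have hom: "f (\<lambda>j. c * v j) = c\<^sup>2 * f v" for c v
    unfolding f_def by (simp add: sum_distrib_left power_mult_distrib mult.left_commute flip: sum_distrib_left)
  have bound: "f w \<le> s * (\<Sum>j\<in>J. (w j)\<^sup>2)" for w
  proof (cases "(\<Sum>j\<in>J. (w j)\<^sup>2) = 0")
    case True
    then have "\<forall>j\<in>J. w j = 0" using fin by (simp add: sum_nonneg_eq_0_iff)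
    then show ?thesis by (simp add: f_def True)
  next
    case False
    define q where "q = (\<Sum>j\<in>J. (w j)\<^sup>2)"
    have q: "0 < q" using False by (simp add: q_def sum_nonneg order.not_eq_order_implies_strict)
    have "(\<lambda>j. (1 / sqrt q) * w j) \<in> B"
      using q by (simp add: B_def power_divide flip: sum_divide_distrib) (simp add: q_def)
    then have "(1 / sqrt q)\<^sup>2 * f w \<le> s" using up hom by metis
    then have "f w / q \<le> s" using q by (simp add: power_divide)
    then show ?thesis using q by (simp add: field_simps q_def)
  qed
  have spos: "0 < s"
  proof -
    obtain i j where ij: "i \<in> I" "j \<in> J" "0 < D i j" using ex by blast
    let ?e = "\<lambda>j'. if j' = j then 1 else (0::real)"
    have "?e \<in> B" using ij fin by (simp add: B_def if_distrib[of "\<lambda>x. x\<^sup>2"] cong: if_cong)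
    have "0 < (D i j)\<^sup>2" using ij by simp
    also have "(D i j)\<^sup>2 = (\<Sum>j'\<in>J. D i j' * ?e j')\<^sup>2" using ij fin by (simp add: if_distrib cong: if_cong)
    also have "\<dots> \<le> f ?e" unfolding f_def using ij fin by (intro member_le_sum) auto
    also have "\<dots> \<le> s" by (rule up[OF \<open>?e \<in> B\<close>])
    finally show ?thesis .
  qed
  have z1: "(\<Sum>j\<in>J. (z j)\<^sup>2) = 1"
  proof -
    have "s * 1 \<le> s * (\<Sum>j\<in>J. (z j)\<^sup>2)" using bound[of z] fzs by simp
    then have "1 \<le> (\<Sum>j\<in>J. (z j)\<^sup>2)" using spos by simp
    then show ?thesis using zBall by (simp add: B_def)
  qed
  show ?thesis
  proof (rule that[of "sqrt s" z])
    show "0 < sqrt s" using spos by simp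
    show "\<And>j. 0 \<le> z j" by (rule z0)
    show "(\<Sum>j\<in>J. (z j)\<^sup>2) = 1" by (rule z1)
    show "(\<Sum>i\<in>I. (\<Sum>j\<in>J. D i j * z j)\<^sup>2) = (sqrt s)\<^sup>2" using fzs spos by (simp add: f_def)
    show "(\<Sum>i\<in>I. (\<Sum>j\<in>J. D i j * w j)\<^sup>2) \<le> (sqrt s)\<^sup>2 * (\<Sum>j\<in>J. (w j)\<^sup>2)" for w
      using bound[of w] spos by (simp add: f_def)
  qed
qed

text \<open>First order condition in coordinate \<open>j\<close>: moving the maximizer by
  \<open>t\<close> in that coordinate must respect the bound, which gives
  \<open>2 * t * b + t\<^sup>2 * c \<le> 0\<close> for all \<open>t\<close> and hence
  \<open>b = 0\<close>.\<close>

lemma maximizer_eigen: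
  fixes D :: "'i \<Rightarrow> 'j \<Rightarrow> real"
  assumes fin: "finite I" "finite J" and y1: "(\<Sum>j\<in>J. (y j)\<^sup>2) = 1"
    and ymax: "(\<Sum>i\<in>I. (\<Sum>j\<in>J. D i j * y j)\<^sup>2) = d\<^sup>2"
    and bound: "\<And>w. (\<Sum>i\<in>I. (\<Sum>j\<in>J. D i j * w j)\<^sup>2) \<le> d\<^sup>2 * (\<Sum>j\<in>J. (w j)\<^sup>2)"
    and j: "j \<in> J"
  shows "(\<Sum>i\<in>I. D i j * (\<Sum>j'\<in>J. D i j' * y j')) = d\<^sup>2 * y j"
proof -
  define g where "g i = (\<Sum>j'\<in>J. D i j' * y j')" for i
  define b where "b = (\<Sum>i\<in>I. D i j * g i) - d\<^sup>2 * y j"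
  define c where "c = (\<Sum>i\<in>I. (D i j)\<^sup>2) - d\<^sup>2"
  have q: "2 * t * b + t\<^sup>2 * c \<le> 0" for t
  proof -
    let ?w = "\<lambda>j'. y j' + (if j' = j then t else 0)"
    have "(\<Sum>j'\<in>J. D i j' * ?w j') = g i + t * D i j" for i
    proof -
      have "(\<Sum>j'\<in>J. D i j' * ?w j') = g i + (\<Sum>j'\<in>J. if j' = j then t * D i j else 0)"
        unfolding g_def sum.distrib[symmetric] by (rule sum.cong) (auto simp: algebra_simps)
      then show ?thesis using j fin by simp
    qed
    then have "(\<Sum>i\<in>I. (\<Sum>j'\<in>J. D i j' * ?w j')\<^sup>2) = (\<Sum>i\<in>I. (g i)\<^sup>2) + 2 * t * (\<Sum>i\<in>I. D i j * g i) + t\<^sup>2 * (\<Sum>i\<in>I. (D i j)\<^sup>2)"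
      by (simp add: power2_sum sum.distrib sum_distrib_left power_mult_distrib ac_simps)
    moreover have "(\<Sum>j'\<in>J. (?w j')\<^sup>2) = 1 + 2 * t * y j + t\<^sup>2"
    proof -
      have "(?w j')\<^sup>2 = (y j')\<^sup>2 + (if j' = j then 2 * t * y j + t\<^sup>2 else 0)" for j'
        by (simp add: power2_sum)
      then show ?thesis using y1 j fin by (simp add: sum.distrib)
    qed
    ultimately show ?thesis using bound[of ?w] ymax
      by (simp add: b_def c_def g_def algebra_simps)
  qed
  have "b = 0"
  proof (rule ccontr)
    assume b: "b \<noteq> 0"
    \<comment> \<open>Small enough relative to \<open>c\<close> for the linear term to dominate: the
      expression is then at least \<open>b\<^sup>2 / (\<bar>c\<bar> + 1)\<close>, which is
      positive.\<close>
    define t where "t = b / (\<bar>c\<bar> + 1)"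
    have "2 * t * b + t\<^sup>2 * c \<le> 0" by (rule q)
    moreover have "2 * t * b = 2 * (b\<^sup>2 / (\<bar>c\<bar> + 1))" by (simp add: t_def power2_eq_square)
    moreover have "- (b\<^sup>2 / (\<bar>c\<bar> + 1)) \<le> t\<^sup>2 * c"
    proof -
      have p: "0 < \<bar>c\<bar> + 1" by linarith
      have "\<bar>c\<bar> / (\<bar>c\<bar> + 1) \<le> 1" using p by simp
      then have "b\<^sup>2 / (\<bar>c\<bar> + 1) * (\<bar>c\<bar> / (\<bar>c\<bar> + 1)) \<le> b\<^sup>2 / (\<bar>c\<bar> + 1)"
        using p by (intro mult_left_le) auto
      moreover have "t\<^sup>2 * \<bar>c\<bar> = b\<^sup>2 / (\<bar>c\<bar> + 1) * (\<bar>c\<bar> / (\<bar>c\<bar> + 1))"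
        by (simp add: t_def power2_eq_square)
      moreover have "- (t\<^sup>2 * \<bar>c\<bar>) \<le> t\<^sup>2 * c"
        using mult_left_mono[of "- \<bar>c\<bar>" c "t\<^sup>2"] by auto
      ultimately show ?thesis by linarith
    qed
    moreover have "0 < b\<^sup>2 / (\<bar>c\<bar> + 1)" using b by (intro divide_pos_pos) auto
    ultimately show False by linarith
  qed
  then show ?thesis by (simp add: b_def g_def)
qed

context conn_incl
begin

text \<open>The maximizer \<open>y\<close> and its image \<open>x\<close>, divided by
  \<open>d\<close>, are nonnegative. Along an edge \<open>x i\<close> and \<open>y j\<close> vanish
  together, so by connectedness all entries vanish or none does, and the normalization excludes the
  former. The variational bound is kept to identify \<open>d\<close> with the operator norm of
  \<open>D\<close>.\<close>

lemma perron_frobenius: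
  assumes "I \<noteq> {}"
  obtains x y d where "pf_conn k I J D \<beta> \<mu> \<xi> x y d"
    "\<And>w. (\<Sum>i\<in>I. (\<Sum>j\<in>J. real (D i j) * w j)\<^sup>2) \<le> d\<^sup>2 * (\<Sum>j\<in>J. (w j)\<^sup>2)"
proof -
  have ex: "\<exists>i\<in>I. \<exists>j\<in>J. 0 < real (D i j)" using assms row_ex by fastforce
  obtain d y where d: "0 < d" and y0: "\<And>j. 0 \<le> y j" and y1: "(\<Sum>j\<in>J. (y j)\<^sup>2) = 1"
    and ymax: "(\<Sum>i\<in>I. (\<Sum>j\<in>J. real (D i j) * y j)\<^sup>2) = d\<^sup>2"
    and bound: "\<And>w. (\<Sum>i\<in>I. (\<Sum>j\<in>J. real (D i j) * w j)\<^sup>2) \<le> d\<^sup>2 * (\<Sum>j\<in>J. (w j)\<^sup>2)"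
    using nonneg_matrix_maximizer[of I J "\<lambda>i j. real (D i j)"] ex by auto
  define x where "x i = (\<Sum>j\<in>J. real (D i j) * y j) / d" for i
  have Dy: "(\<Sum>j\<in>J. real (D i j) * y j) = d * x i" for i using d by (simp add: x_def)
  have Dx: "(\<Sum>i\<in>I. real (D i j) * x i) = d * y j" if j: "j \<in> J" for j
  proof -
    have "d * (\<Sum>i\<in>I. real (D i j) * x i) = (\<Sum>i\<in>I. real (D i j) * (\<Sum>j\<in>J. real (D i j) * y j))"
      unfolding Dy by (simp add: sum_distrib_left ac_simps)
    also have "\<dots> = d * (d * y j)"
      using maximizer_eigen[OF finite_I finite_J y1 ymax bound j] by (simp add: power2_eq_square)
    finally show ?thesis using d by simp
  qed
  have x0: "0 \<le> x i" for i unfolding x_def using y0 d by (intro divide_nonneg_pos sum_nonneg) auto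
  have x1: "(\<Sum>i\<in>I. (x i)\<^sup>2) = 1"
  proof -
    have "d\<^sup>2 * (\<Sum>i\<in>I. (x i)\<^sup>2) = d\<^sup>2"
      using ymax unfolding Dy by (simp add: power_mult_distrib sum_distrib_left)
    then show ?thesis using d by simp
  qed
  have xz: "x i = 0 \<longleftrightarrow> y j = 0" if ij: "i \<in> I" "j \<in> J" "0 < D i j" for i j
  proof
    assume "x i = 0"
    then have "(\<Sum>j\<in>J. real (D i j) * y j) = 0" using Dy by simp
    then have "real (D i j) * y j = 0" using ij y0 by (subst (asm) sum_nonneg_eq_0_iff) auto
    then show "y j = 0" using ij by simp
  next
    assume "y j = 0"
    then have "(\<Sum>i\<in>I. real (D i j) * x i) = 0" using Dx ij by simp
    then have "real (D i j) * x i = 0" using ij x0 by (subst (asm) sum_nonneg_eq_0_iff) auto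
    then show "x i = 0" using ij by simp
  qed
  obtain c where c: "\<And>i. i \<in> I \<Longrightarrow> (if x i = 0 then 0 else 1) = (c :: complex)"
    "\<And>j. j \<in> J \<Longrightarrow> (if y j = 0 then 0 else 1) = c"
    using connected_const[of "\<lambda>i. if x i = 0 then 0 else 1" "\<lambda>j. if y j = 0 then 0 else 1"] xz by auto
  have "c \<noteq> 0"
  proof
    assume "c = 0"
    then have "\<forall>i\<in>I. x i = 0" using c(1) by (metis zero_neq_one)
    then show False using x1 by simp
  qed
  then have "x i \<noteq> 0" if "i \<in> I" for i using c(1)[OF that] by auto
  then have xp: "0 < x i" if "i \<in> I" for i using x0[of i] that by (simp add: order.not_eq_order_implies_strict)
  have "y j \<noteq> 0" if "j \<in> J" for j using c(2)[OF that] \<open>c \<noteq> 0\<close> by auto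
  then have yp: "0 < y j" if "j \<in> J" for j using y0[of j] that by (simp add: order.not_eq_order_implies_strict)
  have "pf_conn k I J D \<beta> \<mu> \<xi> x y d"
    by unfold_locales (use xp yp d Dy Dx x1 in auto)
  then show ?thesis using bound that by blast
qed

end

context pf_conn
begin

lemma opnorm_eq:
  assumes I: "I = {..<m}" and J: "J = {..<n}"
    and bound: "\<And>w. (\<Sum>i\<in>I. (\<Sum>j\<in>J. real (D i j) * w j)\<^sup>2) \<le> d\<^sup>2 * (\<Sum>j\<in>J. (w j)\<^sup>2)"
  shows "opnorm (mat m n (\<lambda>(i, j). real (D i j))) = d"
proof (rule antisym)
  let ?A = "mat m n (\<lambda>(i, j). real (D i j))"
  have sq: "(l2norm (?A *\<^sub>v v))\<^sup>2 = (\<Sum>i\<in>I. (\<Sum>j\<in>J. real (D i j) * v $ j)\<^sup>2)" if "v \<in> carrier_vec n" for v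
    using that by (simp add: l2norm_def L2_set_def sum_nonneg I J scalar_prod_def lessThan_atLeast0)
  have sqv: "(l2norm v)\<^sup>2 = (\<Sum>j\<in>J. (v $ j)\<^sup>2)" if "v \<in> carrier_vec n" for v :: "real vec"
    using that by (simp add: l2norm_def L2_set_def sum_nonneg J)
  show "opnorm ?A \<le> d"
  proof (rule opnorm_le)
    fix v :: "real vec" assume "v \<in> carrier_vec (dim_col ?A)" and v1: "l2norm v \<le> 1"
    then have v: "v \<in> carrier_vec n" by simp
    have "(l2norm (?A *\<^sub>v v))\<^sup>2 \<le> d\<^sup>2 * (l2norm v)\<^sup>2" unfolding sq[OF v] sqv[OF v] by (rule bound)
    also have "\<dots> \<le> d\<^sup>2 * 1" using v1 by (intro mult_left_mono power_le_one l2norm_nonneg) auto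
    finally have "(l2norm (?A *\<^sub>v v))\<^sup>2 \<le> d\<^sup>2" by simp
    then show "l2norm (?A *\<^sub>v v) \<le> d" by (rule power2_le_imp_le) (use d_pos in linarith)
  qed
  define v where "v = vec n y"
  have v: "v \<in> carrier_vec n" by (simp add: v_def)
  have "(l2norm v)\<^sup>2 = 1" unfolding sqv[OF v] using y_norm by (simp add: v_def J)
  then have v1: "l2norm v \<le> 1" using power2_le_imp_le[of "l2norm v" 1] by simp
  have "(l2norm (?A *\<^sub>v v))\<^sup>2 = (\<Sum>i\<in>I. (\<Sum>j\<in>J. real (D i j) * y j)\<^sup>2)"
    unfolding sq[OF v] by (simp add: v_def J)
  also have "\<dots> = (\<Sum>i\<in>I. d\<^sup>2 * (x i)\<^sup>2)" by (rule sum.cong) (auto simp: Dy power_mult_distrib)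
  also have "\<dots> = d\<^sup>2" using x_norm by (simp flip: sum_distrib_left)
  finally have "l2norm (?A *\<^sub>v v) = d" using d_pos by (simp add: power2_eq_iff_nonneg)
  then show "d \<le> opnorm ?A" using opnorm_ge[of v ?A] v v1 by simp
qed

end

subsection \<open>Representations of multi-matrix algebras\<close>

context onb
begin

lemma one_index: "r < k \<Longrightarrow> c < k \<Longrightarrow> one $$ (r, c) = (\<Sum>p\<in>P. \<xi> p $ r * cnj (\<xi> p $ c))"
proof -
  assume rc: "r < k" "c < k"
  have "(\<Sum>p\<in>P. \<Sum>q\<in>P. (if p = q then 1 else 0) * \<xi> p $ r * cnj (\<xi> q $ c)) =
    (\<Sum>p\<in>P. \<Sum>q\<in>P. if q = p then \<xi> p $ r * cnj (\<xi> p $ c) else 0)"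
    by (intro sum.cong refl) auto
  then show ?thesis using rc by (simp add: one_def opr_def)
qed

lemma one_trace: "(\<Sum>r<k. one $$ (r, r)) = of_nat (card P)"
proof -
  have "(\<Sum>r<k. one $$ (r, r)) = (\<Sum>r<k. \<Sum>p\<in>P. \<xi> p $ r * cnj (\<xi> p $ r))"
    by (rule sum.cong) (auto simp: one_index)
  also have "\<dots> = (\<Sum>p\<in>P. \<Sum>r<k. \<xi> p $ r * cnj (\<xi> p $ r))" by (rule sum.swap)
  also have "\<dots> = (\<Sum>p\<in>P. \<xi> p \<bullet>c \<xi> p)" by (rule sum.cong) (auto simp: cscalar_sum[of _ k])
  finally show ?thesis by (simp add: ortho)
qed

text \<open>The projection \<open>one\<close> has trace \<open>card P\<close> and diagonal entries
  at most one.\<close>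

lemma card_le: "card P \<le> k"
proof -
  have le: "Re (one $$ (r, r)) \<le> 1" if r: "r < k" for r
  proof -
    have adj: "one $$ (c, r) = cnj (one $$ (r, c))" if "c < k" for c
      using one_adjoint mat_adjoint_index[of c one r] r that by simp
    have "one $$ (r, r) = (one * one) $$ (r, r)" by simp
    also have "\<dots> = (\<Sum>c<k. one $$ (r, c) * one $$ (c, r))"
      using r by (simp add: scalar_prod_def lessThan_atLeast0 del: one_one)
    also have "\<dots> = (\<Sum>c<k. complex_of_real ((cmod (one $$ (r, c)))\<^sup>2))"
      by (rule sum.cong) (auto simp: adj complex_norm_square simp del: of_real_power)
    finally have "Re (one $$ (r, r)) = (\<Sum>c<k. (cmod (one $$ (r, c)))\<^sup>2)" by simp
    also have "\<dots> \<ge> (cmod (one $$ (r, r)))\<^sup>2" using r by (intro member_le_sum) auto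
    finally have "(cmod (one $$ (r, r)))\<^sup>2 \<le> Re (one $$ (r, r))" .
    then have "(cmod (one $$ (r, r)))\<^sup>2 \<le> cmod (one $$ (r, r))" using complex_Re_le_cmod order_trans by blast
    then have "cmod (one $$ (r, r)) \<le> 1"
      using mult_strict_right_mono[of 1 "cmod (one $$ (r, r))" "cmod (one $$ (r, r))"]
      unfolding power2_eq_square by linarith
    then show ?thesis using complex_Re_le_cmod order_trans by blast
  qed
  have "real (card P) = Re (\<Sum>r<k. one $$ (r, r))" by (simp add: one_trace)
  also have "\<dots> \<le> (\<Sum>r<k. 1)" unfolding Re_sum by (rule sum_mono) (use le in auto)
  finally show ?thesis by simp
qed

lemma one_inner: "v \<in> carrier_vec k \<Longrightarrow> w \<in> carrier_vec k \<Longrightarrow>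
    (one *\<^sub>v v) \<bullet>c w = (\<Sum>p\<in>P. coef v p * cnj (coef w p))"
  by (simp add: one_mult_vec vop_inner)

lemma one_eq_identity:
  assumes "\<And>v w. v \<in> carrier_vec k \<Longrightarrow> w \<in> carrier_vec k \<Longrightarrow> (\<Sum>p\<in>P. coef v p * cnj (coef w p)) = v \<bullet>c w"
  shows "one = 1\<^sub>m k"
  by (rule cscalar_mat_eqI[of _ k k]) (auto simp: one_inner assms)

end

text \<open>A largest orthonormal system fixed by \<open>p\<close> exists because its size is at
  most \<open>a\<close>. If its span were smaller than the range of \<open>p\<close>, the part of
  some \<open>p *\<^sub>v v\<close> orthogonal to it would, after normalization, extend the
  system.\<close>

lemma projection_onb:
  assumes p: "p \<in> carrier_mat a a" "mat_adjoint p = p" "p * p = p"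
  shows "\<exists>n \<eta>. onb a {..<n::nat} \<eta> \<and> onb.one a {..<n} \<eta> = p"
proof -
  define Q where "Q n \<longleftrightarrow> (\<exists>\<eta>. onb a {..<n::nat} \<eta> \<and> (\<forall>i<n. p *\<^sub>v \<eta> i = \<eta> i))" for n
  have Q0: "Q 0" unfolding Q_def by (intro exI[of _ "\<lambda>_. 0\<^sub>v a"] conjI onb.intro) auto
  have Qle: "n \<le> a" if "Q n" for n using that onb.card_le unfolding Q_def by fastforce
  define n where "n = (GREATEST n. Q n)"
  have Qn: "Q n" unfolding n_def by (rule GreatestI_nat[of Q 0 a]) (use Q0 Qle in auto)
  have nmax: "m \<le> n" if "Q m" for m unfolding n_def by (rule Greatest_le_nat[of Q m a]) (use that Qle in auto)
  obtain \<eta> where onb: "onb a {..<n} \<eta>" and p\<eta>: "\<And>i. i < n \<Longrightarrow> p *\<^sub>v \<eta> i = \<eta> i" using Qn unfolding Q_def by blast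
  interpret o: onb a "{..<n}" \<eta> by (rule onb)
  have sa: "(p *\<^sub>v v) \<bullet>c w = v \<bullet>c (p *\<^sub>v w)" if "v \<in> carrier_vec a" "w \<in> carrier_vec a" for v w
    using cscalar_mult_mat_vec[OF p(1) that] p(2) by simp
  have pc: "p *\<^sub>v v \<in> carrier_vec a" if "v \<in> carrier_vec a" for v using p(1) that by simp
  have coefp: "o.coef (p *\<^sub>v w) i = o.coef w i" if "w \<in> carrier_vec a" "i < n" for w i
    unfolding o.coef_def using sa[of w "\<eta> i"] p\<eta> that by simp
  have pvop: "p *\<^sub>v o.vop f = o.vop f" for f
  proof (rule cscalar_eqI[of _ a])
    fix w :: "complex vec" assume w: "w \<in> carrier_vec a"
    have "(p *\<^sub>v o.vop f) \<bullet>c w = o.vop f \<bullet>c (p *\<^sub>v w)" using w by (intro sa) auto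
    also have "\<dots> = o.vop f \<bullet>c w" using w pc[OF w] coefp[OF w] by (simp add: o.vop_inner)
    finally show "(p *\<^sub>v o.vop f) \<bullet>c w = o.vop f \<bullet>c w" .
  qed (auto intro: pc)
  have "o.one = p"
  proof (rule ccontr)
    assume ne: "o.one \<noteq> p"
    obtain v where v: "v \<in> carrier_vec a" "o.one *\<^sub>v v \<noteq> p *\<^sub>v v"
      using mat_vec_eqI[of o.one a a p] ne p(1) by auto
    have ov: "o.one *\<^sub>v v = o.vop (o.coef v)" by (rule o.one_mult_vec[OF v(1)])
    define z where "z = p *\<^sub>v v - o.vop (o.coef v)"
    have z [simp]: "z \<in> carrier_vec a" using pc[OF v(1)] by (simp add: z_def)
    have z0: "z \<noteq> 0\<^sub>v a"
    proof
      assume z0: "z = 0\<^sub>v a"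
      have "p *\<^sub>v v = o.vop (o.coef v)"
      proof (rule eq_vecI)
        fix i assume "i < dim_vec (o.vop (o.coef v))"
        then have i: "i < a" by (simp add: o.vop_def)
        have "(p *\<^sub>v v - o.vop (o.coef v)) $ i = 0" using z0 i unfolding z_def by simp
        then show "(p *\<^sub>v v) $ i = o.vop (o.coef v) $ i"
          using i pc[OF v(1)] by (simp add: o.vop_def del: index_mult_mat_vec)
      qed (use p(1) in \<open>auto simp: o.vop_def\<close>)
      then show False using v(2) ov by simp
    qed
    have minus_inner: "(x - y) \<bullet>c w = x \<bullet>c w - y \<bullet>c w" if "x \<in> carrier_vec a" "y \<in> carrier_vec a" "w \<in> carrier_vec a"
      for x y w :: "complex vec"
      using that by (intro minus_scalar_prod_distrib[of _ a]) auto
    have zi: "z \<bullet>c \<eta> i = 0" if i: "i < n" for i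
    proof -
      have "z \<bullet>c \<eta> i = (p *\<^sub>v v) \<bullet>c \<eta> i - o.vop (o.coef v) \<bullet>c \<eta> i"
        unfolding z_def using i pc[OF v(1)] by (intro minus_inner) auto
      also have "\<dots> = o.coef (p *\<^sub>v v) i - o.coef (o.vop (o.coef v)) i" by (simp add: o.coef_def)
      finally show ?thesis using i v(1) by (simp add: coefp)
    qed
    have iz: "\<eta> i \<bullet>c z = 0" if "i < n" for i
      using zi[OF that] cscalar_commute[of z a "\<eta> i"] that by simp
    have pz: "p *\<^sub>v z = z"
    proof -
      have "p *\<^sub>v z = p *\<^sub>v (p *\<^sub>v v) - p *\<^sub>v o.vop (o.coef v)"
        unfolding z_def using p(1) pc[OF v(1)] by (intro mult_minus_distrib_mat_vec) auto
      also have "p *\<^sub>v (p *\<^sub>v v) = p *\<^sub>v v" using p v(1) by (simp flip: assoc_mult_mat_vec[of p a a p a v])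
      finally show ?thesis unfolding pvop z_def .
    qed
    have zz: "0 < z \<bullet>c z" using z0 conjugate_square_greater_0_vec[OF z] by simp
    obtain R where zzr: "z \<bullet>c z = complex_of_real R" and zzp: "0 < R"
      using zz by (intro that[of "Re (z \<bullet>c z)"]) (auto simp: less_complex_def complex_eq_iff)
    define c where "c = complex_of_real (1 / sqrt R)"
    have cc: "c * (cnj c * (z \<bullet>c z)) = 1"
    proof -
      have "c * (cnj c * (z \<bullet>c z)) = complex_of_real (1 / sqrt R * (1 / sqrt R * R))"
        unfolding zzr c_def complex_cnj_complex_of_real of_real_mult ..
      also have "1 / sqrt R * (1 / sqrt R * R) = 1" using zzp by (simp add: field_simps)
      finally show ?thesis by simp
    qed
    define \<eta>' where "\<eta>' i = (if i < n then \<eta> i else c \<cdot>\<^sub>v z)" for i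
    have cc': "cnj c * (c * (z \<bullet>c z)) = 1" using cc by (simp add: mult.left_commute)
    have "onb a {..<Suc n} \<eta>'"
    proof (rule onb.intro)
      fix i j assume "i \<in> {..<Suc n}" "j \<in> {..<Suc n}"
      then show "\<eta>' i \<bullet>c \<eta>' j = (if i = j then 1 else 0)"
        using zi iz cc' o.ortho
        by (auto simp: \<eta>'_def less_Suc_eq cscalar_smult_left[of _ a] cscalar_smult_right[of _ a])
    qed (auto simp: \<eta>'_def)
    moreover have "p *\<^sub>v \<eta>' i = \<eta>' i" if "i < Suc n" for i
      using that p\<eta> pz p(1) by (auto simp: \<eta>'_def mult_mat_vec[of _ a a])
    ultimately have "Q (Suc n)" unfolding Q_def by blast
    then show False using nmax by fastforce
  qed
  then show ?thesis using onb by blast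
qed

lemma matsum_index: "r < k \<Longrightarrow> c < k \<Longrightarrow> matsum k f V $$ (r, c) = (\<Sum>v\<in>V. f v $$ (r, c))"
  by (simp add: matsum_def)

lemma matsum_mult_vec_inner:
  assumes "finite V" "\<And>v. v \<in> V \<Longrightarrow> f v \<in> carrier_mat k k" "x \<in> carrier_vec k" "y \<in> carrier_vec k"
  shows "(matsum k f V *\<^sub>v x) \<bullet>c y = (\<Sum>v\<in>V. (f v *\<^sub>v x) \<bullet>c y)"
  using assms(1,2)
proof (induction V rule: finite_induct)
  case empty
  have "(0\<^sub>m k k *\<^sub>v x) = 0\<^sub>v k" using assms(3) by (intro eq_vecI) auto
  then show ?case using assms by (simp add: matsum_empty)
next
  case (insert v V)
  have "f v *\<^sub>v x \<in> carrier_vec k" "matsum k f V *\<^sub>v x \<in> carrier_vec k"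
    using insert.prems assms(3) by (auto intro!: mult_mat_vec_carrier[of _ k k])
  then show ?case using insert assms(3,4)
    by (simp add: matsum_insert add_mult_distrib_mat_vec[of _ k k] cscalar_add_left[of _ k])
qed

definition emat :: "nat \<Rightarrow> nat \<Rightarrow> nat \<Rightarrow> complex mat" where
  "emat n s t = mat n n (\<lambda>(p, q). if p = s \<and> q = t then 1 else 0)"

lemma emat_carrier [simp]: "emat n s t \<in> carrier_mat n n" by (simp add: emat_def)

lemma emat_index [simp]: "p < n \<Longrightarrow> q < n \<Longrightarrow> emat n s t $$ (p, q) = (if p = s \<and> q = t then 1 else 0)"
  by (simp add: emat_def)

lemma emat_mult: assumes "t < n" "s' < n" shows "emat n s t * emat n s' t' = (if t = s' then emat n s t' else 0\<^sub>m n n)"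
proof (rule eq_matI)
  fix p q assume "p < dim_row (if t = s' then emat n s t' else 0\<^sub>m n n)" "q < dim_col (if t = s' then emat n s t' else 0\<^sub>m n n)"
  then have pq: "p < n" "q < n" by (auto simp: emat_def split: if_splits)
  have "(emat n s t * emat n s' t') $$ (p, q) = (\<Sum>r<n. (if p = s \<and> r = t then 1 else 0) * (if r = s' \<and> q = t' then 1 else 0))"
    using pq by (simp add: emat_def scalar_prod_def lessThan_atLeast0)
  also have "\<dots> = (\<Sum>r<n. if r = t then if p = s \<and> t = s' \<and> q = t' then 1 else 0 else 0)"
    by (rule sum.cong) auto
  finally show "(emat n s t * emat n s' t') $$ (p, q) = (if t = s' then emat n s t' else 0\<^sub>m n n) $$ (p, q)"
    using pq assms by (auto simp: emat_def)
qed (auto simp: emat_def)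

lemma emat_compress:
  assumes X: "X \<in> carrier_mat n n" and s: "s < n" "s' < n"
  shows "emat n s s * X * emat n s' s' = X $$ (s, s') \<cdot>\<^sub>m emat n s s'"
proof (rule eq_matI)
  fix p q assume "p < dim_row (X $$ (s, s') \<cdot>\<^sub>m emat n s s')" "q < dim_col (X $$ (s, s') \<cdot>\<^sub>m emat n s s')"
  then have pq: "p < n" "q < n" by (auto simp: emat_def)
  have 1: "(emat n s s * X) $$ (p, r) = (if p = s then X $$ (s, r) else 0)" if r: "r < n" for r
  proof -
    have "(emat n s s * X) $$ (p, r) = (\<Sum>t<n. (if p = s \<and> t = s then 1 else 0) * X $$ (t, r))"
      using pq r X by (simp add: emat_def scalar_prod_def lessThan_atLeast0)
    also have "\<dots> = (\<Sum>t<n. if t = s then if p = s then X $$ (s, r) else 0 else 0)"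
      by (rule sum.cong) auto
    finally show ?thesis using s by simp
  qed
  have "(emat n s s * X * emat n s' s') $$ (p, q) = (\<Sum>r<n. (emat n s s * X) $$ (p, r) * emat n s' s' $$ (r, q))"
    using pq X by (simp add: scalar_prod_def lessThan_atLeast0 emat_def)
  also have "\<dots> = (\<Sum>r<n. if r = s' then if p = s \<and> q = s' then X $$ (s, s') else 0 else 0)"
    by (rule sum.cong) (use pq in \<open>auto simp: 1\<close>)
  finally show "(emat n s s * X * emat n s' s') $$ (p, q) = (X $$ (s, s') \<cdot>\<^sub>m emat n s s') $$ (p, q)"
    using pq s by (auto simp: emat_def)
qed (use X in \<open>auto simp: emat_def\<close>)

lemma emat_adjoint: "mat_adjoint (emat n s t) = emat n t s"
  by (rule eq_matI) (auto simp: emat_def)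

locale mm_alg =
  fixes k :: nat and u :: "complex mat" and A :: "complex mat set" and ns :: "nat list"
    and \<Phi> :: "complex mat \<Rightarrow> nat \<Rightarrow> complex mat"
  assumes u_car: "u \<in> carrier_mat k k" and star: "star_subalgebra u A" and iso: "multi_matrix_iso A ns \<Phi>"
begin

abbreviation "m \<equiv> length ns"

lemma ns_pos: "i < m \<Longrightarrow> 0 < ns ! i" using iso by (simp add: multi_matrix_iso_def)
lemma m_pos: "0 < m" using iso by (simp add: multi_matrix_iso_def)

lemma car [simp]: "x \<in> A \<Longrightarrow> x \<in> carrier_mat k k" using star u_car by (auto simp: star_subalgebra_def ops_def)
lemma closed [simp]: "x \<in> A \<Longrightarrow> y \<in> A \<Longrightarrow> x + y \<in> A" "x \<in> A \<Longrightarrow> y \<in> A \<Longrightarrow> x * y \<in> A"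
  "x \<in> A \<Longrightarrow> c \<cdot>\<^sub>m x \<in> A" "x \<in> A \<Longrightarrow> mat_adjoint x \<in> A" "u \<in> A"
  using star by (auto simp: star_subalgebra_def)
lemma unit: "x \<in> A \<Longrightarrow> u * x = x" "x \<in> A \<Longrightarrow> x * u = x"
  using star by (auto simp: star_subalgebra_def ops_def)

lemma \<Phi>_in: "x \<in> A \<Longrightarrow> \<Phi> x \<in> direct_sum ns" using iso by (auto simp: multi_matrix_iso_def bij_betw_def)
lemma \<Phi>_car [simp]: "x \<in> A \<Longrightarrow> i < m \<Longrightarrow> \<Phi> x i \<in> carrier_mat (ns ! i) (ns ! i)"
  using \<Phi>_in by (auto simp: direct_sum_def)
lemma \<Phi>_add: "x \<in> A \<Longrightarrow> y \<in> A \<Longrightarrow> i < m \<Longrightarrow> \<Phi> (x + y) i = \<Phi> x i + \<Phi> y i"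
  and \<Phi>_mult: "x \<in> A \<Longrightarrow> y \<in> A \<Longrightarrow> i < m \<Longrightarrow> \<Phi> (x * y) i = \<Phi> x i * \<Phi> y i"
  and \<Phi>_smult: "x \<in> A \<Longrightarrow> i < m \<Longrightarrow> \<Phi> (c \<cdot>\<^sub>m x) i = c \<cdot>\<^sub>m \<Phi> x i"
  and \<Phi>_adj: "x \<in> A \<Longrightarrow> i < m \<Longrightarrow> \<Phi> (mat_adjoint x) i = mat_adjoint (\<Phi> x i)"
  using iso by (simp_all add: multi_matrix_iso_def)

lemma \<Phi>_eqI: "x \<in> A \<Longrightarrow> y \<in> A \<Longrightarrow> (\<And>i. i < m \<Longrightarrow> \<Phi> x i = \<Phi> y i) \<Longrightarrow> x = y"
proof -
  assume x: "x \<in> A" and y: "y \<in> A" and e: "\<And>i. i < m \<Longrightarrow> \<Phi> x i = \<Phi> y i"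
  have "\<Phi> x = \<Phi> y"
    by (rule extensionalityI[of _ "{..<m}"]) (use \<Phi>_in[OF x] \<Phi>_in[OF y] e in \<open>auto simp: direct_sum_def PiE_def\<close>)
  then show "x = y" using iso x y by (auto simp: multi_matrix_iso_def bij_betw_def inj_on_def)
qed

definition \<Theta> :: "(nat \<Rightarrow> complex mat) \<Rightarrow> complex mat" where "\<Theta> = inv_into A \<Phi>"

lemma \<Theta>_in: "X \<in> direct_sum ns \<Longrightarrow> \<Theta> X \<in> A"
  and \<Phi>_\<Theta>: "X \<in> direct_sum ns \<Longrightarrow> \<Phi> (\<Theta> X) = X"
proof -
  assume X: "X \<in> direct_sum ns"
  have "\<Phi> ` A = direct_sum ns" using iso by (simp add: multi_matrix_iso_def bij_betw_def)
  then show "\<Theta> X \<in> A" "\<Phi> (\<Theta> X) = X" unfolding \<Theta>_def using X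
    by (metis inv_into_into, metis f_inv_into_f)
qed

lemma surj: "(\<And>i. i < m \<Longrightarrow> X i \<in> carrier_mat (ns ! i) (ns ! i)) \<Longrightarrow> \<exists>x\<in>A. \<forall>i<m. \<Phi> x i = X i"
proof -
  assume X: "\<And>i. i < m \<Longrightarrow> X i \<in> carrier_mat (ns ! i) (ns ! i)"
  then have "restrict X {..<m} \<in> direct_sum ns" by (auto simp: direct_sum_def)
  from \<Theta>_in[OF this] \<Phi>_\<Theta>[OF this] show ?thesis by (metis lessThan_iff restrict_apply')
qed

lemma block_in: "x \<in> carrier_mat (ns ! i) (ns ! i) \<Longrightarrow> block_embed ns i x \<in> direct_sum ns"
  by (auto simp: block_embed_def direct_sum_def)

definition eu :: "nat \<Rightarrow> nat \<Rightarrow> nat \<Rightarrow> complex mat" where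
  "eu i s t = \<Theta> (block_embed ns i (emat (ns ! i) s t))"

lemma eu_in [simp]: "eu i s t \<in> A" unfolding eu_def by (intro \<Theta>_in block_in) simp
lemma \<Phi>_eu: "j < m \<Longrightarrow> \<Phi> (eu i s t) j = (if j = i then emat (ns ! i) s t else 0\<^sub>m (ns ! j) (ns ! j))"
  unfolding eu_def by (simp add: \<Phi>_\<Theta> block_in) (simp add: block_embed_def)

lemma zero_in: "0\<^sub>m k k \<in> A" and \<Phi>_zero: "j < m \<Longrightarrow> \<Phi> (0\<^sub>m k k) j = 0\<^sub>m (ns ! j) (ns ! j)"
proof -
  have z: "0 \<cdot>\<^sub>m u = 0\<^sub>m k k" by (rule eq_matI) (auto simp: carrier_matD[OF u_car])
  show "0\<^sub>m k k \<in> A" using closed(3)[OF closed(5), of 0] z by simp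
  show "\<Phi> (0\<^sub>m k k) j = 0\<^sub>m (ns ! j) (ns ! j)" if j: "j < m"
  proof -
    have "\<Phi> (0\<^sub>m k k) j = 0 \<cdot>\<^sub>m \<Phi> u j" using \<Phi>_smult[OF closed(5) j, of 0] z by simp
    also have "\<dots> = 0\<^sub>m (ns ! j) (ns ! j)" using \<Phi>_car[OF closed(5) j] by (intro eq_matI) auto
    finally show ?thesis .
  qed
qed

lemma \<Phi>_u: "j < m \<Longrightarrow> \<Phi> u j = 1\<^sub>m (ns ! j)"
proof -
  assume j: "j < m"
  obtain x where x: "x \<in> A" "\<And>i. i < m \<Longrightarrow> \<Phi> x i = 1\<^sub>m (ns ! i)"
    using surj[of "\<lambda>i. 1\<^sub>m (ns ! i)"] by auto
  have "\<Phi> (u * x) j = \<Phi> u j * \<Phi> x j" using x(1) j by (intro \<Phi>_mult) auto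
  then show ?thesis using unit(1)[OF x(1)] x(2)[OF j] right_mult_one_mat[OF \<Phi>_car[OF closed(5) j]] by simp
qed

lemma eu_mult:
  assumes "i < m" "i' < m" "t < ns ! i" "s' < ns ! i'"
  shows "eu i s t * eu i' s' t' = (if i = i' \<and> t = s' then eu i s t' else 0\<^sub>m k k)"
proof (rule \<Phi>_eqI)
  fix j assume j: "j < m"
  have z: "0\<^sub>m n n * x = 0\<^sub>m n n" "x * 0\<^sub>m n n = 0\<^sub>m n n" if "x \<in> carrier_mat n n" for n and x :: "complex mat"
    using left_mult_zero_mat[OF that, of n] right_mult_zero_mat[OF that, of n] by auto
  show "\<Phi> (eu i s t * eu i' s' t') j = \<Phi> (if i = i' \<and> t = s' then eu i s t' else 0\<^sub>m k k) j"
    using assms j by (auto simp: \<Phi>_mult \<Phi>_eu \<Phi>_zero z emat_mult)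
qed (auto simp: zero_in)

lemma eu_adjoint: "mat_adjoint (eu i s t) = eu i t s"
  by (rule \<Phi>_eqI) (auto simp: \<Phi>_adj \<Phi>_eu emat_adjoint)

text \<open>Compression by diagonal units isolates one entry of \<open>\<Phi> x\<close>. This is how
  the entries are read off in an arbitrary representation.\<close>

lemma eu_compress:
  assumes x: "x \<in> A" and i: "i < m" "i' < m" "s < ns ! i" "s' < ns ! i'"
  shows "eu i s s * x * eu i' s' s' = (if i = i' then \<Phi> x i $$ (s, s') \<cdot>\<^sub>m eu i s s' else 0\<^sub>m k k)"
proof (rule \<Phi>_eqI)
  fix j assume j: "j < m"
  have z: "0\<^sub>m n n * x = 0\<^sub>m n n" "x * 0\<^sub>m n n = 0\<^sub>m n n" if "x \<in> carrier_mat n n" for n and x :: "complex mat"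
    using left_mult_zero_mat[OF that, of n] right_mult_zero_mat[OF that, of n] by auto
  have smz: "c \<cdot>\<^sub>m 0\<^sub>m n n = (0\<^sub>m n n :: complex mat)" for c n by (intro eq_matI) auto
  have c1: "emat (ns ! j) s s * \<Phi> x j \<in> carrier_mat (ns ! j) (ns ! j)" for s
    using \<Phi>_car[OF x j] by (intro mult_car) auto
  show "\<Phi> (eu i s s * x * eu i' s' s') j = \<Phi> (if i = i' then \<Phi> x i $$ (s, s') \<cdot>\<^sub>m eu i s s' else 0\<^sub>m k k) j"
    using x i j \<Phi>_car[OF x j] c1 by (auto simp: \<Phi>_mult \<Phi>_eu \<Phi>_zero \<Phi>_smult z smz emat_compress)
qed (use x in \<open>auto simp: zero_in\<close>)

lemma matsum_A: "finite V \<Longrightarrow> (\<And>v. v \<in> V \<Longrightarrow> f v \<in> A) \<Longrightarrow> matsum k f V \<in> A \<and>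
    (\<forall>j<m. \<Phi> (matsum k f V) j = matsum (ns ! j) (\<lambda>v. \<Phi> (f v) j) V)"
proof (induction V rule: finite_induct)
  case empty
  then show ?case by (simp add: matsum_empty zero_in \<Phi>_zero)
next
  case (insert v V)
  then show ?case by (auto simp: matsum_insert \<Phi>_add)
qed

definition "DI = (SIGMA i:{..<m}. {..<ns ! i})"

lemma eu_sum: "matsum k (\<lambda>(i, s). eu i s s) DI = u"
proof (rule \<Phi>_eqI)
  have fin: "finite DI" by (simp add: DI_def)
  note ms = matsum_A[OF fin, of "\<lambda>(i, s). eu i s s"]
  show "matsum k (\<lambda>(i, s). eu i s s) DI \<in> A" using ms by auto
  fix j assume j: "j < m"
  have "\<Phi> (matsum k (\<lambda>(i, s). eu i s s) DI) j = matsum (ns ! j) (\<lambda>v. \<Phi> (case v of (i, s) \<Rightarrow> eu i s s) j) DI"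
    using ms j by auto
  also have "\<dots> = 1\<^sub>m (ns ! j)"
  proof (rule eq_matI)
    fix r c assume "r < dim_row (1\<^sub>m (ns ! j))" "c < dim_col (1\<^sub>m (ns ! j))"
    then have rc: "r < ns ! j" "c < ns ! j" by auto
    have "matsum (ns ! j) (\<lambda>v. \<Phi> (case v of (i, s) \<Rightarrow> eu i s s) j) DI $$ (r, c) =
      (\<Sum>v\<in>DI. if v = (j, r) then if r = c then 1 else 0 else 0)"
      unfolding matsum_index[OF rc]
    proof (rule sum.cong)
      fix v assume "v \<in> DI"
      obtain i s where "v = (i, s)" by (cases v)
      then show "\<Phi> (case v of (i, s) \<Rightarrow> eu i s s) j $$ (r, c) = (if v = (j, r) then if r = c then 1 else 0 else 0)"
        using j rc by (cases "i = j") (auto simp: \<Phi>_eu)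
    qed simp
    also have "\<dots> = (if r = c then 1 else 0)" using fin j rc by (simp add: DI_def)
    finally show "matsum (ns ! j) (\<lambda>v. \<Phi> (case v of (i, s) \<Rightarrow> eu i s s) j) DI $$ (r, c) = 1\<^sub>m (ns ! j) $$ (r, c)"
      using rc by simp
  qed (auto simp: matsum_def)
  finally show "\<Phi> (matsum k (\<lambda>(i, s). eu i s s) DI) j = \<Phi> u j" using \<Phi>_u[OF j] by simp
qed simp

text \<open>Labels are block, coordinate, copy, in this order; \<open>L i\<close> is the
  multiplicity of block \<open>i\<close> in a representation.\<close>

definition "PW L = {(i, s, l). i < m \<and> s < ns ! i \<and> l < (L i :: nat)}"

lemma finite_PW: "finite (PW L)"
proof (rule finite_subset)
  show "PW L \<subseteq> (SIGMA i:{..<m}. {..<ns ! i} \<times> {..<L i})" by (auto simp: PW_def)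
qed auto

lemma sum_PW: "(\<Sum>p\<in>PW L. h p) = (\<Sum>(i, s)\<in>DI. \<Sum>l<L i. h (i, s, l))"
proof -
  have "(\<Sum>(i, s)\<in>DI. \<Sum>l<L i. h (i, s, l)) = (\<Sum>(v, l)\<in>(SIGMA v:DI. {..<L (fst v)}). h (fst v, snd v, l))"
    by (subst sum.Sigma[symmetric]) (auto simp: DI_def case_prod_unfold)
  also have "\<dots> = (\<Sum>p\<in>PW L. h p)"
    by (rule sum.reindex_bij_witness[of _ "\<lambda>(i, s, l). ((i, s), l)" "\<lambda>((i, s), l). (i, s, l)"])
      (auto simp: PW_def DI_def)
  finally show ?thesis by simp
qed

text \<open>
  The basis consists of the vectors \<open>\<pi> (eu i s 0) \<eta>\<close> with \<open>\<eta>\<close> in an orthonormal basis of the range of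
  \<open>\<pi> (eu i 0 0)\<close>.
\<close>

lemma rep_basis:
  assumes \<pi>c: "\<And>x. x \<in> A \<Longrightarrow> \<pi> x \<in> carrier_mat a a"
    and \<pi>_add: "\<And>x y. x \<in> A \<Longrightarrow> y \<in> A \<Longrightarrow> \<pi> (x + y) = \<pi> x + \<pi> y"
    and \<pi>_mult: "\<And>x y. x \<in> A \<Longrightarrow> y \<in> A \<Longrightarrow> \<pi> (x * y) = \<pi> x * \<pi> y"
    and \<pi>_smult: "\<And>x c. x \<in> A \<Longrightarrow> \<pi> (c \<cdot>\<^sub>m x) = c \<cdot>\<^sub>m \<pi> x"
    and \<pi>_adj: "\<And>x. x \<in> A \<Longrightarrow> \<pi> (mat_adjoint x) = mat_adjoint (\<pi> x)"
    and \<pi>_u: "\<pi> u = 1\<^sub>m a"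
  shows "\<exists>L w. onb a (PW L) w \<and> onb.one a (PW L) w = 1\<^sub>m a \<and>
    (\<forall>x\<in>A. \<forall>i s l i' s' l'. (i, s, l) \<in> PW L \<longrightarrow> (i', s', l') \<in> PW L \<longrightarrow>
       onb.ker w (\<pi> x) (i, s, l) (i', s', l') = (if i = i' \<and> l = l' then \<Phi> x i $$ (s, s') else 0))"
proof -
  let ?E = "\<lambda>i s t. \<pi> (eu i s t)"
  have Ec [simp]: "?E i s t \<in> carrier_mat a a" for i s t by (rule \<pi>c) simp
  have zc: "0 \<cdot>\<^sub>m X = 0\<^sub>m a a" if "X \<in> carrier_mat a a" for X :: "complex mat" using that by (intro eq_matI) auto
  have \<pi>0: "\<pi> (0\<^sub>m k k) = 0\<^sub>m a a"
  proof -
    have "0 \<cdot>\<^sub>m u = 0\<^sub>m k k" by (rule eq_matI) (auto simp: carrier_matD[OF u_car])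
    then show ?thesis using \<pi>_smult[OF closed(5), of 0] zc[OF \<pi>c[OF closed(5)]] by simp
  qed
  have Em: "?E i s t * ?E i' s' t' = (if i = i' \<and> t = s' then ?E i s t' else 0\<^sub>m a a)"
    if "i < m" "i' < m" "t < ns ! i" "s' < ns ! i'" for i s t i' s' t'
    unfolding \<pi>_mult[OF eu_in eu_in, symmetric] eu_mult[OF that] using \<pi>0 by simp
  have Ea: "mat_adjoint (?E i s t) = ?E i t s" for i s t using \<pi>_adj[of "eu i s t"] by (simp add: eu_adjoint)
  have "\<exists>n \<eta>. onb a {..<n::nat} \<eta> \<and> onb.one a {..<n} \<eta> = ?E i 0 0" if i: "i < m" for i
    using ns_pos[OF i] i by (intro projection_onb) (auto simp: Ea Em)
  then have "\<forall>i. \<exists>n \<eta>. i < m \<longrightarrow> onb a {..<n::nat} \<eta> \<and> onb.one a {..<n} \<eta> = ?E i 0 0" by blast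
  from choice[OF this] obtain L
    where "\<forall>i. \<exists>\<eta>. i < m \<longrightarrow> onb a {..<L i::nat} \<eta> \<and> onb.one a {..<L i} \<eta> = ?E i 0 0" by blast
  from choice[OF this] obtain \<eta> where onb\<eta>: "\<And>i. i < m \<Longrightarrow> onb a {..<L i} (\<eta> i)"
    and one\<eta>: "\<And>i. i < m \<Longrightarrow> onb.one a {..<L i} (\<eta> i) = ?E i 0 0" by blast
  define w where "w = (\<lambda>(i, s, l). ?E i s 0 *\<^sub>v \<eta> i l)"
  have \<eta>c: "\<eta> i l \<in> carrier_vec a" if "i < m" "l < L i" for i l
    using onb.xi_carrier[OF onb\<eta>[OF that(1)]] that by simp
  have E\<eta>: "?E i 0 0 *\<^sub>v \<eta> i l = \<eta> i l" if "i < m" "l < L i" for i l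
  proof -
    interpret o: onb a "{..<L i}" "\<eta> i" by (rule onb\<eta>[OF that(1)])
    have "\<eta> i l \<in> hilb o.one" using that by (intro o.xi_hilb) simp
    then show ?thesis using one\<eta>[OF that(1)] by (simp add: hilb_def)
  qed
  have wc: "w p \<in> carrier_vec a" if "p \<in> PW L" for p
  proof -
    obtain i s l where "p = (i, s, l)" by (cases p)
    then show ?thesis using that \<eta>c[of i l] by (auto simp: PW_def w_def intro!: mult_mat_vec_carrier[of _ a a])
  qed
  have zv: "0\<^sub>m a a *\<^sub>v v = 0\<^sub>v a" if "v \<in> carrier_vec a" for v :: "complex vec" using that by (intro eq_vecI) auto
  have Ew: "?E i s t *\<^sub>v w (i', s', l) = (if i = i' \<and> t = s' then w (i, s, l) else 0\<^sub>v a)"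
    if "i < m" "t < ns ! i" "(i', s', l) \<in> PW L" for i s t i' s' l
  proof -
    have i': "i' < m" "s' < ns ! i'" "l < L i'" using that by (auto simp: PW_def)
    have "?E i s t *\<^sub>v w (i', s', l) = (?E i s t * ?E i' s' 0) *\<^sub>v \<eta> i' l"
      unfolding w_def prod.case using \<eta>c[OF i'(1,3)] by (intro assoc_mult_mat_vec[of _ a a _ a, symmetric]) auto
    then show ?thesis unfolding Em[OF that(1) i'(1) that(2) i'(2)] using zv[OF \<eta>c[OF i'(1,3)]] by (simp add: w_def)
  qed
  have ortho: "w p \<bullet>c w q = (if p = q then 1 else 0)" if p: "p \<in> PW L" and q: "q \<in> PW L" for p q
  proof -
    obtain i s l where pp: "p = (i, s, l)" by (cases p)
    obtain i' s' l' where qq: "q = (i', s', l')" by (cases q)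
    have i: "i < m" "s < ns ! i" "l < L i" using p by (auto simp: PW_def pp)
    have i': "i' < m" "s' < ns ! i'" "l' < L i'" using q by (auto simp: PW_def qq)
    have i0: "(i, 0, l) \<in> PW L" using i ns_pos by (auto simp: PW_def)
    have i0': "(i', 0, l') \<in> PW L" using i' ns_pos by (auto simp: PW_def)
    have w0: "w (i, 0, l) = \<eta> i l" using E\<eta>[OF i(1,3)] by (simp add: w_def)
    have "w p \<bullet>c w q = (?E i s 0 *\<^sub>v w (i, 0, l)) \<bullet>c w q"
      using Ew[OF i(1) ns_pos[OF i(1)] i0] by (simp add: pp)
    also have "\<dots> = w (i, 0, l) \<bullet>c (?E i 0 s *\<^sub>v w q)"
      using wc[OF i0] wc[OF q] by (subst cscalar_mult_mat_vec[of _ a a]) (auto simp: Ea)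
    also have "?E i 0 s *\<^sub>v w q = (if i = i' \<and> s = s' then w (i, 0, l') else 0\<^sub>v a)"
      using Ew[OF i(1,2) q[unfolded qq]] by (simp add: qq)
    finally have e: "w p \<bullet>c w q = w (i, 0, l) \<bullet>c (if i = i' \<and> s = s' then w (i, 0, l') else 0\<^sub>v a)" .
    show ?thesis
    proof (cases "i = i' \<and> s = s'")
      case True
      interpret o: onb a "{..<L i}" "\<eta> i" by (rule onb\<eta>[OF i(1)])
      have "w (i, 0, l') = \<eta> i l'" using E\<eta>[OF i(1)] i' True by (simp add: w_def)
      then show ?thesis using e True w0 o.ortho[of l l'] i i' by (simp add: pp qq)
    next
      case False
      then show ?thesis using e wc[OF i0] by (auto simp: pp qq)
    qed
  qed
  have onbW: "onb a (PW L) w" by (rule onb.intro) (use finite_PW wc ortho in auto)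
  interpret W: onb a "PW L" w by (rule onbW)
  have "W.one = 1\<^sub>m a"
  proof (rule W.one_eq_identity)
    fix v v' :: "complex vec" assume v: "v \<in> carrier_vec a" and v': "v' \<in> carrier_vec a"
    \<comment> \<open>Completeness is checked on each diagonal unit, factored as
      \<open>eu i s 0 * eu i 0 0 * eu i 0 s\<close>: the basis of the range of the middle factor
      gives Parseval's identity there, and the diagonal units sum to \<open>u\<close>.\<close>
    have E1: "(?E i s s *\<^sub>v v) \<bullet>c v' = (\<Sum>l<L i. W.coef v (i, s, l) * cnj (W.coef v' (i, s, l)))"
      if i: "i < m" "s < ns ! i" for i s
    proof -
      interpret o: onb a "{..<L i}" "\<eta> i" by (rule onb\<eta>[OF i(1)])
      have oc: "o.coef (?E i 0 s *\<^sub>v v) l = W.coef v (i, s, l)" if "l < L i" "v \<in> carrier_vec a" for l v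
      proof -
        have "o.coef (?E i 0 s *\<^sub>v v) l = v \<bullet>c (?E i s 0 *\<^sub>v \<eta> i l)"
          unfolding o.coef_def using that \<eta>c[OF i(1)] by (subst cscalar_mult_mat_vec[of _ a a]) (auto simp: Ea)
        then show ?thesis unfolding W.coef_def by (simp add: w_def)
      qed
      have c1: "?E i 0 s *\<^sub>v v \<in> carrier_vec a" "?E i 0 s *\<^sub>v v' \<in> carrier_vec a"
        using v v' by (auto intro!: mult_mat_vec_carrier[of _ a a])
      have n0: "0 < ns ! i" by (rule ns_pos[OF i(1)])
      have "?E i s s = ?E i s 0 * ?E i 0 s" using Em[OF i(1) i(1) n0 n0, of s s] by simp
      also have "?E i 0 s = ?E i 0 0 * ?E i 0 s" using Em[OF i(1) i(1) n0 n0, of 0 s] by simp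
      finally have "?E i s s *\<^sub>v v = ?E i s 0 *\<^sub>v (?E i 0 0 *\<^sub>v (?E i 0 s *\<^sub>v v))"
        using v c1 by (simp add: assoc_mult_mat_vec[of _ a a _ a] mult_car)
      then have "(?E i s s *\<^sub>v v) \<bullet>c v' = (o.one *\<^sub>v (?E i 0 s *\<^sub>v v)) \<bullet>c (?E i 0 s *\<^sub>v v')"
        using cscalar_mult_mat_vec[of "?E i s 0" a a "?E i 0 0 *\<^sub>v (?E i 0 s *\<^sub>v v)" v'] v' c1 one\<eta>[OF i(1)]
        by (simp add: Ea mult_mat_vec_carrier[of _ a a])
      then show ?thesis using c1 v v' by (simp add: o.one_inner oc)
    qed
    have fin: "finite DI" by (simp add: DI_def)
    have \<pi>ms: "finite V \<Longrightarrow> (\<And>v. v \<in> V \<Longrightarrow> f v \<in> A) \<Longrightarrow> \<pi> (matsum k f V) = matsum a (\<lambda>v. \<pi> (f v)) V"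
      for f and V :: "(nat \<times> nat) set"
    proof (induction V rule: finite_induct)
      case empty
      then show ?case by (simp add: matsum_empty \<pi>0)
    next
      case (insert v V)
      then show ?case using matsum_A[of V f] by (auto simp: matsum_insert \<pi>_add \<pi>c)
    qed
    have "(\<Sum>p\<in>PW L. W.coef v p * cnj (W.coef v' p)) = (\<Sum>(i, s)\<in>DI. (?E i s s *\<^sub>v v) \<bullet>c v')"
      unfolding sum_PW by (intro sum.cong refl) (auto simp: E1 DI_def)
    also have "\<dots> = (matsum a (\<lambda>(i, s). ?E i s s) DI *\<^sub>v v) \<bullet>c v'"
      by (subst matsum_mult_vec_inner[OF fin _ v v']) (auto simp: case_prod_unfold)
    also have "matsum a (\<lambda>(i, s). ?E i s s) DI = \<pi> (matsum k (\<lambda>(i, s). eu i s s) DI)"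
      by (subst \<pi>ms[OF fin]) (auto simp: case_prod_unfold)
    finally show "(\<Sum>p\<in>PW L. W.coef v p * cnj (W.coef v' p)) = v \<bullet>c v'"
      using v by (simp add: eu_sum \<pi>_u)
  qed
  moreover have "W.ker (\<pi> x) (i, s, l) (i', s', l') = (if i = i' \<and> l = l' then \<Phi> x i $$ (s, s') else 0)"
    if x: "x \<in> A" and p: "(i, s, l) \<in> PW L" and q: "(i', s', l') \<in> PW L" for x i s l i' s' l'
  proof -
    have i: "i < m" "s < ns ! i" "l < L i" using p by (auto simp: PW_def)
    have i': "i' < m" "s' < ns ! i'" "l' < L i'" using q by (auto simp: PW_def)
    have \<pi>x [simp]: "\<pi> x \<in> carrier_mat a a" by (rule \<pi>c[OF x])
    have wi: "?E i s s *\<^sub>v w (i, s, l) = w (i, s, l)" using Ew[OF i(1,2) p] by simp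
    have wi': "?E i' s' s' *\<^sub>v w (i', s', l') = w (i', s', l')" using Ew[OF i'(1,2) q] by simp
    have xw: "\<pi> x *\<^sub>v w (i', s', l') \<in> carrier_vec a" using wc[OF q] by (intro mult_mat_vec_carrier[of _ a a]) auto
    \<comment> \<open>Both basis vectors are fixed by their diagonal units, so \<open>x\<close> may
      be compressed, which leaves a single entry of \<open>\<Phi> x\<close>.\<close>
    have "W.ker (\<pi> x) (i, s, l) (i', s', l') = (\<pi> x *\<^sub>v w (i', s', l')) \<bullet>c (?E i s s *\<^sub>v w (i, s, l))"
      by (simp add: W.ker_def W.coef_def wi)
    also have "\<dots> = (?E i s s *\<^sub>v (\<pi> x *\<^sub>v w (i', s', l'))) \<bullet>c w (i, s, l)"
      using xw wc[OF p] by (simp add: cscalar_mult_mat_vec[of _ a a] Ea)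
    also have "?E i s s *\<^sub>v (\<pi> x *\<^sub>v w (i', s', l')) = ?E i s s *\<^sub>v (\<pi> x *\<^sub>v (?E i' s' s' *\<^sub>v w (i', s', l')))"
      by (simp add: wi')
    also have "\<dots> = (?E i s s * \<pi> x * ?E i' s' s') *\<^sub>v w (i', s', l')"
      using wc[OF q] by (simp add: assoc_mult_mat_vec[of _ a a _ a] mult_car mult_mat_vec_carrier[of _ a a])
    also have "?E i s s * \<pi> x * ?E i' s' s' = \<pi> (eu i s s * x * eu i' s' s')"
      using x by (simp add: \<pi>_mult)
    also have "eu i s s * x * eu i' s' s' = (if i = i' then \<Phi> x i $$ (s, s') \<cdot>\<^sub>m eu i s s' else 0\<^sub>m k k)"
      by (rule eu_compress[OF x i(1) i'(1) i(2) i'(2)])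
    finally have e: "W.ker (\<pi> x) (i, s, l) (i', s', l') =
      (\<pi> (if i = i' then \<Phi> x i $$ (s, s') \<cdot>\<^sub>m eu i s s' else 0\<^sub>m k k) *\<^sub>v w (i', s', l')) \<bullet>c w (i, s, l)" .
    show ?thesis
    proof (cases "i = i'")
      case True
      have p': "(i, s, l') \<in> PW L" using i i' True by (auto simp: PW_def)
      have "(\<pi> (\<Phi> x i $$ (s, s') \<cdot>\<^sub>m eu i s s') *\<^sub>v w (i', s', l')) = \<Phi> x i $$ (s, s') \<cdot>\<^sub>v w (i, s, l')"
        using Ew[OF i(1) _ q, of s' s] i' True wc[OF q] by (simp add: \<pi>_smult smult_mat_vec[of _ a a])
      then show ?thesis using e True wc[OF p'] wc[OF p] ortho[OF p' p]
        by (auto simp: cscalar_smult_left[of _ a])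
    next
      case False
      then show ?thesis using e \<pi>0 zv[OF wc[OF q]] wc[OF p] by simp
    qed
  qed
  ultimately show ?thesis using onbW by blast
qed

end

lemma finite_paths: "finite I \<Longrightarrow> finite J \<Longrightarrow> finite (paths I J D \<beta> \<mu>)"
  by (rule finite_subset[of _ "SIGMA i:I. SIGMA j:J. {..<D i j} \<times> {..<\<beta> j} \<times> {..<\<mu> i}"])
    (auto simp: paths_def)

context mm_alg
begin

lemma PW_slice:
  assumes i: "i < m" "c < L i"
    and z: "\<And>i' s c'. (i', s, c') \<in> PW L \<Longrightarrow> (i', c') \<noteq> (i, c) \<Longrightarrow> g (i', s, c') = 0"
  shows "(\<Sum>r\<in>PW L. g r) = (\<Sum>s<ns ! i. g (i, s, c))"
proof -
  have "(\<Sum>r\<in>PW L. g r) = (\<Sum>r\<in>(\<lambda>s. (i, s, c)) ` {..<ns ! i}. g r)"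
  proof (rule sum.mono_neutral_right[OF finite_PW])
    show "(\<lambda>s. (i, s, c)) ` {..<ns ! i} \<subseteq> PW L" using i by (auto simp: PW_def)
    show "\<forall>r\<in>PW L - (\<lambda>s. (i, s, c)) ` {..<ns ! i}. g r = 0"
    proof
      fix r assume r: "r \<in> PW L - (\<lambda>s. (i, s, c)) ` {..<ns ! i}"
      obtain i' s c' where rr: "r = (i', s, c')" by (cases r)
      have "(i', c') \<noteq> (i, c)" using r by (auto simp: rr PW_def)
      then show "g r = 0" using z r by (auto simp: rr)
    qed
  qed
  also have "\<dots> = (\<Sum>s<ns ! i. g (i, s, c))" by (subst sum.reindex) (auto simp: inj_on_def)
  finally show ?thesis .
qed

lemma sum_PW': "(\<Sum>p\<in>PW L. h p) = (\<Sum>i<m. \<Sum>c<L i. \<Sum>s<ns ! i. h (i, s, c))"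
proof -
  have "(\<Sum>p\<in>PW L. h p) = (\<Sum>i<m. \<Sum>s<ns ! i. \<Sum>l<L i. h (i, s, l))"
    unfolding sum_PW DI_def by (subst sum.Sigma[symmetric]) auto
  also have "\<dots> = (\<Sum>i<m. \<Sum>c<L i. \<Sum>s<ns ! i. h (i, s, c))" by (intro sum.cong refl sum.swap)
  finally show ?thesis .
qed

lemma card_PW: "card (PW L) = (\<Sum>i<m. L i * ns ! i)"
  using sum_PW'[of "\<lambda>_. 1::nat" L] by simp

lemma sum_paths: "(\<Sum>p\<in>paths {..<m'} {..<m} D (\<lambda>j. ns ! j) \<mu>. h p) =
    (\<Sum>i<m'. \<Sum>c<\<mu> i. \<Sum>(j, a, l)\<in>PW (D i). h (i, j, l, a, c))"
proof -
  have "(\<Sum>i<m'. \<Sum>c<\<mu> i. \<Sum>(j, a, l)\<in>PW (D i). h (i, j, l, a, c)) =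
      (\<Sum>(i, c, j, a, l)\<in>(SIGMA i:{..<m'}. {..<\<mu> i} \<times> PW (D i)). h (i, j, l, a, c))"
    by (simp add: sum.Sigma sum.cartesian_product finite_PW case_prod_unfold)
  also have "\<dots> = (\<Sum>p\<in>paths {..<m'} {..<m} D (\<lambda>j. ns ! j) \<mu>. h p)"
    by (rule sum.reindex_bij_witness[of _ "\<lambda>(i, j, l, a, c). (i, c, j, a, l)" "\<lambda>(i, c, j, a, l). (i, j, l, a, c)"])
      (auto simp: paths_def PW_def)
  finally show ?thesis by simp
qed

text \<open>If block \<open>i\<close> has multiplicity zero, no label meets it and its matrix unit
  is represented by zero. Faithful representations therefore have positive multiplicities.\<close>

lemma rep_zero:
  assumes onb: "onb a (PW L) w" and one: "onb.one a (PW L) w = 1\<^sub>m a"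
    and i: "L i = 0" and X: "X \<in> carrier_mat a a"
    and ker: "\<And>i' s l i'' s' l'. (i', s, l) \<in> PW L \<Longrightarrow> (i'', s', l') \<in> PW L \<Longrightarrow>
      onb.ker w X (i', s, l) (i'', s', l') = (if i' = i'' \<and> l = l' then \<Phi> (eu i 0 0) i' $$ (s, s') else 0)"
  shows "X = 0\<^sub>m a a"
proof -
  interpret W: onb a "PW L" w by (rule onb)
  have ops: "Y \<in> ops W.one" if "Y \<in> carrier_mat a a" for Y using that by (auto simp: ops_def one)
  show ?thesis
  proof (rule W.ops_eqI[OF ops[OF X] ops])
    fix p q assume p: "p \<in> PW L" and q: "q \<in> PW L"
    obtain i' s l where pp: "p = (i', s, l)" by (cases p)
    obtain i'' s' l' where qq: "q = (i'', s', l')" by (cases q)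
    have "i' \<noteq> i" using p i by (auto simp: pp PW_def)
    then have "W.ker X p q = 0" using ker[of i' s l i'' s' l'] p q by (auto simp: pp qq PW_def \<Phi>_eu)
    moreover have "W.ker (0\<^sub>m a a) p q = 0" unfolding W.opr_zero[symmetric] using p q by simp
    ultimately show "W.ker X p q = W.ker (0\<^sub>m a a) p q" by simp
  qed simp
qed

lemma eu_nonzero: "i < m \<Longrightarrow> eu i 0 0 \<noteq> 0\<^sub>m k k"
proof
  assume i: "i < m" and e: "eu i 0 0 = 0\<^sub>m k k"
  have "\<Phi> (eu i 0 0) i $$ (0, 0) = 0" using ns_pos[OF i] i unfolding e by (simp add: \<Phi>_zero)
  then show False using ns_pos[OF i] i by (simp add: \<Phi>_eu)
qed

end

section \<open>Inclusions of multi-matrix algebras and their path bases\<close>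

locale mm_incl =
  fixes k :: nat and M N :: "complex mat set" and \<alpha>s \<beta>s :: "nat list"
    and \<Phi> \<Psi> :: "complex mat \<Rightarrow> nat \<Rightarrow> complex mat"
  assumes inclusion: "unital_inclusion (1\<^sub>m k) N M"
    and iso_M: "multi_matrix_iso M \<alpha>s \<Phi>" and iso_N: "multi_matrix_iso N \<beta>s \<Psi>"
begin

sublocale MA: mm_alg k "1\<^sub>m k" M \<alpha>s \<Phi>
  using inclusion iso_M by unfold_locales (auto simp: unital_inclusion_def)
sublocale NA: mm_alg k "1\<^sub>m k" N \<beta>s \<Psi>
  using inclusion iso_N by unfold_locales (auto simp: unital_inclusion_def)

lemma N_M: "x \<in> N \<Longrightarrow> x \<in> M" using inclusion by (auto simp: unital_inclusion_def)

end

text \<open>\<open>D\<close> enters as the array of multiplicities of \<open>N\<close> in the blocks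
  of \<open>M\<close>; it is identified with the matrix dimension and with the inclusion matrix only
  afterwards. The bases \<open>w i\<close> use the label order \<open>(j, a, l)\<close>, while a
  path lists the copy \<open>l\<close> before the coordinate \<open>a\<close>.\<close>

locale mm_path = mm_incl +
  fixes D :: "nat \<Rightarrow> nat \<Rightarrow> nat" and \<mu> :: "nat \<Rightarrow> nat"
    and w :: "nat \<Rightarrow> nat \<times> nat \<times> nat \<Rightarrow> complex vec" and \<xi> :: "path \<Rightarrow> complex vec"
  assumes onb_w: "i < length \<alpha>s \<Longrightarrow> onb (\<alpha>s ! i) (NA.PW (D i)) (w i)"
    and one_w: "i < length \<alpha>s \<Longrightarrow> onb.one (\<alpha>s ! i) (NA.PW (D i)) (w i) = 1\<^sub>m (\<alpha>s ! i)"
    and ker_w: "i < length \<alpha>s \<Longrightarrow> y \<in> N \<Longrightarrow> (j, a, l) \<in> NA.PW (D i) \<Longrightarrow> (j', a', l') \<in> NA.PW (D i) \<Longrightarrow>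
      onb.ker (w i) (\<Phi> y i) (j, a, l) (j', a', l') = (if j = j' \<and> l = l' then \<Psi> y j $$ (a, a') else 0)"
    and \<mu>_pos: "i < length \<alpha>s \<Longrightarrow> 0 < \<mu> i"
    and onb_\<xi>: "onb k (paths {..<length \<alpha>s} {..<length \<beta>s} D (\<lambda>j. \<beta>s ! j) \<mu>) \<xi>"
    and one_\<xi>: "onb.one k (paths {..<length \<alpha>s} {..<length \<beta>s} D (\<lambda>j. \<beta>s ! j) \<mu>) \<xi> = 1\<^sub>m k"
    and ker_\<xi>: "x \<in> M \<Longrightarrow> (i, j, l, a, c) \<in> paths {..<length \<alpha>s} {..<length \<beta>s} D (\<lambda>j. \<beta>s ! j) \<mu> \<Longrightarrow>
      (i', j', l', a', c') \<in> paths {..<length \<alpha>s} {..<length \<beta>s} D (\<lambda>j. \<beta>s ! j) \<mu> \<Longrightarrow>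
      onb.ker \<xi> x (i, j, l, a, c) (i', j', l', a', c') =
        (if i = i' \<and> c = c' then onb.ker (w i) (\<Phi> x i) (j, a, l) (j', a', l') else 0)"

context mm_incl
begin

text \<open>
  If \<open>\<zeta>\<close> is a basis adapted to \<open>M\<close> and \<open>w i\<close> is a basis adapted to the action of \<open>N\<close> on the \<open>i\<close>-th
  block, then \<open>\<xi> (i, j, l, a, c) = \<Sum>\<^sub>s w i (j, a, l) $ s \<cdot> \<zeta> (i, s, c)\<close>.
\<close>

lemma path_basis: "\<exists>D \<mu> w \<xi>. mm_path k M N \<alpha>s \<beta>s \<Phi> \<Psi> D \<mu> w \<xi>"
proof -
  let ?m = "length \<alpha>s" and ?n = "length \<beta>s"
  have "\<exists>\<mu> \<zeta>. onb k (MA.PW \<mu>) \<zeta> \<and> onb.one k (MA.PW \<mu>) \<zeta> = 1\<^sub>m k \<and>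
    (\<forall>x\<in>M. \<forall>i s l i' s' l'. (i, s, l) \<in> MA.PW \<mu> \<longrightarrow> (i', s', l') \<in> MA.PW \<mu> \<longrightarrow>
       onb.ker \<zeta> x (i, s, l) (i', s', l') = (if i = i' \<and> l = l' then \<Phi> x i $$ (s, s') else 0))"
    by (rule MA.rep_basis[of "\<lambda>x. x" k]) auto
  then obtain \<mu> \<zeta> where onb\<zeta>: "onb k (MA.PW \<mu>) \<zeta>" and one\<zeta>: "onb.one k (MA.PW \<mu>) \<zeta> = 1\<^sub>m k"
    and ker\<zeta>: "\<And>x i s l i' s' l'. x \<in> M \<Longrightarrow> (i, s, l) \<in> MA.PW \<mu> \<Longrightarrow> (i', s', l') \<in> MA.PW \<mu> \<Longrightarrow>
       onb.ker \<zeta> x (i, s, l) (i', s', l') = (if i = i' \<and> l = l' then \<Phi> x i $$ (s, s') else 0)"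
    by blast
  \<comment> \<open>\<open>M\<close> acts faithfully on the Hilbert space, so none of its blocks has
    multiplicity zero.\<close>
  have \<mu>p: "0 < \<mu> i" if i: "i < ?m" for i
  proof (rule ccontr)
    assume "\<not> 0 < \<mu> i"
    then have "MA.eu i 0 0 = 0\<^sub>m k k"
      by (intro MA.rep_zero[OF onb\<zeta> one\<zeta>, of i]) (auto simp: ker\<zeta>)
    then show False using MA.eu_nonzero[OF i] by simp
  qed
  have "\<exists>L w. onb (\<alpha>s ! i) (NA.PW L) w \<and> onb.one (\<alpha>s ! i) (NA.PW L) w = 1\<^sub>m (\<alpha>s ! i) \<and>
    (\<forall>y\<in>N. \<forall>j a l j' a' l'. (j, a, l) \<in> NA.PW L \<longrightarrow> (j', a', l') \<in> NA.PW L \<longrightarrow>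
       onb.ker w (\<Phi> y i) (j, a, l) (j', a', l') = (if j = j' \<and> l = l' then \<Psi> y j $$ (a, a') else 0))"
    if i: "i < ?m" for i
    by (rule NA.rep_basis[of "\<lambda>y. \<Phi> y i"])
      (use i N_M in \<open>auto simp: MA.\<Phi>_add MA.\<Phi>_mult MA.\<Phi>_smult MA.\<Phi>_adj MA.\<Phi>_u\<close>)
  then have "\<forall>i. \<exists>L w. i < ?m \<longrightarrow> onb (\<alpha>s ! i) (NA.PW L) w \<and> onb.one (\<alpha>s ! i) (NA.PW L) w = 1\<^sub>m (\<alpha>s ! i) \<and>
    (\<forall>y\<in>N. \<forall>j a l j' a' l'. (j, a, l) \<in> NA.PW L \<longrightarrow> (j', a', l') \<in> NA.PW L \<longrightarrow>
       onb.ker w (\<Phi> y i) (j, a, l) (j', a', l') = (if j = j' \<and> l = l' then \<Psi> y j $$ (a, a') else 0))"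
    by blast
  from choice[OF this] obtain D where "\<forall>i. \<exists>w. i < ?m \<longrightarrow> onb (\<alpha>s ! i) (NA.PW (D i)) w \<and>
    onb.one (\<alpha>s ! i) (NA.PW (D i)) w = 1\<^sub>m (\<alpha>s ! i) \<and>
    (\<forall>y\<in>N. \<forall>j a l j' a' l'. (j, a, l) \<in> NA.PW (D i) \<longrightarrow> (j', a', l') \<in> NA.PW (D i) \<longrightarrow>
       onb.ker w (\<Phi> y i) (j, a, l) (j', a', l') = (if j = j' \<and> l = l' then \<Psi> y j $$ (a, a') else 0))"
    ..
  from choice[OF this] obtain w where w: "\<forall>i. i < ?m \<longrightarrow> onb (\<alpha>s ! i) (NA.PW (D i)) (w i) \<and>
    onb.one (\<alpha>s ! i) (NA.PW (D i)) (w i) = 1\<^sub>m (\<alpha>s ! i) \<and>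
    (\<forall>y\<in>N. \<forall>j a l j' a' l'. (j, a, l) \<in> NA.PW (D i) \<longrightarrow> (j', a', l') \<in> NA.PW (D i) \<longrightarrow>
       onb.ker (w i) (\<Phi> y i) (j, a, l) (j', a', l') = (if j = j' \<and> l = l' then \<Psi> y j $$ (a, a') else 0))"
    ..
  have onbw: "onb (\<alpha>s ! i) (NA.PW (D i)) (w i)"
    and onew: "onb.one (\<alpha>s ! i) (NA.PW (D i)) (w i) = 1\<^sub>m (\<alpha>s ! i)" if "i < ?m" for i
    using w that by simp_all
  have kerw: "onb.ker (w i) (\<Phi> y i) (j, a, l) (j', a', l') = (if j = j' \<and> l = l' then \<Psi> y j $$ (a, a') else 0)"
    if "i < ?m" "y \<in> N" "(j, a, l) \<in> NA.PW (D i)" "(j', a', l') \<in> NA.PW (D i)" for i y j a l j' a' l'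
    using w that by simp
  interpret Z: onb k "MA.PW \<mu>" \<zeta> by (rule onb\<zeta>)
  let ?P = "paths {..<?m} {..<?n} D (\<lambda>j. \<beta>s ! j) \<mu>"
  define f where "f = (\<lambda>(i, j, l, a, c) (i', s, c'). if i' = i \<and> c' = (c::nat) then w i (j, a, l) $ s else 0)"
  define \<xi> where "\<xi> p = Z.vop (f p)" for p
  have wc: "w i q \<in> carrier_vec (\<alpha>s ! i)" if "i < ?m" "q \<in> NA.PW (D i)" for i q
    using onb.xi_carrier[OF onbw[OF that(1)] that(2)] .
  have Pd: "i < ?m" "c < \<mu> i" "(j, a, l) \<in> NA.PW (D i)" if "(i, j, l, a, c) \<in> ?P" for i j l a c
    using that by (auto simp: paths_def NA.PW_def)
  have slice: "(\<Sum>r\<in>MA.PW \<mu>. g r * f (i, j, l, a, c) r) = (\<Sum>s<\<alpha>s ! i. g (i, s, c) * w i (j, a, l) $ s)"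
    "(\<Sum>r\<in>MA.PW \<mu>. g r * cnj (f (i, j, l, a, c) r)) = (\<Sum>s<\<alpha>s ! i. g (i, s, c) * cnj (w i (j, a, l) $ s))"
    if "(i, j, l, a, c) \<in> ?P" for i j l a c and g :: "nat \<times> nat \<times> nat \<Rightarrow> complex"
    using Pd[OF that] by (subst MA.PW_slice[of i c]; auto simp: f_def)+
  have onb\<xi>: "onb k ?P \<xi>"
  proof (rule onb.intro)
    show "finite ?P" by (simp add: finite_paths)
    show "\<xi> p \<in> carrier_vec k" for p by (simp add: \<xi>_def)
    fix p q assume p: "p \<in> ?P" and q: "q \<in> ?P"
    obtain i j l a c where pp: "p = (i, j, l, a, c)" by (cases p)
    obtain i' j' l' a' c' where qq: "q = (i', j', l', a', c')" by (cases q)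
    note i = Pd[OF p[unfolded pp]] and i' = Pd[OF q[unfolded qq]]
    have "\<xi> p \<bullet>c \<xi> q = (\<Sum>r\<in>MA.PW \<mu>. f p r * cnj (f q r))" by (simp add: \<xi>_def Z.vop_inner_vop)
    also have "\<dots> = (\<Sum>s<\<alpha>s ! i'. f p (i', s, c') * cnj (w i' (j', a', l') $ s))"
      unfolding qq by (rule slice(2)[OF q[unfolded qq]])
    also have "\<dots> = (if i = i' \<and> c = c' then w i (j, a, l) \<bullet>c w i (j', a', l') else 0)"
      using wc[OF i(1,3)] wc[OF i'(1,3)] by (auto simp: pp f_def cscalar_sum[of _ "\<alpha>s ! i"])
    also have "\<dots> = (if p = q then 1 else 0)"
      using i i' onb.ortho[OF onbw[OF i(1)], of "(j, a, l)" "(j', a', l')"] by (auto simp: pp qq)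
    finally show "\<xi> p \<bullet>c \<xi> q = (if p = q then 1 else 0)" .
  qed
  interpret X: onb k ?P \<xi> by (rule onb\<xi>)
  \<comment> \<open>Coefficients in the path basis are coefficients, in the basis
    \<open>w i\<close>, of the slice of \<open>v\<close> at \<open>i\<close> and \<open>c\<close>.
    Completeness of the path basis is thereby reduced to that of \<open>w i\<close> and of
    \<open>\<zeta>\<close>.\<close>
  have Xcoef: "X.coef v (i, j, l, a, c) =
      onb.coef (w i) (vec (\<alpha>s ! i) (\<lambda>s. Z.coef v (i, s, c))) (j, a, l)"
    if v: "v \<in> carrier_vec k" and p: "(i, j, l, a, c) \<in> ?P" for v i j l a c
  proof -
    note i = Pd[OF p]
    interpret W: onb "\<alpha>s ! i" "NA.PW (D i)" "w i" by (rule onbw[OF i(1)])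
    have "X.coef v (i, j, l, a, c) = (Z.one *\<^sub>v v) \<bullet>c \<xi> (i, j, l, a, c)" using v by (simp add: X.coef_def one\<zeta>)
    also have "\<dots> = (\<Sum>r\<in>MA.PW \<mu>. Z.coef v r * cnj (f (i, j, l, a, c) r))"
      using v by (simp add: Z.one_mult_vec \<xi>_def Z.vop_inner_vop)
    also have "\<dots> = (\<Sum>s<\<alpha>s ! i. Z.coef v (i, s, c) * cnj (w i (j, a, l) $ s))" by (rule slice(2)[OF p])
    also have "\<dots> = vec (\<alpha>s ! i) (\<lambda>s. Z.coef v (i, s, c)) \<bullet>c w i (j, a, l)"
      using wc[OF i(1,3)] by (simp add: cscalar_sum[of _ "\<alpha>s ! i"])
    finally show ?thesis by (simp add: W.coef_def)
  qed
  have X1: "X.one = 1\<^sub>m k"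
  proof (rule X.one_eq_identity)
    fix v v' :: "complex vec" assume v: "v \<in> carrier_vec k" and v': "v' \<in> carrier_vec k"
    have "(\<Sum>p\<in>?P. X.coef v p * cnj (X.coef v' p)) =
      (\<Sum>i<?m. \<Sum>c<\<mu> i. \<Sum>(j, a, l)\<in>NA.PW (D i). X.coef v (i, j, l, a, c) * cnj (X.coef v' (i, j, l, a, c)))"
      by (rule NA.sum_paths)
    also have "\<dots> = (\<Sum>i<?m. \<Sum>c<\<mu> i. \<Sum>s<\<alpha>s ! i. Z.coef v (i, s, c) * cnj (Z.coef v' (i, s, c)))"
    proof (intro sum.cong refl)
      fix i c assume "i \<in> {..<?m}" "c \<in> {..<\<mu> i}"
      then have i: "i < ?m" and c: "c < \<mu> i" by auto
      interpret W: onb "\<alpha>s ! i" "NA.PW (D i)" "w i" by (rule onbw[OF i])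
      let ?V = "\<lambda>v. vec (\<alpha>s ! i) (\<lambda>s. Z.coef v (i, s, c))"
      have "(\<Sum>(j, a, l)\<in>NA.PW (D i). X.coef v (i, j, l, a, c) * cnj (X.coef v' (i, j, l, a, c))) =
        (\<Sum>p\<in>NA.PW (D i). W.coef (?V v) p * cnj (W.coef (?V v') p))"
      proof (intro sum.cong refl)
        fix p assume p: "p \<in> NA.PW (D i)"
        obtain j a l where pp: "p = (j, a, l)" by (cases p)
        have "(i, j, l, a, c) \<in> ?P" using i c p by (auto simp: pp paths_def NA.PW_def)
        then show "(case p of (j, a, l) \<Rightarrow> X.coef v (i, j, l, a, c) * cnj (X.coef v' (i, j, l, a, c))) =
          W.coef (?V v) p * cnj (W.coef (?V v') p)" by (simp add: pp Xcoef v v')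
      qed
      also have "\<dots> = (W.one *\<^sub>v ?V v) \<bullet>c ?V v'" by (subst W.one_inner) auto
      also have "\<dots> = (\<Sum>s<\<alpha>s ! i. Z.coef v (i, s, c) * cnj (Z.coef v' (i, s, c)))"
        by (simp add: onew[OF i] cscalar_sum[of _ "\<alpha>s ! i"])
      finally show "(\<Sum>(j, a, l)\<in>NA.PW (D i). X.coef v (i, j, l, a, c) * cnj (X.coef v' (i, j, l, a, c))) =
        (\<Sum>s<\<alpha>s ! i. Z.coef v (i, s, c) * cnj (Z.coef v' (i, s, c)))" .
    qed
    also have "\<dots> = (\<Sum>p\<in>MA.PW \<mu>. Z.coef v p * cnj (Z.coef v' p))" by (rule MA.sum_PW'[symmetric])
    also have "\<dots> = v \<bullet>c v'" using Z.one_inner[OF v v'] v by (simp add: one\<zeta>)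
    finally show "(\<Sum>p\<in>?P. X.coef v p * cnj (X.coef v' p)) = v \<bullet>c v'" .
  qed
  have Xker: "X.ker x (i, j, l, a, c) (i', j', l', a', c') =
      (if i = i' \<and> c = c' then onb.ker (w i) (\<Phi> x i) (j, a, l) (j', a', l') else 0)"
    if x: "x \<in> M" and p: "(i, j, l, a, c) \<in> ?P" and q: "(i', j', l', a', c') \<in> ?P"
    for x i j l a c i' j' l' a' c'
  proof -
    note i = Pd[OF p] and i' = Pd[OF q]
    interpret W: onb "\<alpha>s ! i" "NA.PW (D i)" "w i" by (rule onbw[OF i(1)])
    have "x \<in> ops Z.one" using MA.car[OF x] by (auto simp: ops_def one\<zeta>)
    then have xo: "x = Z.opr (Z.ker x)" by (rule Z.opr_ker[symmetric])
    have "X.ker x (i, j, l, a, c) (i', j', l', a', c') = (Z.opr (Z.ker x) *\<^sub>v Z.vop (f (i', j', l', a', c'))) \<bullet>c Z.vop (f (i, j, l, a, c))"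
      unfolding X.ker_def X.coef_def \<xi>_def by (subst xo) (rule refl)
    also have "\<dots> = (\<Sum>r\<in>MA.PW \<mu>. (\<Sum>t\<in>MA.PW \<mu>. Z.ker x r t * f (i', j', l', a', c') t) * cnj (f (i, j, l, a, c) r))"
      by (simp add: Z.vop_inner_vop)
    also have "\<dots> = (\<Sum>s<\<alpha>s ! i. (\<Sum>t<\<alpha>s ! i'. Z.ker x (i, s, c) (i', t, c') * w i' (j', a', l') $ t) * cnj (w i (j, a, l) $ s))"
      unfolding slice(1)[OF q] slice(2)[OF p] ..
    also have "\<dots> = (\<Sum>s<\<alpha>s ! i. (\<Sum>t<\<alpha>s ! i'. (if i = i' \<and> c = c' then \<Phi> x i $$ (s, t) else 0) * w i' (j', a', l') $ t) * cnj (w i (j, a, l) $ s))"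
    proof (intro sum.cong refl arg_cong2[of _ _ _ _ "(*)"])
      fix s t assume st: "s \<in> {..<\<alpha>s ! i}" "t \<in> {..<\<alpha>s ! i'}"
      show "Z.ker x (i, s, c) (i', t, c') = (if i = i' \<and> c = c' then \<Phi> x i $$ (s, t) else 0)"
        using st i i' by (intro ker\<zeta>[OF x]) (auto simp: MA.PW_def)
    qed
    also have "\<dots> = (if i = i' \<and> c = c' then W.ker (\<Phi> x i) (j, a, l) (j', a', l') else 0)"
    proof (cases "i = i' \<and> c = c'")
      case True
      have wq: "w i (j', a', l') \<in> carrier_vec (\<alpha>s ! i)" using wc[OF i'(1,3)] True by simp
      have "W.ker (\<Phi> x i) (j, a, l) (j', a', l') = (\<Phi> x i *\<^sub>v w i (j', a', l')) \<bullet>c w i (j, a, l)"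
        by (simp add: W.ker_def W.coef_def)
      also have "\<dots> = (\<Sum>s<\<alpha>s ! i. (\<Sum>t<\<alpha>s ! i. \<Phi> x i $$ (s, t) * w i (j', a', l') $ t) * cnj (w i (j, a, l) $ s))"
        using wc[OF i(1,3)] wq MA.\<Phi>_car[OF x i(1)]
        by (subst cscalar_sum[of _ "\<alpha>s ! i"])
          (auto simp: scalar_prod_def lessThan_atLeast0 intro!: mult_mat_vec_carrier[of _ "\<alpha>s ! i" "\<alpha>s ! i"] sum.cong)
      finally show ?thesis using True by simp
    qed auto
    finally show ?thesis .
  qed
  have "mm_path k M N \<alpha>s \<beta>s \<Phi> \<Psi> D \<mu> w \<xi>"
    by (intro mm_path.intro mm_path_axioms.intro mm_incl_axioms)
      (use onbw onew kerw \<mu>p onb\<xi> X1 Xker in auto)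
  then show ?thesis by blast
qed

end

subsection \<open>Matrix dimension and inclusion matrix\<close>

lemma mat_mult_index:
  "A \<in> carrier_mat n k \<Longrightarrow> B \<in> carrier_mat k m \<Longrightarrow> r < n \<Longrightarrow> c < m \<Longrightarrow>
   (A * B) $$ (r, c) = (\<Sum>i<k. A $$ (r, i) * B $$ (i, c))"
  by (simp add: scalar_prod_def lessThan_atLeast0)

context onb
begin

lemma unitary_basis:
  assumes e: "bij_betw e {..<k} P" and one: "one = 1\<^sub>m k"
  defines "U \<equiv> mat k k (\<lambda>(r, q). \<xi> (e q) $ r)"
  shows "U * mat_adjoint U = 1\<^sub>m k" "mat_adjoint U * U = 1\<^sub>m k"
    and "Y \<in> carrier_mat k k \<Longrightarrow> (\<And>q q'. q < k \<Longrightarrow> q' < k \<Longrightarrow> K (e q) (e q') = Y $$ (q, q')) \<Longrightarrow>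
      U * Y * mat_adjoint U = opr K"
proof -
  have U [simp]: "U \<in> carrier_mat k k" by (simp add: U_def)
  have Ui: "U $$ (r, q) = \<xi> (e q) $ r" if "r < k" "q < k" for r q using that by (simp add: U_def)
  have conj: "U * Y * mat_adjoint U = opr K"
    if Y: "Y \<in> carrier_mat k k" and K: "\<And>q q'. q < k \<Longrightarrow> q' < k \<Longrightarrow> K (e q) (e q') = Y $$ (q, q')" for Y K
  proof (rule eq_matI)
    fix r c assume "r < dim_row (opr K)" "c < dim_col (opr K)"
    then have rc: "r < k" "c < k" by auto
    have UY: "(U * Y) $$ (r, q') = (\<Sum>q<k. U $$ (r, q) * Y $$ (q, q'))" if "q' < k" for q'
      using U Y rc(1) that by (rule mat_mult_index)
    have "(U * Y * mat_adjoint U) $$ (r, c) = (\<Sum>q'<k. (U * Y) $$ (r, q') * mat_adjoint U $$ (q', c))"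
      by (rule mat_mult_index[OF mult_carrier_mat[OF U Y] mat_adjoint_carrier[OF U] rc])
    also have "\<dots> = (\<Sum>q'<k. \<Sum>q<k. K (e q) (e q') * \<xi> (e q) $ r * cnj (\<xi> (e q') $ c))"
      using rc U by (intro sum.cong refl) (simp add: UY Ui K sum_distrib_left mult_ac carrier_matD[OF U])
    also have "\<dots> = (\<Sum>q<k. \<Sum>q'<k. K (e q) (e q') * \<xi> (e q) $ r * cnj (\<xi> (e q') $ c))" by (rule sum.swap)
    also have "\<dots> = (\<Sum>q<k. \<Sum>p'\<in>P. K (e q) p' * \<xi> (e q) $ r * cnj (\<xi> p' $ c))"
      by (intro sum.cong refl) (rule sum.reindex_bij_betw[OF e])
    also have "\<dots> = (\<Sum>p\<in>P. \<Sum>p'\<in>P. K p p' * \<xi> p $ r * cnj (\<xi> p' $ c))"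
      by (rule sum.reindex_bij_betw[OF e])
    finally show "(U * Y * mat_adjoint U) $$ (r, c) = opr K $$ (r, c)" using rc by (simp add: opr_def)
  qed (use carrier_matD[OF U] in auto)
  show "U * mat_adjoint U = 1\<^sub>m k"
  proof -
    have inj: "e q = e q' \<longleftrightarrow> q = q'" if "q < k" "q' < k" for q q'
      using e that by (auto simp: bij_betw_def inj_on_def)
    have "U * 1\<^sub>m k * mat_adjoint U = opr (\<lambda>p q. if p = q then 1 else 0)"
      by (rule conj) (auto simp: inj)
    then show ?thesis using one U by (simp add: one_def)
  qed
  then show "mat_adjoint U * U = 1\<^sub>m k" by (rule mat_mult_left_right_inverse[rotated 2]) auto
  show "Y \<in> carrier_mat k k \<Longrightarrow> (\<And>q q'. q < k \<Longrightarrow> q' < k \<Longrightarrow> K (e q) (e q') = Y $$ (q, q')) \<Longrightarrow>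
      U * Y * mat_adjoint U = opr K" by (rule conj)
qed

text \<open>Extension of kernels by zero, used to compute a corner inside the ambient basis.\<close>

lemma opr_subset:
  assumes Q: "onb k Q \<xi>" "Q \<subseteq> P"
  shows "onb.opr k Q \<xi> K = opr (\<lambda>p q. if p \<in> Q \<and> q \<in> Q then K p q else 0)"
proof -
  interpret Q: onb k Q \<xi> by (rule Q)
  have "(\<Sum>p\<in>P. \<Sum>q\<in>P. (if p \<in> Q \<and> q \<in> Q then K p q else 0) * \<xi> p $ r * cnj (\<xi> q $ c)) =
      (\<Sum>p\<in>Q. \<Sum>q\<in>Q. K p q * \<xi> p $ r * cnj (\<xi> q $ c))" for r c
  proof -
    have "(\<Sum>p\<in>P. \<Sum>q\<in>P. (if p \<in> Q \<and> q \<in> Q then K p q else 0) * \<xi> p $ r * cnj (\<xi> q $ c)) =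
      (\<Sum>p\<in>Q. \<Sum>q\<in>P. (if p \<in> Q \<and> q \<in> Q then K p q else 0) * \<xi> p $ r * cnj (\<xi> q $ c))"
      by (rule sum.mono_neutral_right) (use Q in auto)
    also have "\<dots> = (\<Sum>p\<in>Q. \<Sum>q\<in>Q. K p q * \<xi> p $ r * cnj (\<xi> q $ c))"
      by (intro sum.cong refl sum.mono_neutral_cong_right) (use Q in auto)
    finally show ?thesis .
  qed
  then show ?thesis by (simp add: opr_def Q.opr_def)
qed

end

text \<open>Position \<open>q\<close> belongs to copy \<open>q div b\<close> and has coordinate
  \<open>q mod b\<close> in it; peeling off one copy shifts both positions by
  \<open>b\<close>.\<close>

lemma diag_block_replicate:
  fixes x :: "complex mat"
  assumes x: "x \<in> carrier_mat b b" and b: "0 < b"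
  shows "diag_block_mat (replicate l x @ [0\<^sub>m r r]) \<in> carrier_mat (l * b + r) (l * b + r) \<and>
    (\<forall>q q'. q < l * b + r \<longrightarrow> q' < l * b + r \<longrightarrow> diag_block_mat (replicate l x @ [0\<^sub>m r r]) $$ (q, q') =
      (if q < l * b \<and> q' < l * b \<and> q div b = q' div b then x $$ (q mod b, q' mod b) else 0))"
proof (induction l)
  case 0
  show ?case by (auto simp: Let_def)
next
  case (Suc l)
  let ?B = "diag_block_mat (replicate l x @ [0\<^sub>m r r])"
  have B: "?B \<in> carrier_mat (l * b + r) (l * b + r)" using Suc by blast
  have Bi: "?B $$ (q, q') = (if q < l * b \<and> q' < l * b \<and> q div b = q' div b then x $$ (q mod b, q' mod b) else 0)"
    if "q < l * b + r" "q' < l * b + r" for q q' using Suc that by blast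
  have e: "diag_block_mat (replicate (Suc l) x @ [0\<^sub>m r r]) =
    four_block_mat x (0\<^sub>m b (l * b + r)) (0\<^sub>m (l * b + r) b) ?B"
    using x B by (simp add: Let_def)
  have c: "diag_block_mat (replicate (Suc l) x @ [0\<^sub>m r r]) \<in> carrier_mat (Suc l * b + r) (Suc l * b + r)"
    unfolding e using x B by (intro carrier_matI) auto
  show ?case
  proof (intro conjI c allI impI)
    fix q q' assume q: "q < Suc l * b + r" "q' < Suc l * b + r"
    have "diag_block_mat (replicate (Suc l) x @ [0\<^sub>m r r]) $$ (q, q') =
      (if q < b then if q' < b then x $$ (q, q') else 0 else if q' < b then 0 else ?B $$ (q - b, q' - b))"
      unfolding e using x B q by (subst index_mat_four_block) (auto simp: algebra_simps)
    also have "\<dots> = (if q < Suc l * b \<and> q' < Suc l * b \<and> q div b = q' div b then x $$ (q mod b, q' mod b) else 0)"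
    proof (cases "q < b"; cases "q' < b")
      assume "q < b" "q' < b"
      then show ?thesis by auto
    next
      assume "q < b" "\<not> q' < b"
      then show ?thesis using b by (auto simp: le_div_geq)
    next
      assume "\<not> q < b" "q' < b"
      then show ?thesis using b by (auto simp: le_div_geq)
    next
      assume "\<not> q < b" "\<not> q' < b"
      then show ?thesis using b q by (auto simp: Bi le_div_geq le_mod_geq)
    qed
    finally show "diag_block_mat (replicate (Suc l) x @ [0\<^sub>m r r]) $$ (q, q') =
      (if q < Suc l * b \<and> q' < Suc l * b \<and> q div b = q' div b then x $$ (q mod b, q' mod b) else 0)" .
  qed
qed

text \<open>The first row of the commutation with the unit at \<open>(0, t)\<close> has row
  \<open>t\<close> of \<open>X\<close> on one side and, on the other, \<open>X $$ (0, 0)\<close> at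
  position \<open>t\<close> and zeros elsewhere.\<close>

lemma emat_commute_scalar:
  assumes X: "X \<in> carrier_mat n n" and n: "0 < n"
    and comm: "\<And>t. t < n \<Longrightarrow> emat n 0 t * X = X * emat n 0 t"
  shows "X = X $$ (0, 0) \<cdot>\<^sub>m 1\<^sub>m n"
proof (rule eq_matI)
  fix t q assume "t < dim_row (X $$ (0, 0) \<cdot>\<^sub>m 1\<^sub>m n)" "q < dim_col (X $$ (0, 0) \<cdot>\<^sub>m 1\<^sub>m n)"
  then have tq: "t < n" "q < n" by auto
  have "(emat n 0 t * X) $$ (0, q) = (\<Sum>r<n. emat n 0 t $$ (0, r) * X $$ (r, q))"
    by (rule mat_mult_index[OF emat_carrier X n tq(2)])
  also have "\<dots> = (\<Sum>r<n. if r = t then X $$ (t, q) else 0)" using n by (intro sum.cong refl) auto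
  finally have 1: "(emat n 0 t * X) $$ (0, q) = X $$ (t, q)" using tq by simp
  have "(X * emat n 0 t) $$ (0, q) = (\<Sum>r<n. X $$ (0, r) * emat n 0 t $$ (r, q))"
    by (rule mat_mult_index[OF X emat_carrier n tq(2)])
  also have "\<dots> = (\<Sum>r<n. if r = 0 then if q = t then X $$ (0, 0) else 0 else 0)"
    using tq by (intro sum.cong refl) auto
  finally have 2: "(X * emat n 0 t) $$ (0, q) = (if q = t then X $$ (0, 0) else 0)" using n by simp
  show "X $$ (t, q) = (X $$ (0, 0) \<cdot>\<^sub>m 1\<^sub>m n) $$ (t, q)"
    using 1 2 unfolding comm[OF tq(1)] using tq by (auto simp del: index_mult_mat)
qed (use X in auto)

context mm_alg
begin

definition "cp i = \<Theta> (block_embed ns i (1\<^sub>m (ns ! i)))"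

lemma cp_in [simp]: "cp i \<in> A" unfolding cp_def by (intro \<Theta>_in block_in) simp
lemma \<Phi>_cp': "\<Phi> (cp i) = block_embed ns i (1\<^sub>m (ns ! i))" unfolding cp_def by (intro \<Phi>_\<Theta> block_in) simp
lemma \<Phi>_cp: "j < m \<Longrightarrow> \<Phi> (cp i) j = (if j = i then 1\<^sub>m (ns ! i) else 0\<^sub>m (ns ! j) (ns ! j))"
  unfolding \<Phi>_cp' by (simp add: block_embed_def)

lemma zero_iff: "x \<in> A \<Longrightarrow> is_zero_mat x \<longleftrightarrow> x = 0\<^sub>m k k"
  using carrier_matD[OF car[of x]] by simp

text \<open>A central projection below \<open>cp i\<close> vanishes in the other blocks and is a
  scalar \<open>g\<close> in block \<open>i\<close>; idempotence leaves \<open>g = 0\<close> or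
  \<open>g = 1\<close>.\<close>

lemma cp_min:
  assumes i: "i < m"
  shows "cp i \<in> min_central_projections A"
proof -
  have z: "0\<^sub>m n n * x = 0\<^sub>m n n" "x * 0\<^sub>m n n = 0\<^sub>m n n" if "x \<in> carrier_mat n n" for n and x :: "complex mat"
    using left_mult_zero_mat[OF that, of n] right_mult_zero_mat[OF that, of n] by auto
  have o: "1\<^sub>m n * x = x" "x * 1\<^sub>m n = x" if "x \<in> carrier_mat n n" for n and x :: "complex mat"
    using that by auto
  have cen: "cp i \<in> center A"
    unfolding center_def mem_Collect_eq
  proof (intro conjI ballI)
    fix a assume a: "a \<in> A"
    show "a * cp i = cp i * a"
    proof (rule \<Phi>_eqI)
      fix j assume j: "j < m"
      show "\<Phi> (a * cp i) j = \<Phi> (cp i * a) j"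
        using a j \<Phi>_car[OF a j] by (simp add: \<Phi>_mult \<Phi>_cp z o)
    qed (use a in auto)
  qed simp
  have proj: "is_projection (cp i)"
    unfolding is_projection_def
  proof (intro conjI)
    have "cp i \<in> carrier_mat k k" by (rule car) simp
    then show "square_mat (cp i)" using carrier_matD[of "cp i" k k] by auto
    show "mat_adjoint (cp i) = cp i" by (rule \<Phi>_eqI) (auto simp: \<Phi>_adj \<Phi>_cp)
    show "cp i * cp i = cp i"
      by (rule \<Phi>_eqI) (auto simp: \<Phi>_mult \<Phi>_cp z)
  qed
  have nz: "cp i \<noteq> 0\<^sub>m k k"
  proof
    assume "cp i = 0\<^sub>m k k"
    then have "\<Phi> (cp i) i $$ (0, 0) = 0" using \<Phi>_zero[OF i] ns_pos[OF i] by simp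
    then show False using \<Phi>_cp[OF i, of i] ns_pos[OF i] by simp
  qed
  have min: "x = 0\<^sub>m k k \<or> x = cp i" if x: "x \<in> center A" "is_projection x" "x * cp i = x" for x
  proof -
    have xA: "x \<in> A" and xc: "\<And>a. a \<in> A \<Longrightarrow> a * x = x * a" using x(1) by (auto simp: center_def)
    have xj: "\<Phi> x j = 0\<^sub>m (ns ! j) (ns ! j)" if j: "j < m" "j \<noteq> i" for j
    proof -
      have "\<Phi> x j = \<Phi> (x * cp i) j" by (simp add: x(3))
      also have "\<dots> = \<Phi> x j * \<Phi> (cp i) j" using xA j by (intro \<Phi>_mult) auto
      also have "\<dots> = 0\<^sub>m (ns ! j) (ns ! j)" using j \<Phi>_car[OF xA j(1)] by (simp add: \<Phi>_cp z)
      finally show ?thesis .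
    qed
    have Xi: "\<Phi> x i \<in> carrier_mat (ns ! i) (ns ! i)" by (rule \<Phi>_car[OF xA i])
    define g where "g = \<Phi> x i $$ (0, 0)"
    have sc: "\<Phi> x i = g \<cdot>\<^sub>m 1\<^sub>m (ns ! i)"
      unfolding g_def
    proof (rule emat_commute_scalar[OF Xi ns_pos[OF i]])
      fix t
      have "\<Phi> (eu i 0 t * x) i = \<Phi> (x * eu i 0 t) i" by (simp add: xc)
      then show "emat (ns ! i) 0 t * \<Phi> x i = \<Phi> x i * emat (ns ! i) 0 t" using xA i by (simp add: \<Phi>_mult \<Phi>_eu)
    qed
    have "\<Phi> x i * \<Phi> x i = \<Phi> x i" using \<Phi>_mult[OF xA xA i] x(2) by (simp add: is_projection_def)
    then have "(g \<cdot>\<^sub>m 1\<^sub>m (ns ! i)) * (g \<cdot>\<^sub>m 1\<^sub>m (ns ! i)) = g \<cdot>\<^sub>m 1\<^sub>m (ns ! i)" by (simp add: sc)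
    then have "((g * g) \<cdot>\<^sub>m 1\<^sub>m (ns ! i)) $$ (0, 0) = (g \<cdot>\<^sub>m 1\<^sub>m (ns ! i)) $$ (0, 0)"
      by (simp add: mult_smult_assoc_mat[of _ "ns ! i" "ns ! i" _ "ns ! i"]
          mult_smult_distrib[of _ "ns ! i" "ns ! i" _ "ns ! i"] smult_smult_mat)
    then have "g * g = g" using ns_pos[OF i] by simp
    then have "g = 0 \<or> g = 1" by simp
    then show ?thesis
    proof
      assume "g = 0"
      then have "\<Phi> x i = 0\<^sub>m (ns ! i) (ns ! i)" unfolding sc by (intro eq_matI) auto
      then have "x = 0\<^sub>m k k"
        by (intro \<Phi>_eqI[OF xA zero_in]) (metis xj \<Phi>_zero)
      then show ?thesis ..
    next
      assume "g = 1"
      then have "\<Phi> x i = 1\<^sub>m (ns ! i)" unfolding sc by (intro eq_matI) auto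
      then have "x = cp i"
        by (intro \<Phi>_eqI[OF xA cp_in]) (metis xj \<Phi>_cp)
      then show ?thesis ..
    qed
  qed
  show ?thesis
    unfolding min_central_projections_def mem_Collect_eq
  proof (intro conjI ballI impI cen proj)
    show "\<not> is_zero_mat (cp i)" using nz zero_iff[OF cp_in] by simp
    fix x assume x: "x \<in> center A" "is_projection x \<and> x * cp i = x"
    then have "x \<in> A" by (simp add: center_def)
    then show "is_zero_mat x \<or> x = cp i" using min x zero_iff by blast
  qed
qed

lemma central_projection_eq: "i < m \<Longrightarrow> central_projection A ns \<Phi> i = cp i"
  unfolding central_projection_def
proof (rule the_equality)
  assume i: "i < m"
  show "cp i \<in> min_central_projections A \<and> \<Phi> (cp i) = block_embed ns i (1\<^sub>m (ns ! i))"
    using cp_min[OF i] \<Phi>_cp' by simp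
  fix z assume "z \<in> min_central_projections A \<and> \<Phi> z = block_embed ns i (1\<^sub>m (ns ! i))"
  then have "z \<in> A" "\<Phi> z = \<Phi> (cp i)" by (auto simp: min_central_projections_def center_def \<Phi>_cp')
  then show "z = cp i" using \<Phi>_eqI[of z "cp i"] by simp
qed

end

context mm_path
begin

text \<open>The adapted orthonormal basis of block \<open>i\<close> has as many elements as the
  block size; the number is read off as the trace of the identity.\<close>

lemma \<alpha>_eq: "i < length \<alpha>s \<Longrightarrow> \<alpha>s ! i = (\<Sum>j<length \<beta>s. D i j * \<beta>s ! j)"
proof -
  assume i: "i < length \<alpha>s"
  interpret W: onb "\<alpha>s ! i" "NA.PW (D i)" "w i" by (rule onb_w[OF i])
  have "(of_nat (\<alpha>s ! i) :: complex) = of_nat (card (NA.PW (D i)))"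
    unfolding W.one_trace[symmetric] one_w[OF i] by simp
  then show ?thesis unfolding NA.card_PW by (simp only: of_nat_eq_iff)
qed

text \<open>A zero row is excluded by the positive block size. A zero column is excluded because
  \<open>N\<close> lies in \<open>M\<close>: a matrix unit of that block of \<open>N\<close> would
  vanish in every block of \<open>M\<close>.\<close>

sublocale Z: incl k "{..<length \<alpha>s}" "{..<length \<beta>s}" D "\<lambda>j. \<beta>s ! j" \<mu> \<xi>
proof unfold_locales
  show "\<exists>j\<in>{..<length \<beta>s}. 0 < D i j" if "i \<in> {..<length \<alpha>s}" for i
  proof (rule ccontr)
    assume "\<not> (\<exists>j\<in>{..<length \<beta>s}. 0 < D i j)"
    then show False using \<alpha>_eq[of i] MA.ns_pos[of i] that by simp
  qed
  show "\<exists>i\<in>{..<length \<alpha>s}. 0 < D i j" if j: "j \<in> {..<length \<beta>s}" for j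
  proof (rule ccontr)
    assume no: "\<not> (\<exists>i\<in>{..<length \<alpha>s}. 0 < D i j)"
    have "NA.eu j 0 0 = 0\<^sub>m k k"
    proof (rule MA.\<Phi>_eqI)
      fix i assume i: "i < length \<alpha>s"
      have "\<Phi> (NA.eu j 0 0) i = 0\<^sub>m (\<alpha>s ! i) (\<alpha>s ! i)"
        by (rule NA.rep_zero[OF onb_w[OF i] one_w[OF i], of j])
          (use no i N_M in \<open>auto simp: ker_w[OF i] intro!: MA.\<Phi>_car\<close>)
      then show "\<Phi> (NA.eu j 0 0) i = \<Phi> (0\<^sub>m k k) i" using i by (simp add: MA.\<Phi>_zero)
    qed (auto simp: MA.zero_in N_M)
    then show False using NA.eu_nonzero[of j] j by simp
  qed
qed (auto simp: NA.ns_pos \<mu>_pos onb_\<xi> onb.ortho[OF onb_\<xi>] onb.xi_carrier[OF onb_\<xi>] onb.finP[OF onb_\<xi>])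

lemma ops_Z: "x \<in> carrier_mat k k \<Longrightarrow> x \<in> ops Z.one" by (auto simp: ops_def one_\<xi>)

lemma ker_Z:
  assumes "x \<in> M" "(i, j, l, a, c) \<in> Z.P" "(i', j', l', a', c') \<in> Z.P"
  shows "Z.ker x (i, j, l, a, c) (i', j', l', a', c') =
    (if i = i' \<and> c = c' then onb.ker (w i) (\<Phi> x i) (j, a, l) (j', a', l') else 0)"
  using assms by (rule ker_\<xi>)

lemma ker_N:
  assumes y: "y \<in> N" and p: "(i, j, l, a, c) \<in> Z.P" and q: "(i', j', l', a', c') \<in> Z.P"
  shows "Z.ker y (i, j, l, a, c) (i', j', l', a', c') =
    (if i = i' \<and> c = c' \<and> j = j' \<and> l = l' then \<Psi> y j $$ (a, a') else 0)"
proof (cases "i = i' \<and> c = c'")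
  case True
  have "onb.ker (w i) (\<Phi> y i) (j, a, l) (j', a', l') = (if j = j' \<and> l = l' then \<Psi> y j $$ (a, a') else 0)"
    using p q True by (intro ker_w y) (auto simp: paths_def NA.PW_def)
  then show ?thesis using ker_Z[OF N_M[OF y] p q] True by simp
next
  case False
  then show ?thesis using ker_Z[OF N_M[OF y] p q] by auto
qed

text \<open>Every kernel of block form occurs because \<open>\<Phi>\<close> is onto the direct sum:
  the component in block \<open>i\<close> is prescribed as the matrix with that kernel in the basis
  \<open>w i\<close>.\<close>

lemma M_eq: "M = Z.M"
proof (intro equalityI subsetI)
  fix x assume x: "x \<in> M"
  define X where "X = (\<lambda>i (j, l, a) (j', l', a'). onb.ker (w i) (\<Phi> x i) (j, a, l) (j', a', l'))"
  have "x = Z.bop Mi Ms Mc X"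
  proof (rule Z.ops_eqI[OF ops_Z ops_Z])
    fix p q assume p: "p \<in> Z.P" and q: "q \<in> Z.P"
    obtain i j l a c where pp: "p = (i, j, l, a, c)" by (cases p)
    obtain i' j' l' a' c' where qq: "q = (i', j', l', a', c')" by (cases q)
    have "Z.ker (Z.bop Mi Ms Mc X) p q = (if Mi p = Mi q \<and> Mc p = Mc q then X (Mi p) (Ms p) (Ms q) else 0)"
      by (rule Z.Mf.ker_bop[OF p q])
    then show "Z.ker x p q = Z.ker (Z.bop Mi Ms Mc X) p q"
      using ker_Z[OF x p[unfolded pp] q[unfolded qq]] by (auto simp: pp qq path_defs X_def)
  qed (use MA.car[OF x] in auto)
  then show "x \<in> Z.M" using Z.Mf.bop_in by metis
next
  fix y assume "y \<in> Z.M"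
  then obtain X where y: "y = Z.bop Mi Ms Mc X" by (elim Z.Mf.algE)
  define X' where "X' i = (\<lambda>(j, a, l) (j', a', l'). X i (j, l, a) (j', l', a'))" for i
  have oc: "onb.opr (\<alpha>s ! i) (NA.PW (D i)) (w i) (X' i) \<in> carrier_mat (\<alpha>s ! i) (\<alpha>s ! i)" if "i < length \<alpha>s" for i
    by (rule onb.opr_carrier[OF onb_w[OF that]])
  obtain x where x: "x \<in> M" and \<Phi>x: "\<And>i. i < length \<alpha>s \<Longrightarrow> \<Phi> x i = onb.opr (\<alpha>s ! i) (NA.PW (D i)) (w i) (X' i)"
    using MA.surj[of "\<lambda>i. onb.opr (\<alpha>s ! i) (NA.PW (D i)) (w i) (X' i)", OF oc] by blast
  have "y = x"
  proof (rule Z.ops_eqI[OF ops_Z ops_Z])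
    fix p q assume p: "p \<in> Z.P" and q: "q \<in> Z.P"
    obtain i j l a c where pp: "p = (i, j, l, a, c)" by (cases p)
    obtain i' j' l' a' c' where qq: "q = (i', j', l', a', c')" by (cases q)
    have i: "i < length \<alpha>s" using p by (auto simp: pp paths_def)
    have k1: "Z.ker y p q = (if i = i' \<and> c = c' then X i (j, l, a) (j', l', a') else 0)"
      unfolding y using Z.Mf.ker_bop[OF p q, of X] by (simp add: pp qq path_defs)
    show "Z.ker y p q = Z.ker x p q"
    proof (cases "i = i' \<and> c = c'")
      case True
      have "onb.ker (w i) (\<Phi> x i) (j, a, l) (j', a', l') = X' i (j, a, l) (j', a', l')"
        unfolding \<Phi>x[OF i] by (rule onb.ker_opr[OF onb_w[OF i]]) (use p q True in \<open>auto simp: pp qq paths_def NA.PW_def\<close>)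
      then show ?thesis using k1 ker_Z[OF x p[unfolded pp] q[unfolded qq]] True by (simp add: pp qq X'_def)
    next
      case False
      then show ?thesis using k1 ker_Z[OF x p[unfolded pp] q[unfolded qq]] by (auto simp: pp qq)
    qed
  qed (use MA.car[OF x] in \<open>auto simp: y\<close>)
  then show "y \<in> M" using x by simp
qed

lemma N_eq: "N = Z.N"
proof (intro equalityI subsetI)
  fix x assume x: "x \<in> N"
  have "x = Z.bop Ni Ns Nc (\<lambda>j a a'. \<Psi> x j $$ (a, a'))"
  proof (rule Z.ops_eqI[OF ops_Z ops_Z])
    fix p q assume p: "p \<in> Z.P" and q: "q \<in> Z.P"
    obtain i j l a c where pp: "p = (i, j, l, a, c)" by (cases p)
    obtain i' j' l' a' c' where qq: "q = (i', j', l', a', c')" by (cases q)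
    show "Z.ker x p q = Z.ker (Z.bop Ni Ns Nc (\<lambda>j a a'. \<Psi> x j $$ (a, a'))) p q"
      unfolding Z.Nf.ker_bop[OF p q]
      using ker_N[OF x p[unfolded pp] q[unfolded qq]] by (auto simp: pp qq path_defs)
  qed (use NA.car[OF x] in auto)
  then show "x \<in> Z.N" using Z.Nf.bop_in by metis
next
  fix y assume "y \<in> Z.N"
  then obtain X where y: "y = Z.bop Ni Ns Nc X" by (elim Z.Nf.algE)
  obtain x where x: "x \<in> N" and \<Psi>x: "\<And>j. j < length \<beta>s \<Longrightarrow> \<Psi> x j = mat (\<beta>s ! j) (\<beta>s ! j) (\<lambda>(a, a'). X j a a')"
    using NA.surj[of "\<lambda>j. mat (\<beta>s ! j) (\<beta>s ! j) (\<lambda>(a, a'). X j a a')"] by auto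
  have "y = x"
  proof (rule Z.ops_eqI[OF ops_Z ops_Z])
    fix p q assume p: "p \<in> Z.P" and q: "q \<in> Z.P"
    obtain i j l a c where pp: "p = (i, j, l, a, c)" by (cases p)
    obtain i' j' l' a' c' where qq: "q = (i', j', l', a', c')" by (cases q)
    show "Z.ker y p q = Z.ker x p q"
      unfolding y Z.Nf.ker_bop[OF p q]
      using ker_N[OF x p[unfolded pp] q[unfolded qq]] p q by (auto simp: pp qq path_defs paths_def \<Psi>x)
  qed (use NA.car[OF x] in \<open>auto simp: y\<close>)
  then show "y \<in> N" using x by simp
qed

lemma cp_M: "i < length \<alpha>s \<Longrightarrow> MA.cp i = Z.dg (\<lambda>i' j'. if i' = i then 1 else 0)"
proof (rule Z.ops_eqI[OF ops_Z ops_Z])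
  assume i: "i < length \<alpha>s"
  fix p q assume p: "p \<in> Z.P" and q: "q \<in> Z.P"
  obtain i1 j l a c where pp: "p = (i1, j, l, a, c)" by (cases p)
  obtain i' j' l' a' c' where qq: "q = (i', j', l', a', c')" by (cases q)
  have i1: "i1 < length \<alpha>s" using p by (auto simp: pp paths_def)
  have d: "Z.ker (Z.dg (\<lambda>i' j'. if i' = i then 1 else 0)) p q = (if p = q \<and> i1 = i then 1 else 0)"
    unfolding Z.dg_def using p q by (auto simp: pp qq path_defs)
  interpret W: onb "\<alpha>s ! i1" "NA.PW (D i1)" "w i1" by (rule onb_w[OF i1])
  show "Z.ker (MA.cp i) p q = Z.ker (Z.dg (\<lambda>i' j'. if i' = i then 1 else 0)) p q"
  proof (cases "i1 = i' \<and> c = c'")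
    case True
    have pq: "(j, a, l) \<in> NA.PW (D i1)" "(j', a', l') \<in> NA.PW (D i1)"
      using p q True by (auto simp: pp qq paths_def NA.PW_def)
    have "W.ker (\<Phi> (MA.cp i) i1) (j, a, l) (j', a', l') =
      (if i1 = i then if (j, a, l) = (j', a', l') then 1 else 0 else 0)"
    proof (cases "i1 = i")
      case True
      then have "\<Phi> (MA.cp i) i1 = 1\<^sub>m (\<alpha>s ! i1)" using MA.\<Phi>_cp[OF i1, of i] by simp
      then have "\<Phi> (MA.cp i) i1 = W.opr (\<lambda>p q. if p = q then 1 else 0)"
        unfolding one_w[OF i1, symmetric] W.one_def .
      then have "W.ker (\<Phi> (MA.cp i) i1) (j, a, l) (j', a', l') = (if (j, a, l) = (j', a', l') then 1 else 0)"
        by (simp only: W.ker_opr[OF pq])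
      then show ?thesis using True by simp
    next
      case False
      then have "\<Phi> (MA.cp i) i1 = W.opr (\<lambda>p q. 0)"
        using MA.\<Phi>_cp[OF i1, of i] by (simp add: W.opr_zero)
      then have "W.ker (\<Phi> (MA.cp i) i1) (j, a, l) (j', a', l') = 0" by (simp only: W.ker_opr[OF pq])
      then show ?thesis using False by simp
    qed
    then show ?thesis using d ker_Z[OF MA.cp_in p[unfolded pp] q[unfolded qq]] True by (auto simp: pp qq)
  next
    case False
    then show ?thesis using d ker_Z[OF MA.cp_in p[unfolded pp] q[unfolded qq]] by (auto simp: pp qq)
  qed
qed auto

lemma cp_N: "j < length \<beta>s \<Longrightarrow> NA.cp j = Z.dg (\<lambda>i' j'. if j' = j then 1 else 0)"
proof (rule Z.ops_eqI[OF ops_Z ops_Z])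
  assume j: "j < length \<beta>s"
  fix p q assume p: "p \<in> Z.P" and q: "q \<in> Z.P"
  obtain i j1 l a c where pp: "p = (i, j1, l, a, c)" by (cases p)
  obtain i' j' l' a' c' where qq: "q = (i', j', l', a', c')" by (cases q)
  have j1: "j1 < length \<beta>s" "a < \<beta>s ! j1" using p by (auto simp: pp paths_def)
  have a': "a' < \<beta>s ! j'" using q by (auto simp: qq paths_def)
  have d: "Z.ker (Z.dg (\<lambda>i' j'. if j' = j then 1 else 0)) p q = (if p = q \<and> j1 = j then 1 else 0)"
    unfolding Z.dg_def using p q by (auto simp: pp qq path_defs)
  show "Z.ker (NA.cp j) p q = Z.ker (Z.dg (\<lambda>i' j'. if j' = j then 1 else 0)) p q"
    using d ker_N[OF NA.cp_in p[unfolded pp] q[unfolded qq]] j1 a' by (auto simp: pp qq NA.\<Phi>_cp)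
qed auto

definition "\<Lambda> = mat (length \<alpha>s) (length \<beta>s) (\<lambda>(i, j). D i j)"

text \<open>The paths through \<open>(i, j)\<close> form an orthonormal basis of the range of
  \<open>p * q\<close>, and in it the corner is an inclusion with the single multiplicity
  \<open>D i j\<close>. Constant vectors are its Perron-Frobenius vectors, so the general formula
  gives the square of that entry.\<close>

lemma reduced_index:
  assumes i: "i < length \<alpha>s" and j: "j < length \<beta>s" and Dij: "0 < D i j"
  defines "p \<equiv> MA.cp i" and "q \<equiv> NA.cp j"
  shows "minimal_index (p * q) {q * x * (p * q) | x. x \<in> M} {x * (p * q) | x. x \<in> N} = (real (D i j))\<^sup>2"
proof -
  let ?Q = "paths {i} {j} D (\<lambda>j. \<beta>s ! j) \<mu>"
  have sub: "?Q \<subseteq> Z.P" using i j by (auto simp: paths_def)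
  have onbQ: "onb k ?Q \<xi>"
  proof (rule onb.intro)
    show "\<xi> p \<bullet>c \<xi> q = (if p = q then 1 else 0)" if "p \<in> ?Q" "q \<in> ?Q" for p q
      using that sub by (intro Z.ortho) blast+
    show "\<xi> p \<in> carrier_vec k" if "p \<in> ?Q" for p using that sub by (intro Z.xi_carrier) blast
  qed (simp add: finite_paths)
  interpret r: incl k "{i}" "{j}" D "\<lambda>j. \<beta>s ! j" \<mu> \<xi>
    by (rule incl.intro) (use i j Dij onbQ in \<open>auto simp: NA.ns_pos \<mu>_pos\<close>)
  interpret rp: pf_incl k "{i}" "{j}" D "\<lambda>j. \<beta>s ! j" \<mu> \<xi> "\<lambda>_. 1" "\<lambda>_. 1" "real (D i j)"
    by unfold_locales (use Dij in auto)
  have Qm: "(i', j', l, a, c) \<in> ?Q \<longleftrightarrow> (i', j', l, a, c) \<in> Z.P \<and> i' = i \<and> j' = j" for i' j' l a c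
    using i j by (auto simp: paths_def)
  have ropr: "r.opr K = Z.opr (\<lambda>p q. if p \<in> ?Q \<and> q \<in> ?Q then K p q else 0)" for K
    by (rule Z.opr_subset[OF onbQ sub])
  have pq: "p * q = Z.opr (\<lambda>s t. if s = t \<and> s \<in> ?Q then 1 else 0)"
    unfolding p_def q_def cp_M[OF i] cp_N[OF j] Z.dg_mult unfolding Z.dg_def
    by (rule Z.opr_cong) (auto simp: path_defs Qm)
  have q: "q = Z.opr (\<lambda>s t. if s = t \<and> Ni s = j then 1 else 0)"
    unfolding q_def cp_N[OF j] Z.dg_def by (rule Z.opr_cong) auto
  have one: "p * q = r.one" unfolding pq r.one_def ropr by (rule Z.opr_cong) auto
  have mr: "Z.opr K * (p * q) = Z.opr (\<lambda>s t. if t \<in> ?Q then K s t else 0)" for K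
  proof -
    have "Z.opr K * (p * q) = Z.opr (\<lambda>s t. \<Sum>r\<in>Z.P. if r = t then if t \<in> ?Q then K s t else 0 else 0)"
      unfolding pq Z.opr_mult by (rule Z.opr_cong, rule sum.cong) auto
    also have "\<dots> = Z.opr (\<lambda>s t. if t \<in> ?Q then K s t else 0)" by (rule Z.opr_cong) simp
    finally show ?thesis .
  qed
  have ml: "q * Z.opr K = Z.opr (\<lambda>s t. if Ni s = j then K s t else 0)" for K
  proof -
    have "q * Z.opr K = Z.opr (\<lambda>s t. \<Sum>r\<in>Z.P. if r = s then if Ni s = j then K s t else 0 else 0)"
      unfolding q Z.opr_mult by (rule Z.opr_cong, rule sum.cong) auto
    also have "\<dots> = Z.opr (\<lambda>s t. if Ni s = j then K s t else 0)" by (rule Z.opr_cong) simp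
    finally show ?thesis .
  qed
  have eM: "q * Z.bop Mi Ms Mc X * (p * q) = r.bop Mi Ms Mc X" for X
    unfolding Z.bop_def r.bop_def ml mr ropr
    by (rule Z.opr_cong) (auto simp: path_defs Qm)
  have eN: "Z.bop Ni Ns Nc X * (p * q) = r.bop Ni Ns Nc X" for X
    unfolding Z.bop_def r.bop_def mr ropr
    by (rule Z.opr_cong) (auto simp: path_defs Qm)
  have "{q * x * (p * q) | x. x \<in> M} = range (\<lambda>X. q * Z.bop Mi Ms Mc X * (p * q))"
    unfolding M_eq Z.balg_def by auto
  then have "{q * x * (p * q) | x. x \<in> M} = r.M" unfolding eM r.balg_def .
  moreover have "{x * (p * q) | x. x \<in> N} = range (\<lambda>X. Z.bop Ni Ns Nc X * (p * q))"
    unfolding N_eq Z.balg_def by auto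
  then have "{x * (p * q) | x. x \<in> N} = r.N" unfolding eN r.balg_def .
  ultimately show ?thesis using rp.minimal_index by (simp add: one)
qed

lemma matrix_dimension_eq: "matrix_dimension M \<alpha>s \<Phi> N \<beta>s \<Psi> = map_mat real \<Lambda>"
proof (rule eq_matI)
  fix i j assume "i < dim_row (map_mat real \<Lambda>)" "j < dim_col (map_mat real \<Lambda>)"
  then have i: "i < length \<alpha>s" and j: "j < length \<beta>s" by (auto simp: \<Lambda>_def)
  let ?p = "MA.cp i" and ?q = "NA.cp j"
  have pq: "?p * ?q = Z.dg (\<lambda>i' j'. (if i' = i then 1 else 0) * (if j' = j then 1 else 0))"
    unfolding cp_M[OF i] cp_N[OF j] Z.dg_mult ..
  have z: "0\<^sub>m k k = Z.dg (\<lambda>_ _. 0)" by (simp add: Z.dg_def Z.opr_zero)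
  have zero: "is_zero_mat (?p * ?q) \<longleftrightarrow> D i j = 0"
  proof
    assume "is_zero_mat (?p * ?q)"
    then have "Z.dg (\<lambda>i' j'. (if i' = i then 1 else 0) * (if j' = j then 1 else 0)) = Z.dg (\<lambda>_ _. 0)"
      unfolding pq by (simp flip: z)
    from Z.dg_eqD[OF this, of i j] show "D i j = 0" using i j by auto
  next
    assume "D i j = 0"
    then have "?p * ?q = 0\<^sub>m k k" unfolding pq z by (intro Z.dg_cong) auto
    then show "is_zero_mat (?p * ?q)" by simp
  qed
  have "matrix_dimension M \<alpha>s \<Phi> N \<beta>s \<Psi> $$ (i, j) =
    (if is_zero_mat (?p * ?q) then 0
     else sqrt (minimal_index (?p * ?q) {?q * x * (?p * ?q) | x. x \<in> M} {x * (?p * ?q) | x. x \<in> N}))"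
    using i j by (simp add: matrix_dimension_def MA.central_projection_eq NA.central_projection_eq Let_def)
  also have "\<dots> = real (D i j)"
  proof (cases "D i j = 0")
    case True
    then show ?thesis using zero by simp
  next
    case False
    then have "\<not> is_zero_mat (?p * ?q)" unfolding zero .
    moreover have "minimal_index (?p * ?q) {?q * x * (?p * ?q) | x. x \<in> M} {x * (?p * ?q) | x. x \<in> N} = (real (D i j))\<^sup>2"
      by (rule reduced_index[OF i j]) (use False in simp)
    ultimately have "(if is_zero_mat (?p * ?q) then 0
       else sqrt (minimal_index (?p * ?q) {?q * x * (?p * ?q) | x. x \<in> M} {x * (?p * ?q) | x. x \<in> N})) = sqrt ((real (D i j))\<^sup>2)"
      by (simp only: if_False)
    then show ?thesis by simp
  qed
  finally show "matrix_dimension M \<alpha>s \<Phi> N \<beta>s \<Psi> $$ (i, j) = map_mat real \<Lambda> $$ (i, j)"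
    using i j by (simp add: \<Lambda>_def)
qed (auto simp: matrix_dimension_def \<Lambda>_def)

text \<open>The adapted basis of block \<open>i\<close> is enumerated so that the copies of block
  \<open>j\<close> come first, copy by copy, and the labels of all other blocks afterwards. The
  basis vectors in this order are the columns of the unitary.\<close>

lemma inclusion_matrix: "is_inclusion_matrix N \<beta>s \<Psi> \<alpha>s \<Phi> \<Lambda>"
  unfolding is_inclusion_matrix_def
proof (intro conjI allI impI)
  show "\<Lambda> \<in> carrier_mat (length \<alpha>s) (length \<beta>s)" by (simp add: \<Lambda>_def)
  fix i j assume i: "i < length \<alpha>s" and j: "j < length \<beta>s"
  define a b l where "a = \<alpha>s ! i" and "b = \<beta>s ! j" and "l = D i j"
  have b0: "0 < b" unfolding b_def by (rule NA.ns_pos[OF j])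
  let ?PW = "NA.PW (D i)"
  have onbW: "onb a ?PW (w i)" unfolding a_def by (rule onb_w[OF i])
  interpret W: onb a ?PW "w i" by (rule onbW)
  have one: "W.one = 1\<^sub>m a" using one_w[OF i] by (simp add: a_def)
  have cardW: "card ?PW = a" using \<alpha>_eq[OF i] by (simp add: NA.card_PW a_def)
  \<comment> \<open>A position \<open>q\<close> below \<open>l * b\<close> is coordinate
    \<open>q mod b\<close> of copy \<open>q div b\<close>, matching the layout of the block diagonal
    matrix.\<close>
  define g where "g q = (j, q mod b, q div b)" for q
  have inj: "inj_on g {..<l * b}"
    by (rule inj_onI) (metis g_def Pair_inject div_mult_mod_eq)
  have divl: "q div b < l" if "q < l * b" for q using that b0 by (simp add: less_mult_imp_div_less)
  have gPW: "g ` {..<l * b} \<subseteq> ?PW"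
    using j b0 divl by (auto simp: g_def NA.PW_def b_def l_def)
  have cg: "card (g ` {..<l * b}) = l * b" using card_image[OF inj] by simp
  have le: "l * b \<le> a" using card_mono[OF NA.finite_PW gPW] cg cardW by simp
  have "card (?PW - g ` {..<l * b}) = card {l * b..<a}"
    using card_Diff_subset[OF finite_subset[OF gPW NA.finite_PW] gPW] cg cardW by simp
  then obtain h where h: "bij_betw h {l * b..<a} (?PW - g ` {..<l * b})"
    using finite_same_card_bij[of "{l * b..<a}" "?PW - g ` {..<l * b}"] NA.finite_PW by auto
  define e where "e q = (if q < l * b then g q else h q)" for q
  have "bij_betw e ({..<l * b} \<union> {l * b..<a}) (g ` {..<l * b} \<union> (?PW - g ` {..<l * b}))"
  proof (rule bij_betw_combine)
    have "bij_betw g {..<l * b} (g ` {..<l * b})" using inj by (simp add: bij_betw_def)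
    then show "bij_betw e {..<l * b} (g ` {..<l * b})"
      by (rule bij_betw_cong[THEN iffD1, rotated]) (simp add: e_def)
    show "bij_betw e {l * b..<a} (?PW - g ` {..<l * b})"
      using h by (rule bij_betw_cong[THEN iffD1, rotated]) (simp add: e_def)
  qed auto
  moreover have "{..<l * b} \<union> {l * b..<a} = {..<a}" using le by auto
  moreover have "g ` {..<l * b} \<union> (?PW - g ` {..<l * b}) = ?PW" using gPW by blast
  ultimately have e: "bij_betw e {..<a} ?PW" by simp
  have ePW: "e q \<in> ?PW" if "q < a" for q using e that by (auto simp: bij_betw_def)
  define U where "U = mat a a (\<lambda>(r, q). w i (e q) $ r)"
  note ub = W.unitary_basis[OF e one, folded U_def]
  have main: "\<Phi> (inv_into N \<Psi> (block_embed \<beta>s j x)) i =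
      U * diag_block_mat (replicate l x @ [0\<^sub>m (a - l * b) (a - l * b)]) * mat_adjoint U"
    if x: "x \<in> carrier_mat b b" for x
  proof -
    define y where "y = NA.\<Theta> (block_embed \<beta>s j x)"
    have blk: "block_embed \<beta>s j x \<in> direct_sum \<beta>s" using x by (intro NA.block_in) (simp add: b_def)
    have y: "y \<in> N" unfolding y_def by (rule NA.\<Theta>_in[OF blk])
    have \<Psi>y: "\<Psi> y j' = (if j' = j then x else 0\<^sub>m (\<beta>s ! j') (\<beta>s ! j'))" if "j' < length \<beta>s" for j'
      unfolding y_def NA.\<Phi>_\<Theta>[OF blk] using that by (simp add: block_embed_def)
    have "\<Phi> y i \<in> carrier_mat a a" unfolding a_def using N_M[OF y] i by simp
    then have "\<Phi> y i \<in> ops W.one" by (auto simp: ops_def one)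
    then have "\<Phi> y i = W.opr (W.ker (\<Phi> y i))" by (rule W.opr_ker[symmetric])
    moreover have "U * diag_block_mat (replicate l x @ [0\<^sub>m (a - l * b) (a - l * b)]) * mat_adjoint U = W.opr (W.ker (\<Phi> y i))"
    proof (rule ub(3))
      note db = diag_block_replicate[OF x b0, of l "a - l * b"]
      show "diag_block_mat (replicate l x @ [0\<^sub>m (a - l * b) (a - l * b)]) \<in> carrier_mat a a" using db le by simp
      fix q q' assume q: "q < a" "q' < a"
      obtain j1 a1 l1 where eq: "e q = (j1, a1, l1)" by (cases "e q")
      obtain j2 a2 l2 where eq': "e q' = (j2, a2, l2)" by (cases "e q'")
      have in1: "j1 < length \<beta>s" "a1 < \<beta>s ! j1" "l1 < D i j1" using ePW[OF q(1)] by (auto simp: eq NA.PW_def)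
      have in2: "j2 < length \<beta>s" "a2 < \<beta>s ! j2" "l2 < D i j2" using ePW[OF q(2)] by (auto simp: eq' NA.PW_def)
      have kw: "W.ker (\<Phi> y i) (e q) (e q') = (if j1 = j2 \<and> l1 = l2 then \<Psi> y j1 $$ (a1, a2) else 0)"
        unfolding eq eq' using ePW[OF q(1)] ePW[OF q(2)] by (intro ker_w i y) (auto simp: eq eq')
      \<comment> \<open>The labels of block \<open>j\<close> are exhausted by the first
        \<open>l * b\<close> positions, so beyond them \<open>y\<close> acts by zero, as the final
        zero block requires.\<close>
      have lt: "q < l * b \<longleftrightarrow> j1 = j" if "e q = (j1, a1, l1)" "q < a" for q j1 a1 l1
      proof
        show "q < l * b \<Longrightarrow> j1 = j" using that by (auto simp: e_def g_def)
        assume jj: "j1 = j"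
        show "q < l * b"
        proof (rule ccontr)
          assume n: "\<not> q < l * b"
          then have "h q \<in> ?PW - g ` {..<l * b}" using bij_betw_apply[OF h] that(2) by simp
          moreover have hq: "h q = (j, a1, l1)" using that n jj by (simp add: e_def)
          moreover have "a1 < b" "l1 < l" using ePW[OF that(2)] that(1) jj by (auto simp: NA.PW_def b_def l_def)
          moreover have "g (l1 * b + a1) = (j, a1, l1)" using \<open>a1 < b\<close> by (simp add: g_def)
          moreover have "l1 * b + a1 < l * b"
          proof -
            have "l1 * b + a1 < Suc l1 * b" using \<open>a1 < b\<close> by simp
            also have "\<dots> \<le> l * b" using \<open>l1 < l\<close> by (intro mult_right_mono) auto
            finally show ?thesis .
          qed
          ultimately show False by (metis DiffD2 imageI lessThan_iff)
        qed
      qed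
      show "W.ker (\<Phi> y i) (e q) (e q') =
        diag_block_mat (replicate l x @ [0\<^sub>m (a - l * b) (a - l * b)]) $$ (q, q')"
      proof (cases "q < l * b \<and> q' < l * b")
        case True
        then have "j1 = j" "a1 = q mod b" "l1 = q div b" "j2 = j" "a2 = q' mod b" "l2 = q' div b"
          using eq eq' by (auto simp: e_def g_def)
        then show ?thesis using kw db q le True in1 by (auto simp: \<Psi>y)
      next
        case False
        then have "\<not> (j1 = j \<and> j2 = j)" using lt[OF eq q(1)] lt[OF eq' q(2)] by simp
        then have "W.ker (\<Phi> y i) (e q) (e q') = 0" unfolding kw using in1 in2 by (auto simp: \<Psi>y)
        then show ?thesis using db q le False by auto
      qed
    qed
    ultimately show ?thesis by (simp add: y_def NA.\<Theta>_def)
  qed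
  have "embeds_with_multiplicity a b (\<lambda>x. \<Phi> (inv_into N \<Psi> (block_embed \<beta>s j x)) i) l"
    unfolding embeds_with_multiplicity_def
    by (intro conjI le bexI[of _ U] ub(1,2) ballI main) (auto simp: U_def)
  then show "embeds_with_multiplicity (\<alpha>s ! i) (\<beta>s ! j)
      (\<lambda>x. \<Phi> (inv_into N \<Psi> (block_embed \<beta>s j x)) i) (\<Lambda> $$ (i, j))"
    using i j by (simp add: a_def b_def l_def \<Lambda>_def)
qed

end

subsection \<open>Dimension, integrality and diagonal algebras\<close>

context mm_alg
begin

definition "UI = {(i, s, t). i < m \<and> s < ns ! i \<and> t < ns ! i}"

lemma UI_Sigma: "UI = (SIGMA i:{..<m}. {..<ns ! i} \<times> {..<ns ! i})" by (auto simp: UI_def)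

lemma finite_UI: "finite UI" unfolding UI_Sigma by auto

lemma card_UI: "card UI = (\<Sum>i<m. (ns ! i)\<^sup>2)" unfolding UI_Sigma by (simp add: power2_eq_square)

lemma eu_index: "(i, s, t) \<in> UI \<Longrightarrow> (j, s', t') \<in> UI \<Longrightarrow>
    \<Phi> (eu i s t) j $$ (s', t') = (if (i, s, t) = (j, s', t') then 1 else 0)"
  by (auto simp: UI_def \<Phi>_eu)

abbreviation "eut \<equiv> \<lambda>(i, s, t). eu i s t"

lemma inj_eut: "inj_on eut UI"
proof (rule inj_onI)
  fix p q assume p: "p \<in> UI" and q: "q \<in> UI" and e: "eut p = eut q"
  obtain i s t where pp: "p = (i, s, t)" by (cases p)
  obtain i' s' t' where qq: "q = (i', s', t')" by (cases q)
  have "\<Phi> (eu i s t) i' $$ (s', t') = \<Phi> (eu i' s' t') i' $$ (s', t')" using e by (simp add: pp qq)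
  then show "p = q" using eu_index[of i s t i' s' t'] eu_index[of i' s' t' i' s' t'] p q
    by (auto simp: pp qq split: if_splits)
qed

lemma \<Phi>_lincomb:
  assumes p: "(j, s, t) \<in> UI"
  shows "\<Phi> (matsum k (\<lambda>v. a v \<cdot>\<^sub>m v) (eut ` UI)) j $$ (s, t) = a (eu j s t)"
proof -
  have j: "j < m" "s < ns ! j" "t < ns ! j" using p by (auto simp: UI_def)
  have fin: "finite (eut ` UI)" using finite_UI by simp
  have cA: "a v \<cdot>\<^sub>m v \<in> A" if "v \<in> eut ` UI" for v using that by auto
  have "\<Phi> (matsum k (\<lambda>v. a v \<cdot>\<^sub>m v) (eut ` UI)) j = matsum (ns ! j) (\<lambda>v. \<Phi> (a v \<cdot>\<^sub>m v) j) (eut ` UI)"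
    using conjunct2[OF matsum_A[OF fin cA]] j(1) by simp
  then have "\<Phi> (matsum k (\<lambda>v. a v \<cdot>\<^sub>m v) (eut ` UI)) j $$ (s, t) =
      (\<Sum>v\<in>eut ` UI. \<Phi> (a v \<cdot>\<^sub>m v) j $$ (s, t))" by (simp add: matsum_index j)
  also have "\<dots> = (\<Sum>q\<in>UI. \<Phi> (a (eut q) \<cdot>\<^sub>m eut q) j $$ (s, t))" by (rule sum.reindex_cong[OF inj_eut]) auto
  also have "\<dots> = (\<Sum>q\<in>UI. if q = (j, s, t) then a (eu j s t) else 0)"
  proof (rule sum.cong)
    fix q assume q: "q \<in> UI"
    obtain i' s' t' where qq: "q = (i', s', t')" by (cases q)
    have "\<Phi> (a (eut q) \<cdot>\<^sub>m eut q) j $$ (s, t) = a (eut q) * \<Phi> (eu i' s' t') j $$ (s, t)"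
      using j carrier_matD[OF \<Phi>_car[OF eu_in j(1), of i' s' t']] by (simp add: qq \<Phi>_smult)
    then show "\<Phi> (a (eut q) \<cdot>\<^sub>m eut q) j $$ (s, t) = (if q = (j, s, t) then a (eu j s t) else 0)"
      using eu_index[of i' s' t' j s t] q p by (auto simp: qq)
  qed simp
  finally show ?thesis using finite_UI p by simp
qed

text \<open>The preimages of the matrix units form a basis, the coordinates of an element being the
  entries of its image under \<open>\<Phi>\<close>; there are as many as the squared block sizes add
  up to.\<close>

lemma algebra_dim_eq: "algebra_dim k A = (\<Sum>i<m. (ns ! i)\<^sup>2)"
proof -
  let ?R = "class_ring :: complex ring" and ?V = "module_mat TYPE(complex) k k"
  let ?W = "?V\<lparr>carrier := A\<rparr>"
  interpret V: vectorspace ?R ?V by (rule matrix_vs)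
  have "submodule ?R A ?V"
    by (intro submodule.intro V.module_axioms) (auto simp: matrix_vs_simps zero_in)
  then have "subspace ?R A ?V" by (intro subspace.intro V.vectorspace_axioms)
  then interpret W: vectorspace ?R ?W by (rule V.subspace_is_vs)
  have simps [simp]: "add ?W = (+)" "zero ?W = 0\<^sub>m k k" "module.smult ?W = (\<cdot>\<^sub>m)" "carrier ?W = A"
    "carrier ?R = UNIV" "zero ?R = 0"
    by (simp_all add: matrix_vs_simps)
  have fs: "finite B \<Longrightarrow> f \<in> B \<rightarrow> A \<Longrightarrow> finsum ?W f B = matsum k f B" for f :: "complex mat \<Rightarrow> complex mat" and B
  proof (induction B rule: finite_induct)
    case empty
    then show ?case by (simp add: matsum_empty)
  next
    case (insert v B)
    then have "finsum ?W f (insert v B) = f v + finsum ?W f B"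
      by (subst W.finsum_insert) auto
    moreover have "f v \<in> carrier_mat k k" "\<And>w. w \<in> B \<Longrightarrow> f w \<in> carrier_mat k k"
      using insert.prems by (auto intro!: car dest: Pi_mem)
    ultimately show ?case using insert by (auto simp: matsum_insert)
  qed
  let ?B = "eut ` UI"
  have finB: "finite ?B" using finite_UI by simp
  have BA: "?B \<subseteq> A" by auto
  have cA: "a v \<cdot>\<^sub>m v \<in> A" if "v \<in> ?B" for a v using that by auto
  have lc: "W.lincomb a ?B = matsum k (\<lambda>v. a v \<cdot>\<^sub>m v) ?B" for a
    unfolding W.lincomb_def simps by (rule fs[OF finB]) auto
  have li: "W.lin_indpt ?B"
  proof (rule W.finite_lin_indpt2[OF finB])
    show "?B \<subseteq> carrier ?W" using BA by simp
    fix a assume "W.lincomb a ?B = \<zero>\<^bsub>?W\<^esub>"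
    then have z: "matsum k (\<lambda>v. a v \<cdot>\<^sub>m v) ?B = 0\<^sub>m k k" unfolding lc by simp
    show "\<forall>v\<in>?B. a v = \<zero>\<^bsub>?R\<^esub>"
    proof (intro ballI)
      fix v assume "v \<in> ?B"
      then obtain j s t where v: "v = eu j s t" "(j, s, t) \<in> UI" by auto
      then have "j < m" "s < ns ! j" "t < ns ! j" by (auto simp: UI_def)
      then show "a v = \<zero>\<^bsub>?R\<^esub>" using \<Phi>_lincomb[OF v(2), of a] unfolding z v(1) by (simp add: \<Phi>_zero)
    qed
  qed
  have "W.span ?B = carrier ?W"
  proof (intro equalityI subsetI)
    fix x assume "x \<in> W.span ?B"
    then obtain a where x: "x = matsum k (\<lambda>v. a v \<cdot>\<^sub>m v) ?B"
      using W.finite_span[OF finB] BA by (auto simp: lc)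
    have "matsum k (\<lambda>v. a v \<cdot>\<^sub>m v) ?B \<in> A" by (rule conjunct1[OF matsum_A[OF finB cA]])
    then show "x \<in> carrier ?W" by (simp add: x)
  next
    fix x assume "x \<in> carrier ?W"
    then have x: "x \<in> A" by simp
    define a where "a v = (case the_inv_into UI eut v of (i, s, t) \<Rightarrow> \<Phi> x i $$ (s, t))" for v
    have a: "a (eu i s t) = \<Phi> x i $$ (s, t)" if "(i, s, t) \<in> UI" for i s t
      using the_inv_into_f_f[OF inj_eut that] by (simp add: a_def)
    have mA: "matsum k (\<lambda>v. a v \<cdot>\<^sub>m v) ?B \<in> A" by (rule conjunct1[OF matsum_A[OF finB cA]])
    have "x = W.lincomb a ?B"
      unfolding lc
    proof (rule \<Phi>_eqI[OF x mA])
      fix i assume i: "i < m"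
      show "\<Phi> x i = \<Phi> (matsum k (\<lambda>v. a v \<cdot>\<^sub>m v) ?B) i"
      proof (rule eq_matI)
        fix s t assume "s < dim_row (\<Phi> (matsum k (\<lambda>v. a v \<cdot>\<^sub>m v) ?B) i)" "t < dim_col (\<Phi> (matsum k (\<lambda>v. a v \<cdot>\<^sub>m v) ?B) i)"
        then have "(i, s, t) \<in> UI" using \<Phi>_car[OF mA i] i by (auto simp: UI_def)
        then show "\<Phi> x i $$ (s, t) = \<Phi> (matsum k (\<lambda>v. a v \<cdot>\<^sub>m v) ?B) i $$ (s, t)"
          by (simp add: \<Phi>_lincomb a)
      qed (use \<Phi>_car[OF mA i] \<Phi>_car[OF x i] in auto)
    qed
    then show "x \<in> W.span ?B" using W.finite_span[OF finB] BA by auto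
  qed
  then have "W.basis ?B" unfolding W.basis_def using li BA by simp
  then have "W.dim = card ?B" by (rule W.dim_basis[OF finB])
  then show ?thesis unfolding algebra_dim_def card_image[OF inj_eut] card_UI .
qed

end

text \<open>
  Each \<open>q ^ t * b 0\<close> is an entry of the integral vector \<open>(D\<^sup>T D)\<^sup>t b\<close>, so the denominators of all powers of
  the rational number \<open>q\<close> divide \<open>b 0\<close>.
\<close>

lemma integral_eigenvalue:
  fixes D :: "nat \<Rightarrow> nat \<Rightarrow> nat" and a b :: "nat \<Rightarrow> nat" and q :: real
  assumes n: "0 < n" and b: "\<And>j. j < n \<Longrightarrow> 0 < b j"
    and Db: "\<And>i. i < m \<Longrightarrow> a i = (\<Sum>j<n. D i j * b j)"
    and Da: "\<And>j. j < n \<Longrightarrow> (\<Sum>i<m. real (D i j) * real (a i)) = q * real (b j)"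
  shows "q = (\<Sum>i<m. (real (a i))\<^sup>2) / (\<Sum>j<n. (real (b j))\<^sup>2)" "q \<in> \<nat>"
proof -
  \<comment> \<open>Pairing the eigenvector equation with \<open>b\<close> and moving
    \<open>D\<close> across yields the pairing of \<open>a\<close> with itself, hence the quotient
    of squared norms.\<close>
  have "(\<Sum>i<m. (real (a i))\<^sup>2) = (\<Sum>i<m. \<Sum>j<n. real (D i j) * real (b j) * real (a i))"
    by (intro sum.cong refl) (simp add: power2_eq_square Db sum_distrib_right sum_distrib_left mult_ac)
  also have "\<dots> = (\<Sum>j<n. \<Sum>i<m. real (D i j) * real (b j) * real (a i))" by (rule sum.swap)
  also have "\<dots> = (\<Sum>j<n. real (b j) * (\<Sum>i<m. real (D i j) * real (a i)))"
    by (simp add: sum_distrib_left mult_ac)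
  also have "\<dots> = (\<Sum>j<n. real (b j) * (q * real (b j)))" by (rule sum.cong) (auto simp: Da)
  also have "\<dots> = q * (\<Sum>j<n. (real (b j))\<^sup>2)"
    by (simp add: sum_distrib_left power2_eq_square mult_ac)
  finally have e: "(\<Sum>i<m. (real (a i))\<^sup>2) = q * (\<Sum>j<n. (real (b j))\<^sup>2)" .
  have "0 < (\<Sum>j<n. (real (b j))\<^sup>2)" using n b by (intro sum_pos) auto
  then show q: "q = (\<Sum>i<m. (real (a i))\<^sup>2) / (\<Sum>j<n. (real (b j))\<^sup>2)" using e by simp
  have q0: "0 \<le> q" unfolding q by (intro divide_nonneg_nonneg sum_nonneg) auto
  have "q = real (\<Sum>i<m. (a i)\<^sup>2) / real (\<Sum>j<n. (b j)\<^sup>2)" unfolding q by simp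
  also have "\<dots> \<in> \<rat>" by (intro Rats_divide Rats_of_nat)
  finally have "q \<in> \<rat>" .
  then obtain A B :: nat where B: "B \<noteq> 0" and qAB: "\<bar>q\<bar> = real A / real B" and cop: "coprime A B"
    by (rule Rats_abs_nat_div_natE)
  \<comment> \<open>Iterates \<open>D\<close> followed by its transpose over the naturals; the
    entries are integers by construction and equal \<open>q ^ t * b j\<close>.\<close>
  define v where "v t = ((\<lambda>u j. \<Sum>i<m. D i j * (\<Sum>j'<n. D i j' * u j')) ^^ t) b" for t
  have v: "real (v t j) = q ^ t * real (b j)" if "j < n" for t j
    using that
  proof (induction t arbitrary: j)
    case 0
    then show ?case by (simp add: v_def)
  next
    case (Suc t)
    have "real (v (Suc t) j) = (\<Sum>i<m. real (D i j) * (\<Sum>j'<n. real (D i j') * real (v t j')))"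
      by (simp add: v_def)
    also have "\<dots> = (\<Sum>i<m. q ^ t * (real (D i j) * real (a i)))"
    proof (intro sum.cong refl)
      fix i assume "i \<in> {..<m}"
      then have "real (a i) = (\<Sum>j'<n. real (D i j') * real (b j'))" using Db[of i] by simp
      then have "(\<Sum>j'<n. real (D i j') * real (v t j')) = q ^ t * real (a i)"
        by (simp add: Suc.IH sum_distrib_left mult_ac)
      then show "real (D i j) * (\<Sum>j'<n. real (D i j') * real (v t j')) = q ^ t * (real (D i j) * real (a i))" by simp
    qed
    also have "\<dots> = q ^ Suc t * real (b j)"
      unfolding sum_distrib_left[symmetric] Da[OF Suc.prems] by simp
    finally show ?case .
  qed
  have "B ^ t dvd b 0" for t
  proof -
    have "real (B ^ t * v t 0) = real (A ^ t * b 0)"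
      using v[OF n, of t] qAB q0 B by (simp add: power_divide)
    then have "B ^ t * v t 0 = A ^ t * b 0" by (simp only: of_nat_eq_iff)
    then have "B ^ t dvd A ^ t * b 0" by (metis dvd_triv_left)
    moreover have "coprime (B ^ t) (A ^ t)" using cop by (simp add: coprime_commute)
    ultimately show ?thesis by (simp add: coprime_dvd_mult_right_iff)
  qed
  then have le: "B ^ t \<le> b 0" for t using b[OF n] by (intro dvd_imp_le) auto
  have "B = 1"
  proof (rule ccontr)
    assume "B \<noteq> 1"
    \<comment> \<open>The exponent \<open>b 0\<close> is already large enough for a contradiction,
      since \<open>2 ^ b 0\<close> exceeds \<open>b 0\<close>.\<close>
    then have "2 \<le> B" using B by simp
    then have "2 ^ b 0 \<le> B ^ b 0" by (rule power_mono) simp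
    then show False using le[of "b 0"] less_exp[of "b 0"] by linarith
  qed
  then have "q = real A" using qAB q0 by simp
  then show "q \<in> \<nat>" by simp
qed

context mm_path
begin

lemma perron_frobenius_path:
  assumes conn: "connected_inclusion (1\<^sub>m k) N M"
  obtains x y where "pf_conn k {..<length \<alpha>s} {..<length \<beta>s} D (\<lambda>j. \<beta>s ! j) \<mu> \<xi> x y (opnorm (map_mat real \<Lambda>))"
proof -
  have "connected_inclusion Z.one Z.N Z.M" using conn unfolding one_\<xi> M_eq[symmetric] N_eq[symmetric] .
  then interpret C: conn_incl k "{..<length \<alpha>s}" "{..<length \<beta>s}" D "\<lambda>j. \<beta>s ! j" \<mu> \<xi> by unfold_locales
  show ?thesis
  proof (rule C.perron_frobenius)
    show "{..<length \<alpha>s} \<noteq> {}" using MA.m_pos by auto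
    fix x y d
    assume pf: "pf_conn k {..<length \<alpha>s} {..<length \<beta>s} D (\<lambda>j. \<beta>s ! j) \<mu> \<xi> x y d"
      and bound: "\<And>w. (\<Sum>i<length \<alpha>s. (\<Sum>j<length \<beta>s. real (D i j) * w j)\<^sup>2) \<le> d\<^sup>2 * (\<Sum>j<length \<beta>s. (w j)\<^sup>2)"
    have "map_mat real \<Lambda> = mat (length \<alpha>s) (length \<beta>s) (\<lambda>(i, j). real (D i j))"
      by (rule eq_matI) (auto simp: \<Lambda>_def)
    then have "opnorm (map_mat real \<Lambda>) = d" using pf_conn.opnorm_eq[OF pf refl refl bound] by simp
    then show ?thesis using pf that by simp
  qed
qed

lemma index_and_super_extremality:
  assumes conn: "connected_inclusion (1\<^sub>m k) N M"
  defines "d \<equiv> opnorm (map_mat real \<Lambda>)"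
  shows "minimal_index (1\<^sub>m k) M N = d\<^sup>2"
    and "super_extremal (1\<^sub>m k) M N \<longleftrightarrow>
      (\<forall>j<length \<beta>s. (\<Sum>i<length \<alpha>s. real (D i j) * real (\<alpha>s ! i)) = d\<^sup>2 * real (\<beta>s ! j))"
proof -
  obtain x y where "pf_conn k {..<length \<alpha>s} {..<length \<beta>s} D (\<lambda>j. \<beta>s ! j) \<mu> \<xi> x y d"
    using perron_frobenius_path[OF conn] unfolding d_def by blast
  then interpret C: pf_conn k "{..<length \<alpha>s}" "{..<length \<beta>s}" D "\<lambda>j. \<beta>s ! j" \<mu> \<xi> x y d .
  show "minimal_index (1\<^sub>m k) M N = d\<^sup>2"
    using C.minimal_index unfolding one_\<xi> M_eq[symmetric] N_eq[symmetric] .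
  have "super_extremal (1\<^sub>m k) M N \<longleftrightarrow>
      (\<forall>j\<in>{..<length \<beta>s}. (\<Sum>i<length \<alpha>s. real (D i j) * real (Z.dimM i)) = d\<^sup>2 * real (\<beta>s ! j))"
    using C.super_extremal_iff unfolding one_\<xi> M_eq[symmetric] N_eq[symmetric] .
  moreover have "(\<Sum>i<length \<alpha>s. real (D i j) * real (Z.dimM i)) = (\<Sum>i<length \<alpha>s. real (D i j) * real (\<alpha>s ! i))" for j
    by (rule sum.cong) (auto simp: Z.dimM_def \<alpha>_eq)
  ultimately show "super_extremal (1\<^sub>m k) M N \<longleftrightarrow>
      (\<forall>j<length \<beta>s. (\<Sum>i<length \<alpha>s. real (D i j) * real (\<alpha>s ! i)) = d\<^sup>2 * real (\<beta>s ! j))" by auto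
qed

end

section \<open>Scalars inside diagonal matrices: every positive integer as an index\<close>

definition diag_algebra :: "nat \<Rightarrow> complex mat set" where
  "diag_algebra r = {x \<in> carrier_mat r r. \<forall>i<r. \<forall>j<r. i \<noteq> j \<longrightarrow> x $$ (i, j) = 0}"

definition scalar_algebra :: "nat \<Rightarrow> complex mat set" where
  "scalar_algebra r = {c \<cdot>\<^sub>m 1\<^sub>m r | c. True}"

lemma diag_algebra_mult:
  assumes x: "x \<in> diag_algebra r" and y: "y \<in> diag_algebra r" and ij: "i < r" "j < r"
  shows "(x * y) $$ (i, j) = (if i = j then x $$ (i, i) * y $$ (i, i) else 0)"
proof -
  have "(x * y) $$ (i, j) = (\<Sum>l<r. x $$ (i, l) * y $$ (l, j))"
    by (rule mat_mult_index[of _ r r _ r]) (use x y ij in \<open>auto simp: diag_algebra_def\<close>)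
  also have "\<dots> = (\<Sum>l<r. if l = i then if i = j then x $$ (i, i) * y $$ (i, i) else 0 else 0)"
    by (rule sum.cong) (use x y ij in \<open>auto simp: diag_algebra_def\<close>)
  finally show ?thesis using ij by simp
qed

lemma diag_algebra_star: "star_subalgebra (1\<^sub>m r) (diag_algebra r)"
  unfolding star_subalgebra_def
proof (intro conjI ballI allI)
  show "is_projection (1\<^sub>m r)" by (simp add: is_projection_def)
  show "diag_algebra r \<subseteq> ops (1\<^sub>m r)" by (auto simp: diag_algebra_def ops_def)
  show "1\<^sub>m r \<in> diag_algebra r" by (simp add: diag_algebra_def)
  fix x assume x: "x \<in> diag_algebra r"
  then have xc: "x \<in> carrier_mat r r" by (simp add: diag_algebra_def)
  show "c \<cdot>\<^sub>m x \<in> diag_algebra r" for c using x xc by (auto simp: diag_algebra_def)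
  show "mat_adjoint x \<in> diag_algebra r" using x xc by (auto simp: diag_algebra_def)
  fix y assume y: "y \<in> diag_algebra r"
  then have yc: "y \<in> carrier_mat r r" by (simp add: diag_algebra_def)
  show "x + y \<in> diag_algebra r" using x y xc yc by (auto simp: diag_algebra_def)
  have "x * y \<in> carrier_mat r r" using xc yc by simp
  then show "x * y \<in> diag_algebra r" unfolding diag_algebra_def
    using diag_algebra_mult[OF x y] by (simp del: index_mult_mat)
qed

lemma scalar_algebra_star: "star_subalgebra (1\<^sub>m r) (scalar_algebra r)"
  unfolding star_subalgebra_def
proof (intro conjI ballI allI)
  show "is_projection (1\<^sub>m r)" by (simp add: is_projection_def)
  show "scalar_algebra r \<subseteq> ops (1\<^sub>m r)"
    by (auto simp: scalar_algebra_def ops_def mult_smult_distrib[of _ r r _ r] mult_smult_assoc_mat[of _ r r _ r])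
  show "1\<^sub>m r \<in> scalar_algebra r" unfolding scalar_algebra_def
    by (intro CollectI exI[of _ 1]) (auto intro!: eq_matI)
  fix x assume "x \<in> scalar_algebra r"
  then obtain a where x: "x = a \<cdot>\<^sub>m 1\<^sub>m r" by (auto simp: scalar_algebra_def)
  show "c \<cdot>\<^sub>m x \<in> scalar_algebra r" for c unfolding x scalar_algebra_def
    by (intro CollectI exI[of _ "c * a"]) (auto intro!: eq_matI)
  show "mat_adjoint x \<in> scalar_algebra r" unfolding x scalar_algebra_def
    by (intro CollectI exI[of _ "cnj a"]) (auto simp: mat_adjoint_smult)
  fix y assume "y \<in> scalar_algebra r"
  then obtain b where y: "y = b \<cdot>\<^sub>m 1\<^sub>m r" by (auto simp: scalar_algebra_def)
  show "x + y \<in> scalar_algebra r" unfolding x y scalar_algebra_def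
    by (intro CollectI exI[of _ "a + b"]) (auto intro!: eq_matI)
  show "x * y \<in> scalar_algebra r" unfolding x y scalar_algebra_def
    by (intro CollectI exI[of _ "a * b"])
      (auto simp: mult_smult_distrib[of _ r r _ r] mult_smult_assoc_mat[of _ r r _ r] intro!: eq_matI)
qed

lemma scalar_subset_diag: "scalar_algebra r \<subseteq> diag_algebra r"
  by (auto simp: scalar_algebra_def diag_algebra_def)

lemma diag_iso:
  assumes r: "0 < r"
  shows "multi_matrix_iso (diag_algebra r) (replicate r 1) (\<lambda>x. \<lambda>i\<in>{..<r}. mat 1 1 (\<lambda>_. x $$ (i, i)))"
proof -
  let ?\<Phi> = "\<lambda>x::complex mat. \<lambda>i\<in>{..<r}. mat 1 1 (\<lambda>_. x $$ (i, i))"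
  have bij: "bij_betw ?\<Phi> (diag_algebra r) (direct_sum (replicate r 1))"
  proof (rule bij_betw_byWitness[where f' = "\<lambda>X. mat r r (\<lambda>(i, j). if i = j then X i $$ (0, 0) else 0)"])
    show "\<forall>x\<in>diag_algebra r. mat r r (\<lambda>(i, j). if i = j then ?\<Phi> x i $$ (0, 0) else 0) = x"
      by (auto simp: diag_algebra_def intro!: eq_matI)
    show "\<forall>X\<in>direct_sum (replicate r 1). ?\<Phi> (mat r r (\<lambda>(i, j). if i = j then X i $$ (0, 0) else 0)) = X"
    proof
      fix X assume X: "X \<in> direct_sum (replicate r 1)"
      show "?\<Phi> (mat r r (\<lambda>(i, j). if i = j then X i $$ (0, 0) else 0)) = X"
      proof (rule extensionalityI[of _ "{..<r}"])
        show "X \<in> extensional {..<r}" using X by (simp add: direct_sum_def PiE_def)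
        fix i assume i: "i \<in> {..<r}"
        then have "X i \<in> carrier_mat 1 1" using X by (auto simp: direct_sum_def dest!: PiE_mem)
        then show "?\<Phi> (mat r r (\<lambda>(i, j). if i = j then X i $$ (0, 0) else 0)) i = X i"
          using i by (auto intro!: eq_matI)
      qed simp
    qed
    show "?\<Phi> ` diag_algebra r \<subseteq> direct_sum (replicate r 1)" by (auto simp: direct_sum_def)
    show "(\<lambda>X. mat r r (\<lambda>(i, j). if i = j then X i $$ (0, 0) else 0)) ` direct_sum (replicate r 1) \<subseteq> diag_algebra r"
      by (auto simp: diag_algebra_def)
  qed
  have "(\<forall>y\<in>diag_algebra r. ?\<Phi> (x + y) i = ?\<Phi> x i + ?\<Phi> y i \<and> ?\<Phi> (x * y) i = ?\<Phi> x i * ?\<Phi> y i) \<and>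
      (\<forall>c. ?\<Phi> (c \<cdot>\<^sub>m x) i = c \<cdot>\<^sub>m ?\<Phi> x i) \<and> ?\<Phi> (mat_adjoint x) i = mat_adjoint (?\<Phi> x i)"
    if x: "x \<in> diag_algebra r" and i: "i < r" for x i
  proof (intro conjI ballI allI)
    have xc: "x \<in> carrier_mat r r" using x by (simp add: diag_algebra_def)
    show "?\<Phi> (c \<cdot>\<^sub>m x) i = c \<cdot>\<^sub>m ?\<Phi> x i" for c using xc i by (auto intro!: eq_matI)
    show "?\<Phi> (mat_adjoint x) i = mat_adjoint (?\<Phi> x i)" using xc i by (auto intro!: eq_matI)
    fix y assume y: "y \<in> diag_algebra r"
    then have yc: "y \<in> carrier_mat r r" by (simp add: diag_algebra_def)
    show "?\<Phi> (x + y) i = ?\<Phi> x i + ?\<Phi> y i" using xc yc i by (auto intro!: eq_matI)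
    have "(x * y) $$ (i, i) = x $$ (i, i) * y $$ (i, i)" using diag_algebra_mult[OF x y i i] by simp
    then show "?\<Phi> (x * y) i = ?\<Phi> x i * ?\<Phi> y i"
      using i by (auto simp: scalar_prod_def simp del: index_mult_mat(1) intro!: eq_matI)
        (simp add: scalar_prod_def)
  qed
  then show ?thesis unfolding multi_matrix_iso_def using bij r by (auto simp del: restrict_apply)
qed

lemma scalar_iso:
  assumes r: "0 < r"
  shows "multi_matrix_iso (scalar_algebra r) [1] (\<lambda>x. \<lambda>i\<in>{..<1}. mat 1 1 (\<lambda>_. x $$ (0, 0)))"
proof -
  let ?\<Phi> = "\<lambda>x::complex mat. \<lambda>i\<in>{..<1::nat}. mat 1 1 (\<lambda>_. x $$ (0, 0))"
  have bij: "bij_betw ?\<Phi> (scalar_algebra r) (direct_sum [1])"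
  proof (rule bij_betw_byWitness[where f' = "\<lambda>X. X 0 $$ (0, 0) \<cdot>\<^sub>m 1\<^sub>m r"])
    show "\<forall>x\<in>scalar_algebra r. ?\<Phi> x 0 $$ (0, 0) \<cdot>\<^sub>m 1\<^sub>m r = x"
      using r by (auto simp: scalar_algebra_def)
    show "\<forall>X\<in>direct_sum [1]. ?\<Phi> (X 0 $$ (0, 0) \<cdot>\<^sub>m 1\<^sub>m r) = X"
    proof
      fix X assume X: "X \<in> direct_sum [1]"
      show "?\<Phi> (X 0 $$ (0, 0) \<cdot>\<^sub>m 1\<^sub>m r) = X"
      proof (rule extensionalityI[of _ "{..<1}"])
        show "X \<in> extensional {..<1}" using X by (simp add: direct_sum_def PiE_def)
        fix i :: nat assume i: "i \<in> {..<1}"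
        then have "X 0 \<in> carrier_mat 1 1" using X by (auto simp: direct_sum_def dest!: PiE_mem)
        then show "?\<Phi> (X 0 $$ (0, 0) \<cdot>\<^sub>m 1\<^sub>m r) i = X i"
          using i r by (auto intro!: eq_matI)
      qed simp
    qed
    show "?\<Phi> ` scalar_algebra r \<subseteq> direct_sum [1]" by (auto simp: direct_sum_def)
    show "(\<lambda>X. X 0 $$ (0, 0) \<cdot>\<^sub>m 1\<^sub>m r) ` direct_sum [1] \<subseteq> scalar_algebra r"
      by (auto simp: scalar_algebra_def)
  qed
  have "(\<forall>y\<in>scalar_algebra r. ?\<Phi> (x + y) 0 = ?\<Phi> x 0 + ?\<Phi> y 0 \<and> ?\<Phi> (x * y) 0 = ?\<Phi> x 0 * ?\<Phi> y 0) \<and>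
      (\<forall>c. ?\<Phi> (c \<cdot>\<^sub>m x) 0 = c \<cdot>\<^sub>m ?\<Phi> x 0) \<and> ?\<Phi> (mat_adjoint x) 0 = mat_adjoint (?\<Phi> x 0)"
    if x: "x \<in> scalar_algebra r" for x
  proof (intro conjI ballI allI)
    have x': "x \<in> diag_algebra r" using x scalar_subset_diag by auto
    then have xc: "x \<in> carrier_mat r r" by (simp add: diag_algebra_def)
    show "?\<Phi> (c \<cdot>\<^sub>m x) 0 = c \<cdot>\<^sub>m ?\<Phi> x 0" for c using xc r by (auto intro!: eq_matI)
    show "?\<Phi> (mat_adjoint x) 0 = mat_adjoint (?\<Phi> x 0)" using xc r by (auto intro!: eq_matI)
    fix y assume "y \<in> scalar_algebra r"
    then have y: "y \<in> diag_algebra r" using scalar_subset_diag by auto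
    then have yc: "y \<in> carrier_mat r r" by (simp add: diag_algebra_def)
    show "?\<Phi> (x + y) 0 = ?\<Phi> x 0 + ?\<Phi> y 0" using xc yc r by (auto intro!: eq_matI)
    have "(x * y) $$ (0, 0) = x $$ (0, 0) * y $$ (0, 0)" using diag_algebra_mult[OF x' y r r] by simp
    then show "?\<Phi> (x * y) 0 = ?\<Phi> x 0 * ?\<Phi> y 0"
      by (auto simp: scalar_prod_def simp del: index_mult_mat(1) intro!: eq_matI)
        (simp add: scalar_prod_def)
  qed
  then show ?thesis unfolding multi_matrix_iso_def using bij by (auto simp del: restrict_apply)
qed

lemma diag_connected: "connected_inclusion (1\<^sub>m r) (scalar_algebra r) (diag_algebra r)"
proof -
  have sc: "a * (c \<cdot>\<^sub>m 1\<^sub>m r) = (c \<cdot>\<^sub>m 1\<^sub>m r) * a" if "a \<in> carrier_mat r r" for a and c :: complex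
    using that by (simp add: mult_smult_distrib[of _ r r _ r] mult_smult_assoc_mat[of _ r r _ r])
  have dc: "a \<in> carrier_mat r r" if "a \<in> diag_algebra r" for a using that by (simp add: diag_algebra_def)
  show ?thesis
    unfolding connected_inclusion_def
  proof (intro equalityI subsetI)
    fix x assume "x \<in> center (scalar_algebra r) \<inter> center (diag_algebra r)"
    then show "x \<in> {c \<cdot>\<^sub>m 1\<^sub>m r | c. True}" by (simp add: center_def scalar_algebra_def)
  next
    fix x :: "complex mat" assume "x \<in> {c \<cdot>\<^sub>m 1\<^sub>m r | c. True}"
    then obtain c where x: "x = c \<cdot>\<^sub>m 1\<^sub>m r" by blast
    have xs: "x \<in> scalar_algebra r" unfolding x scalar_algebra_def by blast
    then have "x \<in> diag_algebra r" using scalar_subset_diag by blast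
    moreover have "a * x = x * a" if "a \<in> diag_algebra r" for a unfolding x by (rule sc[OF dc[OF that]])
    ultimately show "x \<in> center (scalar_algebra r) \<inter> center (diag_algebra r)"
      using xs scalar_subset_diag unfolding center_def by blast
  qed
qed

text \<open>All blocks have size one, so \<open>D\<close> is a column of ones. The Perron-Frobenius
  equations then give \<open>d\<^sup>2 = r\<close>, and the criterion for super-extremality becomes
  the same equation.\<close>

lemma diag_super_extremal:
  assumes r: "0 < r"
  shows "super_extremal (1\<^sub>m r) (diag_algebra r) (scalar_algebra r)"
    and "minimal_index (1\<^sub>m r) (diag_algebra r) (scalar_algebra r) = real r"
proof -
  let ?\<alpha> = "replicate r (1::nat)" and ?\<beta> = "[1::nat]"
  interpret mm_incl r "diag_algebra r" "scalar_algebra r" ?\<alpha> ?\<beta>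
      "\<lambda>x. \<lambda>i\<in>{..<r}. mat 1 1 (\<lambda>_. x $$ (i, i))" "\<lambda>x. \<lambda>i\<in>{..<1}. mat 1 1 (\<lambda>_. x $$ (0, 0))"
    using diag_algebra_star scalar_algebra_star scalar_subset_diag diag_iso[OF r] scalar_iso[OF r]
    by unfold_locales (simp_all add: unital_inclusion_def)
  obtain D \<mu> w \<xi> where "mm_path r (diag_algebra r) (scalar_algebra r) ?\<alpha> ?\<beta>
      (\<lambda>x. \<lambda>i\<in>{..<r}. mat 1 1 (\<lambda>_. x $$ (i, i))) (\<lambda>x. \<lambda>i\<in>{..<1}. mat 1 1 (\<lambda>_. x $$ (0, 0))) D \<mu> w \<xi>"
    using path_basis by blast
  then interpret Q: mm_path r "diag_algebra r" "scalar_algebra r" ?\<alpha> ?\<beta>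
      "\<lambda>x. \<lambda>i\<in>{..<r}. mat 1 1 (\<lambda>_. x $$ (i, i))" "\<lambda>x. \<lambda>i\<in>{..<1}. mat 1 1 (\<lambda>_. x $$ (0, 0))" D \<mu> w \<xi> .
  define d where "d = opnorm (map_mat real Q.\<Lambda>)"
  have D1: "D i 0 = 1" if "i < r" for i using Q.\<alpha>_eq[of i] that by simp
  obtain x y where "pf_conn r {..<length ?\<alpha>} {..<length ?\<beta>} D (\<lambda>j. ?\<beta> ! j) \<mu> \<xi> x y d"
    using Q.perron_frobenius_path[OF diag_connected] unfolding d_def by blast
  then interpret C: pf_conn r "{..<length ?\<alpha>}" "{..<length ?\<beta>}" D "\<lambda>j. ?\<beta> ! j" \<mu> \<xi> x y d .
  have y0: "0 < y 0" using C.y_pos[of 0] by simp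
  have xi: "x i = y 0 / d" if "i < r" for i using C.Dy[of i] that D1[OF that] C.d_pos by (simp add: field_simps)
  have "(\<Sum>i<r. real (D i 0) * x i) = d * y 0" using C.Dx[of 0] by simp
  moreover have "(\<Sum>i<r. real (D i 0) * x i) = (\<Sum>i<r. y 0 / d)" by (rule sum.cong) (auto simp: D1 xi)
  ultimately have "real r * (y 0 / d) = d * y 0" by simp
  then have d2: "d\<^sup>2 = real r" using y0 C.d_pos by (simp add: field_simps power2_eq_square)
  show "minimal_index (1\<^sub>m r) (diag_algebra r) (scalar_algebra r) = real r"
    using Q.index_and_super_extremality(1)[OF diag_connected] d2 by (simp add: d_def)
  have "(\<Sum>i<r. real (D i 0) * real (?\<alpha> ! i)) = real r"
  proof -
    have "(\<Sum>i<r. real (D i 0) * real (?\<alpha> ! i)) = (\<Sum>i<r. 1)" by (rule sum.cong) (auto simp: D1)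
    then show ?thesis by simp
  qed
  then show "super_extremal (1\<^sub>m r) (diag_algebra r) (scalar_algebra r)"
    using Q.index_and_super_extremality(2)[OF diag_connected] d2 by (simp add: d_def)
qed

theorem proposition3p4:
  fixes k :: nat and M N :: "complex mat set"
    and \<alpha>s \<beta>s :: "nat list" and \<Phi> \<Psi> :: "complex mat \<Rightarrow> nat \<Rightarrow> complex mat"
    and \<alpha> \<beta> :: "real vec" and D :: "real mat" and d :: real
  assumes "unital_inclusion (1\<^sub>m k) N M"
    and "connected_inclusion (1\<^sub>m k) N M"
    and "multi_matrix_iso M \<alpha>s \<Phi>"
    and "multi_matrix_iso N \<beta>s \<Psi>"
    and "\<alpha> = vec_of_list (map real \<alpha>s)"
    and "\<beta> = vec_of_list (map real \<beta>s)"
    and "D = matrix_dimension M \<alpha>s \<Phi> N \<beta>s \<Psi>"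
    and "d = opnorm D"
  shows "(\<exists>\<Lambda>. is_inclusion_matrix N \<beta>s \<Psi> \<alpha>s \<Phi> \<Lambda> \<and> D = map_mat real \<Lambda>) \<and>
    minimal_index (1\<^sub>m k) M N = d\<^sup>2 \<and>
    D *\<^sub>v \<beta> = \<alpha> \<and>
    (super_extremal (1\<^sub>m k) M N \<longleftrightarrow> transpose_mat D *\<^sub>v \<alpha> = d\<^sup>2 \<cdot>\<^sub>v \<beta>) \<and>
    (super_extremal (1\<^sub>m k) M N \<longrightarrow>
       d\<^sup>2 = (l2norm \<alpha>)\<^sup>2 / (l2norm \<beta>)\<^sup>2 \<and>
       d\<^sup>2 = real (algebra_dim k M) / real (algebra_dim k N) \<and>
       d\<^sup>2 \<in> \<nat>) \<and>
    (\<forall>r::nat. 0 < r \<longrightarrow>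
       (\<exists>k' M' N'. unital_inclusion (1\<^sub>m k') N' M' \<and> multi_matrix_algebra M' \<and>
          multi_matrix_algebra N' \<and> connected_inclusion (1\<^sub>m k') N' M' \<and>
          super_extremal (1\<^sub>m k') M' N' \<and> minimal_index (1\<^sub>m k') M' N' = real r))"
proof -
  interpret mm_incl k M N \<alpha>s \<beta>s \<Phi> \<Psi> using assms(1,3,4) by unfold_locales
  obtain \<Delta> \<mu> w \<xi> where "mm_path k M N \<alpha>s \<beta>s \<Phi> \<Psi> \<Delta> \<mu> w \<xi>" using path_basis by blast
  then interpret Q: mm_path k M N \<alpha>s \<beta>s \<Phi> \<Psi> \<Delta> \<mu> w \<xi> .
  let ?m = "length \<alpha>s" and ?n = "length \<beta>s"
  have D: "D = map_mat real Q.\<Lambda>" unfolding assms(7) by (rule Q.matrix_dimension_eq)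
  have Dij: "D $$ (i, j) = real (\<Delta> i j)" if "i < ?m" "j < ?n" for i j
    using that by (simp add: D Q.\<Lambda>_def)
  have Dc [simp]: "dim_row D = ?m" "dim_col D = ?n" by (simp_all add: D Q.\<Lambda>_def)
  have \<alpha>: "dim_vec \<alpha> = ?m" "\<And>i. i < ?m \<Longrightarrow> \<alpha> $ i = real (\<alpha>s ! i)"
    and \<beta>: "dim_vec \<beta> = ?n" "\<And>j. j < ?n \<Longrightarrow> \<beta> $ j = real (\<beta>s ! j)"
    by (simp_all add: assms(5,6) vec_of_list_index)
  have ind: "minimal_index (1\<^sub>m k) M N = d\<^sup>2" unfolding assms(8) D by (rule Q.index_and_super_extremality(1)[OF assms(2)])
  have se: "super_extremal (1\<^sub>m k) M N \<longleftrightarrow>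
      (\<forall>j<?n. (\<Sum>i<?m. real (\<Delta> i j) * real (\<alpha>s ! i)) = d\<^sup>2 * real (\<beta>s ! j))"
    unfolding assms(8) D by (rule Q.index_and_super_extremality(2)[OF assms(2)])
  have D\<beta>: "D *\<^sub>v \<beta> = \<alpha>"
  proof (rule eq_vecI)
    fix i assume "i < dim_vec \<alpha>"
    then have i: "i < ?m" by (simp add: \<alpha>)
    have "(D *\<^sub>v \<beta>) $ i = (\<Sum>j<?n. real (\<Delta> i j) * real (\<beta>s ! j))"
      using i \<beta> by (auto simp: scalar_prod_def lessThan_atLeast0 Dij intro!: sum.cong)
    then show "(D *\<^sub>v \<beta>) $ i = \<alpha> $ i" using Q.\<alpha>_eq[OF i] by (simp add: \<alpha> i)
  qed (simp add: \<alpha>)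
  have Dt: "transpose_mat D *\<^sub>v \<alpha> = d\<^sup>2 \<cdot>\<^sub>v \<beta> \<longleftrightarrow>
      (\<forall>j<?n. (\<Sum>i<?m. real (\<Delta> i j) * real (\<alpha>s ! i)) = d\<^sup>2 * real (\<beta>s ! j))"
  proof -
    have e: "(transpose_mat D *\<^sub>v \<alpha>) $ j = (\<Sum>i<?m. real (\<Delta> i j) * real (\<alpha>s ! i))" if j: "j < ?n" for j
      using j \<alpha> by (auto simp: scalar_prod_def lessThan_atLeast0 Dij intro!: sum.cong)
    have "transpose_mat D *\<^sub>v \<alpha> = d\<^sup>2 \<cdot>\<^sub>v \<beta> \<longleftrightarrow> (\<forall>j<?n. (transpose_mat D *\<^sub>v \<alpha>) $ j = (d\<^sup>2 \<cdot>\<^sub>v \<beta>) $ j)"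
      by (simp only: vec_eq_iff) (simp add: \<beta> del: index_mult_mat_vec)
    then show ?thesis by (simp add: e \<beta> del: index_mult_mat_vec)
  qed
  have ratio: "d\<^sup>2 = (l2norm \<alpha>)\<^sup>2 / (l2norm \<beta>)\<^sup>2 \<and>
      d\<^sup>2 = real (algebra_dim k M) / real (algebra_dim k N) \<and> d\<^sup>2 \<in> \<nat>"
    if s: "super_extremal (1\<^sub>m k) M N"
  proof -
    have eig: "(\<Sum>i<?m. real (\<Delta> i j) * real (\<alpha>s ! i)) = d\<^sup>2 * real (\<beta>s ! j)" if "j < ?n" for j
      using s se that by blast
    \<comment> \<open>Super-extremality supplies the second of the two eigenvector equations, which
      makes the integral vector \<beta> an eigenvector for \<open>d\<^sup>2\<close>; both the ratio
      and the integrality follow from this.\<close>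
    note ie = integral_eigenvalue[where a = "\<lambda>i. \<alpha>s ! i" and b = "\<lambda>j. \<beta>s ! j" and D = \<Delta> and m = ?m,
        OF NA.m_pos NA.ns_pos Q.\<alpha>_eq eig]
    have "(l2norm \<alpha>)\<^sup>2 = (\<Sum>i<?m. (real (\<alpha>s ! i))\<^sup>2)" "(l2norm \<beta>)\<^sup>2 = (\<Sum>j<?n. (real (\<beta>s ! j))\<^sup>2)"
      by (simp_all add: l2norm_def L2_set_def sum_nonneg \<alpha> \<beta>)
    moreover have "real (algebra_dim k M) = (\<Sum>i<?m. (real (\<alpha>s ! i))\<^sup>2)"
      "real (algebra_dim k N) = (\<Sum>j<?n. (real (\<beta>s ! j))\<^sup>2)"
      by (simp_all add: MA.algebra_dim_eq NA.algebra_dim_eq)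
    ultimately show ?thesis using ie by simp
  qed
  have ex: "\<exists>k' M' N'. unital_inclusion (1\<^sub>m k') N' M' \<and> multi_matrix_algebra M' \<and>
      multi_matrix_algebra N' \<and> connected_inclusion (1\<^sub>m k') N' M' \<and>
      super_extremal (1\<^sub>m k') M' N' \<and> minimal_index (1\<^sub>m k') M' N' = real r" if r: "0 < r" for r
  proof (intro exI conjI)
    show "unital_inclusion (1\<^sub>m r) (scalar_algebra r) (diag_algebra r)"
      by (simp add: unital_inclusion_def diag_algebra_star scalar_algebra_star scalar_subset_diag)
    show "multi_matrix_algebra (diag_algebra r)" "multi_matrix_algebra (scalar_algebra r)"
      unfolding multi_matrix_algebra_def using diag_iso[OF r] scalar_iso[OF r] by blast+
    show "connected_inclusion (1\<^sub>m r) (scalar_algebra r) (diag_algebra r)" by (rule diag_connected)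
    show "super_extremal (1\<^sub>m r) (diag_algebra r) (scalar_algebra r)"
      "minimal_index (1\<^sub>m r) (diag_algebra r) (scalar_algebra r) = real r"
      by (rule diag_super_extremal[OF r])+
  qed
  show ?thesis using Q.inclusion_matrix D ind D\<beta> se Dt ratio ex by blast
qed

end
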